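(* Let $X=(X_t,\mathbb P_x)$ and $\hat X=(\hat X_t,\hat{\mathbb P}_x)$ be Hunt processes with common state space $(S,\mathcal B(S))$, where $S$ is a locally compact separable metric space, and let $m$ be a Radon measure on $(S,\mathcal B(S))$ such that the resolvent kernels $R_\lambda(x,\cdot)$ of $X$ and $\hat R_\lambda(x,\cdot)$ of $\hat X$ are absolutely continuous with respect to $m$ for all $\lambda>0$, $x\in S$, and $\int_S f\,R_\lambda g\,dm=\int_S \hat R_\lambda f\,g\,dm$ for all $\lambda>0$ and all measurable $f,g:S\to[0,\infty]$. Let $r_\lambda$ be the $\lambda$-resolvent density, and let $a\in S$ be a point such that $r_1(a,a)<\infty$ and $x\mapsto r_1(x,a)$ is continuous at $x=a$. Let $\alpha\in(0,1)$ and $\hat{\alpha}=1-\alpha$. Let $\ell:(0,\infty)\to(0,\infty)$ be slowly varying at $0+$, and suppose $\varepsilon:(0,\infty)\to(0,1)$ satisfies $\varepsilon(t)\to 0$ as $t\to0+$. Let $\tau$ be the inverse local time of $X$ at $a$, and $G(t)$ the last visit time of $X$ to $a$ up to time $t$. Then the following statements hold. (1) Assume $r_\lambda(a,a)\sim \lambda^{-\alpha}/\ell(1/\lambda)$ as $\lambda\to\infty$. Then $$\mathbb{P}_a\bigg(\frac{G(t)}{t}\leq \varepsilon(t)\bigg)\sim\frac{\sin(\pi\alpha)}{\pi\alpha}\,\frac{\ell(t)}{\ell(\varepsilon(t)t)}\,\varepsilon(t)^\alpha,\qquad t\to0+.$$ Suppose additionally that $\tau$ (under $\mathbb{P}_a$)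 is special. Then $$\mathbb{P}_a\bigg(\frac{G(t)}{t}\geq 1-\varepsilon(t)\bigg)\sim\frac{\sin(\pi\hat{\alpha})}{\pi\hat{\alpha}}\,\frac{\ell(\varepsilon(t)t)}{\ell(t)}\,\varepsilon(t)^{\hat{\alpha}},\qquad t\to0+.$$ (2) Assume $r_\lambda(a,a)\asymp \lambda^{-\alpha}/\ell(1/\lambda)$ as $\lambda\to\infty$. Then $$\mathbb{P}_a\bigg(\frac{G(t)}{t}\leq \varepsilon(t)\bigg)\asymp\frac{\ell(t)}{\ell(\varepsilon(t)t)}\,\varepsilon(t)^\alpha,\qquad t\to0+.$$ Suppose additionally that $\tau$ (under $\mathbb{P}_a$) is special. Then $$\mathbb{P}_a\bigg(\frac{G(t)}{t}\geq 1-\varepsilon(t)\bigg)\asymp\frac{\ell(\varepsilon(t)t)}{\ell(t)}\,\varepsilon(t)^{\hat{\alpha}},\qquad t\to0+.$$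
   Context: Asymptotic notation: $f\sim g$ as $x\to a$ means $f(x)/g(x)\to1$. For non-negative $f,g$, $f\asymp g$ as $x\to a$ means that there are constants $0<C_1\le C_2<\infty$ with $C_1f\le g\le C_2f$ on some neighborhood of $a$. A positive measurable $\ell$ is slowly varying at $0+$ if $\ell(\lambda x)/\ell(x)\to1$ as $x\to0+$ for every $\lambda>0$. Setting: $S$ is a locally compact separable metric space with Borel $\sigma$-field $\mathcal B(S)$; $\partial$ is a cemetery point adjoined to $S$ (the point at infinity if $S$ is non-compact, an isolated point if $S$ is compact). $\mathcal B(S)_+$ is the set of measurable $f:S\to[0,\infty]$, with convention $f(\partial)=0$. (A1) $X=(X_t,\mathbb P_x)$ and $\hat X=(\hat X_t,\hat{\mathbb P}_x)$ are Hunt processes with common state space $(S,\mathcal B(S))$. Write $P_tf(x)=\mathbb E_xf(X_t)$, $\hat P_tf(x)=\hat{\mathbb E}_xf(\hat X_t)$, $R_\lambda f=\int_0^\infty e^{-\lambda t}P_tf\,dt$, $\hat R_\lambda f=\int_0^\infty e^{-\lambda t}\hat P_tf\,dt$ for $\lambda>0$, $f\in\mathcal B(S)_+$, and $P_t(x,\cdot)$, $R_\lambda(x,\cdot)$, etc. for the corresponding kernels. (A2) $m$ is a Radon measure on $(S,\mathcal B(S))$; the measures $R_\lambda(x,\cdot)$ and $\hat R_\lambda(x,\cdot)$ are absolutely continuous with respect to $m$ for all $\lambda>0$, $x\in S$; and $\int_S f\,R_\lambda g\,dm=\int_S \hat R_\lambda f\,g\,dm$ for all $\lambda>0$, $f,g\in\mathcal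 B(S)_+$. A function $f\in\mathcal B(S)_+$ is $\lambda$-excessive (resp. $\lambda$-coexcessive) if $\mu R_{\lambda+\mu}f\le f$ for all $\mu>0$ and $\mu R_{\lambda+\mu}f\uparrow f$ as $\mu\to\infty$ (resp. the same with $\hat R$). Under (A1), (A2) there is for each $\lambda>0$ a unique measurable $r_\lambda:S\times S\to[0,\infty]$, the $\lambda$-resolvent density, such that $x\mapsto r_\lambda(x,y)$ is $\lambda$-excessive for every $y$, $y\mapsto r_\lambda(x,y)$ is $\lambda$-coexcessive for every $x$, and $R_\lambda(x,dy)=r_\lambda(x,y)\,m(dy)$, $\hat R_\lambda(y,dx)=r_\lambda(x,y)\,m(dx)$. (A3) (for the point $a\in S$) $r_1(a,a)<\infty$ and $x\mapsto r_1(x,a)$ is continuous at $x=a$. Under (A1)–(A3) there is a local time $L=(L(t))_{t\ge0}$ of $X$ at $a$, i.e. a perfect positive continuous additive functional of $X$ with support $\operatorname{Supp}L=\{a\}$ (where $\operatorname{Supp}L=\{x:\mathbb P_x(\inf\{t:L(t)>0\}=0)=1\}$), unique up to a multiplicative constant; it is normalized so that $\mathbb E_x\int_0^\infty e^{-\lambda t}\,dL(t)=r_\lambda(x,a)$ for all $\lambda>0$, $x\in S$. The inverse local time is $\tau(s)=\inf\{t>0:L(t)>s\}$, $s\ge0$, with $\tau(s)=\infty$ if $s\ge L(\infty):=\lim_{t\to\infty}L(t)$. Under $\mathbb P_a$, $\tau$ is a (killed) subordinator; its Laplace exponent $\Phi$ is given by $\mathbb E_a e^{-\lambda\tau(s)}=e^{-\Phi(\lambda)s}$.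 The last visit time is $$G(t)=\sup\{\tau(s):s\ge0,\ \tau(s)\le t\}=\sup\{0\le s\le t: X_s=a\},\quad t\ge0,\ \mathbb P_a\text{-a.s.}$$ Special: a Bernstein function is an infinitely differentiable $\Phi:(0,\infty)\to[0,\infty)$ with $(-d/d\lambda)^n\Phi(\lambda)\le0$ for all integers $n\ge1$, $\lambda>0$; a Bernstein function $\Phi\neq0$ is special if $\lambda/\Phi(\lambda)$ is also a Bernstein function; a subordinator is special if its Laplace exponent is. *)

theory Defs
  imports "HOL-Probability.Probability" "HOL-Library.Landau_Symbols"
begin

section \<open>The state space with its cemetery point\<close>

text \<open>The extended state space is \<^typ>\<open>'a option\<close>, with \<^const>\<open>None\<close> as the cemetery point. In the
  Alexandroff extension \<^const>\<open>None\<close> is the point at infinity if the space is non-compact and an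
  isolated point if it is compact.\<close>

abbreviation cemetery_topology :: "'a::topological_space option topology" where
  "cemetery_topology \<equiv> Alexandroff_compactification (euclidean :: 'a topology)"

definition cemetery_borel :: "'a::topological_space option measure" where
  "cemetery_borel = sigma UNIV {U. openin cemetery_topology U}"

definition radon_measure :: "'a::topological_space measure \<Rightarrow> bool" where
  "radon_measure m \<longleftrightarrow> sets m = sets borel \<and>
     (\<forall>K. compact K \<longrightarrow> emeasure m K < \<infinity>) \<and>
     (\<forall>A\<in>sets borel. emeasure m A = (SUP K\<in>{K. compact K \<and> K \<subseteq> A}. emeasure m K))"

section \<open>Hunt processes\<close>

text \<open>Time is \<^typ>\<open>ennreal\<close>, so that a process can be evaluated at stopping times with value
  \<^term>\<open>\<infinity>\<close>, where it sits in the cemetery.\<close>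

record ('w, 'a) process =
  law :: "'a option \<Rightarrow> 'w measure"
  pos :: "ennreal \<Rightarrow> 'w \<Rightarrow> 'a option"
  shift :: "ennreal \<Rightarrow> 'w \<Rightarrow> 'w"

abbreviation Omega :: "('w, 'a) process \<Rightarrow> 'w set" where
  "Omega X \<equiv> space (law X None)"

definition lifetime :: "('w, 'a) process \<Rightarrow> 'w \<Rightarrow> ennreal" where
  "lifetime X \<omega> = Inf {t. pos X t \<omega> = None}"

definition hunt_paths :: "('w, 'a::topological_space) process \<Rightarrow> bool" where
  "hunt_paths X \<longleftrightarrow> (\<forall>\<omega>\<in>Omega X.
     pos X \<infinity> \<omega> = None \<and>
     (\<forall>t\<ge>lifetime X \<omega>. pos X t \<omega> = None) \<and>
     (\<forall>t<\<infinity>. shift X t \<omega> \<in> Omega X \<and> (\<forall>s. pos X s (shift X t \<omega>) = pos X (t + s) \<omega>)) \<and>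
     (\<forall>t<\<infinity>. limitin cemetery_topology (\<lambda>s. pos X s \<omega>) (pos X t \<omega>) (at_right t)) \<and>
     (\<forall>t. 0 < t \<and> t < \<infinity> \<longrightarrow>
        (\<exists>l. limitin cemetery_topology (\<lambda>s. pos X s \<omega>) l (at_left t))))"

definition admissible_filtration ::
  "('w, 'a::topological_space) process \<Rightarrow> (ennreal \<Rightarrow> 'w measure) \<Rightarrow> bool" where
  "admissible_filtration X F \<longleftrightarrow> filtration (Omega X) F \<and>
     (\<forall>t. sets (F t) \<subseteq> sets (law X None)) \<and>
     (\<forall>t. pos X t \<in> F t \<rightarrow>\<^sub>M cemetery_borel) \<and>
     (\<forall>t<\<infinity>. sets (F t) = (\<Inter>s\<in>{t<..}. sets (F s)))"

text \<open>\<open>P\<^sub>x(X\<^bsub>T+s\<^esub> \<in> E | F\<^sub>T) = P\<^bsub>X(T)\<^esub>(X\<^sub>s \<in> E)\<close>, with the conditional probability written out. On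
  \<open>T = \<infinity>\<close> both sides refer to the cemetery.\<close>

definition strong_markov ::
  "('w, 'a::topological_space) process \<Rightarrow> (ennreal \<Rightarrow> 'w measure) \<Rightarrow> bool" where
  "strong_markov X F \<longleftrightarrow>
     (\<forall>x T s. \<forall>E\<in>sets cemetery_borel. stopping_time F T \<longrightarrow>
        (\<forall>A\<in>sets (filtration.pre_sigma (Omega X) F T).
           emeasure (law X x) {\<omega>\<in>A. pos X (T \<omega> + s) \<omega> \<in> E} =
           (\<integral>\<^sup>+\<omega>\<in>A. emeasure (law X (pos X (T \<omega>) \<omega>)) {\<omega>'\<in>Omega X. pos X s \<omega>' \<in> E} \<partial>law X x)))"

definition quasi_left_continuous ::
  "('w, 'a::topological_space) process \<Rightarrow> (ennreal \<Rightarrow> 'w measure) \<Rightarrow> bool" where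
  "quasi_left_continuous X F \<longleftrightarrow>
     (\<forall>x (T :: nat \<Rightarrow> 'w \<Rightarrow> ennreal). (\<forall>n. stopping_time F (T n)) \<and> (\<forall>\<omega>\<in>Omega X. incseq (\<lambda>n. T n \<omega>)) \<longrightarrow>
        (AE \<omega> in law X x. (SUP n. T n \<omega>) < \<infinity> \<longrightarrow>
           limitin cemetery_topology (\<lambda>n. pos X (T n \<omega>) \<omega>) (pos X (SUP n. T n \<omega>) \<omega>) sequentially))"

definition hunt_process :: "('w, 'a::topological_space) process \<Rightarrow> bool" where
  "hunt_process X \<longleftrightarrow>
     (\<forall>x. prob_space (law X x) \<and> space (law X x) = Omega X \<and> sets (law X x) = sets (law X None)) \<and>
     (\<forall>t. \<forall>E\<in>sets cemetery_borel.
        (\<lambda>x. emeasure (law X (Some x)) {\<omega>\<in>Omega X. pos X t \<omega> \<in> E}) \<in> borel_measurable borel) \<and>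
     (\<forall>x. AE \<omega> in law X x. pos X 0 \<omega> = x) \<and>
     hunt_paths X \<and>
     (\<exists>F. admissible_filtration X F \<and> strong_markov X F \<and> quasi_left_continuous X F)"

section \<open>Resolvents, excessive functions, resolvent densities\<close>

definition transition :: "('w, 'a) process \<Rightarrow> real \<Rightarrow> ('a \<Rightarrow> ennreal) \<Rightarrow> 'a \<Rightarrow> ennreal" where
  "transition X t f x = (\<integral>\<^sup>+\<omega>. case_option 0 f (pos X (ennreal t) \<omega>) \<partial>law X (Some x))"

definition resolvent :: "('w, 'a) process \<Rightarrow> real \<Rightarrow> ('a \<Rightarrow> ennreal) \<Rightarrow> 'a \<Rightarrow> ennreal" where
  "resolvent X q f x = (\<integral>\<^sup>+t\<in>{0..}. ennreal (exp (- q * t)) * transition X t f x \<partial>lborel)"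

definition resolvent_kernel :: "('w, 'a::topological_space) process \<Rightarrow> real \<Rightarrow> 'a \<Rightarrow> 'a measure" where
  "resolvent_kernel X q x = measure_of UNIV (sets borel) (\<lambda>A. resolvent X q (indicator A) x)"

definition in_duality ::
  "('w, 'a::topological_space) process \<Rightarrow> ('v, 'a) process \<Rightarrow> 'a measure \<Rightarrow> bool" where
  "in_duality X X' m \<longleftrightarrow> (\<forall>q>0.
     (\<forall>x. absolutely_continuous m (resolvent_kernel X q x)) \<and>
     (\<forall>x. absolutely_continuous m (resolvent_kernel X' q x)) \<and>
     (\<forall>f\<in>borel_measurable borel. \<forall>g\<in>borel_measurable borel.
        (\<integral>\<^sup>+x. f x * resolvent X q g x \<partial>m) = (\<integral>\<^sup>+x. resolvent X' q f x * g x \<partial>m)))"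

definition excessive ::
  "('w, 'a::topological_space) process \<Rightarrow> real \<Rightarrow> ('a \<Rightarrow> ennreal) \<Rightarrow> bool" where
  "excessive X q f \<longleftrightarrow> f \<in> borel_measurable borel \<and>
     (\<forall>x. (\<forall>\<mu>>0. ennreal \<mu> * resolvent X (q + \<mu>) f x \<le> f x) \<and>
          mono_on {0<..} (\<lambda>\<mu>. ennreal \<mu> * resolvent X (q + \<mu>) f x) \<and>
          ((\<lambda>\<mu>. ennreal \<mu> * resolvent X (q + \<mu>) f x) \<longlongrightarrow> f x) at_top)"

text \<open>Coexcessive means excessive for the dual process \<open>X'\<close>.\<close>

definition resolvent_density ::
  "('w, 'a::topological_space) process \<Rightarrow> ('v, 'a) process \<Rightarrow> 'a measure \<Rightarrow>
   (real \<Rightarrow> 'a \<Rightarrow> 'a \<Rightarrow> ennreal) \<Rightarrow> bool" where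
  "resolvent_density X X' m r \<longleftrightarrow> (\<forall>q>0.
     (\<lambda>(x, y). r q x y) \<in> borel_measurable (borel \<Otimes>\<^sub>M borel) \<and>
     (\<forall>y. excessive X q (\<lambda>x. r q x y)) \<and>
     (\<forall>x. excessive X' q (\<lambda>y. r q x y)) \<and>
     (\<forall>x. resolvent_kernel X q x = density m (\<lambda>y. r q x y)) \<and>
     (\<forall>y. resolvent_kernel X' q y = density m (\<lambda>x. r q x y)))"

section \<open>Local time\<close>

definition natural_filtration :: "('w, 'a::topological_space) process \<Rightarrow> ennreal \<Rightarrow> 'w measure" where
  "natural_filtration X t =
     sigma (Omega X) {pos X s -` E \<inter> Omega X |s E. s \<le> t \<and> E \<in> sets cemetery_borel}"

definition initial_law ::
  "('w, 'a::topological_space) process \<Rightarrow> 'a option measure \<Rightarrow> 'w measure" where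
  "initial_law X \<mu> =
     measure_of (Omega X) (sets (natural_filtration X \<infinity>)) (\<lambda>A. \<integral>\<^sup>+x. emeasure (law X x) A \<partial>\<mu>)"

text \<open>The completed filtration: the intersection over all initial distributions \<open>\<mu>\<close> of the natural
  filtration augmented by the \<open>P\<^sub>\<mu>\<close>-null sets.\<close>

definition completed_filtration ::
  "('w, 'a::topological_space) process \<Rightarrow> ennreal \<Rightarrow> 'w measure" where
  "completed_filtration X t = sigma (Omega X) {A. A \<subseteq> Omega X \<and>
     (\<forall>\<mu>. prob_space \<mu> \<and> sets \<mu> = sets cemetery_borel \<longrightarrow>
        (\<exists>B\<in>sets (natural_filtration X t). \<exists>N\<in>null_sets (initial_law X \<mu>). (A - B) \<union> (B - A) \<subseteq> N))}"

text \<open>Perfect positive continuous additive functionals. Only the values of \<open>L\<close> at times \<open>t \<ge> 0\<close>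
  matter. The exceptional set does not depend on \<open>s\<close> and \<open>t\<close>; this is what perfect means.\<close>

definition perfect_PCAF ::
  "('w, 'a::topological_space) process \<Rightarrow> (real \<Rightarrow> 'w \<Rightarrow> real) \<Rightarrow> bool" where
  "perfect_PCAF X L \<longleftrightarrow>
     (\<forall>t\<ge>0. L t \<in> borel_measurable (completed_filtration X (ennreal t))) \<and>
     (\<exists>\<Lambda>\<in>sets (completed_filtration X \<infinity>). (\<forall>x. AE \<omega> in law X x. \<omega> \<in> \<Lambda>) \<and>
        (\<forall>\<omega>\<in>\<Lambda>. L 0 \<omega> = 0 \<and> mono_on {0..} (\<lambda>t. L t \<omega>) \<and> continuous_on {0..} (\<lambda>t. L t \<omega>) \<and>
           (\<forall>s\<ge>0. \<forall>t\<ge>s. lifetime X \<omega> \<le> ennreal s \<longrightarrow> L t \<omega> = L s \<omega>) \<and>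
           (\<forall>s\<ge>0. \<forall>t\<ge>0. L (s + t) \<omega> = L s \<omega> + L t (shift X (ennreal s) \<omega>))))"

definition af_support :: "('w, 'a) process \<Rightarrow> (real \<Rightarrow> 'w \<Rightarrow> real) \<Rightarrow> 'a set" where
  "af_support X L =
     {x. AE \<omega> in law X (Some x). Inf {ennreal t |t. 0 \<le> t \<and> 0 < L t \<omega>} = 0}"

text \<open>The inner integral is the Stieltjes integral with respect to \<open>dL(t)\<close> on \<open>[0, \<infinity>)\<close>. Expectations
  and probabilities of functionals of \<open>L\<close> are taken under the completed laws, because \<open>L\<close> is only
  adapted to the completed filtration.\<close>

definition local_time ::
  "('w, 'a::topological_space) process \<Rightarrow> (real \<Rightarrow> 'a \<Rightarrow> 'a \<Rightarrow> ennreal) \<Rightarrow> 'a \<Rightarrow>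
   (real \<Rightarrow> 'w \<Rightarrow> real) \<Rightarrow> bool" where
  "local_time X r a L \<longleftrightarrow> perfect_PCAF X L \<and> af_support X L = {a} \<and>
     (\<forall>q>0. \<forall>x.
        (\<integral>\<^sup>+\<omega>. (\<integral>\<^sup>+t\<in>{0..}. ennreal (exp (- q * t)) \<partial>interval_measure (\<lambda>t. L (max 0 t) \<omega>))
          \<partial>completion (law X (Some x))) = r q x a)"

definition inverse_local_time :: "(real \<Rightarrow> 'w \<Rightarrow> real) \<Rightarrow> real \<Rightarrow> 'w \<Rightarrow> ennreal" where
  "inverse_local_time L s \<omega> = Inf {ennreal t |t. 0 < t \<and> s < L t \<omega>}"

definition last_visit :: "(real \<Rightarrow> 'w \<Rightarrow> real) \<Rightarrow> real \<Rightarrow> 'w \<Rightarrow> real" where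
  "last_visit L t \<omega> = enn2real
     (Sup {inverse_local_time L s \<omega> |s. 0 \<le> s \<and> inverse_local_time L s \<omega> \<le> ennreal t})"

section \<open>Special subordinators\<close>

definition bernstein :: "(real \<Rightarrow> real) \<Rightarrow> bool" where
  "bernstein \<Phi> \<longleftrightarrow> (\<forall>q>0. 0 \<le> \<Phi> q) \<and>
     (\<forall>n. \<forall>q>0. (deriv ^^ n) \<Phi> differentiable (at q)) \<and>
     (\<forall>n\<ge>1. \<forall>q>0. (- 1) ^ n * (deriv ^^ n) \<Phi> q \<le> 0)"

definition special_bernstein :: "(real \<Rightarrow> real) \<Rightarrow> bool" where
  "special_bernstein \<Phi> \<longleftrightarrow> bernstein \<Phi> \<and> (\<exists>q>0. \<Phi> q \<noteq> 0) \<and> bernstein (\<lambda>q. q / \<Phi> q)"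

definition laplace_exponent ::
  "'w measure \<Rightarrow> (real \<Rightarrow> 'w \<Rightarrow> ennreal) \<Rightarrow> (real \<Rightarrow> real) \<Rightarrow> bool" where
  "laplace_exponent P \<tau> \<Phi> \<longleftrightarrow> (\<forall>q>0. \<forall>s\<ge>0.
     (\<integral>\<^sup>+\<omega>. (if \<tau> s \<omega> = \<infinity> then 0 else ennreal (exp (- q * enn2real (\<tau> s \<omega>)))) \<partial>completion P) =
       ennreal (exp (- \<Phi> q * s)))"

definition special_subordinator :: "'w measure \<Rightarrow> (real \<Rightarrow> 'w \<Rightarrow> ennreal) \<Rightarrow> bool" where
  "special_subordinator P \<tau> \<longleftrightarrow> (\<exists>\<Phi>. laplace_exponent P \<tau> \<Phi> \<and> special_bernstein \<Phi>)"

section \<open>Slow variation\<close>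

definition slowly_varying_at_0 :: "(real \<Rightarrow> real) \<Rightarrow> bool" where
  "slowly_varying_at_0 l \<longleftrightarrow> (\<forall>x>0. 0 < l x) \<and> l \<in> borel_measurable (restrict_space borel {0<..}) \<and>
     (\<forall>c>0. ((\<lambda>x. l (c * x) / l x) \<longlongrightarrow> 1) (at_right 0))"

end

theory Submission
  imports Defs "HOL-Real_Asymp.Real_Asymp"
begin

text \<open>
  Under the law of \<open>X\<close> started at \<open>a\<close>, the local time regenerates: after \<open>\<tau>(s)\<close> the path starts
  afresh from \<open>a\<close>. All estimates come from this identity (\<open>regeneration\<close>) and from two functions: the
  potential \<open>U(t) = E L(t)\<close> and the decreasing function \<open>N(y)\<close>, the limit of \<open>P(\<tau>(h) \<ge> y) / h\<close> for
  \<open>h \<rightarrow> 0\<close>, which is the tail of the Levy measure of \<open>\<tau>\<close> plus its killing rate.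

  The event \<open>G(t) \<le> x\<close> says that \<open>L\<close> does not increase between \<open>x\<close> and times slightly after \<open>t\<close>. Summing
  the regeneration identity over a fine grid of local time levels gives
  \<open>U(x) N(t') \<le> P(G(t) \<le> x) \<le> U(x) N(t - x)\<close> for \<open>t' > t\<close> (\<open>last_visit_le_bounds\<close>), and the same
  summation shows that \<open>P(G(t) \<ge> t - d)\<close> is comparable with the integral of \<open>N(t - s) dU(s)\<close> over \<open>s\<close> in
  \<open>(t - d, t]\<close>.

  The exponential transforms of \<open>dU\<close> and \<open>N\<close> are \<open>r\<^sub>q(a, a)\<close> and \<open>1 / (q r\<^sub>q(a, a))\<close>; the second one
  requires that \<open>\<tau>\<close> has no drift, which follows from \<open>\<alpha> < 1\<close>. With \<open>V(x) = x\<^sup>\<alpha> / l(x)\<close>, Karamata's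
  Tauberian theorem yields \<open>U \<sim> V / \<Gamma>(1 + \<alpha>)\<close> and, for the integrated tail \<open>H\<close> of \<open>N\<close>,
  \<open>H(x) \<sim> x / (\<Gamma>(2 - \<alpha>) V(x))\<close>; monotonicity of \<open>N\<close> allows differentiation,
  \<open>N \<sim> 1 / (\<Gamma>(1 - \<alpha>) V)\<close>. Euler's reflection formula turns the product of the constants into
  \<open>sin(\<pi>\<alpha>) / (\<pi>\<alpha>)\<close>, and this is the claim on early last visits.

  For late last visits the local growth of \<open>U\<close> near \<open>t\<close> is needed, which a Tauberian theorem does not
  give. If \<open>\<tau>\<close> is special, \<open>q r\<^sub>q(a, a) = q / \<Phi>(q)\<close> is a Bernstein function. The signs of its
  derivatives say that the weights in Feller's inversion formula for \<open>dU\<close> decrease, so \<open>U\<close> is concave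
  (\<open>special_increments_decreasing\<close>). Difference quotients at scale \<open>t\<close> then bound the slope of \<open>U\<close> near
  \<open>t\<close> on both sides, the slope is about \<open>\<alpha> U(t) / t\<close>, and \<open>P(G(t) \<ge> t - d) \<sim> \<alpha> U(t) H(d) / t\<close>.

  The two-sided versions use the same inequalities; only the Tauberian theorem is replaced by its
  elementary counterpart \<open>O_Tauberian_0\<close>.
\<close>

section \<open>The topology of the cemetery\<close>

lemma compact_shrink:
  fixes x :: "'a::metric_space"
  assumes lc: "locally_compact_space (euclidean :: 'a topology)" and "open V" "x \<in> V"
  obtains W C where "open W" "compact C" "x \<in> W" "W \<subseteq> C" "C \<subseteq> V"
proof -
  obtain U K where UK: "open U" "compact K" "x \<in> U" "U \<subseteq> K"
    using lc unfolding locally_compact_space_def by simp metis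
  obtain e where e: "e > 0" "cball x e \<subseteq> V"
    using assms open_contains_cball by blast
  show ?thesis
  proof (rule that[of "U \<inter> ball x e" "K \<inter> cball x e"])
    show "compact (K \<inter> cball x e)" using UK by (intro compact_Int_closed) auto
  qed (use UK e in auto)
qed

text \<open>Local compactness and second countability give a countable base of relatively compact sets. The
  exhaustion is what makes \<open>X\<^sub>T \<in> U\<close> expressible through countably many events along approximations of
  \<open>T\<close>: limits from sets \<open>I\<close> stay in the closed sets \<open>K\<close>.\<close>

lemma cemetery_open_countable_exhaustion:
  fixes U :: "'a::{metric_space,second_countable_topology} option set"
  assumes lc: "locally_compact_space (euclidean :: 'a topology)"
    and U: "openin cemetery_topology U"
  obtains P where "countable P" "\<And>I K. (I, K) \<in> P \<Longrightarrow> openin cemetery_topology I"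
    "\<And>I K. (I, K) \<in> P \<Longrightarrow> closedin cemetery_topology K"
    "\<And>I K. (I, K) \<in> P \<Longrightarrow> I \<subseteq> K" "\<And>I K. (I, K) \<in> P \<Longrightarrow> K \<subseteq> U"
    "U = (\<Union>(I, K)\<in>P. I)"
proof -
  have base: "\<exists>P. countable P \<and> (\<forall>W C. (W, C) \<in> P \<longrightarrow> open W \<and> compact C \<and> W \<subseteq> C \<and> C \<subseteq> V) \<and> V = (\<Union>(W, C)\<in>P. W)"
    if V: "open V" for V :: "'a set"
  proof -
    define \<W> where "\<W> = {W. open W \<and> (\<exists>C. compact C \<and> W \<subseteq> C \<and> C \<subseteq> V)}"
    have cov: "V = \<Union>\<W>"
    proof
      show "V \<subseteq> \<Union>\<W>"
      proof
        fix x assume "x \<in> V"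
        then obtain W C where "open W" "compact C" "x \<in> W" "W \<subseteq> C" "C \<subseteq> V"
          using compact_shrink[OF lc V] by blast
        then show "x \<in> \<Union>\<W>" unfolding \<W>_def by blast
      qed
    qed (auto simp: \<W>_def)
    obtain \<W>' where W': "\<W>' \<subseteq> \<W>" "countable \<W>'" "\<Union>\<W>' = \<Union>\<W>"
      using Lindelof[of \<W>] unfolding \<W>_def by blast
    have "\<forall>W\<in>\<W>'. \<exists>C. compact C \<and> W \<subseteq> C \<and> C \<subseteq> V" using W'(1) unfolding \<W>_def by blast
    then obtain C where C: "\<And>W. W \<in> \<W>' \<Longrightarrow> compact (C W) \<and> W \<subseteq> C W \<and> C W \<subseteq> V" by metis
    have "V = (\<Union>(W, C)\<in>(\<lambda>W. (W, C W)) ` \<W>'. W)"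
      by (subst cov, subst W'(3)[symmetric]) auto
    moreover have "open W \<and> compact D \<and> W \<subseteq> D \<and> D \<subseteq> V" if "(W, D) \<in> (\<lambda>W. (W, C W)) ` \<W>'" for W D
      using that C W'(1) unfolding \<W>_def by blast
    ultimately show ?thesis
      using W'(2) by (intro exI[of _ "(\<lambda>W. (W, C W)) ` \<W>'"] conjI allI impI) (simp, blast+)
  qed
  have ex: "\<exists>P. countable P \<and> (\<forall>I K. (I, K) \<in> P \<longrightarrow> openin cemetery_topology I \<and> closedin cemetery_topology K \<and> I \<subseteq> K \<and> K \<subseteq> Some ` V)
     \<and> Some ` V = (\<Union>(I, K)\<in>P. I)" if V: "open V" for V :: "'a set"
  proof -
    obtain P where P: "countable P" "\<forall>W C. (W, C) \<in> P \<longrightarrow> open W \<and> compact C \<and> W \<subseteq> C \<and> C \<subseteq> V" "V = (\<Union>(W, C)\<in>P. W)"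
      using base[OF V] by blast
    let ?P = "(\<lambda>(W, C). (Some ` W, Some ` C)) ` P"
    have "openin cemetery_topology I \<and> closedin cemetery_topology K \<and> I \<subseteq> K \<and> K \<subseteq> Some ` V"
      if "(I, K) \<in> ?P" for I K
      using that P(2) by (fastforce simp: compact_imp_closed)
    moreover have "Some ` V = (\<Union>(I, K)\<in>?P. I)" by (subst P(3)) auto
    ultimately show ?thesis
      using P(1) by (intro exI[of _ ?P] conjI allI impI) (simp, blast+)
  qed
  consider V where "open V" "U = Some ` V" | C where "compact C" "U = insert None (Some ` (UNIV - C))"
    using U unfolding openin_Alexandroff_compactification compactin_euclidean_iff open_openin[symmetric] topspace_euclidean by blast
  then show ?thesis
  proof cases
    case 1
    then obtain P where P: "countable P" "\<forall>I K. (I, K) \<in> P \<longrightarrow> openin cemetery_topology I \<and> closedin cemetery_topology K \<and> I \<subseteq> K \<and> K \<subseteq> U"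
      "U = (\<Union>(I, K)\<in>P. I)"
      unfolding \<open>U = Some ` V\<close> using ex[OF \<open>open V\<close>] by blast
    show ?thesis by (rule that[OF P(1) _ _ _ _ P(3)]) (use P(2) in \<open>blast\<close>)+
  next
    case 2
    obtain P where P: "countable P" "\<forall>I K. (I, K) \<in> P \<longrightarrow> openin cemetery_topology I \<and> closedin cemetery_topology K \<and> I \<subseteq> K \<and> K \<subseteq> Some ` (UNIV - C)"
      "Some ` (UNIV - C) = (\<Union>(I, K)\<in>P. I)"
      using ex[of "UNIV - C"] open_Diff[OF open_UNIV compact_imp_closed[OF 2(1)]] by blast
    obtain Q where Q0: "countable Q \<and> (\<forall>W D. (W, D) \<in> Q \<longrightarrow> open W \<and> compact D \<and> W \<subseteq> D \<and> D \<subseteq> UNIV)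
        \<and> (UNIV :: 'a set) = (\<Union>(W, D)\<in>Q. W)"
      using base[OF open_UNIV] by (rule exE)
    note Q = Q0[THEN conjunct1] Q0[THEN conjunct2, THEN conjunct1] Q0[THEN conjunct2, THEN conjunct2]
    have "C \<subseteq> (\<Union>p\<in>Q. fst p)" using Q(3) unfolding split_beta by blast
    then obtain Q' where Q': "Q' \<subseteq> Q" "finite Q'" "C \<subseteq> (\<Union>p\<in>Q'. fst p)"
      using compactE_image[OF 2(1), of Q fst] Q(2) by (metis (no_types, lifting) \<open>C \<subseteq> (\<Union>p\<in>Q. fst p)\<close> prod.collapse)
    define W0 where "W0 = (\<Union>p\<in>Q'. fst p)"
    define D where "D = (\<Union>p\<in>Q'. snd p)"
    have Qp: "open (fst p) \<and> compact (snd p) \<and> fst p \<subseteq> snd p" if "p \<in> Q'" for p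
      using Q(2)[rule_format, of "fst p" "snd p"] Q'(1) that by auto
    have "open W0" unfolding W0_def using Qp by blast
    have "compact D" unfolding D_def using Qp Q'(2) by (intro compact_UN) blast+
    have "C \<subseteq> W0" using Q'(3) by (simp add: W0_def)
    have "W0 \<subseteq> D" unfolding W0_def D_def using Qp by blast
    define I0 where "I0 = insert None (Some ` (UNIV - D))"
    define K0 where "K0 = insert None (Some ` (UNIV - W0))"
    have 0: "openin cemetery_topology I0" unfolding I0_def
      using \<open>compact D\<close> by (auto simp: openin_Alexandroff_compactification compact_imp_closed)
    have 1: "closedin cemetery_topology K0" unfolding K0_def closedin_Alexandroff_compactification
      using \<open>open W0\<close> by (intro disjI2 exI[of _ W0]) auto
    have 2: "I0 \<subseteq> K0" "K0 \<subseteq> U" using \<open>W0 \<subseteq> D\<close> \<open>C \<subseteq> W0\<close> by (auto simp: I0_def K0_def 2)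
    have "Some ` (UNIV - C) \<subseteq> U" by (auto simp: \<open>U = _\<close>)
    show ?thesis
    proof (rule that[of "insert (I0, K0) P"])
      show "U = (\<Union>(I, K)\<in>insert (I0, K0) P. I)"
        unfolding UN_insert P(3)[symmetric] prod.case \<open>U = _\<close> using \<open>I0 \<subseteq> K0\<close> \<open>K0 \<subseteq> U\<close>
        by (auto simp: \<open>U = _\<close> I0_def)
      fix I K assume "(I, K) \<in> insert (I0, K0) P"
      then consider "I = I0 \<and> K = K0" | "(I, K) \<in> P" by blast
      then have "openin cemetery_topology I \<and> closedin cemetery_topology K \<and> I \<subseteq> K \<and> K \<subseteq> U"
      proof cases
        case 1 then show ?thesis using 0 \<open>closedin _ K0\<close> \<open>I0 \<subseteq> K0\<close> \<open>K0 \<subseteq> U\<close> by simp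
      next
        case 2
        from P(2)[rule_format, OF this] \<open>Some ` (UNIV - C) \<subseteq> U\<close> show ?thesis by (meson subset_trans)
      qed
      then show "I \<subseteq> K" "K \<subseteq> U" "openin cemetery_topology I" "closedin cemetery_topology K"
        by simp_all
    qed (use P(1) in simp)
  qed
qed

lemma space_cemetery_borel [simp]: "space cemetery_borel = UNIV"
  by (simp add: cemetery_borel_def)

lemma sets_cemetery_borel: "sets cemetery_borel = sigma_sets UNIV {U. openin cemetery_topology U}"
  by (simp add: cemetery_borel_def sets_measure_of_conv)

lemma open_in_cemetery_borel: "openin cemetery_topology U \<Longrightarrow> U \<in> sets cemetery_borel"
  by (auto simp: sets_cemetery_borel)

lemma closed_in_cemetery_borel:
  assumes "closedin cemetery_topology K" shows "K \<in> sets cemetery_borel"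
proof -
  have "UNIV - K \<in> sets cemetery_borel"
    using assms by (intro open_in_cemetery_borel) (auto simp: closedin_def notin_range_Some UNIV_option_conv[symmetric] insert_absorb)
  then have "UNIV - (UNIV - K) \<in> sets cemetery_borel"
    using sets.compl_sets by (metis space_cemetery_borel)
  then show ?thesis by (simp add: Diff_Diff_Int)
qed

lemma Some_image_cemetery:
  assumes "B \<in> sets (borel :: 'a::{t2_space} measure)"
  shows "Some ` B \<in> sets cemetery_borel"
proof -
  have "B \<in> sigma_sets UNIV (Collect open)" using assms by (simp add: borel_def)
  then show ?thesis
  proof induction
    case (Basic U) then show ?case by (intro open_in_cemetery_borel) simp
  next
    case (Compl B)
    have "Some ` (UNIV - B) = Some ` UNIV - Some ` B" by auto
    moreover have "Some ` (UNIV :: 'a set) \<in> sets cemetery_borel"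
      by (intro open_in_cemetery_borel) simp
    ultimately show ?case using Compl by auto
  next
    case (Union B)
    then show ?case by (auto simp: image_UN)
  qed simp
qed

lemma measurable_cemetery_borelI:
  fixes f :: "'a::t2_space option \<Rightarrow> 'c"
  assumes "(\<lambda>x. f (Some x)) \<in> borel \<rightarrow>\<^sub>M N" "f None \<in> space N"
  shows "f \<in> cemetery_borel \<rightarrow>\<^sub>M N"
proof (rule measurableI)
  show "f x \<in> space N" for x using assms by (cases x) (auto simp: measurable_def)
  fix E assume E: "E \<in> sets N"
  have "(\<lambda>x. f (Some x)) -` E \<in> sets borel" using measurable_sets[OF assms(1) E] by simp
  then have 1: "Some ` ((\<lambda>x. f (Some x)) -` E) \<in> sets cemetery_borel" by (rule Some_image_cemetery)
  have "UNIV - Some ` UNIV \<in> sets (cemetery_borel :: 'a option measure)"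
    using Some_image_cemetery[of "UNIV :: 'a set"] by (metis sets.compl_sets sets.top space_borel space_cemetery_borel)
  then have 2: "{None} \<in> sets (cemetery_borel :: 'a option measure)"
    by (simp add: UNIV_option_conv insert_Diff_if)
  have "f -` E \<inter> space cemetery_borel = Some ` ((\<lambda>x. f (Some x)) -` E) \<union> (if f None \<in> E then {None} else {})"
    (is "?l = ?r")
  proof (rule set_eqI)
    fix x show "x \<in> ?l \<longleftrightarrow> x \<in> ?r" by (cases x) auto
  qed
  also have "\<dots> \<in> sets cemetery_borel" by (rule sets.Un[OF 1]) (simp add: 2)
  finally show "f -` E \<inter> space cemetery_borel \<in> sets cemetery_borel" .
qed

section \<open>The strong Markov property\<close>

text \<open>The filtration, which the definition of a Hunt process only asserts to exist, is fixed here.\<close>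

locale strong_markov_process =
  fixes X :: "('w, 'a::{metric_space,second_countable_topology}) process" and F :: "ennreal \<Rightarrow> 'w measure"
  assumes locally_compact: "locally_compact_space (euclidean :: 'a topology)"
    and hunt: "hunt_process X"
    and admissible: "admissible_filtration X F"
    and strong_markov: "strong_markov X F"
begin

sublocale filtration "Omega X" F
  using admissible by (simp add: admissible_filtration_def)

lemmas hunt_unfolded = hunt[unfolded hunt_process_def]

lemma space_law: "space (law X x) = Omega X"
  and sets_law: "sets (law X x) = sets (law X None)"
  and prob_law: "prob_space (law X x)"
  using hunt_unfolded[THEN conjunct1] by blast+

lemma paths: "hunt_paths X"
  and start: "AE w in law X x. pos X 0 w = x"
  using hunt_unfolded by blast+

lemma kernel_measurable:
  "E \<in> sets cemetery_borel \<Longrightarrow> (\<lambda>x. emeasure (law X (Some x)) {w\<in>Omega X. pos X t w \<in> E}) \<in> borel_measurable borel"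
  using hunt_unfolded[THEN conjunct2, THEN conjunct1] by blast

lemma pos_infinity: "w \<in> Omega X \<Longrightarrow> pos X \<infinity> w = None"
  and shift_in_Omega: "w \<in> Omega X \<Longrightarrow> t < \<infinity> \<Longrightarrow> shift X t w \<in> Omega X"
  and pos_shift: "w \<in> Omega X \<Longrightarrow> t < \<infinity> \<Longrightarrow> pos X s (shift X t w) = pos X (t + s) w"
  and pos_right_continuous: "w \<in> Omega X \<Longrightarrow> t < \<infinity> \<Longrightarrow>
      limitin cemetery_topology (\<lambda>s. pos X s w) (pos X t w) (at_right t)"
  using paths unfolding hunt_paths_def by blast+

lemma sets_F_law: "A \<in> sets (F t) \<Longrightarrow> A \<in> sets (law X x)"
  using admissible sets_law[of x] unfolding admissible_filtration_def by blast

lemma pos_measurable_F: "pos X t \<in> F t \<rightarrow>\<^sub>M cemetery_borel"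
  using admissible unfolding admissible_filtration_def by blast

lemma pos_measurable_law [measurable]: "pos X t \<in> law X x \<rightarrow>\<^sub>M cemetery_borel"
proof (rule measurableI)
  fix E :: "'a option set" assume "E \<in> sets cemetery_borel"
  then show "pos X t -` E \<inter> space (law X x) \<in> sets (law X x)"
    using sets_F_law[OF measurable_sets[OF pos_measurable_F[of t]], of E x] unfolding space_F space_law[of x] by simp
qed simp

lemma sets_F_right_continuous:
  assumes "t < \<infinity>" "\<And>s. t < s \<Longrightarrow> A \<in> sets (F s)"
  shows "A \<in> sets (F t)"
proof -
  have "sets (F t) = (\<Inter>s\<in>{t<..}. sets (F s))"
    using admissible assms(1) unfolding admissible_filtration_def by blast
  with assms(2) show ?thesis by blast
qed

text \<open>The usual approximation of a stopping time from above by dyadic ones; the value is strictly larger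
  than \<open>t\<close>, so that right limits of the path apply.\<close>

definition upper_dyadic :: "nat \<Rightarrow> ennreal \<Rightarrow> ennreal" where
  "upper_dyadic n t = (if t = \<infinity> then \<infinity> else ennreal ((real_of_int \<lfloor>2 ^ n * enn2real t\<rfloor> + 1) / 2 ^ n))"

lemma upper_dyadic_greater:
  assumes "t < \<infinity>" shows "t < upper_dyadic n t"
proof -
  obtain u where u: "t = ennreal u" "u \<ge> 0" using assms by (cases t) auto
  have "2 ^ n * u < real_of_int \<lfloor>2 ^ n * u\<rfloor> + 1" by linarith
  then have "u < (real_of_int \<lfloor>2 ^ n * u\<rfloor> + 1) / 2 ^ n" by (simp add: field_simps)
  then show ?thesis using u by (simp add: upper_dyadic_def ennreal_less_iff)
qed

lemma upper_dyadic_tendsto: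
  assumes "t < \<infinity>"
  shows "filterlim (\<lambda>n. upper_dyadic n t) (at_right t) sequentially"
proof -
  obtain u where u: "t = ennreal u" "u \<ge> 0" using assms by (cases t) auto
  have "(\<lambda>n. (real_of_int \<lfloor>2 ^ n * u\<rfloor> + 1) / 2 ^ n) \<longlonglongrightarrow> u"
  proof (rule tendsto_sandwich[of "\<lambda>_. u" _ _ "\<lambda>n. u + (1/2) ^ n"])
    have "(\<lambda>n. u + (1/2) ^ n) \<longlonglongrightarrow> u + 0"
      by (intro tendsto_intros LIMSEQ_realpow_zero) auto
    then show "(\<lambda>n. u + (1/2) ^ n) \<longlonglongrightarrow> u" by simp
    have "2 ^ n * u < real_of_int \<lfloor>2 ^ n * u\<rfloor> + 1" for n by linarith
    then show "\<forall>\<^sub>F n in sequentially. u \<le> (real_of_int \<lfloor>2 ^ n * u\<rfloor> + 1) / 2 ^ n"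
      by (auto simp: field_simps intro!: always_eventually less_imp_le)
    have "real_of_int \<lfloor>2 ^ n * u\<rfloor> + 1 \<le> 2 ^ n * u + 1" for n by linarith
    then have "(real_of_int \<lfloor>2 ^ n * u\<rfloor> + 1) / 2 ^ n \<le> (2 ^ n * u + 1) / 2 ^ n" for n
      by (intro divide_right_mono) auto
    then show "\<forall>\<^sub>F n in sequentially. (real_of_int \<lfloor>2 ^ n * u\<rfloor> + 1) / 2 ^ n \<le> u + (1/2) ^ n"
      by (auto simp: add_divide_distrib power_one_over intro!: always_eventually)
  qed simp
  then have "(\<lambda>n. ennreal ((real_of_int \<lfloor>2 ^ n * u\<rfloor> + 1) / 2 ^ n)) \<longlonglongrightarrow> ennreal u"
    by (rule tendsto_ennrealI)
  then have "(\<lambda>n. upper_dyadic n t) \<longlonglongrightarrow> t" using u by (simp add: upper_dyadic_def)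
  then show ?thesis
    using upper_dyadic_greater[OF assms] by (auto simp: filterlim_at intro!: always_eventually dest: less_imp_neq[symmetric])
qed

text \<open>By right continuity, \<open>X\<^sub>T \<in> U\<close> holds if and only if, for some pair \<open>(I, K)\<close> of an exhaustion of \<open>U\<close>, the
  path at the dyadic approximations of \<open>T\<close> is eventually in \<open>K\<close>.\<close>

lemma pos_stopping_open_F:
  assumes T: "stopping_time F T" and U: "openin cemetery_topology U"
  shows "{w\<in>Omega X. T w < t \<and> pos X (T w) w \<in> U} \<in> sets (F t)"
proof -
  obtain P where P: "countable P" "\<And>I K. (I, K) \<in> P \<Longrightarrow> openin cemetery_topology I"
    "\<And>I K. (I, K) \<in> P \<Longrightarrow> closedin cemetery_topology K"
    "\<And>I K. (I, K) \<in> P \<Longrightarrow> I \<subseteq> K" "\<And>I K. (I, K) \<in> P \<Longrightarrow> K \<subseteq> U"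
    "U = (\<Union>(I, K)\<in>P. I)"
    using cemetery_open_countable_exhaustion[OF locally_compact U] by metis
  define B where "B n K = {w\<in>Omega X. upper_dyadic n (T w) < t \<and> pos X (upper_dyadic n (T w)) w \<in> K}" for n K
  have B: "B n K \<in> sets (F t)" if K: "closedin cemetery_topology K" for n K
  proof -
    define c where "c j = ennreal (real j / 2 ^ n)" for j
    define D where "D j = (if c (Suc j) < t then {w\<in>Omega X. \<not> T w < c j} \<inter> {w\<in>Omega X. T w < c (Suc j)}
        \<inter> {w\<in>Omega X. pos X (c (Suc j)) w \<in> K} else {})" for j
    have less: "{w\<in>Omega X. T w < c i} \<in> sets (F t)" if "c i \<le> t" for i
      using stopping_time_less_const[OF T, of "c i"] sets_F_mono[OF that]
      by (auto simp: pred_def space_F)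
    have posm: "{w\<in>Omega X. pos X (c i) w \<in> K} \<in> sets (F t)" if "c i \<le> t" for i
      using measurable_sets[OF pos_measurable_F[of "c i"] closed_in_cemetery_borel[OF K]] sets_F_mono[OF that]
      by (auto simp: space_F vimage_def Int_def conj_commute)
    have D: "D j \<in> sets (F t)" for j
    proof (cases "c (Suc j) < t")
      case True
      have "c j \<le> c (Suc j)" unfolding c_def by (intro ennreal_leI divide_right_mono) auto
      then have le: "c j \<le> t" "c (Suc j) \<le> t" using True by auto
      have "{w\<in>Omega X. \<not> T w < c j} = space (F t) - {w\<in>Omega X. T w < c j}"
        by (auto simp: space_F)
      also have "\<dots> \<in> sets (F t)" using less[OF le(1)] by (rule sets.compl_sets)
      finally show ?thesis using less[OF le(2)] posm[OF le(2)] True by (auto simp: D_def)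
    qed (simp add: D_def)
    have "B n K = (\<Union>j. D j)"
    proof (intro equalityI subsetI)
      fix w assume w: "w \<in> B n K"
      then have "T w \<noteq> \<infinity>" by (auto simp: B_def upper_dyadic_def)
      then obtain u where u: "T w = ennreal u" "u \<ge> 0" by (cases "T w") auto
      define j where "j = nat \<lfloor>2 ^ n * u\<rfloor>"
      have j: "real j = real_of_int \<lfloor>2 ^ n * u\<rfloor>" using u by (simp add: j_def)
      have "upper_dyadic n (T w) = c (Suc j)" using u j by (simp add: upper_dyadic_def c_def add.commute)
      moreover have "real j \<le> 2 ^ n * u" "2 ^ n * u < real j + 1" unfolding j by linarith+
      then have "\<not> T w < c j" "T w < c (Suc j)"
        using u by (auto simp: c_def ennreal_less_iff field_simps)
      ultimately show "w \<in> (\<Union>j. D j)" using w by (auto simp: B_def D_def)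
    next
      fix w assume "w \<in> (\<Union>j. D j)"
      then obtain j where w: "w \<in> D j" by blast
      then have t: "c (Suc j) < t" and w': "w \<in> Omega X" "c j \<le> T w" "T w < c (Suc j)" "pos X (c (Suc j)) w \<in> K"
        by (auto simp: D_def not_less split: if_splits)
      obtain u where u: "T w = ennreal u" "u \<ge> 0" using w'(3) by (cases "T w") (auto simp: c_def)
      have "real j \<le> 2 ^ n * u" "2 ^ n * u < real j + 1"
        using w'(2,3) u by (auto simp: c_def ennreal_less_iff field_simps)
      then have "\<lfloor>2 ^ n * u\<rfloor> = int j" by linarith
      then have "upper_dyadic n (T w) = c (Suc j)" using u by (simp add: upper_dyadic_def c_def add.commute)
      then show "w \<in> B n K" using t w' by (auto simp: B_def)
    qed
    then show ?thesis using D by auto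
  qed
  have Tt: "{w\<in>Omega X. T w < t} \<in> sets (F t)"
    using stopping_time_less_const[OF T, of t] by (auto simp: pred_def space_F)
  have "{w\<in>Omega X. T w < t \<and> pos X (T w) w \<in> U} =
      {w\<in>Omega X. T w < t} \<inter> (\<Union>p\<in>P. \<Union>N. \<Inter>n\<in>{N..}. B n (snd p))" (is "?l = ?r")
  proof (intro equalityI subsetI)
    fix w assume w: "w \<in> ?l"
    then have fin: "T w < \<infinity>" by (metis (mono_tags, lifting) infinity_ennreal_def mem_Collect_eq top.not_eq_extremum top.extremum_strict)
    have lim: "limitin cemetery_topology (\<lambda>s. pos X s w) (pos X (T w) w) (at_right (T w))"
      using pos_right_continuous w fin by blast
    obtain I K where IK: "(I, K) \<in> P" "pos X (T w) w \<in> I" using w P(6) by auto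
    have "\<forall>\<^sub>F s in at_right (T w). pos X s w \<in> I"
      using lim IK P(2)[OF IK(1)] by (auto simp: limitin_def)
    then have e1: "\<forall>\<^sub>F n in sequentially. pos X (upper_dyadic n (T w)) w \<in> I"
      using upper_dyadic_tendsto[OF fin] by (auto simp: filterlim_iff)
    have "\<forall>\<^sub>F s in at_right (T w). s < t"
      using w by (auto intro: eventually_at_rightI)
    then have "\<forall>\<^sub>F n in sequentially. upper_dyadic n (T w) < t"
      using upper_dyadic_tendsto[OF fin] by (auto simp: filterlim_iff)
    with e1 have "\<forall>\<^sub>F n in sequentially. w \<in> B n K"
      by eventually_elim (use w P(4)[OF IK(1)] in \<open>auto simp: B_def\<close>)
    then obtain N where "\<And>n. n \<ge> N \<Longrightarrow> w \<in> B n K" by (auto simp: eventually_sequentially)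
    then have "w \<in> (\<Union>N. \<Inter>n\<in>{N..}. B n (snd (I, K)))" by auto
    with IK(1) w show "w \<in> ?r" by blast
  next
    fix w assume w: "w \<in> ?r"
    then obtain I K N where IK: "(I, K) \<in> P" "\<And>n. n \<ge> N \<Longrightarrow> w \<in> B n K" by fastforce
    from w have w': "w \<in> Omega X" "T w < t" by auto
    then have fin: "T w < \<infinity>" by (metis infinity_ennreal_def top.not_eq_extremum top.extremum_strict)
    have lim: "limitin cemetery_topology (\<lambda>s. pos X s w) (pos X (T w) w) (at_right (T w))"
      using pos_right_continuous w' fin by blast
    then have "limitin cemetery_topology (\<lambda>n. pos X (upper_dyadic n (T w)) w) (pos X (T w) w) sequentially"
      using upper_dyadic_tendsto[OF fin] unfolding limitin_def filterlim_iff by blast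
    moreover have "\<forall>\<^sub>F n in sequentially. pos X (upper_dyadic n (T w)) w \<in> K"
      using IK(2) by (auto simp: eventually_sequentially B_def)
    ultimately have "pos X (T w) w \<in> K"
      using limitin_closedin[OF _ P(3)[OF IK(1)] _ trivial_limit_sequentially] by blast
    with P(5)[OF IK(1)] w' show "w \<in> ?l" by auto
  qed
  also have "\<dots> \<in> sets (F t)"
  proof -
    have "(\<Union>N. \<Inter>n\<in>{N..}. B n (snd p)) \<in> sets (F t)" if "p \<in> P" for p
    proof -
      have "B n (snd p) \<in> sets (F t)" for n using P(3)[of "fst p" "snd p"] that by (intro B) simp
      then show ?thesis by (intro sets.countable_UN image_subsetI sets.countable_INT') auto
    qed
    then have "(\<Union>p\<in>P. \<Union>N. \<Inter>n\<in>{N..}. B n (snd p)) \<in> sets (F t)"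
      by (rule sets.countable_UN''[OF P(1)])
    with Tt show ?thesis by (rule sets.Int)
  qed
  finally show ?thesis .
qed

lemma pos_stopping_measurable:
  assumes T: "stopping_time F T"
  shows "(\<lambda>w. pos X (T w) w) \<in> pre_sigma T \<rightarrow>\<^sub>M cemetery_borel"
  unfolding cemetery_borel_def
proof (rule measurable_measure_of)
  fix U :: "'a option set" assume "U \<in> {U. openin cemetery_topology U}"
  then have U: "openin cemetery_topology U" by simp
  have le: "{w\<in>Omega X. T w \<le> t} \<in> sets (F s)" if "t \<le> s" for t s
    using stopping_time_le_const[OF T that] by (auto simp: pred_def space_F)
  show "(\<lambda>w. pos X (T w) w) -` U \<inter> space (pre_sigma T) \<in> sets (pre_sigma T)"
  proof (rule sets_pre_sigmaI[OF T])
    fix t :: ennreal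
    show "{w \<in> (\<lambda>w. pos X (T w) w) -` U \<inter> space (pre_sigma T). T w \<le> t} \<in> sets (F t)"
      (is "?S \<in> _")
    proof (cases "t = \<infinity>")
      case True
      have None: "pos X \<infinity> w = None" if "w \<in> Omega X" for w
        using pos_infinity that by blast
      have "?S = {w\<in>Omega X. T w < t \<and> pos X (T w) w \<in> U} \<union>
          (if None \<in> U then Omega X - {w\<in>Omega X. T w < t} else {})"
        using None by (auto simp: True space_pre_sigma top.not_eq_extremum) (metis infinity_ennreal_def top.not_eq_extremum)+
      moreover have "Omega X - {w\<in>Omega X. T w < t} \<in> sets (F t)"
        using sets.compl_sets[of "{w\<in>Omega X. T w < t}" "F t"] stopping_time_less_const[OF T, of t]
        by (auto simp: pred_def space_F)
      ultimately show ?thesis using pos_stopping_open_F[OF T U, of t] by auto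
    next
      case False
      show ?thesis
      proof (rule sets_F_right_continuous)
        show "t < \<infinity>" using False by (simp add: top.not_eq_extremum)
        fix s assume s: "t < s"
        have "?S = {w\<in>Omega X. T w < s \<and> pos X (T w) w \<in> U} \<inter> {w\<in>Omega X. T w \<le> t}"
          using s by (auto simp: space_pre_sigma)
        then show "?S \<in> sets (F s)" using pos_stopping_open_F[OF T U, of s] le[of t s] s by auto
      qed
    qed
  qed
qed auto

lemma sets_pre_sigma_law: 
  assumes "stopping_time F T" "A \<in> sets (pre_sigma T)" shows "A \<in> sets (law X x)"
proof -
  have "{w\<in>A. T w \<le> \<infinity>} \<in> sets (F \<infinity>)" by (rule sets_pre_sigmaD[OF assms])
  then show ?thesis using sets_F_law by auto
qed

lemma pos_stopping_measurable_law:
  assumes "stopping_time F T"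
  shows "(\<lambda>w. pos X (T w) w) \<in> law X x \<rightarrow>\<^sub>M cemetery_borel"
proof (rule measurableI)
  fix E :: "'a option set" assume "E \<in> sets cemetery_borel"
  then show "(\<lambda>w. pos X (T w) w) -` E \<inter> space (law X x) \<in> sets (law X x)"
    using sets_pre_sigma_law[OF assms measurable_sets[OF pos_stopping_measurable[OF assms]], of E x]
    unfolding space_pre_sigma space_law[of x] by simp
qed simp

lemma stopping_time_add:
  assumes T: "stopping_time F T" shows "stopping_time F (\<lambda>w. T w + s)"
proof (rule stopping_timeI)
  fix t :: ennreal
  show "Measurable.pred (F t) (\<lambda>w. T w + s \<le> t)"
  proof (cases "s = \<infinity> \<or> \<not> s \<le> t")
    case True
    have "(T w + s \<le> t) = (s \<le> t)" for w
    proof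
      assume "T w + s \<le> t"
      moreover have "s \<le> T w + s" by simp
      ultimately show "s \<le> t" by (rule order.trans[rotated])
    next
      assume "s \<le> t"
      with True have "t = \<infinity>" by (auto simp: top_unique)
      then show "T w + s \<le> t" by simp
    qed
    then show ?thesis by simp
  next
    case False
    then have "(T w + s \<le> t) = (T w \<le> t - s)" for w
      by (cases "T w"; cases s; cases t) (auto simp: ennreal_minus top_unique simp flip: ennreal_plus)
    then show ?thesis
      using stopping_time_le_const[OF T diff_le_self_ennreal] by simp
  qed
qed

end

context strong_markov_process
begin

lemma kernel_measurable_cemetery:
  assumes "E \<in> sets cemetery_borel"
  shows "(\<lambda>y. emeasure (law X y) {w\<in>Omega X. pos X s w \<in> E}) \<in> borel_measurable cemetery_borel"
  using kernel_measurable[OF assms] by (rule measurable_cemetery_borelI) simp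

lemma emeasure_pos_eq:
  "{w\<in>Omega X. pos X s w \<in> E} = pos X s -` E \<inter> space (law X y)"
  unfolding space_law[of y] by auto

text \<open>The defining identity concerns one time and one set; monotone classes extend it to functions. The
  measurability of the inner integral has to be carried through the same induction.\<close>

lemma strong_markov_function:
  assumes "\<phi> \<in> borel_measurable cemetery_borel"
  shows "(\<lambda>y. \<integral>\<^sup>+w. \<phi> (pos X s w) \<partial>law X y) \<in> borel_measurable cemetery_borel \<and>
    (\<forall>T A. stopping_time F T \<longrightarrow> A \<in> sets (pre_sigma T) \<longrightarrow>
      (\<integral>\<^sup>+w. indicator A w * \<phi> (pos X (T w + s) w) \<partial>law X x) =
      (\<integral>\<^sup>+w. indicator A w * (\<integral>\<^sup>+w'. \<phi> (pos X s w') \<partial>law X (pos X (T w) w)) \<partial>law X x))"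
  using assms
proof (induction rule: borel_measurable_induct)
  case (cong f g)
  then have "f = g" by (auto simp: fun_eq_iff)
  with cong show ?case by simp
next
  case (set E)
  have 1: "(\<integral>\<^sup>+w. indicator E (pos X s w) \<partial>law X y) = emeasure (law X y) {w\<in>Omega X. pos X s w \<in> E}" for y
  proof -
    have "(\<integral>\<^sup>+w. indicator E (pos X s w) \<partial>law X y) = (\<integral>\<^sup>+w. indicator (pos X s -` E \<inter> space (law X y)) w \<partial>law X y)"
      by (intro nn_integral_cong) (auto simp: indicator_def)
    also have "\<dots> = emeasure (law X y) (pos X s -` E \<inter> space (law X y))"
      using set by (intro nn_integral_indicator) measurable
    finally show ?thesis by (simp only: emeasure_pos_eq[symmetric])
  qed
  have 2: "(\<integral>\<^sup>+w. indicator A w * indicator E (pos X (T w + s) w) \<partial>law X x) =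
      (\<integral>\<^sup>+w. indicator A w * emeasure (law X (pos X (T w) w)) {w\<in>Omega X. pos X s w \<in> E} \<partial>law X x)"
    if T: "stopping_time F T" and A: "A \<in> sets (pre_sigma T)" for T A
  proof -
    have Al: "A \<in> sets (law X x)" using sets_pre_sigma_law[OF T A] .
    have "(\<lambda>w. pos X (T w + s) w) -` E \<inter> space (law X x) \<in> sets (law X x)"
      using measurable_sets[OF pos_stopping_measurable_law[OF stopping_time_add[OF T]] set] .
    then have B: "A \<inter> ((\<lambda>w. pos X (T w + s) w) -` E \<inter> space (law X x)) \<in> sets (law X x)"
      using Al by auto
    have "A \<inter> ((\<lambda>w. pos X (T w + s) w) -` E \<inter> space (law X x)) = {w\<in>A. pos X (T w + s) w \<in> E}"
      using sets.sets_into_space[OF Al] by auto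
    with B have B': "{w\<in>A. pos X (T w + s) w \<in> E} \<in> sets (law X x)" by simp
    have "(\<integral>\<^sup>+w. indicator A w * indicator E (pos X (T w + s) w) \<partial>law X x) =
        (\<integral>\<^sup>+w. indicator {w\<in>A. pos X (T w + s) w \<in> E} w \<partial>law X x)"
      by (intro nn_integral_cong) (auto simp: indicator_def)
    also have "\<dots> = emeasure (law X x) {w\<in>A. pos X (T w + s) w \<in> E}"
      using B' by (rule nn_integral_indicator)
    also have "\<dots> = (\<integral>\<^sup>+w\<in>A. emeasure (law X (pos X (T w) w)) {w\<in>Omega X. pos X s w \<in> E} \<partial>law X x)"
      using strong_markov T A set unfolding strong_markov_def by blast
    finally show ?thesis by (simp only: mult.commute)
  qed
  from kernel_measurable_cemetery[OF set] 2 show ?case unfolding 1 by blast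
next
  case (mult u c)
  have m: "(\<lambda>w. u (pos X s w)) \<in> borel_measurable (law X y)" for y
    using mult(2) by measurable
  have 1: "(\<integral>\<^sup>+w. c * u (pos X s w) \<partial>law X y) = c * (\<integral>\<^sup>+w. u (pos X s w) \<partial>law X y)" for y
    by (rule nn_integral_cmult[OF m])
  have 2: "(\<integral>\<^sup>+w. indicator A w * (c * u (pos X (T w + s) w)) \<partial>law X x) =
      (\<integral>\<^sup>+w. indicator A w * (c * (\<integral>\<^sup>+w'. u (pos X s w') \<partial>law X (pos X (T w) w))) \<partial>law X x)"
    if T: "stopping_time F T" and A: "A \<in> sets (pre_sigma T)" for T A
  proof -
    note [measurable] = sets_pre_sigma_law[OF T A] pos_stopping_measurable_law[OF T]
      pos_stopping_measurable_law[OF stopping_time_add[OF T]] mult(2) mult(4)[THEN conjunct1]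
    have [measurable]: "(\<lambda>w. \<integral>\<^sup>+w'. u (pos X s w') \<partial>law X (pos X (T w) w)) \<in> borel_measurable (law X x)"
      by (rule measurable_compose[OF pos_stopping_measurable_law[OF T] mult(4)[THEN conjunct1]])
    have [measurable]: "(\<lambda>w. u (pos X (T w + s) w)) \<in> borel_measurable (law X x)"
      by (rule measurable_compose[OF pos_stopping_measurable_law[OF stopping_time_add[OF T]] mult(2)])
    show ?thesis
      using mult(4)[THEN conjunct2] T A by (simp add: mult.left_commute[of _ c] nn_integral_cmult)
  qed
  have 3: "(\<lambda>y. c * (\<integral>\<^sup>+w. u (pos X s w) \<partial>law X y)) \<in> borel_measurable cemetery_borel"
    using mult(4)[THEN conjunct1] by measurable
  show ?case unfolding 1 using 2 3 by blast
next
  case (add u v)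
  have m: "(\<lambda>w. u (pos X s w)) \<in> borel_measurable (law X y)" "(\<lambda>w. v (pos X s w)) \<in> borel_measurable (law X y)" for y
    using add(1,3) by measurable
  have 1: "(\<integral>\<^sup>+w. v (pos X s w) + u (pos X s w) \<partial>law X y) = (\<integral>\<^sup>+w. v (pos X s w) \<partial>law X y) + (\<integral>\<^sup>+w. u (pos X s w) \<partial>law X y)" for y
    by (rule nn_integral_add[OF m(2) m(1)])
  have 2: "(\<integral>\<^sup>+w. indicator A w * (v (pos X (T w + s) w) + u (pos X (T w + s) w)) \<partial>law X x) =
      (\<integral>\<^sup>+w. indicator A w * ((\<integral>\<^sup>+w'. v (pos X s w') \<partial>law X (pos X (T w) w)) + (\<integral>\<^sup>+w'. u (pos X s w') \<partial>law X (pos X (T w) w))) \<partial>law X x)"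
    if T: "stopping_time F T" and A: "A \<in> sets (pre_sigma T)" for T A
  proof -
    note [measurable] = sets_pre_sigma_law[OF T A]
    note c = measurable_compose[OF pos_stopping_measurable_law[OF T]]
      measurable_compose[OF pos_stopping_measurable_law[OF stopping_time_add[OF T]]]
    note [measurable] = c(1)[OF add.IH(1)[THEN conjunct1]] c(1)[OF add.IH(2)[THEN conjunct1]]
      c(2)[OF add(1)] c(2)[OF add(3)]
    show ?thesis
      using add.IH[THEN conjunct2] T A by (simp add: distrib_left nn_integral_add)
  qed
  have 3: "(\<lambda>y. (\<integral>\<^sup>+w. v (pos X s w) \<partial>law X y) + (\<integral>\<^sup>+w. u (pos X s w) \<partial>law X y)) \<in> borel_measurable cemetery_borel"
    using add.IH[THEN conjunct1] by measurable
  show ?case unfolding 1 using 2 3 by blast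
next
  case (seq U)
  have m: "(\<lambda>w. U i (pos X s w)) \<in> borel_measurable (law X y)" for y i
    using seq(1) by measurable
  have inc: "incseq (\<lambda>i w. U i (pos X s w))" using seq(3) by (auto simp: incseq_def le_fun_def)
  have 1: "(\<integral>\<^sup>+w. (SUP i. U i) (pos X s w) \<partial>law X y) = (SUP i. \<integral>\<^sup>+w. U i (pos X s w) \<partial>law X y)" for y
    unfolding SUP_apply by (rule nn_integral_monotone_convergence_SUP[OF inc m])
  have 2: "(\<integral>\<^sup>+w. indicator A w * (SUP i. U i) (pos X (T w + s) w) \<partial>law X x) =
      (\<integral>\<^sup>+w. indicator A w * (SUP i. \<integral>\<^sup>+w'. U i (pos X s w') \<partial>law X (pos X (T w) w)) \<partial>law X x)"
    if T: "stopping_time F T" and A: "A \<in> sets (pre_sigma T)" for T A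
  proof -
    note [measurable] = sets_pre_sigma_law[OF T A]
    note c = measurable_compose[OF pos_stopping_measurable_law[OF T]]
      measurable_compose[OF pos_stopping_measurable_law[OF stopping_time_add[OF T]]]
    note [measurable] = c(1)[OF seq.IH[THEN conjunct1]] c(2)[OF seq(1)]
    have "(\<integral>\<^sup>+w. indicator A w * (SUP i. U i) (pos X (T w + s) w) \<partial>law X x) =
       (\<integral>\<^sup>+w. (SUP i. indicator A w * U i (pos X (T w + s) w)) \<partial>law X x)"
      by (simp add: SUP_apply SUP_mult_left_ennreal image_image)
    also have "\<dots> = (SUP i. \<integral>\<^sup>+w. indicator A w * U i (pos X (T w + s) w) \<partial>law X x)"
      using seq(3) by (intro nn_integral_monotone_convergence_SUP) (auto simp: incseq_def le_fun_def intro!: mult_left_mono)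
    also have "\<dots> = (SUP i. \<integral>\<^sup>+w. indicator A w * (\<integral>\<^sup>+w'. U i (pos X s w') \<partial>law X (pos X (T w) w)) \<partial>law X x)"
      using seq.IH[THEN conjunct2] T A by simp
    also have "\<dots> = (\<integral>\<^sup>+w. (SUP i. indicator A w * (\<integral>\<^sup>+w'. U i (pos X s w') \<partial>law X (pos X (T w) w))) \<partial>law X x)"
      using seq(3) by (intro nn_integral_monotone_convergence_SUP[symmetric])
        (auto simp: incseq_def le_fun_def intro!: mult_left_mono nn_integral_mono)
    finally show ?thesis by (simp add: SUP_mult_left_ennreal image_image)
  qed
  have 3: "(\<lambda>y. SUP i. \<integral>\<^sup>+w. U i (pos X s w) \<partial>law X y) \<in> borel_measurable cemetery_borel"
    using seq.IH[THEN conjunct1] by measurable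
  show ?case unfolding 1 using 2 3 by blast
qed

definition cylinder :: "(ennreal \<times> 'a option set) list \<Rightarrow> 'w set" where
  "cylinder xs = {w\<in>Omega X. \<forall>(s, E)\<in>set xs. pos X s w \<in> E}"

lemma cylinder_sets_law:
  assumes "\<forall>(s, E)\<in>set xs. E \<in> sets cemetery_borel"
  shows "cylinder xs \<in> sets (law X y)"
proof -
  have "cylinder xs = {w\<in>space (law X y). \<forall>p\<in>set xs. pos X (fst p) w \<in> snd p}"
    unfolding space_law[of y] cylinder_def by (auto simp: split_beta)
  also have "\<dots> \<in> sets (law X y)"
    using assms by (intro sets.sets_Collect_finite_All) (auto simp: split_beta intro!: measurable_sets_Collect)
  finally show ?thesis .
qed

text \<open>Induction on the number of times: the first time is handled at \<open>T\<close>, the remaining ones at the stopping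
  time \<open>T + s\<close>, with all times shifted by \<open>s\<close>.\<close>

lemma strong_markov_cylinder:
  assumes "sorted (map fst xs)" "\<forall>(s, E)\<in>set xs. E \<in> sets cemetery_borel"
  shows "(\<lambda>y. emeasure (law X y) (cylinder xs)) \<in> borel_measurable cemetery_borel \<and>
    (\<forall>x T A. stopping_time F T \<longrightarrow> A \<in> sets (pre_sigma T) \<longrightarrow>
      emeasure (law X x) {w\<in>A. \<forall>(s, E)\<in>set xs. pos X (T w + s) w \<in> E} =
      (\<integral>\<^sup>+w. indicator A w * emeasure (law X (pos X (T w) w)) (cylinder xs) \<partial>law X x))"
  using assms
proof (induction "length xs" arbitrary: xs)
  case 0
  have "emeasure (law X y) (Omega X) = 1" for y
    using prob_space.emeasure_space_1[OF prob_law[of y]] unfolding space_law[of y] .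
  moreover have "emeasure (law X x) A = (\<integral>\<^sup>+w. indicator A w \<partial>law X x)"
    if "stopping_time F T" "A \<in> sets (pre_sigma T)" for x T A
    using nn_integral_indicator[OF sets_pre_sigma_law[OF that]] by simp
  ultimately show ?case using 0 by (simp add: cylinder_def)
next
  case (Suc n)
  then obtain s E ys where xs: "xs = (s, E) # ys" by (cases xs) auto
  define zs where "zs = map (\<lambda>(t, B). (t - s, B)) ys"
  have E: "E \<in> sets cemetery_borel" using Suc.prems xs by simp
  have ge: "s \<le> t" if "(t, B) \<in> set ys" for t B using Suc.prems(1) xs that by force
  have map_zs: "map fst zs = map (\<lambda>t. t - s) (map fst ys)" by (simp add: zs_def split_beta comp_def)
  have "sorted (map fst ys)" using Suc.prems(1) xs by simp
  then have "sorted (map fst zs)" unfolding map_zs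
    by (simp add: sorted_iff_nth_mono ennreal_minus_mono)
  moreover have "\<forall>(s, E)\<in>set zs. E \<in> sets cemetery_borel" using Suc.prems(2) xs by (auto simp: zs_def)
  moreover have "n = length zs" using Suc.hyps(2) xs by (simp add: zs_def)
  ultimately have IH0: "(\<lambda>y. emeasure (law X y) (cylinder zs)) \<in> borel_measurable cemetery_borel \<and>
    (\<forall>x T A. stopping_time F T \<longrightarrow> A \<in> sets (pre_sigma T) \<longrightarrow>
      emeasure (law X x) {w\<in>A. \<forall>(s, E)\<in>set zs. pos X (T w + s) w \<in> E} =
      (\<integral>\<^sup>+w. indicator A w * emeasure (law X (pos X (T w) w)) (cylinder zs) \<partial>law X x))"
    by (intro Suc.hyps(1))
  note IH = IH0[THEN conjunct1] IH0[THEN conjunct2, rule_format]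
  (* G: the first constraint holds at y, the remaining ones along a path from y. *)
  define G where "G y = indicator E y * emeasure (law X y) (cylinder zs)" for y
  have G: "G \<in> borel_measurable cemetery_borel"
    unfolding G_def using IH(1) E by measurable
  define K where "K y = (\<integral>\<^sup>+w. G (pos X s w) \<partial>law X y)" for y
  have step: "emeasure (law X x) {w\<in>A. \<forall>(s, E)\<in>set xs. pos X (T w + s) w \<in> E} =
      (\<integral>\<^sup>+w. indicator A w * G (pos X (T w + s) w) \<partial>law X x)"
    if T: "stopping_time F T" and A: "A \<in> sets (pre_sigma T)" for x T A
  proof -
    define A' where "A' = {w\<in>A. pos X (T w + s) w \<in> E}"
    have T': "stopping_time F (\<lambda>w. T w + s)" by (rule stopping_time_add[OF T])
    have A1: "A \<in> sets (pre_sigma (\<lambda>w. T w + s))"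
      using mono_pre_sigma[OF T T'] A by auto
    have "A' = A \<inter> ((\<lambda>w. pos X (T w + s) w) -` E \<inter> space (pre_sigma (\<lambda>w. T w + s)))"
      using sets.sets_into_space[OF A1] by (auto simp: A'_def)
    also have "\<dots> \<in> sets (pre_sigma (\<lambda>w. T w + s))"
      using A1 measurable_sets[OF pos_stopping_measurable[OF T'] E] by (rule sets.Int)
    finally have A': "A' \<in> sets (pre_sigma (\<lambda>w. T w + s))" .
    have add: "T w + s + (fst p - s) = T w + fst p" if "p \<in> set ys" for p w
      using ge[of "fst p" "snd p"] that by (simp add: add.assoc add_diff_inverse_ennreal)
    have "{w\<in>A. \<forall>(s, E)\<in>set xs. pos X (T w + s) w \<in> E} =
       {w\<in>A'. \<forall>(v, B)\<in>set zs. pos X (T w + s + v) w \<in> B}"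
      unfolding xs zs_def A'_def by (auto simp: split_beta add)
    then have "emeasure (law X x) {w\<in>A. \<forall>(s, E)\<in>set xs. pos X (T w + s) w \<in> E} =
       (\<integral>\<^sup>+w. indicator A' w * emeasure (law X (pos X (T w + s) w)) (cylinder zs) \<partial>law X x)"
      using IH(2)[OF T' A'] by simp
    also have "\<dots> = (\<integral>\<^sup>+w. indicator A w * G (pos X (T w + s) w) \<partial>law X x)"
      by (intro nn_integral_cong) (auto simp: A'_def G_def indicator_def)
    finally show ?thesis .
  qed
  have "emeasure (law X y) (cylinder xs) = K y" for y
  proof -
    have T0: "stopping_time F (\<lambda>_. 0)" by (rule stopping_time_const)
    have "emeasure (law X y) {w\<in>space (pre_sigma (\<lambda>_. 0)). \<forall>(s, E)\<in>set xs. pos X (0 + s) w \<in> E} =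
       (\<integral>\<^sup>+w. indicator (space (pre_sigma (\<lambda>_. 0))) w * G (pos X (0 + s) w) \<partial>law X y)"
      using step[OF T0 sets.top] .
    also have "\<dots> = K y" unfolding K_def
      by (intro nn_integral_cong) (simp add: space_pre_sigma space_law[of y])
    finally show ?thesis by (simp add: cylinder_def space_pre_sigma)
  qed
  then have cyl: "(\<lambda>y. emeasure (law X y) (cylinder xs)) = K" by auto
  show ?case
  proof (intro conjI allI impI)
    show "(\<lambda>y. emeasure (law X y) (cylinder xs)) \<in> borel_measurable cemetery_borel"
      unfolding cyl K_def using strong_markov_function[OF G] by blast
    fix x T A assume T: "stopping_time F T" and A: "A \<in> sets (pre_sigma T)"
    show "emeasure (law X x) {w\<in>A. \<forall>(s, E)\<in>set xs. pos X (T w + s) w \<in> E} =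
      (\<integral>\<^sup>+w. indicator A w * emeasure (law X (pos X (T w) w)) (cylinder xs) \<partial>law X x)"
      unfolding step[OF T A] fun_cong[OF cyl] K_def using strong_markov_function[OF G, of s x] T A by blast
  qed
qed

end

section \<open>Completion and path space\<close>

lemma AE_eq_completion:
  assumes S: "S \<in> sets M" and E: "E \<subseteq> space M" and AE: "AE w in M. w \<in> E \<longleftrightarrow> w \<in> S"
  shows "E \<in> sets (completion M)" "measure (completion M) E = measure M S"
proof -
  obtain N where N: "{w\<in>space M. \<not> (w \<in> E \<longleftrightarrow> w \<in> S)} \<subseteq> N" "emeasure M N = 0" "N \<in> sets M"
    using AE_E[OF AE] by blast
  have null: "N \<in> null_sets M" using N by auto
  have "E \<inter> N \<in> null_sets (completion M)"
    using null_sets_completion_subset[OF _ null_sets_completionI[OF null]] by (metis inf_le2)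
  moreover have eq: "E = (S - N) \<union> (E \<inter> N)"
    using N(1) E sets.sets_into_space[OF S] by blast
  moreover have SN: "S - N \<in> sets (completion M)" using S N by auto
  ultimately show "E \<in> sets (completion M)" by (metis null_setsD2 sets.Un)
  have "AE w in completion M. w \<in> E \<longleftrightarrow> w \<in> S" using AE by (rule AE_completion)
  then have "measure (completion M) E = measure (completion M) S"
    using \<open>E \<in> sets (completion M)\<close> S by (intro measure_eq_AE) auto
  then show "measure (completion M) E = measure M S"
    using S by (simp add: measure_def)
qed

context strong_markov_process
begin

lemma space_natural: "space (natural_filtration X t) = Omega X"
  by (simp add: natural_filtration_def space_measure_of_conv)

lemma sets_natural: "sets (natural_filtration X t) =
    sigma_sets (Omega X) {pos X s -` E \<inter> Omega X |s E. s \<le> t \<and> E \<in> sets cemetery_borel}"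
  unfolding natural_filtration_def by (rule sets_measure_of) auto

lemma sets_natural_F: "sets (natural_filtration X t) \<subseteq> sets (F t)"
proof -
  have "{pos X s -` E \<inter> Omega X |s E. s \<le> t \<and> E \<in> sets cemetery_borel} \<subseteq> sets (F t)"
  proof clarify
    fix s and E :: "'a option set" assume "s \<le> t" "E \<in> sets cemetery_borel"
    then show "pos X s -` E \<inter> Omega X \<in> sets (F t)"
      using measurable_sets[OF pos_measurable_F[of s], of E] sets_F_mono[of s t] by (auto simp: space_F)
  qed
  then show ?thesis unfolding sets_natural
    using sets.sigma_sets_subset[of _ "F t"] unfolding space_F by blast
qed

lemma sets_natural_law: "A \<in> sets (natural_filtration X t) \<Longrightarrow> A \<in> sets (law X x)"
  using sets_natural_F sets_F_law by blast

lemma sets_natural_mono: "s \<le> t \<Longrightarrow> sets (natural_filtration X s) \<subseteq> sets (natural_filtration X t)"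
  unfolding sets_natural by (intro sigma_sets_mono') (blast intro: order_trans)

definition cylinders :: "'w set set" where
  "cylinders = {cylinder xs |xs. sorted (map fst xs) \<and> (\<forall>(s, E)\<in>set xs. E \<in> sets cemetery_borel)}"

lemma cylinders_Int_stable: "Int_stable cylinders"
proof (rule Int_stableI)
  fix C D assume "C \<in> cylinders" "D \<in> cylinders"
  then obtain xs ys where xs: "C = cylinder xs" "\<forall>(s, E)\<in>set xs. E \<in> sets cemetery_borel"
    and ys: "D = cylinder ys" "\<forall>(s, E)\<in>set ys. E \<in> sets cemetery_borel"
    unfolding cylinders_def by blast
  have "C \<inter> D = cylinder (sort_key fst (xs @ ys))"
    by (auto simp: cylinder_def xs ys)
  moreover have "\<forall>(s, E)\<in>set (sort_key fst (xs @ ys)). E \<in> sets cemetery_borel"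
    using xs ys by auto
  ultimately show "C \<inter> D \<in> cylinders"
    unfolding cylinders_def using sorted_sort_key[of fst "xs @ ys"] by blast
qed

lemma sets_natural_cylinders: "sets (natural_filtration X \<infinity>) \<subseteq> sigma_sets (Omega X) cylinders"
  unfolding sets_natural
proof (rule sigma_sets_mono', clarify)
  fix s :: ennreal and E :: "'a option set" assume "E \<in> sets cemetery_borel"
  moreover have "pos X s -` E \<inter> Omega X = cylinder [(s, E)]" by (auto simp: cylinder_def)
  ultimately show "pos X s -` E \<inter> Omega X \<in> cylinders"
    unfolding cylinders_def by (intro CollectI exI[of _ "[(s, E)]"]) auto
qed

text \<open>Cylinders are stable under intersection and generate the natural filtration, so both claims spread from
  cylinders by Dynkin's argument.\<close>

lemma strong_markov_path:
  assumes \<Gamma>: "\<Gamma> \<in> sets (natural_filtration X \<infinity>)"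
  shows "(\<lambda>y. emeasure (law X y) \<Gamma>) \<in> borel_measurable cemetery_borel \<and>
    (\<forall>x T A. stopping_time F T \<longrightarrow> A \<in> sets (pre_sigma T) \<longrightarrow> (\<forall>w\<in>A. T w < \<infinity>) \<longrightarrow>
      {w\<in>A. shift X (T w) w \<in> \<Gamma>} \<in> sets (law X x) \<and>
      emeasure (law X x) {w\<in>A. shift X (T w) w \<in> \<Gamma>} =
      (\<integral>\<^sup>+w. indicator A w * emeasure (law X (pos X (T w) w)) \<Gamma> \<partial>law X x))"
    (is "?M \<Gamma> \<and> ?E \<Gamma>")
proof -
  have 0: "cylinders \<subseteq> Pow (Omega X)" by (auto simp: cylinders_def cylinder_def)
  have 1: "\<Gamma> \<in> sigma_sets (Omega X) cylinders" using \<Gamma> sets_natural_cylinders by blast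
  have shift: "shift X (T w) w \<in> Omega X"
    if "A \<in> sets (pre_sigma T)" "\<forall>w\<in>A. T w < \<infinity>" "w \<in> A" for A T w
    using sets.sets_into_space[OF that(1)] that(2,3) by (intro shift_in_Omega) (auto simp: space_pre_sigma)
  have sub: "B \<in> sets (law X x)" if "B \<in> sigma_sets (Omega X) cylinders" for B x
  proof -
    have "cylinders \<subseteq> sets (law X x)" using cylinder_sets_law by (auto simp: cylinders_def)
    then show ?thesis using sets.sigma_sets_subset[of cylinders "law X x"] that unfolding space_law[of x] by blast
  qed
  show ?thesis
    using cylinders_Int_stable 0 1
  proof (induction rule: sigma_sets_induct_disjoint)
    case (basic C)
    then obtain xs where xs: "C = cylinder xs" "sorted (map fst xs)" "\<forall>(s, E)\<in>set xs. E \<in> sets cemetery_borel"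
      unfolding cylinders_def by blast
    note cyl = strong_markov_cylinder[OF xs(2,3)]
    show ?case
    proof (intro conjI allI impI)
      show "?M C" unfolding xs(1) by (rule cyl[THEN conjunct1])
      fix x T A assume T: "stopping_time F T" and A: "A \<in> sets (pre_sigma T)" and fin: "\<forall>w\<in>A. T w < \<infinity>"
      have AO: "A \<subseteq> Omega X" using sets.sets_into_space[OF A] by (simp add: space_pre_sigma)
      have eq: "{w\<in>A. shift X (T w) w \<in> C} = {w\<in>A. \<forall>(s, E)\<in>set xs. pos X (T w + s) w \<in> E}"
      proof (intro Collect_cong conj_cong refl)
        fix w assume "w \<in> A"
        then have w: "w \<in> Omega X" "T w < \<infinity>" "shift X (T w) w \<in> Omega X"
          using AO fin shift[OF A fin] by blast+
        show "shift X (T w) w \<in> C \<longleftrightarrow> (\<forall>(s, E)\<in>set xs. pos X (T w + s) w \<in> E)"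
          unfolding xs(1) cylinder_def mem_Collect_eq pos_shift[OF w(1,2)] using w(3) by blast
      qed
      have "{w\<in>A. \<forall>(s, E)\<in>set xs. pos X (T w + s) w \<in> E} =
          A \<inter> {w\<in>space (law X x). \<forall>p\<in>set xs. pos X (T w + fst p) w \<in> snd p}"
        using AO unfolding space_law[of x] by (auto simp: split_beta)
      also have "\<dots> \<in> sets (law X x)"
      proof (intro sets.Int[OF sets_pre_sigma_law[OF T A]] sets.sets_Collect_finite_All finite_set)
        fix p assume "p \<in> set xs"
        then have "snd p \<in> sets cemetery_borel" using xs(3) by (auto simp: split_beta)
        from measurable_sets[OF pos_stopping_measurable_law[OF stopping_time_add[OF T]] this, of "fst p" x]
        show "{w\<in>space (law X x). pos X (T w + fst p) w \<in> snd p} \<in> sets (law X x)"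
          by (simp add: vimage_def Int_def conj_commute)
      qed
      finally show "{w\<in>A. shift X (T w) w \<in> C} \<in> sets (law X x)" unfolding eq .
      show "emeasure (law X x) {w\<in>A. shift X (T w) w \<in> C} =
          (\<integral>\<^sup>+w. indicator A w * emeasure (law X (pos X (T w) w)) C \<partial>law X x)"
        unfolding eq unfolding xs(1) by (rule cyl[THEN conjunct2, rule_format, OF T A])
    qed
  next
    case empty
    show ?case by simp
  next
    case (compl C)
    have c: "emeasure (law X y) (Omega X - C) = 1 - emeasure (law X y) C" for y
    proof -
      interpret prob_space "law X y" by (rule prob_law)
      show ?thesis using emeasure_compl[OF sub[OF compl(1)], of y] emeasure_finite[of C]
        unfolding space_law[of y] emeasure_space_1[unfolded space_law[of y]] by simp
    qed
    show ?case
    proof (intro conjI allI impI)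
      show "?M (Omega X - C)" unfolding c using compl(2)[THEN conjunct1] by measurable
      fix x T A assume T: "stopping_time F T" and A: "A \<in> sets (pre_sigma T)" and fin: "\<forall>w\<in>A. T w < \<infinity>"
      interpret prob_space "law X x" by (rule prob_law)
      have Al: "A \<in> sets (law X x)" using sets_pre_sigma_law[OF T A] .
      let ?S = "{w\<in>A. shift X (T w) w \<in> C}"
      have IH: "?S \<in> sets (law X x)" "emeasure (law X x) ?S =
          (\<integral>\<^sup>+w. indicator A w * emeasure (law X (pos X (T w) w)) C \<partial>law X x)"
        using compl(2)[THEN conjunct2, rule_format, OF T A] fin by simp_all
      have eq: "{w\<in>A. shift X (T w) w \<in> Omega X - C} = A - ?S"
        using shift[OF A fin] by blast
      show "{w\<in>A. shift X (T w) w \<in> Omega X - C} \<in> sets (law X x)"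
        unfolding eq using Al IH(1) by (rule sets.Diff)
      have m: "(\<lambda>w. emeasure (law X (pos X (T w) w)) C) \<in> borel_measurable (law X x)"
        by (rule measurable_compose[OF pos_stopping_measurable_law[OF T] compl(2)[THEN conjunct1]])
      have le1: "emeasure (law X y) C \<le> 1" for y
        using prob_space.emeasure_le_1[OF prob_law[of y]] .
      have "emeasure (law X x) (A - ?S) = emeasure (law X x) A - emeasure (law X x) ?S"
        using Al IH(1) by (intro emeasure_Diff) auto
      also have "\<dots> = (\<integral>\<^sup>+w. indicator A w \<partial>law X x) -
          (\<integral>\<^sup>+w. indicator A w * emeasure (law X (pos X (T w) w)) C \<partial>law X x)"
        unfolding IH(2) using Al by simp
      also have "\<dots> = (\<integral>\<^sup>+w. indicator A w - indicator A w * emeasure (law X (pos X (T w) w)) C \<partial>law X x)"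
      proof (rule nn_integral_diff[symmetric])
        show "(\<lambda>w. indicator A w * emeasure (law X (pos X (T w) w)) C) \<in> borel_measurable (law X x)"
          using Al m by measurable
        show "AE w in law X x. indicator A w * emeasure (law X (pos X (T w) w)) C \<le> indicator A w"
          using le1 by (auto simp: indicator_def)
        show "(\<integral>\<^sup>+w. indicator A w * emeasure (law X (pos X (T w) w)) C \<partial>law X x) \<noteq> \<infinity>"
          unfolding IH(2)[symmetric] by simp
      qed (use Al in measurable)
      also have "\<dots> = (\<integral>\<^sup>+w. indicator A w * emeasure (law X (pos X (T w) w)) (Omega X - C) \<partial>law X x)"
        unfolding c by (intro nn_integral_cong) (auto simp: indicator_def)
      finally show "emeasure (law X x) {w\<in>A. shift X (T w) w \<in> Omega X - C} =
        (\<integral>\<^sup>+w. indicator A w * emeasure (law X (pos X (T w) w)) (Omega X - C) \<partial>law X x)" unfolding eq .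
    qed
  next
    case (union C)
    have sets: "range C \<subseteq> sets (law X y)" for y using sub union(2) by blast
    have c: "emeasure (law X y) (\<Union>(range C)) = (\<Sum>i. emeasure (law X y) (C i))" for y
      using suminf_emeasure[OF sets union(1)] by simp
    show ?case
    proof (intro conjI allI impI)
      show "?M (\<Union>(range C))" unfolding c using union(3)[THEN conjunct1] by measurable
      fix x T A assume T: "stopping_time F T" and A: "A \<in> sets (pre_sigma T)" and fin: "\<forall>w\<in>A. T w < \<infinity>"
      let ?S = "\<lambda>i. {w\<in>A. shift X (T w) w \<in> C i}"
      have IH: "?S i \<in> sets (law X x)" "emeasure (law X x) (?S i) =
          (\<integral>\<^sup>+w. indicator A w * emeasure (law X (pos X (T w) w)) (C i) \<partial>law X x)" for i
        using union(3)[of i, THEN conjunct2, rule_format, OF T A] fin by simp_all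
      have eq: "{w\<in>A. shift X (T w) w \<in> \<Union>(range C)} = (\<Union>i. ?S i)" by blast
      show "{w\<in>A. shift X (T w) w \<in> \<Union>(range C)} \<in> sets (law X x)"
        unfolding eq using IH(1) by blast
      have m: "(\<lambda>w. emeasure (law X (pos X (T w) w)) (C i)) \<in> borel_measurable (law X x)" for i
        by (rule measurable_compose[OF pos_stopping_measurable_law[OF T] union(3)[THEN conjunct1]])
      have "disjoint_family ?S" using union(1) unfolding disjoint_family_on_def by blast
      then have "emeasure (law X x) (\<Union>i. ?S i) = (\<Sum>i. emeasure (law X x) (?S i))"
        using IH(1) by (intro suminf_emeasure[symmetric]) auto
      also have "\<dots> = (\<integral>\<^sup>+w. (\<Sum>i. indicator A w * emeasure (law X (pos X (T w) w)) (C i)) \<partial>law X x)"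
        unfolding IH(2) using sets_pre_sigma_law[OF T A, of x] m
        by (intro nn_integral_suminf[symmetric] borel_measurable_times_ennreal borel_measurable_indicator)
      also have "\<dots> = (\<integral>\<^sup>+w. indicator A w * emeasure (law X (pos X (T w) w)) (\<Union>(range C)) \<partial>law X x)"
        unfolding c by (simp add: ennreal_suminf_cmult)
      finally show "emeasure (law X x) {w\<in>A. shift X (T w) w \<in> \<Union>(range C)} =
        (\<integral>\<^sup>+w. indicator A w * emeasure (law X (pos X (T w) w)) (\<Union>(range C)) \<partial>law X x)" unfolding eq .
    qed
  qed
qed

lemma kernel_measurable_natural:
  "\<Gamma> \<in> sets (natural_filtration X \<infinity>) \<Longrightarrow> (\<lambda>y. emeasure (law X y) \<Gamma>) \<in> borel_measurable cemetery_borel"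
  using strong_markov_path by blast

lemma strong_markov_shift:
  assumes "\<Gamma> \<in> sets (natural_filtration X \<infinity>)" "stopping_time F T" "A \<in> sets (pre_sigma T)" "\<And>w. w \<in> A \<Longrightarrow> T w < \<infinity>"
  shows "{w\<in>A. shift X (T w) w \<in> \<Gamma>} \<in> sets (law X x)"
    "emeasure (law X x) {w\<in>A. shift X (T w) w \<in> \<Gamma>} =
      (\<integral>\<^sup>+w. indicator A w * emeasure (law X (pos X (T w) w)) \<Gamma> \<partial>law X x)"
  using strong_markov_path[OF assms(1), THEN conjunct2, rule_format, OF assms(2,3)] assms(4) by simp_all

lemma sets_initial_law: "sets (initial_law X \<mu>) = sets (natural_filtration X \<infinity>)"
  unfolding initial_law_def using sets.sigma_sets_eq[of "natural_filtration X \<infinity>"]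
  by (subst sets_measure_of) (use sets.space_closed[of "natural_filtration X \<infinity>"] in \<open>auto simp: space_natural\<close>)

lemma emeasure_initial_law:
  assumes \<mu>: "sets \<mu> = sets cemetery_borel" and \<Gamma>: "\<Gamma> \<in> sets (natural_filtration X \<infinity>)"
  shows "emeasure (initial_law X \<mu>) \<Gamma> = (\<integral>\<^sup>+x. emeasure (law X x) \<Gamma> \<partial>\<mu>)"
proof (rule emeasure_measure_of[OF initial_law_def])
  show "sets (natural_filtration X \<infinity>) \<subseteq> Pow (Omega X)"
    using sets.space_closed[of "natural_filtration X \<infinity>"] by (simp add: space_natural)
  show "\<Gamma> \<in> sets (initial_law X \<mu>)" using \<Gamma> by (simp add: sets_initial_law)
  show "positive (sets (initial_law X \<mu>)) (\<lambda>A. \<integral>\<^sup>+x. emeasure (law X x) A \<partial>\<mu>)"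
    by (simp add: positive_def)
  show "countably_additive (sets (initial_law X \<mu>)) (\<lambda>A. \<integral>\<^sup>+x. emeasure (law X x) A \<partial>\<mu>)"
    unfolding sets_initial_law
  proof (rule countably_additiveI)
    fix C :: "nat \<Rightarrow> 'w set"
    assume C: "range C \<subseteq> sets (natural_filtration X \<infinity>)" "disjoint_family C"
    have m: "(\<lambda>y. emeasure (law X y) (C i)) \<in> borel_measurable \<mu>" for i
      using kernel_measurable_natural[of "C i"] C(1) measurable_cong_sets[OF \<mu> refl] by blast
    have r: "range C \<subseteq> sets (law X y)" for y using C(1) sets_natural_law by blast
    have "(\<Sum>i. \<integral>\<^sup>+x. emeasure (law X x) (C i) \<partial>\<mu>) = (\<integral>\<^sup>+x. (\<Sum>i. emeasure (law X x) (C i)) \<partial>\<mu>)"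
      using m by (intro nn_integral_suminf[symmetric])
    also have "\<dots> = (\<integral>\<^sup>+x. emeasure (law X x) (\<Union>(range C)) \<partial>\<mu>)"
      using suminf_emeasure[OF r C(2)] by simp
    finally show "(\<Sum>i. \<integral>\<^sup>+x. emeasure (law X x) (C i) \<partial>\<mu>) = (\<integral>\<^sup>+x. emeasure (law X x) (\<Union>(range C)) \<partial>\<mu>)" .
  qed
qed

text \<open>The sets with this approximation property, for all initial laws at once, already form a sigma-algebra.\<close>

lemma completed_filtration_approx:
  assumes A: "A \<in> sets (completed_filtration X t)" and \<mu>: "prob_space \<mu>" "sets \<mu> = sets cemetery_borel"
  obtains B N where "B \<in> sets (natural_filtration X t)" "N \<in> sets (natural_filtration X \<infinity>)"
    "(\<integral>\<^sup>+x. emeasure (law X x) N \<partial>\<mu>) = 0" "A - B \<subseteq> N" "B - A \<subseteq> N"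
proof -
  let ?C = "{A. A \<subseteq> Omega X \<and>
     (\<forall>\<mu>. prob_space \<mu> \<and> sets \<mu> = sets cemetery_borel \<longrightarrow>
        (\<exists>B\<in>sets (natural_filtration X t). \<exists>N\<in>null_sets (initial_law X \<mu>). (A - B) \<union> (B - A) \<subseteq> N))}"
  have "A \<in> sigma_sets (Omega X) ?C"
    using A unfolding completed_filtration_def by (subst (asm) sets_measure_of) auto
  then have "A \<subseteq> Omega X \<and> (\<exists>B\<in>sets (natural_filtration X t). \<exists>N\<in>null_sets (initial_law X \<mu>). (A - B) \<union> (B - A) \<subseteq> N)"
  proof induction
    case (Basic A) then show ?case using \<mu> by blast
  next
    case Empty
    show ?case by (intro conjI bexI[of _ "{}"]) auto
  next
    case (Compl A)
    then obtain B N where BN: "B \<in> sets (natural_filtration X t)" "N \<in> null_sets (initial_law X \<mu>)" "(A - B) \<union> (B - A) \<subseteq> N" by blast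
    have "Omega X - B \<in> sets (natural_filtration X t)"
      using sets.compl_sets[OF BN(1)] by (simp add: space_natural)
    moreover have "(Omega X - A) - (Omega X - B) \<union> ((Omega X - B) - (Omega X - A)) \<subseteq> N"
      using BN(3) by blast
    ultimately show ?case using BN(2) by blast
  next
    case (Union A)
    then have "\<forall>i. \<exists>B N. B \<in> sets (natural_filtration X t) \<and> N \<in> null_sets (initial_law X \<mu>) \<and> (A i - B) \<union> (B - A i) \<subseteq> N"
      using Union.IH[THEN conjunct2] by (meson)
    then obtain B N where BN: "\<And>i. B i \<in> sets (natural_filtration X t)" "\<And>i. N i \<in> null_sets (initial_law X \<mu>)"
        "\<And>i. (A i - B i) \<union> (B i - A i) \<subseteq> N i" by metis
    have 1: "(\<Union>i. B i) \<in> sets (natural_filtration X t)" using BN(1) by blast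
    have 2: "(\<Union>i. N i) \<in> null_sets (initial_law X \<mu>)" using BN(2) by (rule null_sets_UN)
    have 3: "((\<Union>i. A i) - (\<Union>i. B i)) \<union> ((\<Union>i. B i) - (\<Union>i. A i)) \<subseteq> (\<Union>i. N i)" using BN(3) by blast
    have "A i \<subseteq> Omega X" for i using Union.IH[of i] by (rule conjunct1)
    then have 4: "(\<Union>i. A i) \<subseteq> Omega X" by (rule UN_least)
    show ?case
      by (rule conjI[OF 4], rule bexI[OF _ 1], rule bexI[OF _ 2], rule 3)
  qed
  then obtain B N where BN: "B \<in> sets (natural_filtration X t)" "N \<in> null_sets (initial_law X \<mu>)" "(A - B) \<union> (B - A) \<subseteq> N"
    by blast
  have N: "N \<in> sets (natural_filtration X \<infinity>)" "emeasure (initial_law X \<mu>) N = 0"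
    using BN(2) by (auto simp: sets_initial_law null_sets_def)
  show ?thesis
    using that[OF BN(1) N(1)] emeasure_initial_law[OF \<mu>(2) N(1)] N(2) BN(3) by auto
qed

lemma completed_filtration_approx_point:
  assumes A: "A \<in> sets (completed_filtration X t)"
  obtains B N where "B \<in> sets (natural_filtration X t)" "N \<in> sets (natural_filtration X \<infinity>)"
    "emeasure (law X x) N = 0" "A - B \<subseteq> N" "B - A \<subseteq> N"
proof -
  have \<mu>: "prob_space (return cemetery_borel x)" "sets (return cemetery_borel x) = sets cemetery_borel"
    by (auto intro: prob_space_return)
  obtain B N where BN: "B \<in> sets (natural_filtration X t)" "N \<in> sets (natural_filtration X \<infinity>)"
    "(\<integral>\<^sup>+y. emeasure (law X y) N \<partial>return cemetery_borel x) = 0" "A - B \<subseteq> N" "B - A \<subseteq> N"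
    using completed_filtration_approx[OF A \<mu>] .
  have "(\<integral>\<^sup>+y. emeasure (law X y) N \<partial>return cemetery_borel x) = emeasure (law X x) N"
    using kernel_measurable_natural[OF BN(2)] by (intro nn_integral_return) auto
  with BN show ?thesis using that[of B N] by simp
qed

lemma sets_completed_completion:
  assumes A: "A \<in> sets (completed_filtration X t)"
  shows "A \<in> sets (completion (law X x))"
proof -
  obtain B N where BN: "B \<in> sets (natural_filtration X t)" "N \<in> sets (natural_filtration X \<infinity>)"
    "emeasure (law X x) N = 0" "A - B \<subseteq> N" "B - A \<subseteq> N"
    using completed_filtration_approx_point[OF A, of x] .
  have "A \<subseteq> Omega X" using sets.sets_into_space[OF A]
    by (auto simp: completed_filtration_def space_measure_of_conv)
  moreover have "N \<in> null_sets (law X x)" using BN(2,3) sets_natural_law by blast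
  then have "AE w in law X x. w \<in> A \<longleftrightarrow> w \<in> B"
    by (rule AE_I') (use BN(4,5) in auto)
  ultimately show ?thesis
    using AE_eq_completion(1)[OF sets_natural_law[OF BN(1)], of A x] unfolding space_law[of x] by blast
qed

end

section \<open>Regeneration of the local time\<close>

text \<open>Continuity of \<open>L\<close> excludes that the level \<open>s\<close> is passed exactly at time \<open>t\<close>.\<close>

lemma inverse_local_time_less_iff:
  assumes mono: "mono_on {0..} (\<lambda>t. L t w)" and cont: "continuous_on {0..} (\<lambda>t. L t w)" and t: "0 < t"
  shows "inverse_local_time L s w < ennreal t \<longleftrightarrow> s < L t w"
proof
  assume "inverse_local_time L s w < ennreal t"
  then obtain u where u: "0 < u" "s < L u w" "ennreal u < ennreal t"
    unfolding inverse_local_time_def Inf_less_iff by blast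
  then have "u < t" using t by (simp add: ennreal_less_iff)
  then have "L u w \<le> L t w" using mono u t by (auto simp: mono_on_def)
  then show "s < L t w" using u by simp
next
  assume s: "s < L t w"
  have "isCont (\<lambda>t. L t w) t"
    using continuous_on_interior[OF cont, of t] t by (simp add: interior_real_atLeast)
  then have "((\<lambda>t. L t w) \<longlongrightarrow> L t w) (at_left t)"
    by (simp add: isCont_def filterlim_at_split)
  then have "\<forall>\<^sub>F u in at_left t. s < L u w" using s by (rule order_tendstoD)
  moreover have "\<forall>\<^sub>F u in at_left t. u \<in> {0<..<t}" using t by (rule eventually_at_leftI[rotated]) simp
  ultimately have "\<forall>\<^sub>F u in at_left t. s < L u w \<and> u \<in> {0<..<t}" by eventually_elim simp
  then obtain u where u: "s < L u w" "0 < u" "u < t"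
    using eventually_happens[of _ "at_left t"] by auto
  then have "inverse_local_time L s w \<le> ennreal u"
    unfolding inverse_local_time_def by (intro Inf_lower) auto
  also have "\<dots> < ennreal t" using u by (simp add: ennreal_less_iff)
  finally show "inverse_local_time L s w < ennreal t" .
qed

lemma at_inverse_local_time:
  assumes zero: "L 0 w = 0" and mono: "mono_on {0..} (\<lambda>t. L t w)" and cont: "continuous_on {0..} (\<lambda>t. L t w)"
    and s: "0 \<le> s" and u: "inverse_local_time L s w = ennreal u" "0 \<le> u"
  shows "L u w = s" "u < t \<Longrightarrow> s < L t w"
proof -
  show gt: "s < L t w" if "u < t" for t
    using inverse_local_time_less_iff[of L w t s, OF mono cont] u that by (simp add: ennreal_less_iff)
  have "\<not> s < L u w"
  proof (cases "u = 0")
    case False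
    then show ?thesis using inverse_local_time_less_iff[of L w u s, OF mono cont] u by simp
  qed (use zero s in simp)
  moreover have "s \<le> L u w"
  proof (rule tendsto_lowerbound)
    have "((\<lambda>t. L t w) \<longlongrightarrow> L u w) (at u within {0..})"
      using cont u by (auto simp: continuous_on_def)
    then show "((\<lambda>t. L t w) \<longlongrightarrow> L u w) (at_right u)"
      by (rule tendsto_mono[rotated]) (use u in \<open>intro at_le, auto\<close>)
    show "\<forall>\<^sub>F t in at_right u. s \<le> L t w"
      using gt by (intro eventually_at_rightI[of u "u + 1"]) (auto intro: less_imp_le)
  qed simp
  ultimately show "L u w = s" by simp
qed

lemma space_completed_filtration: "space (completed_filtration X t) = Omega X"
  by (simp add: completed_filtration_def space_measure_of_conv)

text \<open>A perfect positive continuous additive functional whose support is one point; \<open>\<Lambda>\<close> is the set of paths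
  on which it behaves as it should.\<close>

locale local_time_process = strong_markov_process X F
  for X :: "('w, 'a::{metric_space,second_countable_topology}) process" and F +
  fixes L :: "real \<Rightarrow> 'w \<Rightarrow> real" and a :: 'a and \<Lambda> :: "'w set"
  assumes L_adapted: "0 \<le> t \<Longrightarrow> L t \<in> borel_measurable (completed_filtration X (ennreal t))"
    and \<Lambda>_sets: "\<Lambda> \<in> sets (completed_filtration X \<infinity>)"
    and \<Lambda>_AE: "AE w in law X x. w \<in> \<Lambda>"
    and L_0: "w \<in> \<Lambda> \<Longrightarrow> L 0 w = 0"
    and L_mono: "w \<in> \<Lambda> \<Longrightarrow> mono_on {0..} (\<lambda>t. L t w)"
    and L_cont: "w \<in> \<Lambda> \<Longrightarrow> continuous_on {0..} (\<lambda>t. L t w)"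
    and L_dead: "w \<in> \<Lambda> \<Longrightarrow> 0 \<le> s \<Longrightarrow> s \<le> t \<Longrightarrow> lifetime X w \<le> ennreal s \<Longrightarrow> L t w = L s w"
    and L_additive: "w \<in> \<Lambda> \<Longrightarrow> 0 \<le> s \<Longrightarrow> 0 \<le> t \<Longrightarrow> L (s + t) w = L s w + L t (shift X (ennreal s) w)"
    and L_support: "af_support X L = {a}"
begin

abbreviation \<tau> where "\<tau> \<equiv> inverse_local_time L"

lemma L_greater_sets: "0 \<le> t \<Longrightarrow> {w\<in>Omega X. u < L t w} \<in> sets (completed_filtration X (ennreal t))"
  using measurable_sets[OF L_adapted[of t], of "{u<..}"]
  by (simp add: space_completed_filtration vimage_def Int_def conj_commute)

lemma stopping_time_lessI:
  assumes less: "\<And>t. t < \<infinity> \<Longrightarrow> {w\<in>Omega X. T w < t} \<in> sets (F t)"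
  shows "stopping_time F T"
proof (rule stopping_timeI)
  fix t :: ennreal
  have "{w\<in>Omega X. T w \<le> t} \<in> sets (F t)"
  proof (cases "t < \<infinity>")
    case True
    show ?thesis
    proof (rule sets_F_right_continuous[OF True])
      fix s assume s: "t < s"
      have "\<forall>\<^sub>F r in at_right t. r < s" using s by (auto intro: eventually_at_rightI)
      then have "\<forall>\<^sub>F n in sequentially. upper_dyadic n t < s"
        using upper_dyadic_tendsto[OF True] by (auto simp: filterlim_iff)
      then obtain N where N: "\<And>n. n \<ge> N \<Longrightarrow> upper_dyadic n t < s" by (auto simp: eventually_sequentially)
      have lim: "(\<lambda>n. upper_dyadic n t) \<longlonglongrightarrow> t"
        using upper_dyadic_tendsto[OF True] by (simp add: filterlim_at)
      have "T w \<le> t \<longleftrightarrow> (\<forall>n\<in>{N..}. T w < upper_dyadic n t)" for w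
      proof
        show "T w \<le> t \<Longrightarrow> \<forall>n\<in>{N..}. T w < upper_dyadic n t"
          using upper_dyadic_greater[OF True] by (blast intro: le_less_trans)
        assume "\<forall>n\<in>{N..}. T w < upper_dyadic n t"
        then show "T w \<le> t" by (intro LIMSEQ_le_const[OF lim] exI[of _ N]) (simp add: less_imp_le)
      qed
      then have "{w\<in>Omega X. T w \<le> t} = (\<Inter>n\<in>{N..}. {w\<in>Omega X. T w < upper_dyadic n t})"
        by auto
      also have "\<dots> \<in> sets (F s)"
      proof (intro sets.countable_INT' image_subsetI)
        fix n assume "n \<in> {N..}"
        then have *: "upper_dyadic n t < s" using N by simp
        then have "upper_dyadic n t < \<infinity>" by (metis infinity_ennreal_def top.not_eq_extremum top.extremum_strict)
        then have "{w\<in>Omega X. T w < upper_dyadic n t} \<in> sets (F (upper_dyadic n t))" by (rule less)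
        then show "{w\<in>Omega X. T w < upper_dyadic n t} \<in> sets (F s)"
          by (rule subsetD[OF sets_F_mono[OF less_imp_le[OF *]]])
      qed auto
      finally show "{w\<in>Omega X. T w \<le> t} \<in> sets (F s)" .
    qed
  next
    case False
    then have "t = top" by (cases t) auto
    then have "{w\<in>Omega X. T w \<le> t} = space (F t)" by (auto simp: space_F)
    then show ?thesis by (metis sets.top)
  qed
  then show "Measurable.pred (F t) (\<lambda>w. T w \<le> t)" by (simp add: pred_def space_F)
qed

text \<open>The local time is adapted to the completed filtration only, whereas the strong Markov property is
  available for \<open>F\<close>. Replacing the events \<open>u < L(q)\<close> for rational \<open>q\<close> by natural ones produces a stopping
  time that agrees with \<open>\<tau>(u)\<close> almost surely.\<close>

lemma inverse_local_time_stopping_version: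
  obtains T where "stopping_time F T" "AE w in law X x. T w = \<tau> u w"
proof -
  have "\<forall>q\<in>\<rat> \<inter> {0<..}. \<exists>p. fst p \<in> sets (natural_filtration X (ennreal q)) \<and> snd p \<in> null_sets (law X x) \<and>
      {w\<in>Omega X. u < L q w} - fst p \<subseteq> snd p \<and> fst p - {w\<in>Omega X. u < L q w} \<subseteq> snd p"
  proof
    fix q :: real assume q: "q \<in> \<rat> \<inter> {0<..}"
    then have "0 \<le> q" by simp
    obtain B N where BN: "B \<in> sets (natural_filtration X (ennreal q))" "N \<in> sets (natural_filtration X \<infinity>)"
      "emeasure (law X x) N = 0" "{w\<in>Omega X. u < L q w} - B \<subseteq> N" "B - {w\<in>Omega X. u < L q w} \<subseteq> N"
      using completed_filtration_approx_point[OF L_greater_sets[OF \<open>0 \<le> q\<close>, of u], of x] .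
    have "N \<in> null_sets (law X x)" using sets_natural_law[OF BN(2)] BN(3) by (intro null_setsI)
    with BN show "\<exists>p. fst p \<in> sets (natural_filtration X (ennreal q)) \<and> snd p \<in> null_sets (law X x) \<and>
      {w\<in>Omega X. u < L q w} - fst p \<subseteq> snd p \<and> fst p - {w\<in>Omega X. u < L q w} \<subseteq> snd p"
      by (intro exI[of _ "(B, N)"]) simp
  qed
  from bchoice[OF this] obtain p where p: "\<forall>q\<in>\<rat> \<inter> {0<..}. fst (p q) \<in> sets (natural_filtration X (ennreal q)) \<and> snd (p q) \<in> null_sets (law X x) \<and>
      {w\<in>Omega X. u < L q w} - fst (p q) \<subseteq> snd (p q) \<and> fst (p q) - {w\<in>Omega X. u < L q w} \<subseteq> snd (p q)"
    by (elim exE)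
  define B N where "B q = fst (p q)" and "N q = snd (p q)" for q
  have B: "\<And>q. q \<in> \<rat> \<inter> {0<..} \<Longrightarrow> B q \<in> sets (natural_filtration X (ennreal q))"
    and N: "\<And>q. q \<in> \<rat> \<inter> {0<..} \<Longrightarrow> N q \<in> null_sets (law X x)"
    and BN: "\<And>q. q \<in> \<rat> \<inter> {0<..} \<Longrightarrow> {w\<in>Omega X. u < L q w} - B q \<subseteq> N q \<and> B q - {w\<in>Omega X. u < L q w} \<subseteq> N q"
    unfolding B_def N_def using p by simp_all
  have ctbl: "countable (\<rat> \<inter> {0<..} :: real set)" using countable_rat by blast
  (* Rational times only, so that the union of the exceptional sets N q is null. *)
  define T where "T w = Inf {ennreal q |q. q \<in> \<rat> \<inter> {0<..} \<and> w \<in> B q}" for w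
  show ?thesis
  proof (rule that[of T])
    show "stopping_time F T"
    proof (rule stopping_time_lessI)
      fix t :: ennreal assume "t < \<infinity>"
      have BO: "B q \<subseteq> Omega X" if "q \<in> \<rat> \<inter> {0<..}" for q
        using sets.sets_into_space[OF B[OF that]] by (simp add: space_natural)
      have "{w\<in>Omega X. T w < t} = (\<Union>q\<in>{q \<in> \<rat> \<inter> {0<..}. ennreal q < t}. B q)"
        unfolding T_def Inf_less_iff using BO by blast
      also have "\<dots> \<in> sets (F t)"
      proof (rule sets.countable_UN'')
        show "countable {q \<in> \<rat> \<inter> {0<..}. ennreal q < t}" using ctbl by (rule countable_subset[rotated]) auto
        fix q assume "q \<in> {q \<in> \<rat> \<inter> {0<..}. ennreal q < t}"
        then have "B q \<in> sets (F (ennreal q))" "ennreal q \<le> t" using B sets_natural_F by auto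
        then show "B q \<in> sets (F t)" using sets_F_mono by blast
      qed
      finally show "{w\<in>Omega X. T w < t} \<in> sets (F t)" .
    qed
    have "(\<Union>q\<in>\<rat> \<inter> {0<..}. N q) \<in> null_sets (law X x)" using N ctbl by (intro null_sets_UN') auto
    then have "AE w in law X x. w \<notin> (\<Union>q\<in>\<rat> \<inter> {0<..}. N q)" by (rule AE_not_in)
    then show "AE w in law X x. T w = \<tau> u w"
      using \<Lambda>_AE[of x] AE_space[of "law X x"]
    proof eventually_elim
      case (elim w)
      have O: "w \<in> Omega X" using elim(3) unfolding space_law[of x] .
      have iff: "w \<in> B q \<longleftrightarrow> u < L q w" if "q \<in> \<rat> \<inter> {0<..}" for q
        using BN[OF that] elim(1) that O by blast
      show "T w = \<tau> u w"
      proof (rule antisym)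
        show "\<tau> u w \<le> T w" unfolding T_def inverse_local_time_def
          by (rule Inf_superset_mono) (use iff in auto)
        show "T w \<le> \<tau> u w" unfolding inverse_local_time_def
        proof (rule Inf_greatest)
          fix y assume "y \<in> {ennreal t |t. 0 < t \<and> u < L t w}"
          then obtain t where t: "y = ennreal t" "0 < t" "u < L t w" by blast
          show "T w \<le> y"
          proof (rule dense_ge)
            fix z assume "y < z"
            then obtain v1 where v1: "y < ennreal v1" "ennreal v1 < z" "v1 > t"
              using dense[OF \<open>y < z\<close>] t by (metis ennreal_cases ennreal_less_iff infinity_ennreal_def less_imp_le top.not_eq_extremum top.extremum_strict)
            obtain q where q: "q \<in> \<rat>" "t < q" "q < v1" using Rats_dense_in_real[OF v1(3)] by blast
            have "L t w \<le> L q w" using L_mono[OF elim(2)] t q by (auto simp: mono_on_def)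
            then have "w \<in> B q" using iff[of q] t q by auto
            then have "T w \<le> ennreal q" unfolding T_def using q t by (intro Inf_lower) auto
            also have "\<dots> \<le> ennreal v1" using q by (intro ennreal_leI) auto
            finally show "T w \<le> z" using v1(2) by auto
          qed
        qed
      qed
    qed
  qed
qed

lemma L_shift_inverse:
  assumes w: "w \<in> \<Lambda>" and u: "0 \<le> u" and fin: "\<tau> u w < \<infinity>" and t: "0 \<le> t"
  shows "L t (shift X (\<tau> u w) w) = L (enn2real (\<tau> u w) + t) w - u"
proof -
  obtain v where v: "\<tau> u w = ennreal v" "0 \<le> v" using fin by (cases "\<tau> u w") auto
  show ?thesis
    using L_additive[OF w v(2) t] at_inverse_local_time(1)[of L w u v] L_0[OF w] L_mono[OF w] L_cont[OF w] u v
    by simp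
qed

text \<open>Right after \<open>\<tau>(u)\<close> the local time increases. By the strong Markov property, it therefore increases
  immediately under the law started from \<open>X\<close> at \<open>\<tau>(u)\<close>, so this state lies in the support.\<close>

lemma pos_at_inverse_local_time:
  assumes u: "0 \<le> u" and T: "stopping_time F T" and T\<tau>: "AE w in law X x. T w = \<tau> u w"
  shows "AE w in law X x. T w < \<infinity> \<longrightarrow> pos X (T w) w = Some a"
proof -
  interpret P: prob_space "law X x" by (rule prob_law)
  define \<nu> where "\<nu> = distr (law X x) cemetery_borel (\<lambda>w. pos X (T w) w)"
  have \<nu>: "prob_space \<nu>" "sets \<nu> = sets cemetery_borel"
    unfolding \<nu>_def by (auto intro!: P.prob_space_distr pos_stopping_measurable_law[OF T])
  (* The local time has increased by time 1/(n+1). *)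
  define \<Gamma> where "\<Gamma> n = {w\<in>Omega X. 0 < L (1 / Suc n) w}" for n :: nat
  have "\<exists>B N. B \<in> sets (natural_filtration X \<infinity>) \<and> N \<in> sets (natural_filtration X \<infinity>) \<and>
    (\<integral>\<^sup>+y. emeasure (law X y) N \<partial>\<nu>) = 0 \<and> \<Gamma> n - B \<subseteq> N \<and> B - \<Gamma> n \<subseteq> N" for n
  proof -
    have "\<Gamma> n \<in> sets (completed_filtration X (ennreal (1 / Suc n)))" unfolding \<Gamma>_def by (rule L_greater_sets) simp
    from completed_filtration_approx[OF this \<nu>] obtain B N where BN: "B \<in> sets (natural_filtration X (ennreal (1 / Suc n)))"
      "N \<in> sets (natural_filtration X \<infinity>)" "(\<integral>\<^sup>+y. emeasure (law X y) N \<partial>\<nu>) = 0" "\<Gamma> n - B \<subseteq> N" "B - \<Gamma> n \<subseteq> N" by metis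
    have "B \<in> sets (natural_filtration X \<infinity>)" using BN(1) sets_natural_mono[of "ennreal (1 / Suc n)" \<infinity>] by auto
    with BN show ?thesis by blast
  qed
  then obtain B N where B: "\<And>n. B n \<in> sets (natural_filtration X \<infinity>)" and N: "\<And>n. N n \<in> sets (natural_filtration X \<infinity>)"
    and N0: "\<And>n. (\<integral>\<^sup>+y. emeasure (law X y) (N n) \<partial>\<nu>) = 0" and BN: "\<And>n. \<Gamma> n - B n \<subseteq> N n" "\<And>n. B n - \<Gamma> n \<subseteq> N n"
    by metis
  have "AE w in law X x. emeasure (law X (pos X (T w) w)) (N n) = 0" for n
  proof -
    have "(\<integral>\<^sup>+w. emeasure (law X (pos X (T w) w)) (N n) \<partial>law X x) = 0"
      using N0[of n] unfolding \<nu>_def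
      by (subst (asm) nn_integral_distr) (auto intro!: pos_stopping_measurable_law[OF T] kernel_measurable_natural N)
    then show ?thesis
      by (subst (asm) nn_integral_0_iff_AE)
        (auto intro!: measurable_compose[OF pos_stopping_measurable_law[OF T] kernel_measurable_natural] N)
  qed
  then have null: "AE w in law X x. \<forall>n. emeasure (law X (pos X (T w) w)) (N n) = 0"
    by (subst AE_all_countable) blast
  define A where "A = {w\<in>Omega X. T w < \<infinity>}"
  have A: "A \<in> sets (pre_sigma T)"
  proof -
    have "A = T -` {..<\<infinity>} \<inter> space (pre_sigma T)" by (auto simp: A_def space_pre_sigma)
    also have "\<dots> \<in> sets (pre_sigma T)"
      by (rule measurable_sets[OF measurable_stopping_time_pre_sigma[OF T]]) simp
    finally show ?thesis .
  qed
  have Al: "A \<in> sets (law X x)" by (rule sets_pre_sigma_law[OF T A])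
  have fin: "\<And>w. w \<in> A \<Longrightarrow> T w < \<infinity>" by (simp add: A_def)
  have full: "AE w in law X x. w \<in> A \<longrightarrow> emeasure (law X (pos X (T w) w)) (B n \<union> N n) = 1" for n
  proof -
    have D: "B n \<union> N n \<in> sets (natural_filtration X \<infinity>)" using B N by blast
    let ?p = "\<lambda>w. emeasure (law X (pos X (T w) w)) (B n \<union> N n)"
    have [measurable]: "?p \<in> borel_measurable (law X x)"
      by (rule measurable_compose[OF pos_stopping_measurable_law[OF T] kernel_measurable_natural[OF D]])
    note [measurable] = Al
    have le1: "?p w \<le> 1" for w using prob_space.emeasure_le_1[OF prob_law] .
    have "AE w in law X x. w \<in> A \<longleftrightarrow> w \<in> {w\<in>A. shift X (T w) w \<in> B n \<union> N n}"
      using T\<tau> \<Lambda>_AE[of x]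
    proof eventually_elim
      case (elim w)
      have "shift X (T w) w \<in> B n \<union> N n" if "w \<in> A"
      proof -
        have w: "w \<in> Omega X" "T w < \<infinity>" using that by (auto simp: A_def)
        obtain v where v: "\<tau> u w = ennreal v" "0 \<le> v" using w(2) elim(1) by (cases "\<tau> u w") auto
        have "L (1 / Suc n) (shift X (T w) w) = L (v + 1 / Suc n) w - u"
          using L_shift_inverse[OF elim(2) u, of "1 / Suc n"] w(2) elim(1) v by simp
        moreover have "u < L (v + 1 / Suc n) w"
          by (rule at_inverse_local_time(2)[of L w u v, OF L_0[OF elim(2)] L_mono[OF elim(2)] L_cont[OF elim(2)] u v]) simp
        ultimately have "shift X (T w) w \<in> \<Gamma> n"
          unfolding \<Gamma>_def using shift_in_Omega[OF w] by simp
        then show ?thesis using BN(1) by blast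
      qed
      then show ?case by blast
    qed
    then have "emeasure (law X x) A = emeasure (law X x) {w\<in>A. shift X (T w) w \<in> B n \<union> N n}"
      by (rule emeasure_eq_AE) (use Al strong_markov_shift(1)[OF D T A fin] in auto)
    also have "\<dots> = (\<integral>\<^sup>+w. indicator A w * ?p w \<partial>law X x)"
      by (rule strong_markov_shift(2)[OF D T A fin])
    finally have eq: "(\<integral>\<^sup>+w. indicator A w \<partial>law X x) = (\<integral>\<^sup>+w. indicator A w * ?p w \<partial>law X x)"
      using Al by simp
    have "(\<integral>\<^sup>+w. indicator A w - indicator A w * ?p w \<partial>law X x) =
        (\<integral>\<^sup>+w. indicator A w \<partial>law X x) - (\<integral>\<^sup>+w. indicator A w * ?p w \<partial>law X x)"
    proof (rule nn_integral_diff)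
      show "AE w in law X x. indicator A w * ?p w \<le> indicator A w" using le1 by (auto simp: indicator_def)
      show "(\<integral>\<^sup>+w. indicator A w * ?p w \<partial>law X x) \<noteq> \<infinity>" unfolding eq[symmetric] using Al by simp
    qed measurable
    also have "\<dots> = 0" unfolding eq[symmetric] using Al by simp
    finally have "AE w in law X x. indicator A w - indicator A w * ?p w = 0"
      by (subst (asm) nn_integral_0_iff_AE) auto
    then show ?thesis
    proof eventually_elim
      case (elim w)
      show ?case
      proof
        assume "w \<in> A"
        then have "1 - ?p w = 0" using elim by simp
        then have "1 \<le> ?p w" by (metis ennreal_minus_eq_0)
        then show "?p w = 1" using le1 by (metis antisym)
      qed
    qed
  qed
  have "AE w in law X x. \<forall>n. w \<in> A \<longrightarrow> emeasure (law X (pos X (T w) w)) (B n \<union> N n) = 1"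
    using full by (subst AE_all_countable) blast
  then show ?thesis using null AE_space[of "law X x"]
  proof eventually_elim
    case (elim w)
    show ?case
    proof
      assume "T w < \<infinity>"
      then have "w \<in> A" using elim(3) unfolding A_def space_law[of x] by blast
      define y where "y = pos X (T w) w"
      interpret Y: prob_space "law X y" by (rule prob_law)
      have "AE w' in law X y. w' \<in> \<Gamma> n" for n
      proof -
        have "AE w' in law X y. w' \<in> B n \<union> N n"
        proof (rule Y.AE_prob_1)
          have "emeasure (law X y) (B n \<union> N n) = 1" using elim(1) \<open>w \<in> A\<close> unfolding y_def by blast
          then show "Y.prob (B n \<union> N n) = 1" by (simp add: measure_def)
        qed
        moreover have "AE w' in law X y. w' \<notin> N n"
          using elim(2) sets_natural_law[OF N[of n], of y] by (intro AE_not_in null_setsI) (simp_all add: y_def)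
        ultimately show ?thesis by eventually_elim (use BN(2) in blast)
      qed
      then have all: "AE w' in law X y. \<forall>n. w' \<in> \<Gamma> n" by (subst AE_all_countable) blast
      (* At the cemetery L would be constant. *)
      show "pos X (T w) w = Some a"
      proof (cases y)
        case None
        have "AE w' in law X y. False"
          using all \<Lambda>_AE[of y] start[of y]
        proof eventually_elim
          case (elim w')
          have "pos X 0 w' = None" using elim(3) None by simp
          then have "lifetime X w' \<le> 0" unfolding lifetime_def by (intro Inf_lower) simp
          then have "L 1 w' = L 0 w'" using L_dead[OF elim(2), of 0 1] by simp
          moreover have "0 < L 1 w'" using spec[OF elim(1), of 0] by (simp add: \<Gamma>_def)
          ultimately show False using L_0[OF elim(2)] by simp
        qed
        then show ?thesis by simp
      next
        case (Some z)
        have "AE w' in law X y. Inf {ennreal t |t. 0 \<le> t \<and> 0 < L t w'} = 0"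
          using all
        proof eventually_elim
          case (elim w')
          have "Inf {ennreal t |t. 0 \<le> t \<and> 0 < L t w'} \<le> ennreal (1 / Suc n)" for n
            using spec[OF elim, of n] by (intro Inf_lower) (auto simp: \<Gamma>_def)
          moreover have "(\<lambda>n. ennreal (1 / Suc n)) \<longlonglongrightarrow> ennreal 0"
            by (intro tendsto_ennrealI) real_asymp
          ultimately have "Inf {ennreal t |t. 0 \<le> t \<and> 0 < L t w'} \<le> ennreal 0"
            by (intro LIMSEQ_le_const) auto
          then show ?case by simp
        qed
        then have "z \<in> af_support X L" unfolding af_support_def Some by simp
        then show ?thesis using L_support Some y_def by simp
      qed
    qed
  qed
qed

text \<open>The strong Markov property at \<open>\<tau>(s)\<close>, where the state is \<open>a\<close>, combined with additivity: passing the
  level \<open>s + h\<close> within time \<open>y\<close> after \<open>\<tau>(s)\<close> means that the shifted local time exceeds \<open>h\<close> at time \<open>y\<close>.\<close>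

lemma regeneration:
  assumes s: "0 \<le> s" and h: "0 \<le> h" and x: "0 < x" and y: "0 < y"
  defines "M \<equiv> completion (law X (Some a))"
  shows "measure M {w\<in>Omega X. \<tau> s w < ennreal x \<and> \<tau> (s + h) w < \<tau> s w + ennreal y} =
    measure M {w\<in>Omega X. \<tau> s w < ennreal x} * measure M {w\<in>Omega X. h < L y w}"
proof -
  let ?P = "law X (Some a)"
  interpret P: prob_space ?P by (rule prob_law)
  obtain T where T: "stopping_time F T" and T\<tau>: "AE w in ?P. T w = \<tau> s w"
    using inverse_local_time_stopping_version .
  have Xa: "AE w in ?P. T w < \<infinity> \<longrightarrow> pos X (T w) w = Some a"
    by (rule pos_at_inverse_local_time[OF s T T\<tau>])
  define \<Gamma> where "\<Gamma> = {w\<in>Omega X. h < L y w}"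
  obtain B N where B0: "B \<in> sets (natural_filtration X (ennreal y))" and N: "N \<in> sets (natural_filtration X \<infinity>)"
    and N0: "emeasure ?P N = 0" and BN: "\<Gamma> - B \<subseteq> N" "B - \<Gamma> \<subseteq> N"
    using completed_filtration_approx_point[OF L_greater_sets[of y h], of "Some a"] y unfolding \<Gamma>_def by auto
  have B: "B \<in> sets (natural_filtration X \<infinity>)" using B0 sets_natural_mono[of "ennreal y" \<infinity>] by auto
  define A where "A = {w\<in>Omega X. T w < ennreal x}"
  have A: "A \<in> sets (pre_sigma T)"
  proof -
    have "A = T -` {..<ennreal x} \<inter> space (pre_sigma T)" by (auto simp: A_def space_pre_sigma)
    also have "\<dots> \<in> sets (pre_sigma T)"
      by (rule measurable_sets[OF measurable_stopping_time_pre_sigma[OF T]]) simp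
    finally show ?thesis .
  qed
  have Al: "A \<in> sets ?P" by (rule sets_pre_sigma_law[OF T A])
  have fin: "T w < \<infinity>" if "w \<in> A" for w
    using that by (auto simp: A_def) (metis ennreal_less_top order.strict_trans infinity_ennreal_def)
  have shiftP: "emeasure ?P {w\<in>A. shift X (T w) w \<in> D} = emeasure ?P A * emeasure ?P D"
    if D: "D \<in> sets (natural_filtration X \<infinity>)" for D
  proof -
    have "emeasure ?P {w\<in>A. shift X (T w) w \<in> D} = (\<integral>\<^sup>+w. indicator A w * emeasure (law X (pos X (T w) w)) D \<partial>?P)"
      by (rule strong_markov_shift(2)[OF D T A fin])
    also have "\<dots> = (\<integral>\<^sup>+w. emeasure ?P D * indicator A w \<partial>?P)"
    proof (rule nn_integral_cong_AE)
      show "AE w in ?P. indicator A w * emeasure (law X (pos X (T w) w)) D = emeasure ?P D * indicator A w"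
        using Xa by eventually_elim (use fin in \<open>auto simp: indicator_def\<close>)
    qed
    also have "\<dots> = emeasure ?P A * emeasure ?P D" unfolding nn_integral_cmult_indicator[OF Al] by (rule mult.commute)
    finally show ?thesis .
  qed
  have "AE w in ?P. w \<notin> {w\<in>A. shift X (T w) w \<in> N}"
  proof (rule AE_not_in)
    have "emeasure ?P {w\<in>A. shift X (T w) w \<in> N} = 0" using shiftP[OF N] N0 by simp
    then show "{w\<in>A. shift X (T w) w \<in> N} \<in> null_sets ?P"
      using strong_markov_shift(1)[OF N T A fin] by (simp add: null_sets_def)
  qed
  then have AE1: "AE w in ?P. w \<in> {w\<in>Omega X. \<tau> s w < ennreal x \<and> \<tau> (s + h) w < \<tau> s w + ennreal y} \<longleftrightarrow>
      w \<in> {w\<in>A. shift X (T w) w \<in> B}"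
    using T\<tau> \<Lambda>_AE AE_space
  proof eventually_elim
    case (elim w)
    have O: "w \<in> Omega X" using elim(4) unfolding space_law[of "Some a"] .
    show ?case
    proof (cases "w \<in> A")
      case True
      have f: "\<tau> s w < \<infinity>" using fin[OF True] elim(2) by simp
      obtain v where v: "\<tau> s w = ennreal v" "0 \<le> v" using f by (cases "\<tau> s w") auto
      have sh: "shift X (T w) w \<in> Omega X" using shift_in_Omega[OF O fin[OF True]] .
      have "\<tau> (s + h) w < \<tau> s w + ennreal y \<longleftrightarrow> \<tau> (s + h) w < ennreal (v + y)"
        using v y by (simp add: ennreal_plus)
      also have "\<dots> \<longleftrightarrow> s + h < L (v + y) w"
        by (rule inverse_local_time_less_iff[of L w "v + y" "s + h", OF L_mono[OF elim(3)] L_cont[OF elim(3)]]) (use v y in simp)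
      also have "\<dots> \<longleftrightarrow> h < L y (shift X (T w) w)"
        using L_shift_inverse[OF elim(3) s f, of y] y elim(2) v by auto
      also have "\<dots> \<longleftrightarrow> shift X (T w) w \<in> \<Gamma>" using sh by (simp add: \<Gamma>_def)
      also have "\<dots> \<longleftrightarrow> shift X (T w) w \<in> B" using elim(1) True BN by blast
      finally show ?thesis using True elim(2) O by (auto simp: A_def)
    next
      case False
      then show ?thesis using elim(2) O by (auto simp: A_def)
    qed
  qed
  have AE2: "AE w in ?P. w \<in> {w\<in>Omega X. \<tau> s w < ennreal x} \<longleftrightarrow> w \<in> A"
    using T\<tau> by eventually_elim (simp add: A_def)
  have "AE w in ?P. w \<notin> N" using N0 sets_natural_law[OF N] by (intro AE_not_in) auto
  then have AE3: "AE w in ?P. w \<in> {w\<in>Omega X. h < L y w} \<longleftrightarrow> w \<in> B"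
    by eventually_elim (use BN in \<open>auto simp: \<Gamma>_def\<close>)
  have m1: "measure M {w\<in>Omega X. \<tau> s w < ennreal x \<and> \<tau> (s + h) w < \<tau> s w + ennreal y} = measure ?P {w\<in>A. shift X (T w) w \<in> B}"
    unfolding M_def by (rule AE_eq_completion(2)[OF strong_markov_shift(1)[OF B T A fin] _ AE1]) (auto simp: space_law[of "Some a"])
  have m2: "measure M {w\<in>Omega X. \<tau> s w < ennreal x} = measure ?P A"
    unfolding M_def by (rule AE_eq_completion(2)[OF Al _ AE2]) (auto simp: space_law[of "Some a"])
  have m3: "measure M {w\<in>Omega X. h < L y w} = measure ?P B"
    unfolding M_def by (rule AE_eq_completion(2)[OF sets_natural_law[OF B] _ AE3]) (auto simp: space_law[of "Some a"])
  show ?thesis unfolding m1 m2 m3 using shiftP[OF B] by (simp add: measure_def enn2real_mult)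
qed

end

section \<open>Renewal estimates on a grid\<close>

text \<open>All that the rest of the argument needs to know about the local time under the law started at \<open>a\<close>: the
  process \<open>A\<close> is the inverse of a killed subordinator, expressed without reference to subordinators.\<close>

locale regenerative_clock = prob_space M for M :: "'w measure" +
  fixes A :: "real \<Rightarrow> 'w \<Rightarrow> real"
  assumes A_integrable: "integrable M (A t)"
    and A_nonpos: "w \<in> space M \<Longrightarrow> t \<le> 0 \<Longrightarrow> A t w = 0"
    and A_mono: "w \<in> space M \<Longrightarrow> s \<le> t \<Longrightarrow> A s w \<le> A t w"
    and A_cont: "w \<in> space M \<Longrightarrow> continuous_on UNIV (\<lambda>t. A t w)"
    and A_pos: "0 < t \<Longrightarrow> AE w in M. 0 < A t w"
    and regeneration: "0 \<le> s \<Longrightarrow> 0 \<le> h \<Longrightarrow> 0 < x \<Longrightarrow> 0 < y \<Longrightarrow>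
      prob {w\<in>space M. inverse_local_time A s w < ennreal x \<and>
        inverse_local_time A (s + h) w < inverse_local_time A s w + ennreal y} =
      prob {w\<in>space M. inverse_local_time A s w < ennreal x} * prob {w\<in>space M. h < A y w}"
begin

abbreviation \<tau> where "\<tau> \<equiv> inverse_local_time A"

lemma A_measurable [measurable]: "A t \<in> borel_measurable M"
  using A_integrable by (rule borel_measurable_integrable)

lemma A_nonneg: "w \<in> space M \<Longrightarrow> 0 \<le> A t w"
  using A_mono[of w "min t 0" t] A_nonpos[of w "min t 0"] by simp

lemma \<tau>_less_iff: "w \<in> space M \<Longrightarrow> 0 < t \<Longrightarrow> \<tau> s w < ennreal t \<longleftrightarrow> s < A t w"
  by (rule inverse_local_time_less_iff)
    (auto simp: mono_on_def A_mono intro: continuous_on_subset[OF A_cont])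

lemma \<tau>_measurable [measurable]: "\<tau> s \<in> borel_measurable M"
proof (rule borel_measurableI_less)
  fix c :: ennreal
  have fin: "{w\<in>space M. \<tau> s w < ennreal t} \<in> sets M" for t
  proof (cases "0 < t")
    case True
    then have "{w\<in>space M. \<tau> s w < ennreal t} = {w\<in>space M. s < A t w}" using \<tau>_less_iff by auto
    then show ?thesis by simp
  qed (simp add: ennreal_neg)
  show "{w\<in>space M. \<tau> s w < c} \<in> sets M"
  proof (cases c)
    case (real r) then show ?thesis using fin by simp
  next
    case top
    have "{w\<in>space M. \<tau> s w < c} = (\<Union>n. {w\<in>space M. \<tau> s w < ennreal (real n)})"
    proof (intro equalityI subsetI)
      fix w assume w: "w \<in> {w\<in>space M. \<tau> s w < c}"
      then obtain v where v: "\<tau> s w = ennreal v" "0 \<le> v" using top by (cases "\<tau> s w") auto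
      obtain n where "v < real n" using reals_Archimedean2 by blast
      then have "\<tau> s w < ennreal (real n)" using v by (simp add: ennreal_less_iff)
      then show "w \<in> (\<Union>n. {w\<in>space M. \<tau> s w < ennreal (real n)})" using w by auto
    qed (use top in \<open>auto intro: order.strict_trans\<close>)
    then show ?thesis using fin by auto
  qed
qed

text \<open>\<open>Q s t\<close> is the distribution function of \<open>\<tau>(s)\<close>, and \<open>Uh\<close>, \<open>Nh\<close> approximate the potential \<open>U\<close> and the Levy
  tail on a grid of local time levels with mesh \<open>h\<close>.\<close>

definition Q :: "real \<Rightarrow> real \<Rightarrow> real" where "Q s t = prob {w\<in>space M. s < A t w}"

definition U :: "real \<Rightarrow> real" where "U t = expectation (A t)"

definition Uh :: "real \<Rightarrow> real \<Rightarrow> real" where "Uh h t = h * (\<Sum>k. Q (real k * h) t)"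

definition Nh :: "real \<Rightarrow> real \<Rightarrow> real" where "Nh h y = (1 - Q h y) / h"

lemma Q_nonneg: "0 \<le> Q s t" and Q_le_1: "Q s t \<le> 1" by (simp_all add: Q_def)

lemma Q_mono: "s' \<le> s \<Longrightarrow> t \<le> t' \<Longrightarrow> Q s t \<le> Q s' t'"
  unfolding Q_def by (intro finite_measure_mono) (auto dest: A_mono[of _ t t'])

lemma Q_nonpos: "0 \<le> s \<Longrightarrow> t \<le> 0 \<Longrightarrow> Q s t = 0"
proof -
  assume "0 \<le> s" "t \<le> 0"
  then have "{w\<in>space M. s < A t w} = {}" by (auto simp: A_nonpos)
  then show ?thesis unfolding Q_def by (simp only: measure_empty)
qed

lemma Q_tau: "0 \<le> s \<Longrightarrow> prob {w\<in>space M. \<tau> s w < ennreal t} = Q s t"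
proof (cases "0 < t")
  case True
  then show ?thesis unfolding Q_def by (intro arg_cong[where f=prob]) (auto simp: \<tau>_less_iff)
qed (simp add: Q_nonpos ennreal_neg)

lemma prob_increment:
  assumes "0 \<le> s" "0 \<le> h" "0 \<le> x1" "x1 \<le> x2" "0 < y"
  shows "prob {w\<in>space M. \<not> \<tau> s w < ennreal x1 \<and> \<tau> s w < ennreal x2 \<and> \<not> \<tau> (s + h) w < \<tau> s w + ennreal y} =
    (Q s x2 - Q s x1) * (1 - Q h y)"
proof -
  define E where "E x = {w\<in>space M. \<tau> s w < ennreal x \<and> \<not> \<tau> (s + h) w < \<tau> s w + ennreal y}" for x
  have E: "E x \<in> sets M" for x unfolding E_def by measurable
  have PE: "prob (E x) = Q s x * (1 - Q h y)" if "0 \<le> x" for x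
  proof (cases "x = 0")
    case True
    then show ?thesis using Q_nonpos[OF assms(1), of x] by (simp add: E_def)
  next
    case False
    let ?B = "{w\<in>space M. \<tau> s w < ennreal x}"
    let ?C = "{w\<in>space M. \<tau> s w < ennreal x \<and> \<tau> (s + h) w < \<tau> s w + ennreal y}"
    have "E x = ?B - ?C" by (auto simp: E_def)
    then have "prob (E x) = prob ?B - prob ?C" by (simp add: finite_measure_Diff subset_eq)
    also have "\<dots> = Q s x - Q s x * Q h y"
      using regeneration[of s h x y] Q_tau[OF assms(1), of x] assms that False by (simp add: Q_def)
    finally show ?thesis by (simp add: algebra_simps)
  qed
  have sub: "E x1 \<subseteq> E x2" using assms(4) by (auto simp: E_def intro: order.strict_trans2 ennreal_leI)
  have "{w\<in>space M. \<not> \<tau> s w < ennreal x1 \<and> \<tau> s w < ennreal x2 \<and> \<not> \<tau> (s + h) w < \<tau> s w + ennreal y} = E x2 - E x1"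
    by (auto simp: E_def)
  then show ?thesis
    using finite_measure_Diff[OF E E sub] PE[of x1] PE[of x2] assms by (simp add: algebra_simps)
qed

lemma U_nonneg: "0 \<le> U t" unfolding U_def using A_nonneg by (intro integral_nonneg_AE) auto

lemma U_mono: "s \<le> t \<Longrightarrow> U s \<le> U t"
  unfolding U_def using A_mono by (intro integral_mono A_integrable) auto

lemma U_nonpos: "t \<le> 0 \<Longrightarrow> U t = 0"
proof -
  assume "t \<le> 0"
  then have "U t = (\<integral>w. 0 \<partial>M)" unfolding U_def by (intro Bochner_Integration.integral_cong) (auto simp: A_nonpos)
  then show ?thesis by simp
qed

lemma U_isCont: "isCont U t"
  unfolding isCont_def U_def
proof (rule tendsto_at_iff_sequentially[THEN iffD2], intro allI impI, unfold comp_def)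
  fix X :: "nat \<Rightarrow> real" assume X: "\<forall>i. X i \<in> UNIV - {t}" "X \<longlonglongrightarrow> t"
  obtain b where b: "\<And>i. X i \<le> b"
    using convergent_imp_Bseq[of X] X(2) by (metis BseqE abs_le_D1 convergentI real_norm_def)
  show "(\<lambda>i. expectation (A (X i))) \<longlonglongrightarrow> expectation (A t)"
  proof (rule integral_dominated_convergence[where w = "A b"])
    show "AE w in M. (\<lambda>i. A (X i) w) \<longlonglongrightarrow> A t w"
    proof (intro AE_I2)
      fix w assume "w \<in> space M"
      then have "isCont (\<lambda>t. A t w) t" using A_cont by (simp add: continuous_on_eq_continuous_at)
      then show "(\<lambda>i. A (X i) w) \<longlonglongrightarrow> A t w" by (rule isCont_tendsto_compose[OF _ X(2)])
    qed
    show "AE w in M. norm (A (X i) w) \<le> A b w" for i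
      using b A_nonneg A_mono by (intro AE_I2) auto
  qed (auto intro: A_integrable)
qed

text \<open>The number of grid levels below \<open>A(t)\<close> is \<open>A(t) / h\<close> rounded up.\<close>

lemma Uh_sums:
  assumes h: "0 < h"
  shows "summable (\<lambda>k. Q (real k * h) t)" "U t \<le> Uh h t" "Uh h t \<le> U t + h"
proof -
  have "(\<Sum>k. ennreal (Q (real k * h) t)) = (\<Sum>k. \<integral>\<^sup>+w. indicator {w\<in>space M. real k * h < A t w} w \<partial>M)"
    by (simp add: Q_def emeasure_eq_measure)
  also have "\<dots> = (\<integral>\<^sup>+w. (\<Sum>k. indicator {w\<in>space M. real k * h < A t w} w) \<partial>M)"
    by (intro nn_integral_suminf[symmetric]) simp
  also have "\<dots> = (\<integral>\<^sup>+w. ennreal (of_int \<lceil>A t w / h\<rceil>) \<partial>M)"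
  proof (rule nn_integral_cong)
    fix w assume w: "w \<in> space M"
    have nn: "0 \<le> A t w / h" using A_nonneg[OF w] h by simp
    then have nn': "0 \<le> \<lceil>A t w / h\<rceil>" by linarith
    have iff: "real k * h < A t w \<longleftrightarrow> k < nat \<lceil>A t w / h\<rceil>" for k
      using h nn' by (simp add: pos_less_divide_eq[symmetric] zless_nat_conj less_ceiling_iff zless_nat_eq_int_zless)
    have "(\<Sum>k. indicator {w\<in>space M. real k * h < A t w} w :: ennreal) =
        (\<Sum>k<nat \<lceil>A t w / h\<rceil>. indicator {w\<in>space M. real k * h < A t w} w)"
      by (rule suminf_finite) (auto simp: indicator_def iff)
    also have "\<dots> = (\<Sum>k<nat \<lceil>A t w / h\<rceil>. 1)"
      using w by (intro sum.cong) (auto simp: indicator_def iff)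
    also have "\<dots> = ennreal (of_int \<lceil>A t w / h\<rceil>)"
      using nn' by (simp add: ennreal_of_nat_eq_real_of_nat)
    finally show "(\<Sum>k. indicator {w\<in>space M. real k * h < A t w} w) = ennreal (of_int \<lceil>A t w / h\<rceil>)" .
  qed
  finally have S: "(\<Sum>k. ennreal (Q (real k * h) t)) = (\<integral>\<^sup>+w. ennreal (of_int \<lceil>A t w / h\<rceil>) \<partial>M)" .
  have int1: "integrable M (\<lambda>w. A t w / h)" using A_integrable by simp
  have int2: "integrable M (\<lambda>w. A t w / h + 1)" using A_integrable by simp
  have int3: "integrable M (\<lambda>w. real_of_int \<lceil>A t w / h\<rceil>)"
  proof (rule Bochner_Integration.integrable_bound[OF int2])
    show "AE w in M. norm (real_of_int \<lceil>A t w / h\<rceil>) \<le> norm (A t w / h + 1)"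
    proof (intro AE_I2)
      fix w assume w: "w \<in> space M"
      have nn: "0 \<le> A t w / h" using A_nonneg[OF w] h by simp
      then have "0 \<le> \<lceil>A t w / h\<rceil>" by linarith
      then show "norm (real_of_int \<lceil>A t w / h\<rceil>) \<le> norm (A t w / h + 1)" using nn
        using ceiling_correct[of "A t w / h"] by simp
    qed
  qed simp
  have nnc: "AE w in M. 0 \<le> real_of_int \<lceil>A t w / h\<rceil>"
  proof (intro AE_I2)
    fix w assume w: "w \<in> space M"
    have nn: "0 \<le> A t w / h" using A_nonneg[OF w] h by simp
    then show "0 \<le> real_of_int \<lceil>A t w / h\<rceil>" by linarith
  qed
  have S': "(\<Sum>k. ennreal (Q (real k * h) t)) = ennreal (\<integral>w. of_int \<lceil>A t w / h\<rceil> \<partial>M)"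
    unfolding S by (rule nn_integral_eq_integral[OF int3 nnc])
  show sm: "summable (\<lambda>k. Q (real k * h) t)"
    by (rule summable_suminf_not_top) (auto simp: Q_nonneg S')
  have "ennreal (\<Sum>k. Q (real k * h) t) = ennreal (\<integral>w. of_int \<lceil>A t w / h\<rceil> \<partial>M)"
    using suminf_ennreal2[OF _ sm] S' Q_nonneg by simp
  then have eq: "(\<Sum>k. Q (real k * h) t) = (\<integral>w. of_int \<lceil>A t w / h\<rceil> \<partial>M)"
    using integral_nonneg_AE[OF nnc] suminf_nonneg[OF sm] Q_nonneg by (subst (asm) ennreal_inj) auto
  have "(\<integral>w. A t w / h \<partial>M) \<le> (\<Sum>k. Q (real k * h) t)" unfolding eq
    by (intro integral_mono int1 int3) (rule le_of_int_ceiling)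
  then have "U t / h \<le> (\<Sum>k. Q (real k * h) t)" by (simp add: U_def)
  then show "U t \<le> Uh h t" using h by (simp add: Uh_def field_simps)
  have "(\<Sum>k. Q (real k * h) t) \<le> (\<integral>w. A t w / h + 1 \<partial>M)" unfolding eq
    by (intro integral_mono int2 int3) linarith
  also have "\<dots> = U t / h + 1" using int1 by (simp add: U_def prob_space)
  finally show "Uh h t \<le> U t + h" using h by (simp add: Uh_def field_simps)
qed

text \<open>The events "\<open>\<tau>(kh)\<close> falls between \<open>x1\<close> and \<open>x2\<close>, and the clock then needs at least \<open>t - x1\<close> to advance by
  \<open>h\<close>" are disjoint for different \<open>k\<close>, and each has a product probability by regeneration.\<close>

lemma grid_lower:
  assumes h: "0 < h" and x: "0 \<le> x1" "x1 < x2" "x2 \<le> t"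
  shows "(Uh h x2 - Uh h x1) * Nh h (t - x1) \<le> prob {w\<in>space M. A x1 w < A x2 w \<and> A t w - A x2 w < h}"
proof -
  define E where "E k = {w\<in>space M. \<not> \<tau> (real k * h) w < ennreal x1 \<and> \<tau> (real k * h) w < ennreal x2 \<and>
    \<not> \<tau> (real k * h + h) w < \<tau> (real k * h) w + ennreal (t - x1)}" for k
  have E: "E k \<in> sets M" for k unfolding E_def by measurable
  have PE: "prob (E k) = (Q (real k * h) x2 - Q (real k * h) x1) * (1 - Q h (t - x1))" for k
    unfolding E_def by (rule prob_increment) (use h x in auto)
  have Esub: "w \<in> space M \<and> A x1 w \<le> real k * h \<and> real k * h < A x2 w \<and> A t w \<le> real k * h + h" if w: "w \<in> E k" for k w
  proof -
    have sp: "w \<in> space M" using w by (simp add: E_def)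
    have 1: "real k * h < A x2 w" using w \<tau>_less_iff[OF sp, of x2 "real k * h"] x by (auto simp: E_def)
    have 2: "A x1 w \<le> real k * h"
    proof (cases "x1 = 0")
      case True then show ?thesis using A_nonpos[OF sp, of 0] h by simp
    next
      case False then show ?thesis using w \<tau>_less_iff[OF sp, of x1 "real k * h"] x by (auto simp: E_def)
    qed
    have 3: "A t w \<le> real k * h + h"
    proof (rule ccontr)
      assume "\<not> A t w \<le> real k * h + h"
      then have "\<tau> (real k * h + h) w < ennreal t" using \<tau>_less_iff[OF sp, of t] x by auto
      also have "ennreal t = ennreal x1 + ennreal (t - x1)" using x by (simp add: ennreal_plus[symmetric] del: ennreal_plus)
      also have "\<dots> \<le> \<tau> (real k * h) w + ennreal (t - x1)"
        using w by (intro add_right_mono) (auto simp: E_def not_less)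
      finally show False using w by (simp add: E_def)
    qed
    show ?thesis using 1 2 3 sp by blast
  qed
  have disj: "disjoint_family E"
  proof (unfold disjoint_family_on_def, intro ballI impI, rule ccontr)
    fix k j assume "k \<noteq> j" "E k \<inter> E j \<noteq> {}"
    then obtain w where w: "w \<in> E k" "w \<in> E j" by blast
    have At: "A x2 w \<le> A t w" using A_mono Esub[OF w(1)] x by blast
    have "real k * h < (real j + 1) * h" "real j * h < (real k + 1) * h"
      using Esub[OF w(1)] Esub[OF w(2)] At by (auto simp: algebra_simps)
    then have "k < j + 1" "j < k + 1" using h by auto
    then show False using \<open>k \<noteq> j\<close> by simp
  qed
  have "(\<lambda>k. prob (E k)) sums prob (\<Union>k. E k)"
    using finite_measure_UNION[OF _ disj] E by auto
  moreover have "(\<lambda>k. prob (E k)) sums (((\<Sum>k. Q (real k * h) x2) - (\<Sum>k. Q (real k * h) x1)) * (1 - Q h (t - x1)))"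
    unfolding PE by (intro sums_mult2 sums_diff summable_sums Uh_sums(1)[OF h])
  ultimately have le: "((\<Sum>k. Q (real k * h) x2) - (\<Sum>k. Q (real k * h) x1)) * (1 - Q h (t - x1)) = prob (\<Union>k. E k)"
    by (rule sums_unique2[symmetric])
  have "(Uh h x2 - Uh h x1) * Nh h (t - x1) =
      ((\<Sum>k. Q (real k * h) x2) - (\<Sum>k. Q (real k * h) x1)) * (1 - Q h (t - x1))"
    unfolding Uh_def Nh_def right_diff_distrib[symmetric] using h by simp
  also note le
  also have "prob (\<Union>k. E k) \<le> prob {w\<in>space M. A x1 w < A x2 w \<and> A t w - A x2 w < h}"
    by (rule finite_measure_mono) (use Esub in fastforce)+
  finally show ?thesis .
qed

text \<open>If the clock stands still between \<open>x\<close> and \<open>t\<close>, the last grid level passed before \<open>x\<close> is followed by a step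
  of duration at least \<open>t - x\<close>.\<close>

lemma grid_upper:
  assumes h: "0 < h" and x: "0 < x" "x < t"
  shows "prob {w\<in>space M. A t w = A x w} \<le> Uh h x * Nh h (t - x)"
proof -
  define E where "E k = {w\<in>space M. \<not> \<tau> (real k * h) w < ennreal 0 \<and> \<tau> (real k * h) w < ennreal x \<and>
    \<not> \<tau> (real k * h + h) w < \<tau> (real k * h) w + ennreal (t - x)}" for k
  have E: "E k \<in> sets M" for k unfolding E_def by measurable
  have PE: "prob (E k) = Q (real k * h) x * (1 - Q h (t - x))" for k
    unfolding E_def by (subst prob_increment) (use h x in \<open>auto simp: Q_nonpos\<close>)
  have sums: "(\<lambda>k. prob (E k)) sums ((\<Sum>k. Q (real k * h) x) * (1 - Q h (t - x)))"
    unfolding PE by (intro sums_mult2 summable_sums Uh_sums(1)[OF h])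
  have "prob {w\<in>space M. A t w = A x w} \<le> prob (\<Union>k. E k)"
  proof (rule finite_measure_mono_AE)
    show "AE w in M. w \<in> {w\<in>space M. A t w = A x w} \<longrightarrow> w \<in> (\<Union>k. E k)"
      using A_pos[OF x(1)]
    proof eventually_elim
      case (elim w)
      show ?case
      proof
        assume "w \<in> {w\<in>space M. A t w = A x w}"
        then have sp: "w \<in> space M" and eq: "A t w = A x w" by auto
        define k where "k = nat (\<lceil>A x w / h\<rceil> - 1)"
        have pos: "0 < A x w / h" using elim h by simp
        then have "0 < \<lceil>A x w / h\<rceil>" by simp
        then have k: "real k = of_int \<lceil>A x w / h\<rceil> - 1" by (simp add: k_def)
        have "real k < A x w / h" "A x w / h \<le> real k + 1" unfolding k by linarith+
        then have k1: "real k * h < A x w" and k2: "A x w \<le> real k * h + h" using h by (auto simp: field_simps)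
        have t1: "\<tau> (real k * h) w < ennreal x" using \<tau>_less_iff[OF sp x(1)] k1 by simp
        have "\<not> \<tau> (real k * h + h) w < \<tau> (real k * h) w + ennreal (t - x)"
        proof
          assume "\<tau> (real k * h + h) w < \<tau> (real k * h) w + ennreal (t - x)"
          also have "\<dots> \<le> ennreal x + ennreal (t - x)" using t1 by (intro add_right_mono) simp
          also have "\<dots> = ennreal t" using x by (simp add: ennreal_plus[symmetric] del: ennreal_plus)
          finally have "real k * h + h < A t w" using \<tau>_less_iff[OF sp, of t] x by simp
          then show False using eq k2 by simp
        qed
        then have "w \<in> E k" using sp t1 by (simp add: E_def)
        then show "w \<in> (\<Union>k. E k)" by blast
      qed
    qed
    show "(\<Union>k. E k) \<in> sets M" using E by blast
  qed
  also have "\<dots> \<le> (\<Sum>k. prob (E k))"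
    by (rule finite_measure_subadditive_countably) (use E sums in \<open>auto simp: sums_iff\<close>)
  also have "\<dots> = (\<Sum>k. Q (real k * h) x) * (1 - Q h (t - x))" using sums by (simp add: sums_iff)
  finally show ?thesis using h by (simp add: Uh_def Nh_def)
qed

end

lemma interval_sum_bound:
  fixes d :: real
  assumes d: "0 < d" and s: "s \<in> {c<..c + real n * d}"
  obtains i where "i < n" "s \<in> {c + real i * d<..c + real (Suc i) * d}"
proof -
  define i where "i = nat (\<lceil>(s - c) / d\<rceil> - 1)"
  have pos: "0 < (s - c) / d" using s d by simp
  then have "0 < \<lceil>(s - c) / d\<rceil>" by simp
  then have i: "real i = of_int \<lceil>(s - c) / d\<rceil> - 1" by (simp add: i_def)
  have b: "real i < (s - c) / d" "(s - c) / d \<le> real i + 1" unfolding i by linarith+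
  then have 1: "s \<in> {c + real i * d<..c + real (Suc i) * d}" using d by (auto simp: field_simps)
  have "s \<le> c + real n * d" using s by simp
  with 1 have "real i * d < real n * d" by (simp only: greaterThanAtMost_iff) linarith
  then have "i < n" using d by simp
  with 1 show ?thesis using that by blast
qed

lemma (in finite_measure) sum_disjoint_le:
  assumes "finite I" "\<And>i. i \<in> I \<Longrightarrow> E i \<in> sets M" "disjoint_family_on E I" "\<And>i. i \<in> I \<Longrightarrow> E i \<subseteq> B" "B \<in> sets M"
  shows "(\<Sum>i\<in>I. measure M (E i)) \<le> measure M B"
proof -
  have "(\<Sum>i\<in>I. measure M (E i)) = measure M (\<Union>i\<in>I. E i)"
    using assms by (intro finite_measure_finite_Union[symmetric]) auto
  also have "\<dots> \<le> measure M B" using assms by (intro finite_measure_mono) auto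
  finally show ?thesis .
qed

context regenerative_clock
begin

text \<open>The tail of the Levy measure of \<open>\<tau>\<close> including the killing rate. Dyadic meshes make the limit monotone
  after taking logarithms.\<close>

definition N :: "real \<Rightarrow> real" where "N y = lim (\<lambda>n. Nh (1 / 2 ^ n) y)"

lemma Q_dyadic_tendsto:
  assumes "0 < y" shows "(\<lambda>n. Q (1 / 2 ^ n) y) \<longlonglongrightarrow> 1"
proof -
  have "(\<lambda>n. prob {w\<in>space M. 1 / 2 ^ n < A y w}) \<longlonglongrightarrow> prob (\<Union>n. {w\<in>space M. 1 / 2 ^ n < A y w})"
  proof (rule finite_Lim_measure_incseq)
    show "incseq (\<lambda>n. {w\<in>space M. 1 / 2 ^ n < A y w})"
    proof (rule monoI)
      fix m n :: nat assume "m \<le> n"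
      then have "1 / 2 ^ n \<le> (1 / 2 ^ m :: real)" by (simp add: field_simps)
      then show "{w\<in>space M. 1 / 2 ^ m < A y w} \<le> {w\<in>space M. 1 / 2 ^ n < A y w}" by auto
    qed
  qed auto
  also have "(\<Union>n. {w\<in>space M. 1 / 2 ^ n < A y w}) = {w\<in>space M. 0 < A y w}"
  proof (intro equalityI subsetI)
    fix w assume "w \<in> {w\<in>space M. 0 < A y w}"
    then obtain n where "(1/2) ^ n < A y w" using real_arch_pow_inv[of "A y w" "1/2"] by auto
    then show "w \<in> (\<Union>n. {w\<in>space M. 1 / 2 ^ n < A y w})" using \<open>w \<in> _\<close> by (auto simp: power_one_over)
  qed (auto intro: less_trans[rotated])
  also have "prob {w\<in>space M. 0 < A y w} = 1"
    using A_pos[OF assms] by (subst prob_eq_1) auto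
  finally show ?thesis by (simp add: Q_def)
qed

lemma Q_double:
  assumes "0 < h" "0 < y" shows "Q (2 * h) y \<le> (Q h y)\<^sup>2"
proof -
  have "Q (2 * h) y \<le> prob {w\<in>space M. \<tau> h w < ennreal y \<and> \<tau> (h + h) w < \<tau> h w + ennreal y}"
    unfolding Q_def
  proof (rule finite_measure_mono)
    show "{w\<in>space M. 2 * h < A y w} \<subseteq> {w\<in>space M. \<tau> h w < ennreal y \<and> \<tau> (h + h) w < \<tau> h w + ennreal y}"
    proof safe
      fix w assume sp: "w \<in> space M" and w: "2 * h < A y w"
      show "\<tau> h w < ennreal y" using \<tau>_less_iff[OF sp assms(2), of h] w assms by simp
      have "\<tau> (h + h) w < ennreal y" using \<tau>_less_iff[OF sp assms(2), of "h + h"] w by simp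
      also have "\<dots> \<le> \<tau> h w + ennreal y" by simp
      finally show "\<tau> (h + h) w < \<tau> h w + ennreal y" .
    qed
  qed measurable
  also have "\<dots> = Q h y * Q h y"
    using regeneration[of h h y y] Q_tau[of h y] assms by (simp add: Q_def)
  finally show ?thesis by (simp add: power2_eq_square)
qed

text \<open>Regeneration makes \<open>Q\<close> submultiplicative in the level, so \<open>- ln Q(h, y) / h\<close> decreases along dyadic \<open>h\<close>, and
  \<open>1 - Q\<close> is asymptotic to \<open>- ln Q\<close>.\<close>

lemma Nh_tendsto_N:
  assumes y: "0 < y" shows "(\<lambda>n. Nh (1 / 2 ^ n) y) \<longlonglongrightarrow> N y"
proof -
  define p where "p n = Q (1 / 2 ^ n) y" for n
  have p1: "p n \<le> 1" "0 \<le> p n" for n by (simp_all add: p_def Q_le_1 Q_nonneg)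
  have lim: "p \<longlonglongrightarrow> 1" unfolding p_def by (rule Q_dyadic_tendsto[OF y])
  have dbl: "p n \<le> (p (Suc n))\<^sup>2" for n
    using Q_double[of "1 / 2 ^ Suc n" y] y by (simp add: p_def)
  have "\<forall>\<^sub>F n in sequentially. 0 < p n" using lim by (rule order_tendstoD) simp
  then obtain n0 where n0: "\<And>n. n \<ge> n0 \<Longrightarrow> 0 < p n" by (auto simp: eventually_sequentially)
  define u where "u n = - ln (p (n + n0))" for n
  (* b n is - ln Q(h, y) / h for h = 2^-(n + n0). *)
  define b where "b n = u n * 2 ^ (n + n0)" for n
  have pos: "0 < p (n + n0)" for n using n0 by simp
  have u0: "0 \<le> u n" for n using pos[of n] p1(1)[of "n + n0"] by (simp add: u_def)
  have "b (Suc n) \<le> b n" for n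
  proof -
    have "ln (p (n + n0)) \<le> ln ((p (Suc n + n0))\<^sup>2)"
      using dbl[of "n + n0"] pos[of n] pos[of "Suc n"] by (subst ln_le_cancel_iff) auto
    also have "\<dots> = 2 * ln (p (Suc n + n0))" using pos[of "Suc n"] by (simp add: ln_realpow)
    finally have "2 * u (Suc n) \<le> u n" by (simp add: u_def)
    then have "2 * u (Suc n) * 2 ^ (n + n0) \<le> u n * 2 ^ (n + n0)" by (intro mult_right_mono) auto
    then show ?thesis by (simp add: b_def)
  qed
  then have dec: "decseq b" by (rule decseq_SucI)
  moreover have b0: "0 \<le> b n" for n using u0 by (simp add: b_def)
  ultimately obtain l where l: "b \<longlonglongrightarrow> l" using decseq_convergent[of b 0] by blast
  have u_lim: "u \<longlonglongrightarrow> 0"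
  proof -
    have "(\<lambda>n. - ln (p (n + n0))) \<longlonglongrightarrow> - ln 1"
      by (intro tendsto_intros LIMSEQ_ignore_initial_segment lim) simp
    then show ?thesis by (simp add: u_def[abs_def])
  qed
  have bounds: "b n - u n * b n \<le> Nh (1 / 2 ^ (n + n0)) y \<and> Nh (1 / 2 ^ (n + n0)) y \<le> b n" for n
  proof -
    have eq: "Nh (1 / 2 ^ (n + n0)) y = (1 - exp (- u n)) * 2 ^ (n + n0)"
      using pos[of n] by (simp add: Nh_def u_def p_def)
    have "1 - exp (- u n) \<le> u n" using exp_ge_add_one_self[of "- u n"] by simp
    moreover have "u n - u n * u n \<le> 1 - exp (- u n)"
    proof -
      have "exp (- u n) \<le> 1 / (1 + u n)"
        using exp_ge_add_one_self[of "u n"] u0[of n] by (simp add: exp_minus field_simps)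
      also have "\<dots> \<le> 1 - u n + u n * u n"
        using u0[of n] by (simp add: field_simps)
      finally show ?thesis by simp
    qed
    ultimately have "(u n - u n * u n) * 2 ^ (n + n0) \<le> (1 - exp (- u n)) * 2 ^ (n + n0)"
        "(1 - exp (- u n)) * 2 ^ (n + n0) \<le> u n * 2 ^ (n + n0)"
      by (simp_all add: mult_right_mono)
    then show ?thesis unfolding eq b_def by (simp add: algebra_simps)
  qed
  have "(\<lambda>n. Nh (1 / 2 ^ (n + n0)) y) \<longlonglongrightarrow> l"
  proof (rule tendsto_sandwich[OF _ _ _ l])
    have "(\<lambda>n. b n - u n * b n) \<longlonglongrightarrow> l - 0 * l" by (intro tendsto_intros l u_lim)
    then show "(\<lambda>n. b n - u n * b n) \<longlonglongrightarrow> l" by simp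
  qed (use bounds in auto)
  then have "(\<lambda>n. Nh (1 / 2 ^ n) y) \<longlonglongrightarrow> l" by (rule LIMSEQ_offset)
  then show ?thesis unfolding N_def by (metis limI)
qed

lemma Nh_nonneg: "0 < h \<Longrightarrow> 0 \<le> Nh h y" using Q_le_1 by (simp add: Nh_def)

lemma Nh_antimono: "0 < h \<Longrightarrow> y \<le> z \<Longrightarrow> Nh h z \<le> Nh h y"
  unfolding Nh_def using Q_mono[of h h y z] by (intro divide_right_mono) auto

lemma N_nonneg: "0 < y \<Longrightarrow> 0 \<le> N y"
  by (rule LIMSEQ_le_const[OF Nh_tendsto_N]) (auto simp: Nh_nonneg)

lemma N_antimono: "0 < y \<Longrightarrow> y \<le> z \<Longrightarrow> N z \<le> N y"
  by (rule LIMSEQ_le[OF Nh_tendsto_N Nh_tendsto_N]) (auto simp: Nh_antimono)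

lemma Uh_tendsto_U: "(\<lambda>n. Uh (1 / 2 ^ n) t) \<longlonglongrightarrow> U t"
proof (rule tendsto_sandwich[of "\<lambda>_. U t" _ _ "\<lambda>n. U t + (1/2) ^ n"])
  have "(\<lambda>n. U t + (1/2) ^ n) \<longlonglongrightarrow> U t + 0"
    by (intro tendsto_intros LIMSEQ_realpow_zero) auto
  then show "(\<lambda>n. U t + (1/2) ^ n) \<longlonglongrightarrow> U t" by simp
qed (use Uh_sums in \<open>auto simp: power_one_over\<close>)

text \<open>The estimate behind all lower bounds, the limit of \<open>grid_lower\<close>: an increase of the clock between \<open>x1\<close> and
  \<open>x2\<close> is followed by a flat stretch up to \<open>t\<close>.\<close>

lemma increase_then_flat:
  assumes x: "0 \<le> x1" "x1 < x2" "x2 \<le> t"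
  shows "(U x2 - U x1) * N (t - x1) \<le> prob {w\<in>space M. A x1 w < A x2 w \<and> A t w = A x2 w}"
proof (rule LIMSEQ_le)
  show "(\<lambda>n. (Uh (1 / 2 ^ n) x2 - Uh (1 / 2 ^ n) x1) * Nh (1 / 2 ^ n) (t - x1)) \<longlonglongrightarrow> (U x2 - U x1) * N (t - x1)"
    using x by (intro tendsto_intros Uh_tendsto_U Nh_tendsto_N) auto
  let ?E = "\<lambda>n. {w\<in>space M. A x1 w < A x2 w \<and> A t w - A x2 w < 1 / 2 ^ n}"
  have "(\<lambda>n. prob (?E n)) \<longlonglongrightarrow> prob (\<Inter>n. ?E n)"
  proof (rule finite_Lim_measure_decseq)
    show "decseq ?E"
    proof (rule antimonoI)
      fix m n :: nat assume "m \<le> n"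
      then have "1 / 2 ^ n \<le> (1 / 2 ^ m :: real)" by (simp add: field_simps)
      then show "?E n \<le> ?E m" by auto
    qed
  qed auto
  also have "(\<Inter>n. ?E n) = {w\<in>space M. A x1 w < A x2 w \<and> A t w = A x2 w}"
  proof (intro equalityI subsetI)
    fix w assume w: "w \<in> (\<Inter>n. ?E n)"
    then have sp: "w \<in> space M" by auto
    have "A t w - A x2 w \<le> 0"
    proof (rule LIMSEQ_le_const[of "\<lambda>n. (1/2) ^ n"])
      show "(\<lambda>n. (1/2) ^ n) \<longlonglongrightarrow> (0::real)" by (rule LIMSEQ_realpow_zero) auto
      show "\<exists>N. \<forall>n\<ge>N. A t w - A x2 w \<le> (1/2) ^ n"
        using w by (intro exI[of _ 0]) (auto simp: power_one_over intro: less_imp_le)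
    qed
    then show "w \<in> {w\<in>space M. A x1 w < A x2 w \<and> A t w = A x2 w}"
      using w A_mono[OF sp x(3)] by auto
  qed auto
  finally show "(\<lambda>n. prob (?E n)) \<longlonglongrightarrow> prob {w\<in>space M. A x1 w < A x2 w \<and> A t w = A x2 w}" .
qed (use grid_lower[OF _ x] in auto)

lemma flat_upper:
  assumes "0 < x" "x < t" shows "prob {w\<in>space M. A t w = A x w} \<le> U x * N (t - x)"
proof (rule LIMSEQ_le_const)
  show "(\<lambda>n. Uh (1 / 2 ^ n) x * Nh (1 / 2 ^ n) (t - x)) \<longlonglongrightarrow> U x * N (t - x)"
    using assms by (intro tendsto_intros Uh_tendsto_U Nh_tendsto_N) auto
qed (use grid_upper[OF _ assms] in auto)

lemma flat_lower:
  assumes "0 < x" "x \<le> t" shows "U x * N t \<le> prob {w\<in>space M. A t w = A x w}"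
proof -
  have "U x * N t \<le> prob {w\<in>space M. A 0 w < A x w \<and> A t w = A x w}"
    using increase_then_flat[of 0 x t] assms by (simp add: U_nonpos)
  also have "\<dots> \<le> prob {w\<in>space M. A t w = A x w}" by (intro finite_measure_mono) auto
  finally show ?thesis .
qed

lemma sum_increase_then_flat:
  assumes c: "0 \<le> c" and d: "0 < d" and n: "c + real n * d \<le> t"
  shows "(\<Sum>i<n. (U (c + real (Suc i) * d) - U (c + real i * d)) * N (t - (c + real i * d))) \<le>
    prob {w\<in>space M. A c w < A (c + real n * d) w \<and> A t w = A (c + real n * d) w}"
proof -
  define E where "E i = {w\<in>space M. A (c + real i * d) w < A (c + real (Suc i) * d) w \<and> A t w = A (c + real (Suc i) * d) w}" for i
  have le: "c + real (Suc i) * d \<le> c + real n * d" if "i < n" for i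
    using that d by (intro add_left_mono mult_right_mono) auto
  have "(\<Sum>i<n. (U (c + real (Suc i) * d) - U (c + real i * d)) * N (t - (c + real i * d))) \<le> (\<Sum>i<n. prob (E i))"
    unfolding E_def
  proof (intro sum_mono increase_then_flat)
    fix i assume "i \<in> {..<n}"
    then show "c + real (Suc i) * d \<le> t" using le[of i] n by simp
  qed (use c d in \<open>auto simp: algebra_simps\<close>)
  also have "\<dots> \<le> prob {w\<in>space M. A c w < A (c + real n * d) w \<and> A t w = A (c + real n * d) w}"
  proof (rule sum_disjoint_le)
    show "disjoint_family_on E {..<n}"
    proof -
      have False if ij: "i < j" "j < n" "w \<in> E i" "w \<in> E j" for i j w
      proof -
        have sp: "w \<in> space M" using ij by (simp add: E_def)
        have "c + real (Suc i) * d \<le> c + real j * d"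
          using ij d by (intro add_left_mono mult_right_mono) auto
        then have "A (c + real (Suc i) * d) w \<le> A (c + real j * d) w" by (rule A_mono[OF sp])
        then show False using ij by (auto simp: E_def)
      qed
      then show ?thesis unfolding disjoint_family_on_def by (metis disjoint_iff lessThan_iff linorder_neqE_nat)
    qed
    fix i assume i: "i \<in> {..<n}"
    show "E i \<subseteq> {w\<in>space M. A c w < A (c + real n * d) w \<and> A t w = A (c + real n * d) w}"
    proof
      fix w assume w: "w \<in> E i"
      then have sp: "w \<in> space M" by (simp add: E_def)
      have 1: "A c w \<le> A (c + real i * d) w" by (rule A_mono[OF sp]) (use d in simp)
      have 2: "A (c + real (Suc i) * d) w \<le> A (c + real n * d) w" using i by (intro A_mono[OF sp] le) simp
      have 3: "A (c + real n * d) w \<le> A t w" by (rule A_mono[OF sp n])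
      show "w \<in> {w\<in>space M. A c w < A (c + real n * d) w \<and> A t w = A (c + real n * d) w}"
        using w 1 2 3 by (auto simp: E_def)
    qed
    show "E i \<in> sets M" unfolding E_def by measurable
  qed auto
  finally show ?thesis .
qed

lemma N_measurable: "(\<lambda>s. N s * indicator {0<..} s) \<in> borel_measurable borel"
proof -
  have "mono_on {0<..} (\<lambda>s. - N s)" by (auto simp: mono_on_def N_antimono)
  then have "(\<lambda>s. - N s) \<in> borel_measurable (restrict_space borel {0<..})"
    by (rule borel_measurable_mono_on_fnc)
  then have "(\<lambda>s. - (- N s)) \<in> borel_measurable (restrict_space borel {0<..})" by (rule borel_measurable_uminus)
  then show ?thesis
    by (subst (asm) borel_measurable_restrict_space_iff) (auto simp: mult.commute)
qed

text \<open>Decompose according to the grid interval of the last increase before \<open>t\<close> and replace \<open>dU\<close> by its minimal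
  slope; the resulting Riemann sums converge to the integral of \<open>N\<close>.\<close>

lemma increase_lower:
  assumes y: "0 \<le> y" "y < t" and D: "0 \<le> D" and slope: "\<And>a b. y \<le> a \<Longrightarrow> a \<le> b \<Longrightarrow> b \<le> t \<Longrightarrow> D * (b - a) \<le> U b - U a"
  shows "ennreal D * (\<integral>\<^sup>+s\<in>{0<..t - y}. ennreal (N s) \<partial>lborel) \<le> ennreal (prob {w\<in>space M. A y w < A t w})"
proof -
  define d where "d = t - y"
  have d: "0 < d" using y by (simp add: d_def)
  have [measurable]: "(\<lambda>s. ennreal (N s) * indicator {0<..d} s) \<in> borel_measurable borel"
  proof -
    have "(\<lambda>s. ennreal (N s) * indicator {0<..d} s) = (\<lambda>s. ennreal (N s * indicator {0<..} s) * indicator {0<..d} s)"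
      by (auto simp: indicator_def)
    then show ?thesis using N_measurable by simp
  qed
  have m2: "(\<lambda>s. ennreal (N s) * indicator {d / real (Suc n)<..d} s) \<in> borel_measurable borel" for n
  proof -
    have "0 < d / real (Suc n)" using d by simp
    then have "(\<lambda>s. ennreal (N s) * indicator {d / real (Suc n)<..d} s) = (\<lambda>s. (ennreal (N s) * indicator {0<..d} s) * indicator {d / real (Suc n)<..d} s)"
      by (auto simp: indicator_def)
    then show ?thesis by simp
  qed
  have bound: "ennreal D * (\<integral>\<^sup>+s\<in>{d / real (Suc n)<..d}. ennreal (N s) \<partial>lborel) \<le> ennreal (prob {w\<in>space M. A y w < A t w})" for n
  proof -
    define e where "e = d / real (Suc n)"
    have e: "0 < e" "real (Suc n) * e = d" using d by (auto simp: e_def)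
    have tail: "t - (y + real i * e) = real (Suc n - i) * e" if "i \<le> n" for i
      using that e(2) by (simp add: d_def algebra_simps of_nat_diff)
    have "(\<Sum>j<Suc n. D * e * N (real (Suc j) * e)) = (\<Sum>i<Suc n. D * e * N (real (Suc n - i) * e))"
      by (rule sum.reindex_bij_witness[of _ "\<lambda>i. n - i" "\<lambda>i. n - i"]) (auto simp: Suc_diff_le)
    also have "\<dots> = (\<Sum>i<Suc n. D * e * N (t - (y + real i * e)))"
      by (intro sum.cong refl) (subst tail, auto)
    also have "\<dots> \<le> (\<Sum>i<Suc n. (U (y + real (Suc i) * e) - U (y + real i * e)) * N (t - (y + real i * e)))"
    proof (intro sum_mono mult_right_mono)
      fix i assume i: "i \<in> {..<Suc n}"
      have "real (Suc i) * e \<le> real (Suc n) * e" using i e by (intro mult_right_mono) auto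
      then have le: "y + real (Suc i) * e \<le> t" using e(2) by (simp add: d_def)
      have "D * e = D * ((y + real (Suc i) * e) - (y + real i * e))" by (simp add: algebra_simps)
      also have "\<dots> \<le> U (y + real (Suc i) * e) - U (y + real i * e)"
        using e le by (intro slope) (auto simp: algebra_simps)
      finally show "D * e \<le> U (y + real (Suc i) * e) - U (y + real i * e)" .
      have "real i * e < real (Suc i) * e" using e by simp
      then show "0 \<le> N (t - (y + real i * e))" using le by (intro N_nonneg) simp
    qed
    also have "\<dots> \<le> prob {w\<in>space M. A y w < A (y + real (Suc n) * e) w \<and> A t w = A (y + real (Suc n) * e) w}"
      by (rule sum_increase_then_flat) (use y e in \<open>auto simp: d_def\<close>)
    also have "\<dots> \<le> prob {w\<in>space M. A y w < A t w}" by (intro finite_measure_mono) auto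
    finally have grid: "(\<Sum>j<Suc n. D * e * N (real (Suc j) * e)) \<le> prob {w\<in>space M. A y w < A t w}" .
    have "(\<integral>\<^sup>+s\<in>{e<..d}. ennreal (N s) \<partial>lborel) \<le> (\<integral>\<^sup>+s. (\<Sum>j<n. ennreal (N (real (Suc j) * e)) * indicator {real (Suc j) * e<..real (Suc (Suc j)) * e} s) \<partial>lborel)"
    proof (rule nn_integral_mono)
      fix s :: real
      show "ennreal (N s) * indicator {e<..d} s \<le> (\<Sum>j<n. ennreal (N (real (Suc j) * e)) * indicator {real (Suc j) * e<..real (Suc (Suc j)) * e} s)"
      proof (cases "s \<in> {e<..d}")
        case True
        then have "s \<in> {e<..e + real n * e}" using e by (simp add: algebra_simps)
        then obtain j where j: "j < n" "s \<in> {e + real j * e<..e + real (Suc j) * e}"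
          using interval_sum_bound[OF e(1)] by blast
        then have s: "s \<in> {real (Suc j) * e<..real (Suc (Suc j)) * e}" by (simp add: algebra_simps)
        have "ennreal (N s) * indicator {e<..d} s \<le> ennreal (N (real (Suc j) * e)) * indicator {real (Suc j) * e<..real (Suc (Suc j)) * e} s"
          using s e True by (auto intro!: ennreal_leI N_antimono)
        also have "\<dots> \<le> (\<Sum>j<n. ennreal (N (real (Suc j) * e)) * indicator {real (Suc j) * e<..real (Suc (Suc j)) * e} s)"
          using j(1) by (intro member_le_sum) auto
        finally show ?thesis .
      qed simp
    qed
    also have "\<dots> = (\<Sum>j<n. ennreal (N (real (Suc j) * e)) * ennreal e)"
      using e by (subst nn_integral_sum) (auto simp: nn_integral_cmult algebra_simps intro!: sum.cong)
    also have "\<dots> = ennreal (\<Sum>j<n. N (real (Suc j) * e) * e)"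
    proof -
      have "0 \<le> N (real (Suc j) * e)" for j using e by (intro N_nonneg) simp
      then show ?thesis
        using e(1) by (subst sum_ennreal[symmetric]) (auto simp: ennreal_mult intro!: sum.cong)
    qed
    finally have "ennreal D * (\<integral>\<^sup>+s\<in>{e<..d}. ennreal (N s) \<partial>lborel) \<le> ennreal D * ennreal (\<Sum>j<n. N (real (Suc j) * e) * e)"
      by (rule mult_left_mono) simp
    also have "\<dots> = ennreal (\<Sum>j<n. D * e * N (real (Suc j) * e))"
      using D by (simp add: ennreal_mult'[symmetric] sum_distrib_left mult_ac)
    also have "\<dots> \<le> ennreal (\<Sum>j<Suc n. D * e * N (real (Suc j) * e))"
      using D e by (intro ennreal_leI) (simp add: N_nonneg[OF d])
    also have "\<dots> \<le> ennreal (prob {w\<in>space M. A y w < A t w})"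
      by (rule ennreal_leI[OF grid])
    finally show ?thesis by (simp add: e_def)
  qed
  have "(\<integral>\<^sup>+s\<in>{0<..d}. ennreal (N s) \<partial>lborel) = (\<integral>\<^sup>+s. (SUP n. ennreal (N s) * indicator {d / real (Suc n)<..d} s) \<partial>lborel)"
  proof (rule nn_integral_cong)
    fix s :: real
    show "ennreal (N s) * indicator {0<..d} s = (SUP n. ennreal (N s) * indicator {d / real (Suc n)<..d} s)"
    proof (cases "s \<in> {0<..d}")
      case True
      then obtain n where n: "inverse (real (Suc n)) < s / d" using d reals_Archimedean[of "s / d"] by auto
      then have "d / real (Suc n) < s" using d by (simp add: field_simps)
      then have eq: "ennreal (N s) * indicator {0<..d} s = ennreal (N s) * indicator {d / real (Suc n)<..d} s" using True by simp
      have "ennreal (N s) * indicator {0<..d} s \<le> (SUP n. ennreal (N s) * indicator {d / real (Suc n)<..d} s)"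
        unfolding eq by (rule SUP_upper[OF UNIV_I])
      moreover have "(SUP n. ennreal (N s) * indicator {d / real (Suc n)<..d} s) \<le> ennreal (N s) * indicator {0<..d} s"
        using True by (intro SUP_least) (auto simp: indicator_def)
      ultimately show ?thesis by (rule antisym)
    next
      case False
      have z: "ennreal (N s) * indicator {d / real (Suc n)<..d} s = 0" for n
      proof -
        have "0 < d / real (Suc n)" using d by simp
        then have "s \<notin> {d / real (Suc n)<..d}" using False by auto
        then show ?thesis by simp
      qed
      show ?thesis unfolding z using False by simp
    qed
  qed
  also have "\<dots> = (SUP n. \<integral>\<^sup>+s. ennreal (N s) * indicator {d / real (Suc n)<..d} s \<partial>lborel)"
  proof (rule nn_integral_monotone_convergence_SUP)
    show "incseq (\<lambda>n s. ennreal (N s) * indicator {d / real (Suc n)<..d} s)"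
    proof (intro monoI le_funI mult_left_mono)
      fix m n :: nat and s :: real assume "m \<le> n"
      then have "d / real (Suc n) \<le> d / real (Suc m)" using d by (intro divide_left_mono) auto
      then show "(indicator {d / real (Suc m)<..d} s :: ennreal) \<le> indicator {d / real (Suc n)<..d} s"
        by (auto simp: indicator_def)
    qed simp
  qed (use m2 in simp)
  finally have "ennreal D * (\<integral>\<^sup>+s\<in>{0<..d}. ennreal (N s) \<partial>lborel) = (SUP n. ennreal D * (\<integral>\<^sup>+s\<in>{d / real (Suc n)<..d}. ennreal (N s) \<partial>lborel))"
    by (simp add: SUP_mult_left_ennreal)
  also have "\<dots> \<le> ennreal (prob {w\<in>space M. A y w < A t w})"
    by (intro SUP_least bound)
  finally show ?thesis by (simp add: d_def)
qed

lemma U_isCont_right: "continuous (at_right t) U"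
  using U_isCont[of t] by (simp add: continuous_at_imp_continuous_at_within)

lemma emeasure_dU: "a \<le> b \<Longrightarrow> emeasure (interval_measure U) {a<..b} = ennreal (U b - U a)"
  by (rule emeasure_interval_measure_Ioc) (auto simp: U_mono U_isCont_right)

text \<open>The Stieltjes counterpart of \<open>flat_lower\<close>, again by summation over a grid of the time axis; \<open>t' > t\<close> absorbs
  the mesh.\<close>

lemma convolution_flat:
  assumes y: "0 < y" "y \<le> t" "t < t'"
  shows "(\<integral>\<^sup>+s\<in>{0<..y}. ennreal (N (t' - s)) \<partial>interval_measure U) \<le> ennreal (prob {w\<in>space M. A t w = A y w})"
proof -
  obtain n where "y / (t' - t) < real n" using reals_Archimedean2 by blast
  moreover have "0 < y / (t' - t)" using y by simp
  ultimately have n0: "0 < n" by (cases n) auto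
  with \<open>y / (t' - t) < real n\<close> have n: "y / real n < t' - t" using y by (simp add: field_simps)
  define e where "e = y / real n"
  have e: "0 < e" "real n * e = y" "e < t' - t" using y n0 n by (auto simp: e_def)
  define v1 where "v1 = t' - e"
  have v1: "t \<le> v1" using e by (simp add: v1_def)
  have "(\<integral>\<^sup>+s\<in>{0<..y}. ennreal (N (t' - s)) \<partial>interval_measure U) \<le>
      (\<integral>\<^sup>+s. (\<Sum>i<n. ennreal (N (v1 - real i * e)) * indicator {real i * e<..real (Suc i) * e} s) \<partial>interval_measure U)"
  proof (rule nn_integral_mono)
    fix s :: real
    show "ennreal (N (t' - s)) * indicator {0<..y} s \<le> (\<Sum>i<n. ennreal (N (v1 - real i * e)) * indicator {real i * e<..real (Suc i) * e} s)"
    proof (cases "s \<in> {0<..y}")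
      case True
      then have "s \<in> {0<..0 + real n * e}" using e by simp
      then obtain i where i: "i < n" "s \<in> {0 + real i * e<..0 + real (Suc i) * e}"
        using interval_sum_bound[OF e(1)] by blast
      have "real (Suc i) * e \<le> real n * e" using i e by (intro mult_right_mono) auto
      then have "v1 - real i * e \<le> t' - s" "0 < v1 - real i * e"
        using i(2) e v1 y by (auto simp: v1_def algebra_simps)
      then have "ennreal (N (t' - s)) * indicator {0<..y} s \<le> ennreal (N (v1 - real i * e)) * indicator {real i * e<..real (Suc i) * e} s"
        using i(2) True by (auto intro!: ennreal_leI N_antimono)
      also have "\<dots> \<le> (\<Sum>i<n. ennreal (N (v1 - real i * e)) * indicator {real i * e<..real (Suc i) * e} s)"
        using i(1) by (intro member_le_sum) auto
      finally show ?thesis .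
    qed simp
  qed
  also have "\<dots> = (\<Sum>i<n. ennreal (N (v1 - real i * e)) * ennreal (U (real (Suc i) * e) - U (real i * e)))"
    using e by (subst nn_integral_sum) (auto simp: nn_integral_cmult emeasure_dU intro!: sum.cong)
  also have "\<dots> = ennreal (\<Sum>i<n. (U (0 + real (Suc i) * e) - U (0 + real i * e)) * N (v1 - (0 + real i * e)))"
  proof -
    have "0 \<le> N (v1 - real i * e)" if "i < n" for i
    proof -
      have "real i * e < real n * e" using that e(1) by simp
      then show ?thesis using e(2) y v1 by (intro N_nonneg) simp
    qed
    moreover have "0 \<le> U (real (Suc i) * e) - U (real i * e)" for i
      using U_mono[of "real i * e" "real (Suc i) * e"] e by simp
    ultimately show ?thesis
      by (subst sum_ennreal[symmetric]) (auto simp: ennreal_mult'[symmetric] mult.commute intro!: sum.cong)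
  qed
  also have "\<dots> \<le> ennreal (prob {w\<in>space M. A 0 w < A (0 + real n * e) w \<and> A v1 w = A (0 + real n * e) w})"
    by (intro ennreal_leI sum_increase_then_flat) (use e y v1 in auto)
  also have "\<dots> \<le> ennreal (prob {w\<in>space M. A t w = A y w})"
  proof (intro ennreal_leI finite_measure_mono subsetI)
    fix w assume "w \<in> {w\<in>space M. A 0 w < A (0 + real n * e) w \<and> A v1 w = A (0 + real n * e) w}"
    then have sp: "w \<in> space M" and "A v1 w = A y w" using e by auto
    then show "w \<in> {w\<in>space M. A t w = A y w}" using A_mono[OF sp v1] A_mono[OF sp y(2)] by auto
  qed measurable
  finally show ?thesis .
qed

end

section \<open>Laplace transforms of the clock\<close>

lemma nn_integral_exp_tail:
  assumes q: "0 < q"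
  shows "(\<integral>\<^sup>+t\<in>{v..}. ennreal (q * exp (- q * t)) \<partial>lborel) = ennreal (exp (- q * v))"
    and "(\<integral>\<^sup>+t\<in>{v<..}. ennreal (q * exp (- q * t)) \<partial>lborel) = ennreal (exp (- q * v))"
proof -
  show 1: "(\<integral>\<^sup>+t\<in>{v..}. ennreal (q * exp (- q * t)) \<partial>lborel) = ennreal (exp (- q * v))"
  proof -
    have "((\<lambda>t. - exp (- q * t)) \<longlongrightarrow> 0) at_top" using q by real_asymp
    then have "(\<integral>\<^sup>+t. ennreal (q * exp (- q * t)) * indicator {v..} t \<partial>lborel) = ennreal (0 - (- exp (- q * v)))"
      using q by (intro nn_integral_FTC_atLeast) (auto intro!: derivative_eq_intros)
    then show ?thesis by simp
  qed
  have "AE t in lborel. t \<noteq> v" by (rule AE_lborel_singleton)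
  then have "(\<integral>\<^sup>+t\<in>{v<..}. ennreal (q * exp (- q * t)) \<partial>lborel) = (\<integral>\<^sup>+t\<in>{v..}. ennreal (q * exp (- q * t)) \<partial>lborel)"
    by (intro nn_integral_cong_AE) (auto simp: indicator_def elim!: eventually_mono)
  then show "(\<integral>\<^sup>+t\<in>{v<..}. ennreal (q * exp (- q * t)) \<partial>lborel) = ennreal (exp (- q * v))" using 1 by simp
qed

lemma Laplace_Stieltjes:
  fixes G :: "real \<Rightarrow> real"
  assumes mono: "\<And>s t. s \<le> t \<Longrightarrow> G s \<le> G t" and cont: "continuous_on UNIV G" and zero: "G 0 = 0" and q: "0 < q"
  shows "(\<integral>\<^sup>+s\<in>{0..}. ennreal (exp (- q * s)) \<partial>interval_measure G) = (\<integral>\<^sup>+t\<in>{0..}. ennreal (q * exp (- q * t) * G t) \<partial>lborel)"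
proof -
  have ctr: "continuous (at_right t) G" for t
    using cont by (simp add: continuous_on_eq_continuous_at continuous_at_imp_continuous_at_within)
  interpret S: sigma_finite_measure "interval_measure G"
    by (rule sigma_finite_interval_measure[OF mono ctr])
  interpret P: pair_sigma_finite "interval_measure G" lborel ..
  have "(\<integral>\<^sup>+s\<in>{0..}. ennreal (exp (- q * s)) \<partial>interval_measure G) =
      (\<integral>\<^sup>+s. (\<integral>\<^sup>+t. ennreal (q * exp (- q * t)) * indicator {s..} t * indicator {0..} s \<partial>lborel) \<partial>interval_measure G)"
    by (simp add: nn_integral_multc nn_integral_exp_tail(1)[OF q, simplified])
  also have "\<dots> = (\<integral>\<^sup>+t. (\<integral>\<^sup>+s. ennreal (q * exp (- q * t)) * indicator {s..} t * indicator {0..} s \<partial>interval_measure G) \<partial>lborel)"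
  proof (rule P.Fubini'[symmetric])
    have "(\<lambda>(s, t). ennreal (q * exp (- q * t)) * indicator {p. fst p \<le> snd p} (s, t) * indicator {0..} s)
        \<in> borel_measurable (interval_measure G \<Otimes>\<^sub>M lborel)"
      by measurable
    also have "(\<lambda>(s, t). ennreal (q * exp (- q * t)) * indicator {p. fst p \<le> snd p} (s, t) * indicator {0..} s) =
        (\<lambda>(s, t). ennreal (q * exp (- q * t)) * indicator {s..} t * indicator {0..} s)"
      by (auto simp: indicator_def)
    finally show "(\<lambda>(s, t). ennreal (q * exp (- q * t)) * indicator {s..} t * indicator {0..} s)
        \<in> borel_measurable (interval_measure G \<Otimes>\<^sub>M lborel)" .
  qed
  also have "\<dots> = (\<integral>\<^sup>+t\<in>{0..}. ennreal (q * exp (- q * t) * G t) \<partial>lborel)"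
  proof (rule nn_integral_cong)
    fix t :: real
    have "(\<integral>\<^sup>+s. ennreal (q * exp (- q * t)) * indicator {s..} t * indicator {0..} s \<partial>interval_measure G) =
        (\<integral>\<^sup>+s. ennreal (q * exp (- q * t)) * indicator {0..t} s \<partial>interval_measure G)"
      by (intro nn_integral_cong) (auto simp: indicator_def)
    also have "\<dots> = ennreal (q * exp (- q * t)) * emeasure (interval_measure G) {0..t}"
      by (subst nn_integral_cmult_indicator) auto
    also have "\<dots> = ennreal (q * exp (- q * t) * G t) * indicator {0..} t"
    proof (cases "0 \<le> t")
      case True
      have "emeasure (interval_measure G) {0..t} = ennreal (G t - G 0)"
        using True by (intro emeasure_interval_measure_Icc mono cont)
      then show ?thesis using True zero q mono[of 0 t] by (simp add: ennreal_mult)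
    qed simp
    finally show "(\<integral>\<^sup>+s. ennreal (q * exp (- q * t)) * indicator {s..} t * indicator {0..} s \<partial>interval_measure G) =
        ennreal (q * exp (- q * t) * G t) * indicator {0..} t" .
  qed
  finally show ?thesis .
qed

text \<open>The function \<open>exp (- q x)\<close> extended by \<open>0\<close> at infinity, where the subordinator is killed.\<close>

definition exp_neg :: "real \<Rightarrow> ennreal \<Rightarrow> ennreal" where
  "exp_neg q x = (if x = \<infinity> then 0 else ennreal (exp (- q * enn2real x)))"

abbreviation exp_weight :: "real \<Rightarrow> real \<Rightarrow> ennreal" where
  "exp_weight q t \<equiv> ennreal (q * exp (- q * t)) * indicator {0..} t"

lemma exp_neg_eq_integral:
  assumes q: "0 < q"
  shows "(\<integral>\<^sup>+t. exp_weight q t * indicator {t. x < ennreal t} t \<partial>lborel) = exp_neg q x"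
proof (cases x)
  case (real v)
  have "(\<integral>\<^sup>+t. exp_weight q t * indicator {t. x < ennreal t} t \<partial>lborel) = (\<integral>\<^sup>+t\<in>{v<..}. ennreal (q * exp (- q * t)) \<partial>lborel)"
    using real by (intro nn_integral_cong) (auto simp: indicator_def ennreal_less_iff)
  then show ?thesis using real nn_integral_exp_tail(2)[OF q, of v] by (simp add: exp_neg_def)
qed (simp add: exp_neg_def)

lemma exp_neg_add: "exp_neg q (x + y) = exp_neg q x * exp_neg q y"
  by (cases x; cases y) (auto simp: exp_neg_def ennreal_plus[symmetric] ring_distribs exp_add ennreal_mult'[symmetric] exp_diff exp_minus field_simps simp del: ennreal_plus)

context regenerative_clock
begin

definition g :: "real \<Rightarrow> real \<Rightarrow> ennreal" where
  "g q s = (\<integral>\<^sup>+w. exp_neg q (\<tau> s w) \<partial>M)"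

lemma emeasure_tau: "0 \<le> s \<Longrightarrow> emeasure M {w\<in>space M. \<tau> s w < ennreal t} = ennreal (Q s t)"
  by (simp add: emeasure_eq_measure Q_tau)

lemma g_eq:
  assumes q: "0 < q" and s: "0 \<le> s"
  shows "g q s = (\<integral>\<^sup>+t. exp_weight q t * ennreal (Q s t) \<partial>lborel)"
proof -
  interpret P: pair_sigma_finite M lborel ..
  have "g q s = (\<integral>\<^sup>+w. (\<integral>\<^sup>+t. exp_weight q t * indicator {p\<in>space (M \<Otimes>\<^sub>M borel). \<tau> s (fst p) < ennreal (snd p)} (w, t) \<partial>lborel) \<partial>M)"
    unfolding g_def exp_neg_eq_integral[OF q, symmetric]
    by (intro nn_integral_cong) (auto simp: indicator_def space_pair_measure)
  also have "\<dots> = (\<integral>\<^sup>+t. (\<integral>\<^sup>+w. exp_weight q t * indicator {p\<in>space (M \<Otimes>\<^sub>M borel). \<tau> s (fst p) < ennreal (snd p)} (w, t) \<partial>M) \<partial>lborel)"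
    by (rule P.Fubini'[symmetric]) measurable
  also have "\<dots> = (\<integral>\<^sup>+t. exp_weight q t * ennreal (Q s t) \<partial>lborel)"
  proof (rule nn_integral_cong)
    fix t
    have "(\<integral>\<^sup>+w. exp_weight q t * indicator {p\<in>space (M \<Otimes>\<^sub>M borel). \<tau> s (fst p) < ennreal (snd p)} (w, t) \<partial>M) =
       (\<integral>\<^sup>+w. exp_weight q t * indicator {w\<in>space M. \<tau> s w < ennreal t} w \<partial>M)"
      by (intro nn_integral_cong) (auto simp: indicator_def space_pair_measure)
    also have "\<dots> = exp_weight q t * ennreal (Q s t)"
      by (subst nn_integral_cmult_indicator) (auto simp: emeasure_tau[OF s])
    finally show "(\<integral>\<^sup>+w. exp_weight q t * indicator {p\<in>space (M \<Otimes>\<^sub>M borel). \<tau> s (fst p) < ennreal (snd p)} (w, t) \<partial>M) =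
       exp_weight q t * ennreal (Q s t)" .
  qed
  finally show ?thesis .
qed

text \<open>The transform of the sum of independent increments is a product. Independence is available only as
  the regeneration identity for distribution functions, so both exponentials are written as integrals over
  thresholds.\<close>

lemma g_add:
  assumes q: "0 < q" and s: "0 \<le> s" and h: "0 \<le> h"
  shows "g q (s + h) = g q s * g q h"
proof -
  interpret P: pair_sigma_finite M lborel ..
  define I :: "'w \<Rightarrow> real \<Rightarrow> real \<Rightarrow> ennreal" where
    "I w x y = indicator {p\<in>space (M \<Otimes>\<^sub>M (borel \<Otimes>\<^sub>M borel)). \<tau> s (fst p) < ennreal (fst (snd p)) \<and>
      \<tau> (s + h) (fst p) < \<tau> s (fst p) + ennreal (snd (snd p))} (w, x, y)" for w x y
  have I_meas: "(\<lambda>p. I (fst p) (fst (snd p)) (snd (snd p))) \<in> borel_measurable (M \<Otimes>\<^sub>M (borel \<Otimes>\<^sub>M borel))"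
    unfolding I_def by measurable
  have I_meas1 [measurable]: "(\<lambda>(p, y). I (fst p) (snd p) y) \<in> borel_measurable ((M \<Otimes>\<^sub>M borel) \<Otimes>\<^sub>M borel)"
  proof -
    have "(\<lambda>z. (fst (fst z), snd (fst z), snd z)) \<in> (M \<Otimes>\<^sub>M borel) \<Otimes>\<^sub>M borel \<rightarrow>\<^sub>M M \<Otimes>\<^sub>M ((borel :: real measure) \<Otimes>\<^sub>M (borel :: real measure))"
      by measurable
    from measurable_compose[OF this I_meas] show ?thesis by (simp add: split_beta')
  qed
  have I_meas2: "(\<lambda>(w, y). I w x y) \<in> borel_measurable (M \<Otimes>\<^sub>M borel)" for x
  proof -
    have "(\<lambda>z. (fst z, x, snd z)) \<in> M \<Otimes>\<^sub>M borel \<rightarrow>\<^sub>M M \<Otimes>\<^sub>M ((borel :: real measure) \<Otimes>\<^sub>M (borel :: real measure))"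
      by measurable
    from measurable_compose[OF this I_meas] show ?thesis by (simp add: split_beta')
  qed
  have inner: "exp_neg q (\<tau> (s + h) w) = (\<integral>\<^sup>+x. (\<integral>\<^sup>+y. exp_weight q x * (exp_weight q y * I w x y) \<partial>lborel) \<partial>lborel)"
    if sp: "w \<in> space M" for w
  proof -
    have le: "\<tau> s w \<le> \<tau> (s + h) w" unfolding inverse_local_time_def
      using h by (intro Inf_superset_mono) (auto intro: order.strict_trans1[rotated])
    have I: "I w x y = indicator {x. \<tau> s w < ennreal x} x * indicator {y. \<tau> (s + h) w < \<tau> s w + ennreal y} y" for x y
      using sp by (auto simp: I_def indicator_def space_pair_measure)
    show ?thesis
    proof (cases "\<tau> s w")
      case top
      then have "\<tau> (s + h) w = \<infinity>" using le by (simp add: top_unique)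
      then show ?thesis using top by (simp add: I exp_neg_def)
    next
      case (real v)
      define \<zeta> where "\<zeta> = \<tau> (s + h) w - \<tau> s w"
      have \<zeta>: "\<tau> (s + h) w = \<tau> s w + \<zeta>" using le by (simp add: \<zeta>_def add_diff_inverse_ennreal)
      have iff: "\<tau> (s + h) w < \<tau> s w + ennreal y \<longleftrightarrow> \<zeta> < ennreal y" for y
        unfolding \<zeta> using real by (simp add: ennreal_add_left_cancel_less)
      have "(\<integral>\<^sup>+y. exp_weight q x * (exp_weight q y * I w x y) \<partial>lborel) = exp_weight q x * indicator {x. \<tau> s w < ennreal x} x * exp_neg q \<zeta>" for x
      proof -
        have "(\<integral>\<^sup>+y. exp_weight q x * (exp_weight q y * I w x y) \<partial>lborel) =
            (\<integral>\<^sup>+y. (exp_weight q x * indicator {x. \<tau> s w < ennreal x} x) * (exp_weight q y * indicator {y. \<zeta> < ennreal y} y) \<partial>lborel)"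
          unfolding I iff by (intro nn_integral_cong) (simp only: mult_ac)
        also have "\<dots> = exp_weight q x * indicator {x. \<tau> s w < ennreal x} x * (\<integral>\<^sup>+y. exp_weight q y * indicator {y. \<zeta> < ennreal y} y \<partial>lborel)"
          by (rule nn_integral_cmult) measurable
        finally show ?thesis unfolding exp_neg_eq_integral[OF q] .
      qed
      then have "(\<integral>\<^sup>+x. (\<integral>\<^sup>+y. exp_weight q x * (exp_weight q y * I w x y) \<partial>lborel) \<partial>lborel) =
          (\<integral>\<^sup>+x. exp_weight q x * indicator {x. \<tau> s w < ennreal x} x * exp_neg q \<zeta> \<partial>lborel)" by simp
      also have "\<dots> = exp_neg q (\<tau> s w) * exp_neg q \<zeta>"
        unfolding exp_neg_eq_integral[OF q, of "\<tau> s w", symmetric] by (rule nn_integral_multc) measurable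
      finally show ?thesis unfolding \<zeta> exp_neg_add by simp
    qed
  qed
  have P: "(\<integral>\<^sup>+w. I w x y \<partial>M) = ennreal (Q s x) * ennreal (Q h y)" if "0 \<le> x" "0 \<le> y" for x y
  proof -
    let ?E = "{w\<in>space M. \<tau> s w < ennreal x \<and> \<tau> (s + h) w < \<tau> s w + ennreal y}"
    have "(\<integral>\<^sup>+w. I w x y \<partial>M) = (\<integral>\<^sup>+w. indicator ?E w \<partial>M)"
      by (intro nn_integral_cong) (auto simp: I_def indicator_def space_pair_measure)
    also have "\<dots> = emeasure M ?E" by simp
    also have "\<dots> = ennreal (Q s x) * ennreal (Q h y)"
    proof (cases "x = 0 \<or> y = 0")
      case True
      have le: "\<tau> s w \<le> \<tau> (s + h) w" for w unfolding inverse_local_time_def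
        using h by (intro Inf_superset_mono) (auto intro: order.strict_trans1[rotated])
      have "?E = {}" using True le by (auto simp: not_less)
      moreover have "Q s x = 0 \<or> Q h y = 0" using True Q_nonpos s h by auto
      ultimately show ?thesis by (metis emeasure_empty ennreal_0 mult_zero_left mult_zero_right)
    next
      case False
      then show ?thesis
        using regeneration[of s h x y] Q_tau[OF s, of x] s h that
        by (simp add: emeasure_eq_measure Q_def ennreal_mult)
    qed
    finally show ?thesis .
  qed
  have "g q (s + h) = (\<integral>\<^sup>+w. (\<integral>\<^sup>+x. (\<integral>\<^sup>+y. exp_weight q x * (exp_weight q y * I w x y) \<partial>lborel) \<partial>lborel) \<partial>M)"
    unfolding g_def by (intro nn_integral_cong inner)
  also have "\<dots> = (\<integral>\<^sup>+x. (\<integral>\<^sup>+w. (\<integral>\<^sup>+y. exp_weight q x * (exp_weight q y * I w x y) \<partial>lborel) \<partial>M) \<partial>lborel)"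
  proof (rule P.Fubini'[symmetric])
    show "(\<lambda>(w, x). \<integral>\<^sup>+y. exp_weight q x * (exp_weight q y * I w x y) \<partial>lborel) \<in> borel_measurable (M \<Otimes>\<^sub>M lborel)"
      unfolding split_beta' by (intro lborel.borel_measurable_nn_integral) (use I_meas1 in \<open>measurable\<close>)
  qed
  also have "\<dots> = (\<integral>\<^sup>+x. (\<integral>\<^sup>+y. (\<integral>\<^sup>+w. exp_weight q x * (exp_weight q y * I w x y) \<partial>M) \<partial>lborel) \<partial>lborel)"
    by (intro nn_integral_cong P.Fubini'[symmetric]) (use I_meas2 in measurable)
  also have "\<dots> = (\<integral>\<^sup>+x. (\<integral>\<^sup>+y. (exp_weight q x * ennreal (Q s x)) * (exp_weight q y * ennreal (Q h y)) \<partial>lborel) \<partial>lborel)"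
  proof (intro nn_integral_cong)
    fix x y :: real
    have "(\<lambda>w. (w, x, y)) \<in> M \<rightarrow>\<^sub>M M \<Otimes>\<^sub>M ((borel :: real measure) \<Otimes>\<^sub>M (borel :: real measure))"
      by (intro measurable_Pair measurable_ident measurable_const) auto
    from measurable_compose[OF this I_meas] have [measurable]: "(\<lambda>w. I w x y) \<in> borel_measurable M"
      by simp
    have "(\<integral>\<^sup>+w. exp_weight q x * (exp_weight q y * I w x y) \<partial>M) = exp_weight q x * (\<integral>\<^sup>+w. exp_weight q y * I w x y \<partial>M)"
      by (rule nn_integral_cmult) measurable
    also have "(\<integral>\<^sup>+w. exp_weight q y * I w x y \<partial>M) = exp_weight q y * (\<integral>\<^sup>+w. I w x y \<partial>M)"
      by (rule nn_integral_cmult) measurable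
    also have "exp_weight q x * (exp_weight q y * (\<integral>\<^sup>+w. I w x y \<partial>M)) =
        (exp_weight q x * ennreal (Q s x)) * (exp_weight q y * ennreal (Q h y))"
    proof (cases "0 \<le> x \<and> 0 \<le> y")
      case True
      then have "(\<integral>\<^sup>+w. I w x y \<partial>M) = ennreal (Q s x) * ennreal (Q h y)" by (intro P) auto
      then show ?thesis by (simp only: mult_ac)
    qed auto
    finally show "(\<integral>\<^sup>+w. exp_weight q x * (exp_weight q y * I w x y) \<partial>M) =
        (exp_weight q x * ennreal (Q s x)) * (exp_weight q y * ennreal (Q h y))" .
  qed
  also have "\<dots> = g q s * g q h"
  proof -
    have [measurable]: "(\<lambda>t. Q s t) \<in> borel_measurable borel" for s
      by (rule borel_measurable_mono) (auto simp: mono_def intro: Q_mono)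
    show ?thesis unfolding g_eq[OF q s] g_eq[OF q h]
      by (simp add: nn_integral_cmult nn_integral_multc)
  qed
  finally show ?thesis .
qed

end

section \<open>The resolvent of the clock\<close>

text \<open>An upper bound for the slope of \<open>G\<close> bounds \<open>dG\<close> on intervals, and super-level sets of an increasing
  function are intervals.\<close>

lemma nn_integral_le_slope:
  fixes f G :: "real \<Rightarrow> real"
  assumes G: "\<And>s t. s \<le> t \<Longrightarrow> G s \<le> G t" "continuous_on UNIV G"
    and slope: "\<And>a b. y \<le> a \<Longrightarrow> a \<le> b \<Longrightarrow> b \<le> z \<Longrightarrow> G b - G a \<le> D * (b - a)" and D: "0 \<le> D"
    and f: "\<And>a b. y < a \<Longrightarrow> a \<le> b \<Longrightarrow> b < z \<Longrightarrow> f a \<le> f b"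
    and f_meas: "(\<lambda>s. f s * indicator {y<..<z} s) \<in> borel_measurable borel"
  shows "(\<integral>\<^sup>+s\<in>{y<..<z}. ennreal (f s) \<partial>interval_measure G) \<le> ennreal D * (\<integral>\<^sup>+s\<in>{y<..<z}. ennreal (f s) \<partial>lborel)"
proof -
  have ctr: "continuous (at_right t) G" for t
    using G(2) by (simp add: continuous_on_eq_continuous_at continuous_at_imp_continuous_at_within)
  interpret S: sigma_finite_measure "interval_measure G"
    by (rule sigma_finite_interval_measure[OF G(1) ctr])
  interpret P: pair_sigma_finite "interval_measure G" lborel ..
  let ?f = "\<lambda>s. f s * indicator {y<..<z} s"
  define S where "S v = {s. v < ?f s}" for v
  have S_meas: "{p. fst p < ?f (snd p)} \<inter> ({0..} \<times> UNIV) \<in> sets (borel \<Otimes>\<^sub>M borel)"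
  proof -
    note [measurable] = f_meas
    have "{p \<in> space (borel \<Otimes>\<^sub>M borel). fst p < ?f (snd p) \<and> 0 \<le> fst p} \<in> sets (borel \<Otimes>\<^sub>M (borel :: real measure))"
      by measurable
    also have "{p \<in> space (borel \<Otimes>\<^sub>M (borel :: real measure)). fst p < ?f (snd p) \<and> 0 \<le> fst p} = {p. fst p < ?f (snd p)} \<inter> ({0..} \<times> UNIV)"
      by (auto simp: space_pair_measure)
    finally show ?thesis .
  qed
  define I :: "real \<Rightarrow> real \<Rightarrow> ennreal" where "I s v = indicator ({p. fst p < ?f (snd p)} \<inter> ({0..} \<times> UNIV)) (v, s)" for s v
  have I_meas: "(\<lambda>(s, v). I s v) \<in> borel_measurable (borel \<Otimes>\<^sub>M borel)"
  proof -
    have "(\<lambda>p. indicator ({p. fst p < ?f (snd p)} \<inter> ({0..} \<times> UNIV)) p :: ennreal) \<in> borel_measurable (borel \<Otimes>\<^sub>M borel)"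
      using S_meas by simp
    from measurable_compose[OF measurable_pair_swap' this] show ?thesis unfolding I_def by (simp add: split_beta')
  qed
  (* Layer-cake representation of f. *)
  have layer: "ennreal (f s) * indicator {y<..<z} s = (\<integral>\<^sup>+v. I s v \<partial>lborel)" for s
  proof -
    have "(\<integral>\<^sup>+v. I s v \<partial>lborel) = (\<integral>\<^sup>+v. indicator {0..<?f s} v \<partial>lborel)"
      by (intro nn_integral_cong) (auto simp: I_def indicator_def)
    also have "\<dots> = ennreal (?f s)" by (cases "0 \<le> ?f s") (auto simp: ennreal_neg)
    finally show ?thesis by (auto simp: indicator_def)
  qed
  have slice: "emeasure (interval_measure G) (S v) \<le> ennreal D * emeasure lborel (S v)" if v: "0 \<le> v" for v
  proof (cases "S v = {}")
    case False
    have sub: "S v \<subseteq> {y<..<z}" using v by (auto simp: S_def indicator_def split: if_splits)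
    define s0 where "s0 = Inf (S v)"
    have bb: "bdd_below (S v)" using sub by (intro bdd_belowI[of _ y]) auto
    have s0: "y \<le> s0" unfolding s0_def using False sub by (intro cInf_greatest) auto
    have s0z: "s0 < z" unfolding s0_def using False sub cInf_lower[OF _ bb] by (metis equals0I greaterThanLessThan_iff le_less_trans subsetD)
    have S1: "S v \<subseteq> {s0..z}" using sub cInf_lower[OF _ bb] unfolding s0_def by (auto simp: subset_iff)
    have S2: "{s0<..<z} \<subseteq> S v"
    proof
      fix s assume s: "s \<in> {s0<..<z}"
      then obtain u where u: "u \<in> S v" "u < s" using cInf_less_iff[OF False bb] unfolding s0_def by auto
      then have "f u \<le> f s" using sub s by (intro f) auto
      then show "s \<in> S v" using u sub s s0 by (auto simp: S_def)
    qed
    have Sm: "S v \<in> sets borel"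
    proof -
      note [measurable] = f_meas
      have "{s \<in> space borel. v < ?f s} \<in> sets borel" by measurable
      then show ?thesis by (simp add: S_def)
    qed
    have "emeasure (interval_measure G) (S v) \<le> emeasure (interval_measure G) {s0..z}"
      using S1 by (intro emeasure_mono) auto
    also have "\<dots> = ennreal (G z - G s0)" using s0z G by (intro emeasure_interval_measure_Icc) auto
    also have "\<dots> \<le> ennreal (D * (z - s0))" using s0 s0z by (intro ennreal_leI slope) auto
    also have "\<dots> = ennreal D * emeasure lborel {s0<..<z}" using D s0z by (simp add: ennreal_mult)
    also have "\<dots> \<le> ennreal D * emeasure lborel (S v)" using S2 Sm by (intro mult_left_mono emeasure_mono) auto
    finally show ?thesis .
  qed simp
  have SI: "(\<integral>\<^sup>+s. I s v \<partial>\<mu>) = (if 0 \<le> v then emeasure \<mu> (S v) else 0)" if "sets \<mu> = sets borel" for \<mu> :: "real measure" and v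
  proof -
    have "S v \<in> sets \<mu>"
    proof -
      note [measurable] = f_meas
      have "{s \<in> space borel. v < ?f s} \<in> sets borel" by measurable
      then show ?thesis using that by (simp add: S_def)
    qed
    moreover have "(\<integral>\<^sup>+s. I s v \<partial>\<mu>) = (if 0 \<le> v then (\<integral>\<^sup>+s. indicator (S v) s \<partial>\<mu>) else 0)"
      by (auto simp: I_def S_def indicator_def intro!: nn_integral_cong)
    ultimately show ?thesis by simp
  qed
  have "(\<integral>\<^sup>+s\<in>{y<..<z}. ennreal (f s) \<partial>interval_measure G) = (\<integral>\<^sup>+s. (\<integral>\<^sup>+v. I s v \<partial>lborel) \<partial>interval_measure G)"
    unfolding layer ..
  also have "\<dots> = (\<integral>\<^sup>+v. (\<integral>\<^sup>+s. I s v \<partial>interval_measure G) \<partial>lborel)"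
    by (rule P.Fubini'[symmetric]) (use I_meas in measurable)
  also have "\<dots> \<le> (\<integral>\<^sup>+v. ennreal D * (\<integral>\<^sup>+s. I s v \<partial>lborel) \<partial>lborel)"
    using slice by (intro nn_integral_mono) (simp add: SI)
  also have "\<dots> = ennreal D * (\<integral>\<^sup>+v. (\<integral>\<^sup>+s. I s v \<partial>lborel) \<partial>lborel)"
  proof (rule nn_integral_cmult)
    have "(\<lambda>(v, s). I s v) \<in> borel_measurable (lborel \<Otimes>\<^sub>M lborel)"
      using measurable_compose[OF measurable_pair_swap' I_meas] by (simp add: split_beta')
    then show "(\<lambda>v. \<integral>\<^sup>+s. I s v \<partial>lborel) \<in> borel_measurable lborel"
      by (rule lborel.borel_measurable_nn_integral)
  qed
  also have "(\<integral>\<^sup>+v. (\<integral>\<^sup>+s. I s v \<partial>lborel) \<partial>lborel) = (\<integral>\<^sup>+s. (\<integral>\<^sup>+v. I s v \<partial>lborel) \<partial>lborel)"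
    by (rule lborel_pair.Fubini') (use I_meas in measurable)
  finally show ?thesis unfolding layer .
qed

text \<open>Links the clock to the resolvent density: \<open>r q\<close> plays the role of \<open>r\<^sub>q(a, a)\<close>.\<close>

locale resolvent_clock = regenerative_clock M A for M :: "'w measure" and A +
  fixes r :: "real \<Rightarrow> real"
  assumes r_eq: "1 \<le> q \<Longrightarrow> (\<integral>\<^sup>+t\<in>{0..}. ennreal (q * exp (- q * t) * U t) \<partial>lborel) = ennreal (r q)"
begin

lemma U_measurable [measurable]: "U \<in> borel_measurable borel"
  by (rule borel_measurable_mono) (auto simp: mono_def U_mono)

lemma Q_measurable [measurable]: "Q s \<in> borel_measurable borel"
  by (rule borel_measurable_mono) (auto simp: mono_def Q_mono)

lemma U_pos: "0 < t \<Longrightarrow> 0 < U t"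
proof -
  assume t: "0 < t"
  have "U t \<noteq> 0"
  proof
    assume "U t = 0"
    then have "AE w in M. A t w = 0"
      unfolding U_def using A_nonneg by (subst (asm) integral_nonneg_eq_0_iff_AE[OF A_integrable]) auto
    with A_pos[OF t] have "AE w in M. False" by eventually_elim simp
    then show False by simp
  qed
  then show ?thesis using U_nonneg[of t] by simp
qed

lemma r_pos: assumes q: "1 \<le> q" shows "0 < r q"
proof -
  have "ennreal (U 1) * ennreal (exp (- q)) = (\<integral>\<^sup>+t. ennreal (U 1) * (ennreal (q * exp (- q * t)) * indicator {1..} t) \<partial>lborel)"
    using nn_integral_exp_tail(1)[of q 1] q by (subst nn_integral_cmult) auto
  also have "\<dots> \<le> (\<integral>\<^sup>+t\<in>{0..}. ennreal (q * exp (- q * t) * U t) \<partial>lborel)"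
    using q by (intro nn_integral_mono)
      (auto simp: indicator_def U_nonneg ennreal_mult'[symmetric] intro!: ennreal_leI mult_mono U_mono)
  also have "\<dots> = ennreal (r q)" by (rule r_eq[OF q])
  finally have "ennreal (U 1 * exp (- q)) \<le> ennreal (r q)" by (simp add: ennreal_mult' U_nonneg)
  moreover have "0 < U 1 * exp (- q)" using U_pos[of 1] by simp
  ultimately show ?thesis by (cases "0 < r q") (auto simp: ennreal_neg ennreal_eq_0_iff not_less)
qed

lemma exp_weight_total: "0 < q \<Longrightarrow> (\<integral>\<^sup>+t. exp_weight q t \<partial>lborel) = 1"
  using nn_integral_exp_tail(1)[of q 0] by simp

lemma g_0: assumes q: "0 < q" shows "g q 0 = 1"
proof -
  have "g q 0 = (\<integral>\<^sup>+t. exp_weight q t * ennreal (Q 0 t) \<partial>lborel)" using g_eq[OF q] by simp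
  also have "\<dots> = (\<integral>\<^sup>+t. exp_weight q t \<partial>lborel)"
  proof (rule nn_integral_cong_AE)
    have "Q 0 t = 1" if "0 < t" for t
      unfolding Q_def using A_pos[OF that] by (subst prob_eq_1) auto
    moreover have "AE t in lborel. t \<noteq> (0::real)" by (rule AE_lborel_singleton)
    ultimately show "AE t in lborel. exp_weight q t * ennreal (Q 0 t) = exp_weight q t"
      by (auto elim!: eventually_mono simp: indicator_def)
  qed
  finally show ?thesis using exp_weight_total[OF q] by simp
qed

lemma g_le_1: "0 < q \<Longrightarrow> 0 \<le> s \<Longrightarrow> g q s \<le> 1"
  unfolding g_eq exp_weight_total[symmetric] using Q_le_1
  by (intro nn_integral_mono) (auto simp: indicator_def mult_left_le)

lemma g_power:
  assumes q: "0 < q" and h: "0 \<le> h" shows "g q (real k * h) = ennreal (enn2real (g q h) ^ k)"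
proof (induction k)
  case 0
  then show ?case using g_0[OF q] by simp
next
  case (Suc k)
  have fin: "g q h < \<infinity>" using g_le_1[OF q h] by (simp add: le_less_trans)
  have "g q (real (Suc k) * h) = g q (real k * h + h)" by (simp add: algebra_simps)
  also have "\<dots> = g q (real k * h) * g q h" by (rule g_add[OF q]) (use h in auto)
  also have "\<dots> = ennreal (enn2real (g q h) ^ k) * ennreal (enn2real (g q h))" using Suc fin by simp
  finally show ?case by (simp add: ennreal_mult'[symmetric] mult.commute)
qed

lemma Laplace_Uh:
  assumes q: "0 < q" and h: "0 < h"
  shows "(\<integral>\<^sup>+t. exp_weight q t * ennreal (Uh h t) \<partial>lborel) = (\<Sum>k. ennreal (h * enn2real (g q h) ^ k))"
proof -
  have "(\<Sum>k. ennreal (h * enn2real (g q h) ^ k)) = (\<Sum>k. ennreal h * g q (real k * h))"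
    using h by (simp add: g_power[OF q] ennreal_mult)
  also have "\<dots> = (\<Sum>k. \<integral>\<^sup>+t. exp_weight q t * ennreal (h * Q (real k * h) t) \<partial>lborel)"
  proof (rule suminf_cong)
    fix k
    have "(\<integral>\<^sup>+t. exp_weight q t * ennreal (h * Q (real k * h) t) \<partial>lborel) = (\<integral>\<^sup>+t. ennreal h * (exp_weight q t * ennreal (Q (real k * h) t)) \<partial>lborel)"
      using h by (intro nn_integral_cong) (simp add: ennreal_mult Q_nonneg mult_ac)
    also have "\<dots> = ennreal h * g q (real k * h)"
      using h by (subst g_eq[OF q], simp) (rule nn_integral_cmult, measurable)
    finally show "ennreal h * g q (real k * h) = (\<integral>\<^sup>+t. exp_weight q t * ennreal (h * Q (real k * h) t) \<partial>lborel)" ..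
  qed
  also have "\<dots> = (\<integral>\<^sup>+t. (\<Sum>k. exp_weight q t * ennreal (h * Q (real k * h) t)) \<partial>lborel)"
    by (intro nn_integral_suminf[symmetric]) measurable
  also have "\<dots> = (\<integral>\<^sup>+t. exp_weight q t * ennreal (Uh h t) \<partial>lborel)"
  proof (rule nn_integral_cong)
    fix t
    have "(\<Sum>k. ennreal (h * Q (real k * h) t)) = ennreal (\<Sum>k. h * Q (real k * h) t)"
      using h by (intro suminf_ennreal2 summable_mult Uh_sums) (simp_all add: Q_nonneg)
    also have "(\<Sum>k. h * Q (real k * h) t) = Uh h t"
      unfolding Uh_def by (rule suminf_mult[OF Uh_sums(1)[OF h]])
    finally show "(\<Sum>k. exp_weight q t * ennreal (h * Q (real k * h) t)) = exp_weight q t * ennreal (Uh h t)"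
      by simp
  qed
  finally show ?thesis ..
qed

text \<open>\<open>Uh\<close> has transform \<open>h / (1 - g)\<close> by the geometric series and differs from \<open>U\<close> by at most \<open>h\<close>.\<close>

lemma one_minus_g_bounds:
  assumes q: "1 \<le> q" and h: "0 < h"
  shows "1 / (r q + h) \<le> (1 - enn2real (g q h)) / h" "(1 - enn2real (g q h)) / h \<le> 1 / r q"
proof -
  have q0: "0 < q" using q by simp
  define G where "G = enn2real (g q h)"
  have gG: "g q h = ennreal G" unfolding G_def using g_le_1[OF q0, of h] h by (simp add: le_less_trans)
  have G: "0 \<le> G" by (simp add: G_def)
  have "ennreal G \<le> ennreal 1" using g_le_1[OF q0, of h] h gG by simp
  then have "G \<le> 1" by (subst (asm) ennreal_le_iff) auto
  let ?S = "\<Sum>k. ennreal (h * G ^ k)"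
  have S: "?S = (\<integral>\<^sup>+t. exp_weight q t * ennreal (Uh h t) \<partial>lborel)"
    using Laplace_Uh[OF q0 h] by (simp add: G_def)
  have RU: "(\<integral>\<^sup>+t. exp_weight q t * ennreal (U t) \<partial>lborel) = ennreal (r q)"
    using q U_nonneg by (subst r_eq[OF q, symmetric]) (auto intro!: nn_integral_cong simp: ennreal_mult mult_ac)
  have lower: "ennreal (r q) \<le> ?S" unfolding S RU[symmetric]
    using Uh_sums(2)[OF h] by (intro nn_integral_mono mult_left_mono ennreal_leI) auto
  have "?S \<le> (\<integral>\<^sup>+t. exp_weight q t * ennreal (U t) + exp_weight q t * ennreal h \<partial>lborel)"
    unfolding S using Uh_sums(3)[OF h] h U_nonneg
    by (intro nn_integral_mono) (auto simp: distrib_left[symmetric] ennreal_plus[symmetric] simp del: ennreal_plus intro!: mult_left_mono ennreal_leI)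
  also have "\<dots> = ennreal (r q) + ennreal h"
  proof -
    have "(\<integral>\<^sup>+t. exp_weight q t * ennreal h \<partial>lborel) = (\<integral>\<^sup>+t. exp_weight q t \<partial>lborel) * ennreal h"
      by (rule nn_integral_multc) measurable
    then have h1: "(\<integral>\<^sup>+t. exp_weight q t * ennreal h \<partial>lborel) = ennreal h" unfolding exp_weight_total[OF q0] by simp
    have "(\<integral>\<^sup>+t. exp_weight q t * ennreal (U t) + exp_weight q t * ennreal h \<partial>lborel) =
        (\<integral>\<^sup>+t. exp_weight q t * ennreal (U t) \<partial>lborel) + (\<integral>\<^sup>+t. exp_weight q t * ennreal h \<partial>lborel)"
      by (rule nn_integral_add) measurable
    then show ?thesis by (simp only: RU h1)
  qed
  finally have upper: "?S \<le> ennreal (r q + h)" using r_pos[OF q] h by simp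
  then have fin: "?S \<noteq> top" by (metis ennreal_neq_top top.extremum_unique)
  have sm: "summable (\<lambda>k. h * G ^ k)"
    by (rule summable_suminf_not_top[OF _ fin]) (use h G in auto)
  have "G \<noteq> 1"
  proof
    assume "G = 1"
    then have "summable (\<lambda>k::nat. h)" using sm by simp
    then have "(\<lambda>k::nat. h) \<longlonglongrightarrow> 0" by (rule summable_LIMSEQ_zero)
    then show False using h by (simp add: LIMSEQ_const_iff)
  qed
  then have G1: "G < 1" using \<open>G \<le> 1\<close> by simp
  have "?S = ennreal (\<Sum>k. h * G ^ k)" using h G sm by (intro suminf_ennreal2) auto
  also have "(\<Sum>k. h * G ^ k) = h / (1 - G)"
    using G G1 by (subst suminf_mult) (auto simp: suminf_geometric summable_geometric)
  finally have S': "?S = ennreal (h / (1 - G))" .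
  have b1: "r q \<le> h / (1 - G)"
    using lower h G1 unfolding S' by (subst (asm) ennreal_le_iff) auto
  have b2: "h / (1 - G) \<le> r q + h"
    using upper h r_pos[OF q] unfolding S' by (subst (asm) ennreal_le_iff) auto
  show "1 / (r q + h) \<le> (1 - enn2real (g q h)) / h" "(1 - enn2real (g q h)) / h \<le> 1 / r q"
    using b1 b2 h G1 r_pos[OF q] unfolding G_def[symmetric] by (auto simp: field_simps)
qed

lemma Laplace_Nh:
  assumes q: "1 \<le> q" and h: "0 < h"
  obtains c where "1 / (r q + h) \<le> c" "c \<le> 1 / r q"
    "(\<integral>\<^sup>+t. exp_weight q t * ennreal (Nh h t) \<partial>lborel) = ennreal c"
proof -
  have q0: "0 < q" using q by simp
  define G where "G = enn2real (g q h)"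
  have gG: "g q h = ennreal G" unfolding G_def using g_le_1[OF q0, of h] h by (simp add: le_less_trans)
  have G: "0 \<le> G" by (simp add: G_def)
  define c where "c = (1 - G) / h"
  have c: "1 / (r q + h) \<le> c" "c \<le> 1 / r q"
    using one_minus_g_bounds[OF q h] unfolding c_def G_def by auto
  have sum1: "(\<integral>\<^sup>+t. exp_weight q t * ennreal (Q h t) \<partial>lborel) + (\<integral>\<^sup>+t. exp_weight q t * ennreal (1 - Q h t) \<partial>lborel) = 1"
  proof -
    have "(\<integral>\<^sup>+t. exp_weight q t * ennreal (Q h t) \<partial>lborel) + (\<integral>\<^sup>+t. exp_weight q t * ennreal (1 - Q h t) \<partial>lborel) =
       (\<integral>\<^sup>+t. exp_weight q t * ennreal (Q h t) + exp_weight q t * ennreal (1 - Q h t) \<partial>lborel)"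
      by (rule nn_integral_add[symmetric]) measurable
    also have "\<dots> = (\<integral>\<^sup>+t. exp_weight q t \<partial>lborel)"
      using Q_nonneg Q_le_1 by (intro nn_integral_cong) (simp add: distrib_left[symmetric] ennreal_plus[symmetric] del: ennreal_plus)
    finally show ?thesis using exp_weight_total[OF q0] by simp
  qed
  have X: "(\<integral>\<^sup>+t. exp_weight q t * ennreal (1 - Q h t) \<partial>lborel) = ennreal (1 - G)"
  proof -
    let ?X = "\<integral>\<^sup>+t. exp_weight q t * ennreal (1 - Q h t) \<partial>lborel"
    have e: "ennreal G + ?X = 1" using sum1 g_eq[OF q0, of h] h gG by simp
    then have "?X \<noteq> top" by auto
    then obtain x where x: "?X = ennreal x" "0 \<le> x" by (cases ?X) auto
    have "G + x = 1" using e x G by (simp add: ennreal_plus[symmetric] ennreal_1[symmetric] del: ennreal_plus ennreal_1)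
    then show ?thesis using x by (simp add: eq_diff_eq)
  qed
  have "(\<integral>\<^sup>+t. exp_weight q t * ennreal (Nh h t) \<partial>lborel) = (\<integral>\<^sup>+t. ennreal (1 / h) * (exp_weight q t * ennreal (1 - Q h t)) \<partial>lborel)"
    using h Q_le_1 by (intro nn_integral_cong) (simp add: Nh_def divide_inverse ennreal_mult mult_ac)
  also have "\<dots> = ennreal (1 / h) * ennreal (1 - G)"
    unfolding X[symmetric] by (rule nn_integral_cmult) measurable
  also have "\<dots> = ennreal c" using h by (simp add: c_def ennreal_mult'[symmetric])
  finally show ?thesis using that c by blast
qed

text \<open>\<open>1 / (q r q)\<close> is up to \<open>h\<close> the Laplace transform of the nonnegative function \<open>Nh\<close>, hence decreasing.\<close>

lemma qr_mono:
  assumes "1 \<le> p" "p \<le> q" shows "p * r p \<le> q * r q"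
proof -
  have bound: "1 / (q * (r q + h)) \<le> 1 / (p * r p)" if h: "0 < h" for h
  proof -
    obtain c where c: "1 / (r q + h) \<le> c" "(\<integral>\<^sup>+t. exp_weight q t * ennreal (Nh h t) \<partial>lborel) = ennreal c"
      by (rule Laplace_Nh[of q h]) (use assms h in auto)
    obtain d where d: "d \<le> 1 / r p" "(\<integral>\<^sup>+t. exp_weight p t * ennreal (Nh h t) \<partial>lborel) = ennreal d"
      by (rule Laplace_Nh[of p h]) (use assms h in auto)
    have Nm [measurable]: "Nh h \<in> borel_measurable borel" unfolding Nh_def by measurable
    have c0: "0 < c" using c(1) r_pos[of q] assms h by (smt (verit) divide_pos_pos)
    have "ennreal (1 / q) * ennreal c = (\<integral>\<^sup>+t. ennreal (1 / q) * (exp_weight q t * ennreal (Nh h t)) \<partial>lborel)"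
      unfolding c(2)[symmetric] by (rule nn_integral_cmult[symmetric]) measurable
    also have "\<dots> \<le> (\<integral>\<^sup>+t. ennreal (1 / p) * (exp_weight p t * ennreal (Nh h t)) \<partial>lborel)"
      using assms h Nh_nonneg[OF h]
      by (intro nn_integral_mono) (auto simp: indicator_def ennreal_mult'[symmetric] intro!: ennreal_leI mult_right_mono)
    also have "\<dots> = ennreal (1 / p) * ennreal d"
      unfolding d(2)[symmetric] by (rule nn_integral_cmult) measurable
    finally have "ennreal (1 / q * c) \<le> ennreal (1 / p * d)" using assms by (subst (1 2) ennreal_mult') auto
    moreover have "0 < 1 / q * c" using assms c0 by simp
    ultimately have "1 / q * c \<le> 1 / p * d" by (subst (asm) ennreal_le_iff2) linarith
    also have "\<dots> \<le> 1 / p * (1 / r p)" using assms d(1) by (intro mult_left_mono) auto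
    finally have "1 / q * c \<le> 1 / (p * r p)" by simp
    moreover have "1 / q * (1 / (r q + h)) \<le> 1 / q * c" using assms c(1) by (intro mult_left_mono) auto
    ultimately show ?thesis by simp
  qed
  have "1 / (q * r q) \<le> 1 / (p * r p)"
  proof (rule tendsto_upperbound)
    have "((\<lambda>h. 1 / (q * (r q + h))) \<longlongrightarrow> 1 / (q * (r q + 0))) (at_right 0)"
      using r_pos[of q] assms by (intro tendsto_intros) auto
    then show "((\<lambda>h. 1 / (q * (r q + h))) \<longlongrightarrow> 1 / (q * r q)) (at_right 0)" by simp
    show "\<forall>\<^sub>F h in at_right 0. 1 / (q * (r q + h)) \<le> 1 / (p * r p)"
      using bound by (intro eventually_at_rightI[of 0 1]) auto
  qed simp
  moreover have "0 < p * r p" "0 < q * r q" using r_pos assms by auto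
  ultimately show ?thesis by (simp add: field_simps)
qed

lemma Nh_measurable [measurable]: "Nh h \<in> borel_measurable borel"
  unfolding Nh_def by measurable

lemma Nh_small_mass:
  assumes h: "0 < h" and p: "1 \<le> p"
  shows "(\<integral>\<^sup>+t\<in>{0..1 / p}. ennreal (Nh h t) \<partial>lborel) \<le> ennreal (exp 1 / (p * r p))"
proof -
  obtain c where c: "c \<le> 1 / r p" "(\<integral>\<^sup>+t. exp_weight p t * ennreal (Nh h t) \<partial>lborel) = ennreal c"
    by (rule Laplace_Nh[OF p h])
  have "(\<integral>\<^sup>+t\<in>{0..1 / p}. ennreal (Nh h t) \<partial>lborel) \<le> (\<integral>\<^sup>+t. ennreal (exp 1 / p) * (exp_weight p t * ennreal (Nh h t)) \<partial>lborel)"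
  proof (rule nn_integral_mono)
    fix t :: real
    have "Nh h t \<le> exp 1 / p * (p * exp (- p * t) * Nh h t)" if "t \<le> 1 / p"
    proof -
      have "1 \<le> exp (1 - p * t)" using that p by (simp add: field_simps)
      then have "1 * Nh h t \<le> exp (1 - p * t) * Nh h t" using Nh_nonneg[OF h] by (rule mult_right_mono)
      then show ?thesis using p by (simp add: exp_diff exp_minus field_simps)
    qed
    then show "ennreal (Nh h t) * indicator {0..1 / p} t \<le> ennreal (exp 1 / p) * (exp_weight p t * ennreal (Nh h t))"
      using p Nh_nonneg[OF h, of t] by (auto simp: indicator_def ennreal_mult'[symmetric] intro!: ennreal_leI)
  qed
  also have "\<dots> = ennreal (exp 1 / p) * ennreal c"
    unfolding c(2)[symmetric] by (rule nn_integral_cmult) measurable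
  also have "\<dots> = ennreal (exp 1 / p * c)" using p by (subst ennreal_mult') auto
  also have "\<dots> \<le> ennreal (exp 1 / p * (1 / r p))" using p c(1) by (intro ennreal_leI mult_left_mono) auto
  finally show ?thesis by simp
qed

lemma N_ennreal_measurable [measurable]: "(\<lambda>t. ennreal (N t) * indicator {0<..} t) \<in> borel_measurable borel"
proof -
  have "(\<lambda>t. ennreal (N t) * indicator {0<..} t) = (\<lambda>t. ennreal (N t * indicator {0<..} t))"
    by (auto simp: indicator_def)
  then show ?thesis using N_measurable by simp
qed

text \<open>The approximations \<open>Nh\<close> have this transform in the limit. Mass can escape only to the origin, where it
  would create a drift; the hypothesis excludes this.\<close>

lemma Laplace_N:
  assumes lim: "filterlim (\<lambda>q. q * r q) at_top at_top" and q: "1 \<le> q"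
  shows "(\<integral>\<^sup>+t. ennreal (q * exp (- q * t)) * (ennreal (N t) * indicator {0<..} t) \<partial>lborel) = ennreal (1 / r q)"
    (is "?I = _")
proof (rule antisym)
  let ?h = "\<lambda>n::nat. 1 / 2 ^ n :: real"
  have hpos: "0 < ?h n" for n by simp
  have h0: "?h \<longlonglongrightarrow> 0" using LIMSEQ_realpow_zero[of "1/2::real"] by (simp add: power_one_over)
  let ?u = "\<lambda>n t. ennreal (q * exp (- q * t)) * (ennreal (Nh (?h n) t) * indicator {0<..} t)"
  have ulim: "(\<lambda>n. ?u n t) \<longlonglongrightarrow> ennreal (q * exp (- q * t)) * (ennreal (N t) * indicator {0<..} t)" for t
  proof (cases "0 < t")
    case True
    have "(\<lambda>n. ennreal (q * exp (- q * t) * Nh (?h n) t)) \<longlonglongrightarrow> ennreal (q * exp (- q * t) * N t)"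
      by (intro tendsto_ennrealI tendsto_intros Nh_tendsto_N True)
    then show ?thesis using True q by (simp add: ennreal_mult')
  qed simp
  have uint: "(\<integral>\<^sup>+t. ?u n t \<partial>lborel) \<le> ennreal (1 / r q)" for n
  proof -
    obtain c where c: "c \<le> 1 / r q" "(\<integral>\<^sup>+t. exp_weight q t * ennreal (Nh (?h n) t) \<partial>lborel) = ennreal c"
      by (rule Laplace_Nh[OF q hpos])
    have "(\<integral>\<^sup>+t. ?u n t \<partial>lborel) \<le> (\<integral>\<^sup>+t. exp_weight q t * ennreal (Nh (?h n) t) \<partial>lborel)"
      by (intro nn_integral_mono) (auto simp: indicator_def)
    also have "\<dots> \<le> ennreal (1 / r q)" unfolding c(2) by (rule ennreal_leI[OF c(1)])
    finally show ?thesis .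
  qed
  have "?I = (\<integral>\<^sup>+t. liminf (\<lambda>n. ?u n t) \<partial>lborel)"
    using lim_imp_Liminf[OF sequentially_bot ulim] by simp
  also have "\<dots> \<le> liminf (\<lambda>n. \<integral>\<^sup>+t. ?u n t \<partial>lborel)"
    by (rule nn_integral_liminf) measurable
  also have "\<dots> \<le> liminf (\<lambda>n::nat. ennreal (1 / r q))"
    using uint by (intro Liminf_mono always_eventually) blast
  also have "\<dots> = ennreal (1 / r q)" by (simp add: Liminf_const)
  finally show "?I \<le> ennreal (1 / r q)" .
  (* The part of the transform of Nh below 1/p is of order 1 / (p r p), uniformly in h. *)
  have key: "ennreal (1 / r q) \<le> ennreal (q * exp 1 / (p * r p)) + ?I" if p: "1 \<le> p" for p
  proof -
    let ?d = "1 / p"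
    have d: "0 < ?d" using p by simp
    let ?b' = "\<lambda>t. ennreal (q * exp (- q * t)) * (ennreal (N t) * indicator {?d<..} t)"
    let ?b = "\<lambda>n t. ennreal (q * exp (- q * t)) * (ennreal (Nh (?h n) t) * indicator {?d<..} t)"
    let ?B = "\<lambda>n. \<integral>\<^sup>+t. ?b n t \<partial>lborel"
    let ?B' = "\<integral>\<^sup>+t. ?b' t \<partial>lborel"
    have "Bseq (\<lambda>n. Nh (?h n) ?d)" using Nh_tendsto_N[OF d] by (intro convergent_imp_Bseq convergentI)
    then obtain K where K: "0 < K" "\<And>n. norm (Nh (?h n) ?d) \<le> K" by (auto elim: BseqE)
    have Bm: "(\<lambda>t. ?b' t) \<in> borel_measurable borel"
    proof -
      have "(\<lambda>t. ?b' t) =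
        (\<lambda>t. ennreal (q * exp (- q * t)) * (ennreal (N t) * indicator {0<..} t) * indicator {?d<..} t)"
      proof
        fix t :: real
        show "?b' t =
            ennreal (q * exp (- q * t)) * (ennreal (N t) * indicator {0<..} t) * indicator {?d<..} t"
        proof (cases "?d < t")
          case True
          with d have "0 < t" by linarith
          with True show ?thesis by simp
        qed simp
      qed
      then show ?thesis by simp
    qed
    have Blim: "?B \<longlonglongrightarrow> ?B'"
    proof (rule nn_integral_dominated_convergence[where w = "\<lambda>t. exp_weight q t * ennreal K"])
      show "(\<integral>\<^sup>+t. exp_weight q t * ennreal K \<partial>lborel) < \<infinity>"
      proof -
        have "(\<integral>\<^sup>+t. exp_weight q t * ennreal K \<partial>lborel) = (\<integral>\<^sup>+t. exp_weight q t \<partial>lborel) * ennreal K"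
          by (rule nn_integral_multc) measurable
        then show ?thesis using exp_weight_total[of q] q by simp
      qed
      show "AE t in lborel. ?b n t \<le> exp_weight q t * ennreal K" for n
      proof (intro AE_I2)
        fix t :: real
        show "?b n t \<le> exp_weight q t * ennreal K"
        proof (cases "?d < t")
          case True
          then have "Nh (?h n) t \<le> Nh (?h n) ?d" by (intro Nh_antimono) auto
          also have "\<dots> \<le> K" using K(2)[of n] by simp
          finally have "Nh (?h n) t \<le> K" .
          moreover have "0 \<le> t" using True d by linarith
          ultimately show ?thesis using True by (auto intro!: mult_left_mono ennreal_leI)
        qed simp
      qed
      show "AE t in lborel. (\<lambda>n. ?b n t) \<longlonglongrightarrow>
          ?b' t"
      proof (intro AE_I2)
        fix t :: real
        show "(\<lambda>n. ?b n t) \<longlonglongrightarrow>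
          ?b' t"
        proof (cases "?d < t")
          case True
          then have "0 < t" using d by linarith
          with ulim[of t] True show ?thesis by simp
        qed simp
      qed
    qed (use Bm in measurable)
    have "ennreal (1 / (r q + ?h n)) \<le> ennreal (q * exp 1 / (p * r p)) + ?B n" for n
    proof -
      obtain c where c: "1 / (r q + ?h n) \<le> c" "(\<integral>\<^sup>+t. exp_weight q t * ennreal (Nh (?h n) t) \<partial>lborel) = ennreal c"
        by (rule Laplace_Nh[OF q hpos])
      have "ennreal (1 / (r q + ?h n)) \<le> (\<integral>\<^sup>+t. exp_weight q t * ennreal (Nh (?h n) t) \<partial>lborel)"
        unfolding c(2) by (rule ennreal_leI[OF c(1)])
      also have "\<dots> \<le> (\<integral>\<^sup>+t. ennreal q * (ennreal (Nh (?h n) t) * indicator {0..?d} t) +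
          ?b n t \<partial>lborel)"
        using q d by (intro nn_integral_mono) (auto simp: indicator_def intro!: mult_right_mono ennreal_leI)
      also have "\<dots> = ennreal q * (\<integral>\<^sup>+t\<in>{0..?d}. ennreal (Nh (?h n) t) \<partial>lborel) + ?B n"
      proof -
        have "(\<integral>\<^sup>+t. ennreal q * (ennreal (Nh (?h n) t) * indicator {0..?d} t) +
          ?b n t \<partial>lborel) =
          (\<integral>\<^sup>+t. ennreal q * (ennreal (Nh (?h n) t) * indicator {0..?d} t) \<partial>lborel) + ?B n"
          by (rule nn_integral_add) measurable
        also have "(\<integral>\<^sup>+t. ennreal q * (ennreal (Nh (?h n) t) * indicator {0..?d} t) \<partial>lborel) =
          ennreal q * (\<integral>\<^sup>+t\<in>{0..?d}. ennreal (Nh (?h n) t) \<partial>lborel)"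
          by (rule nn_integral_cmult) measurable
        finally show ?thesis .
      qed
      also have "\<dots> \<le> ennreal q * ennreal (exp 1 / (p * r p)) + ?B n"
        by (intro add_right_mono mult_left_mono Nh_small_mass hpos p) auto
      also have "ennreal q * ennreal (exp 1 / (p * r p)) = ennreal (q * exp 1 / (p * r p))"
        using q by (subst ennreal_mult'[symmetric]) auto
      finally show ?thesis .
    qed
    moreover have "(\<lambda>n. ennreal (1 / (r q + ?h n))) \<longlonglongrightarrow> ennreal (1 / (r q + 0))"
      using r_pos[OF q] by (intro tendsto_ennrealI tendsto_intros h0) auto
    moreover have "(\<lambda>n. ennreal (q * exp 1 / (p * r p)) + ?B n) \<longlonglongrightarrow> ennreal (q * exp 1 / (p * r p)) + ?B'"
      by (intro tendsto_add tendsto_const Blim)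
    ultimately have "ennreal (1 / (r q + 0)) \<le> ennreal (q * exp 1 / (p * r p)) + ?B'"
      by (intro LIMSEQ_le[of "\<lambda>n. ennreal (1 / (r q + ?h n))" _ "\<lambda>n. ennreal (q * exp 1 / (p * r p)) + ?B n"]) auto
    also have "?B' \<le> ?I"
    proof (rule nn_integral_mono)
      fix t :: real
      show "?b' t \<le> ennreal (q * exp (- q * t)) * (ennreal (N t) * indicator {0<..} t)"
      proof (cases "?d < t")
        case True
        with d have "0 < t" by linarith
        with True show ?thesis by simp
      qed simp
    qed
    finally show ?thesis by (simp add: add_left_mono)
  qed
  have "((\<lambda>p. ennreal (q * exp 1 / (p * r p)) + ?I) \<longlongrightarrow> ennreal 0 + ?I) at_top"
  proof (intro tendsto_add tendsto_const tendsto_ennrealI)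
    show "((\<lambda>p. q * exp 1 / (p * r p)) \<longlongrightarrow> 0) at_top"
      by (rule real_tendsto_divide_at_top[OF tendsto_const lim])
  qed
  moreover have "\<forall>\<^sub>F p in at_top. ennreal (1 / r q) \<le> ennreal (q * exp 1 / (p * r p)) + ?I"
    using eventually_ge_at_top[of "1::real"] by eventually_elim (rule key)
  ultimately have "ennreal (1 / r q) \<le> ennreal 0 + ?I"
    by (rule tendsto_lowerbound) simp
  then show "ennreal (1 / r q) \<le> ?I" by simp
qed

text \<open>The probability that \<open>\<tau>\<close> jumps over the level \<open>t\<close> (or is killed below it).\<close>

definition convolution :: "real \<Rightarrow> ennreal" where
  "convolution t = (\<integral>\<^sup>+s\<in>{0<..<t}. ennreal (N (t - s)) \<partial>interval_measure U)"

lemma U_continuous_on: "continuous_on UNIV U"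
  using U_isCont by (simp add: continuous_on_eq_continuous_at)

lemma N_shift_measurable: "(\<lambda>s. ennreal (N (t - s)) * indicator {0<..<t} s) \<in> borel_measurable borel"
proof -
  have "(\<lambda>s. ennreal (N (t - s)) * indicator {0<..<t} s) = (\<lambda>s. (ennreal (N (t - s)) * indicator {0<..} (t - s)) * indicator {0<..<t} s)"
    by (auto simp: indicator_def)
  moreover have "(\<lambda>s. ennreal (N (t - s)) * indicator {0<..} (t - s)) \<in> borel_measurable borel"
    by (rule measurable_compose[OF _ N_ennreal_measurable]) simp
  ultimately show ?thesis by simp
qed

lemma convolution_le_1:
  assumes t: "0 < t" shows "convolution t \<le> 1"
proof -
  let ?y = "\<lambda>n. t - 1 / real (Suc n)"
  let ?u = "\<lambda>n s. ennreal (N (t - s)) * indicator {0<..?y n} s"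
  have "convolution t = (\<integral>\<^sup>+s. (SUP n. ?u n s) \<partial>interval_measure U)"
    unfolding convolution_def
  proof (rule nn_integral_cong)
    fix s :: real
    show "ennreal (N (t - s)) * indicator {0<..<t} s = (SUP n. ?u n s)"
    proof (rule antisym)
      show "ennreal (N (t - s)) * indicator {0<..<t} s \<le> (SUP n. ?u n s)"
      proof (cases "s \<in> {0<..<t}")
        case True
        then obtain n where "inverse (real (Suc n)) < t - s" using reals_Archimedean[of "t - s"] by auto
        then have eq: "ennreal (N (t - s)) * indicator {0<..<t} s = ?u n s" using True by (auto simp: inverse_eq_divide)
        show ?thesis unfolding eq by (rule SUP_upper[OF UNIV_I])
      qed simp
      show "(SUP n. ?u n s) \<le> ennreal (N (t - s)) * indicator {0<..<t} s"
      proof (rule SUP_least)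
        fix n
        have "s < t" if "s \<le> ?y n"
        proof -
          have "0 < 1 / real (Suc n)" by simp
          with that show ?thesis by linarith
        qed
        then show "?u n s \<le> ennreal (N (t - s)) * indicator {0<..<t} s" by (auto simp: indicator_def)
      qed
    qed
  qed
  also have "\<dots> = (SUP n. \<integral>\<^sup>+s. ?u n s \<partial>interval_measure U)"
  proof (rule nn_integral_monotone_convergence_SUP)
    show "incseq ?u"
    proof (intro monoI le_funI mult_left_mono)
      fix m n :: nat and s :: real assume "m \<le> n"
      then have "1 / real (Suc n) \<le> 1 / real (Suc m)" by (intro divide_left_mono) auto
      then show "(indicator {0<..?y m} s :: ennreal) \<le> indicator {0<..?y n} s" by (auto simp: indicator_def)
    qed simp
    show "?u n \<in> borel_measurable (interval_measure U)" for n
    proof -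
      have "?u n = (\<lambda>s. (ennreal (N (t - s)) * indicator {0<..<t} s) * indicator {0<..?y n} s)"
      proof
        fix s :: real
        have "0 < 1 / real (Suc n)" by simp
        then have "s \<le> ?y n \<Longrightarrow> s < t" by linarith
        then show "?u n s = (ennreal (N (t - s)) * indicator {0<..<t} s) * indicator {0<..?y n} s"
          by (cases "s \<in> {0<..?y n}") simp_all
      qed
      then show ?thesis using N_shift_measurable[of t] by simp
    qed
  qed
  also have "\<dots> \<le> 1"
  proof (rule SUP_least)
    fix n
    show "(\<integral>\<^sup>+s. ?u n s \<partial>interval_measure U) \<le> 1"
    proof (cases "0 < ?y n")
      case True
      have "(\<integral>\<^sup>+s. ?u n s \<partial>interval_measure U) \<le> ennreal (prob {w\<in>space M. A (?y n) w = A (?y n) w})"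
        by (rule convolution_flat) (use True in auto)
      also have "\<dots> \<le> 1" by simp
      finally show ?thesis .
    next
      case False
      then have z: "?u n s = 0" for s by (auto simp: indicator_def)
      show ?thesis unfolding z by simp
    qed
  qed
  finally show ?thesis .
qed

lemma convolution_measurable_pair:
  "(\<lambda>(t, s). ennreal (N (t - s)) * indicator {0<..<t} s) \<in> borel_measurable (borel \<Otimes>\<^sub>M borel)"
proof -
  have "(\<lambda>p. fst p - snd p) \<in> borel \<Otimes>\<^sub>M borel \<rightarrow>\<^sub>M (borel :: real measure)" by measurable
  from measurable_compose[OF this N_ennreal_measurable]
  have [measurable]: "(\<lambda>p. ennreal (N (fst p - snd p)) * indicator {0<..} (fst p - snd p)) \<in> borel_measurable (borel \<Otimes>\<^sub>M (borel :: real measure))" .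
  have "(\<lambda>p. ennreal (N (fst p - snd p)) * indicator {0<..} (fst p - snd p) * indicator {0<..} (snd p)) \<in> borel_measurable (borel \<Otimes>\<^sub>M (borel :: real measure))"
    by measurable
  also have "(\<lambda>p. ennreal (N (fst p - snd p)) * indicator {0<..} (fst p - snd p) * indicator {0<..} (snd p)) =
    (\<lambda>(t, s). ennreal (N (t - s)) * indicator {0<..<t} s)"
    by (auto simp: indicator_def fun_eq_iff)
  finally show ?thesis .
qed

text \<open>A subordinator without drift does not creep. Here: the convolution is at most \<open>1\<close>, and its exponential
  transform equals that of the constant \<open>1\<close>.\<close>

lemma convolution_eq_1:
  assumes lim: "filterlim (\<lambda>q. q * r q) at_top at_top"
  shows "AE t in lborel. 0 < t \<longrightarrow> convolution t = 1"
proof -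
  interpret S: sigma_finite_measure "interval_measure U"
    by (rule sigma_finite_interval_measure) (auto simp: U_mono U_isCont_right)
  interpret P: pair_sigma_finite lborel "interval_measure U" ..
  let ?K = "\<lambda>t s. ennreal (N (t - s)) * indicator {0<..<t} s"
  have c_meas [measurable]: "convolution \<in> borel_measurable borel"
    unfolding convolution_def using convolution_measurable_pair
    by (intro S.borel_measurable_nn_integral) (simp add: split_beta')
  (* At q = 1 the transform of the convolution is r 1 * (1 / r 1). *)
  have inner: "(\<integral>\<^sup>+t. exp_weight 1 t * ?K t s \<partial>lborel) = ennreal (1 / r 1) * (ennreal (exp (- 1 * s)) * indicator {0<..} s)" for s
  proof (cases "0 < s")
    case True
    have "(\<integral>\<^sup>+t. exp_weight 1 t * ?K t s \<partial>lborel) =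
      (\<integral>\<^sup>+t. ennreal (exp (- t)) * (ennreal (N (t - s)) * indicator {0<..} (t - s)) \<partial>lborel)"
      using True by (intro nn_integral_cong) (auto simp: indicator_def)
    also have "\<dots> = ennreal \<bar>1\<bar> * (\<integral>\<^sup>+v. ennreal (exp (- (s + 1 * v))) * (ennreal (N (s + 1 * v - s)) * indicator {0<..} (s + 1 * v - s)) \<partial>lborel)"
    proof (rule nn_integral_real_affine)
      have "(\<lambda>t. ennreal (N (t - s)) * indicator {0<..} (t - s)) \<in> borel_measurable borel"
        by (rule measurable_compose[OF _ N_ennreal_measurable]) simp
      then show "(\<lambda>t. ennreal (exp (- t)) * (ennreal (N (t - s)) * indicator {0<..} (t - s))) \<in> borel_measurable borel"
        by measurable
    qed simp
    also have "\<dots> = (\<integral>\<^sup>+v. ennreal (exp (- s)) * (ennreal (1 * exp (- 1 * v)) * (ennreal (N v) * indicator {0<..} v)) \<partial>lborel)"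
      by (simp add: exp_add[symmetric] mult.assoc[symmetric] ennreal_mult'[symmetric] exp_diff exp_minus divide_inverse)
    also have "\<dots> = ennreal (exp (- s)) * ennreal (1 / r 1)"
      unfolding Laplace_N[OF lim order_refl, symmetric] by (rule nn_integral_cmult) measurable
    finally show ?thesis using True by (simp add: mult.commute)
  next
    case False
    then have "exp_weight 1 t * ?K t s = 0" for t by (auto simp: indicator_def)
    then show ?thesis using False by simp
  qed
  have dU: "(\<integral>\<^sup>+s\<in>{0<..}. ennreal (exp (- 1 * s)) \<partial>interval_measure U) = ennreal (r 1)"
  proof -
    have "emeasure (interval_measure U) {0..0} = ennreal (U 0 - U 0)"
      by (rule emeasure_interval_measure_Icc) (auto simp: U_mono U_continuous_on)
    then have "{0} \<in> null_sets (interval_measure U)" by auto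
    then have "AE s in interval_measure U. s \<notin> {0}" by (rule AE_not_in)
    then have "(\<integral>\<^sup>+s\<in>{0<..}. ennreal (exp (- 1 * s)) \<partial>interval_measure U) = (\<integral>\<^sup>+s\<in>{0..}. ennreal (exp (- 1 * s)) \<partial>interval_measure U)"
      by (intro nn_integral_cong_AE) (auto elim!: eventually_mono simp: indicator_def)
    also have "\<dots> = (\<integral>\<^sup>+t\<in>{0..}. ennreal (1 * exp (- 1 * t) * U t) \<partial>lborel)"
      by (rule Laplace_Stieltjes) (auto simp: U_mono U_continuous_on U_nonpos)
    also have "\<dots> = ennreal (r 1)" by (rule r_eq) simp
    finally show ?thesis .
  qed
  have total: "(\<integral>\<^sup>+t. exp_weight 1 t * convolution t \<partial>lborel) = 1"
  proof -
    have "(\<integral>\<^sup>+t. exp_weight 1 t * convolution t \<partial>lborel) = (\<integral>\<^sup>+t. (\<integral>\<^sup>+s. exp_weight 1 t * ?K t s \<partial>interval_measure U) \<partial>lborel)"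
      unfolding convolution_def using N_shift_measurable by (intro nn_integral_cong nn_integral_cmult[symmetric]) simp
    also have "\<dots> = (\<integral>\<^sup>+s. (\<integral>\<^sup>+t. exp_weight 1 t * ?K t s \<partial>lborel) \<partial>interval_measure U)"
    proof (rule P.Fubini'[symmetric])
      note [measurable] = convolution_measurable_pair[unfolded split_beta']
      show "(\<lambda>(t, s). exp_weight 1 t * ?K t s) \<in> borel_measurable (lborel \<Otimes>\<^sub>M interval_measure U)"
        unfolding split_beta' by measurable
    qed
    also have "\<dots> = ennreal (1 / r 1) * ennreal (r 1)"
      unfolding inner dU[symmetric] by (rule nn_integral_cmult) measurable
    also have "\<dots> = 1" using r_pos[of 1] by (simp add: ennreal_mult'[symmetric])
    finally show ?thesis .
  qed
  have nn: "exp_weight 1 t * convolution t \<le> exp_weight 1 t" for t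
    using convolution_le_1[of t] by (cases "0 < t") (auto simp: convolution_def indicator_def mult_left_le)
  have "(\<integral>\<^sup>+t. exp_weight 1 t - exp_weight 1 t * convolution t \<partial>lborel) =
      (\<integral>\<^sup>+t. exp_weight 1 t \<partial>lborel) - (\<integral>\<^sup>+t. exp_weight 1 t * convolution t \<partial>lborel)"
  proof (rule nn_integral_diff)
    show "AE t in lborel. exp_weight 1 t * convolution t \<le> exp_weight 1 t" using nn by auto
    show "(\<integral>\<^sup>+t. exp_weight 1 t * convolution t \<partial>lborel) \<noteq> \<infinity>" unfolding total by simp
  qed measurable
  also have "\<dots> = 0" unfolding total using exp_weight_total[of 1] by simp
  finally have "AE t in lborel. exp_weight 1 t - exp_weight 1 t * convolution t = 0"
    by (subst (asm) nn_integral_0_iff_AE) auto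
  then show ?thesis
  proof eventually_elim
    case (elim t)
    show ?case
    proof
      assume t: "0 < t"
      obtain c where c: "convolution t = ennreal c" "0 \<le> c" "c \<le> 1"
        using convolution_le_1[OF t] by (cases "convolution t") (auto simp: ennreal_le_1 top_unique)
      have "ennreal (exp (- t)) - ennreal (exp (- t)) * ennreal c = 0" using elim t c by simp
      then have "ennreal (exp (- t) - exp (- t) * c) = 0"
        using c by (simp add: ennreal_mult'[symmetric] ennreal_minus)
      then have "exp (- t) \<le> exp (- t) * c" by (simp add: ennreal_eq_0_iff)
      then have "1 \<le> c" by simp
      then show "convolution t = 1" using c by simp
    qed
  qed
qed

text \<open>If \<open>\<tau>\<close> jumps from below \<open>y\<close> over a level slightly above \<open>t\<close>, the clock stands still between \<open>y\<close> and \<open>t\<close>.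
  Since all jump probabilities over that level sum to \<open>1\<close>, the complementary event is bounded by the part of the
  convolution beyond \<open>y\<close>, and there the slope of \<open>U\<close> can be used.\<close>

lemma increase_upper:
  assumes lim: "filterlim (\<lambda>q. q * r q) at_top at_top"
    and y: "0 < y" "y < t" "t < t'" and D: "0 \<le> D"
    and slope: "\<And>a b. y \<le> a \<Longrightarrow> a \<le> b \<Longrightarrow> U b - U a \<le> D * (b - a)"
  shows "ennreal (prob {w\<in>space M. A y w < A t w}) \<le> ennreal D * (\<integral>\<^sup>+s\<in>{0<..t' - y}. ennreal (N s) \<partial>lborel)"
proof -
  obtain v1 where v1: "t < v1" "v1 < t'" "convolution v1 = 1"
  proof -
    have "\<exists>v1\<in>{t<..<t'}. convolution v1 = 1"
    proof (rule ccontr)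
      assume "\<not> (\<exists>v1\<in>{t<..<t'}. convolution v1 = 1)"
      with convolution_eq_1[OF lim] have "AE v1 in lborel. v1 \<notin> {t<..<t'}"
        using y by (auto elim!: eventually_mono)
      then have "{t<..<t'} \<in> null_sets lborel" by (subst (asm) AE_iff_null_sets[symmetric]) auto
      then show False using y by (simp add: null_sets_def)
    qed
    then show ?thesis using that by auto
  qed
  have m: "(\<lambda>s. N (v1 - s) * indicator {y<..<v1} s) \<in> borel_measurable borel"
  proof -
    have "(\<lambda>s. N (v1 - s) * indicator {0<..} (v1 - s)) \<in> borel_measurable borel"
      by (rule measurable_compose[OF _ N_measurable]) simp
    then have "(\<lambda>s. (N (v1 - s) * indicator {0<..} (v1 - s)) * indicator {y<..<v1} s) \<in> borel_measurable borel" by simp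
    also have "(\<lambda>s. (N (v1 - s) * indicator {0<..} (v1 - s)) * indicator {y<..<v1} s) = (\<lambda>s. N (v1 - s) * indicator {y<..<v1} s)"
      by (auto simp: indicator_def)
    finally show ?thesis .
  qed
  let ?F = "{w\<in>space M. A t w = A y w}"
  have "1 = (\<integral>\<^sup>+s\<in>{0<..y}. ennreal (N (v1 - s)) \<partial>interval_measure U) + (\<integral>\<^sup>+s\<in>{y<..<v1}. ennreal (N (v1 - s)) \<partial>interval_measure U)"
  proof -
    have m1: "(\<lambda>s. ennreal (N (v1 - s)) * indicator {0<..y} s) \<in> borel_measurable borel"
    proof -
      have "(\<lambda>s. ennreal (N (v1 - s)) * indicator {0<..y} s) = (\<lambda>s. (ennreal (N (v1 - s)) * indicator {0<..<v1} s) * indicator {0<..y} s)"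
        using v1 y by (auto simp: indicator_def)
      then show ?thesis using N_shift_measurable[of v1] by simp
    qed
    have m2: "(\<lambda>s. ennreal (N (v1 - s)) * indicator {y<..<v1} s) \<in> borel_measurable borel"
    proof -
      have "(\<lambda>s. ennreal (N (v1 - s)) * indicator {y<..<v1} s) = (\<lambda>s. (ennreal (N (v1 - s)) * indicator {0<..<v1} s) * indicator {y<..<v1} s)"
        using v1 y by (auto simp: indicator_def)
      then show ?thesis using N_shift_measurable[of v1] by simp
    qed
    have "1 = (\<integral>\<^sup>+s. ennreal (N (v1 - s)) * indicator {0<..y} s + ennreal (N (v1 - s)) * indicator {y<..<v1} s \<partial>interval_measure U)"
      unfolding v1(3)[symmetric] convolution_def using v1 y by (intro nn_integral_cong) (auto simp: indicator_def)
    also have "\<dots> = (\<integral>\<^sup>+s\<in>{0<..y}. ennreal (N (v1 - s)) \<partial>interval_measure U) + (\<integral>\<^sup>+s\<in>{y<..<v1}. ennreal (N (v1 - s)) \<partial>interval_measure U)"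
      using m1 m2 by (intro nn_integral_add) auto
    finally show ?thesis .
  qed
  also have "\<dots> \<le> ennreal (prob ?F) + ennreal D * (\<integral>\<^sup>+s\<in>{y<..<v1}. ennreal (N (v1 - s)) \<partial>lborel)"
    using y v1 D m
    by (intro add_mono convolution_flat nn_integral_le_slope slope) (auto simp: U_mono U_continuous_on intro!: N_antimono)
  also have "(\<integral>\<^sup>+s\<in>{y<..<v1}. ennreal (N (v1 - s)) \<partial>lborel) \<le> (\<integral>\<^sup>+s\<in>{0<..t' - y}. ennreal (N s) \<partial>lborel)"
  proof -
    have "(\<integral>\<^sup>+s\<in>{y<..<v1}. ennreal (N (v1 - s)) \<partial>lborel) = ennreal \<bar>- 1\<bar> * (\<integral>\<^sup>+s. ennreal (N (v1 - (v1 + (- 1) * s))) * indicator {y<..<v1} (v1 + (- 1) * s) \<partial>lborel)"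
    proof (rule nn_integral_real_affine)
      have "(\<lambda>s. ennreal (N (v1 - s)) * indicator {y<..<v1} s) = (\<lambda>s. ennreal (N (v1 - s) * indicator {y<..<v1} s))"
        by (auto simp: indicator_def)
      then show "(\<lambda>s. ennreal (N (v1 - s)) * indicator {y<..<v1} s) \<in> borel_measurable borel" using m by simp
    qed simp
    also have "\<dots> = (\<integral>\<^sup>+s. ennreal (N s) * indicator {y<..<v1} (v1 - s) \<partial>lborel)" by simp
    also have "\<dots> \<le> (\<integral>\<^sup>+s\<in>{0<..t' - y}. ennreal (N s) \<partial>lborel)"
      using v1 by (intro nn_integral_mono) (auto simp: indicator_def)
    finally show ?thesis .
  qed
  finally have le: "1 \<le> ennreal (prob ?F) + ennreal D * (\<integral>\<^sup>+s\<in>{0<..t' - y}. ennreal (N s) \<partial>lborel)"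
    by (simp add: add_left_mono mult_left_mono)
  have "{w\<in>space M. A y w < A t w} = space M - ?F"
  proof -
    have "A y w \<le> A t w" if "w \<in> space M" for w using A_mono[OF that] y by simp
    then show ?thesis by force
  qed
  then have "prob {w\<in>space M. A y w < A t w} = 1 - prob ?F" by (simp add: prob_compl)
  then have eq: "ennreal (prob ?F) + ennreal (prob {w\<in>space M. A y w < A t w}) = 1"
    by (simp add: ennreal_plus[symmetric] del: ennreal_plus)
  show ?thesis using le unfolding eq[symmetric] by (simp add: ennreal_add_left_cancel_le)
qed

end

section \<open>Karamata's Tauberian theorem\<close>

text \<open>Weierstrass approximation on the unit interval.\<close>

lemma moments_imp_weak_conv:
  assumes R: "\<And>n. real_distribution (\<nu> n)" "real_distribution \<nu>'"
    and supp: "\<And>n. AE u in \<nu> n. u \<in> {0..1}" "AE u in \<nu>'. u \<in> {0..1}"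
    and mom: "\<And>k. (\<lambda>n. \<integral>u. u ^ k \<partial>\<nu> n) \<longlonglongrightarrow> (\<integral>u. u ^ k \<partial>\<nu>')"
  shows "weak_conv_m \<nu> \<nu>'"
proof (rule integral_bdd_continuous_conv_imp_weak_conv[OF R])
  fix f :: "real \<Rightarrow> real" assume cont: "\<And>x. isCont f x" and bdd: "\<And>x. \<bar>f x\<bar> \<le> 1"
  have f_meas: "f \<in> borel_measurable borel"
    using cont by (intro borel_measurable_continuous_onI continuous_at_imp_continuous_on) auto
  have approx: "\<exists>a n. (\<forall>x\<in>{0..1}. \<bar>f x - (\<Sum>i\<le>n. a i * x ^ i)\<bar> < e)" if "0 < e" for e
  proof -
    have "continuous_on {0..1} f" using cont by (intro continuous_at_imp_continuous_on) auto
    from Stone_Weierstrass_real_polynomial_function[OF compact_Icc this that]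
    obtain g where g: "real_polynomial_function g" "\<And>x. x \<in> {0..1} \<Longrightarrow> \<bar>f x - g x\<bar> < e"
      by metis
    from g(1) obtain a n where "g = (\<lambda>x. \<Sum>i\<le>n. a i * x ^ i)" unfolding real_polynomial_function_iff_sum by blast
    with g(2) show ?thesis by blast
  qed
  have pw: "integrable D (\<lambda>u. u ^ k)" if "real_distribution D" "AE u in D. u \<in> {0..1}" for D :: "real measure" and k
  proof -
    interpret D: real_distribution D by fact
    show ?thesis
    proof (rule D.integrable_const_bound[of _ 1])
      show "AE u in D. norm (u ^ k) \<le> 1" using that(2) by eventually_elim (simp add: power_le_one)
    qed simp
  qed
  have err: "\<bar>(\<integral>u. f u \<partial>D) - (\<Sum>i\<le>n. a i * (\<integral>u. u ^ i \<partial>D))\<bar> \<le> e"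
    if D: "real_distribution D" "AE u in D. u \<in> {0..1}" and a: "\<forall>x\<in>{0..1}. \<bar>f x - (\<Sum>i\<le>n. a i * x ^ i)\<bar> < e"
    for D :: "real measure" and a n e
  proof -
    interpret D: real_distribution D by fact
    have i1: "integrable D f" using bdd f_meas by (intro D.integrable_const_bound[of _ 1]) auto
    have i2: "integrable D (\<lambda>u. \<Sum>i\<le>n. a i * u ^ i)" using pw[OF D] by simp
    have "(\<integral>u. f u \<partial>D) - (\<Sum>i\<le>n. a i * (\<integral>u. u ^ i \<partial>D)) = (\<integral>u. f u - (\<Sum>i\<le>n. a i * u ^ i) \<partial>D)"
      using i1 i2 pw[OF D] by (simp add: Bochner_Integration.integral_sum)
    also have "\<bar>\<dots>\<bar> \<le> (\<integral>u. \<bar>f u - (\<Sum>i\<le>n. a i * u ^ i)\<bar> \<partial>D)" by (rule integral_abs_bound)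
    also have "\<dots> \<le> (\<integral>u. e \<partial>D)"
    proof (rule integral_mono_AE)
      show "AE u in D. \<bar>f u - (\<Sum>i\<le>n. a i * u ^ i)\<bar> \<le> e"
        using D(2) by eventually_elim (use a in \<open>auto intro: less_imp_le\<close>)
    qed (use i1 i2 in auto)
    also have "\<dots> = e" using D.prob_space by simp
    finally show ?thesis .
  qed
  show "(\<lambda>n. integral\<^sup>L (\<nu> n) f) \<longlonglongrightarrow> integral\<^sup>L \<nu>' f"
  proof (rule LIMSEQ_I)
    fix e :: real assume e: "0 < e"
    obtain a m where a: "\<forall>x\<in>{0..1}. \<bar>f x - (\<Sum>i\<le>m. a i * x ^ i)\<bar> < e / 4" using approx[of "e / 4"] e by auto
    have "(\<lambda>n. \<Sum>i\<le>m. a i * (\<integral>u. u ^ i \<partial>\<nu> n)) \<longlonglongrightarrow> (\<Sum>i\<le>m. a i * (\<integral>u. u ^ i \<partial>\<nu>'))"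
      by (intro tendsto_intros mom)
    moreover have "0 < e / 4" using e by simp
    ultimately obtain n0 where n0: "\<forall>n\<ge>n0. norm ((\<Sum>i\<le>m. a i * (\<integral>u. u ^ i \<partial>\<nu> n)) - (\<Sum>i\<le>m. a i * (\<integral>u. u ^ i \<partial>\<nu>'))) < e / 4"
      by (blast dest: LIMSEQ_D)
    have "\<bar>integral\<^sup>L (\<nu> n) f - integral\<^sup>L \<nu>' f\<bar> < e" if "n \<ge> n0" for n
      using err[OF R(1) supp(1) a, of n] err[OF R(2) supp(2) a] n0[rule_format, OF that, unfolded real_norm_def] e by linarith
    then show "\<exists>no. \<forall>n\<ge>no. norm (integral\<^sup>L (\<nu> n) f - integral\<^sup>L \<nu>' f) < e" by auto
  qed
qed

definition gamma_measure :: "real \<Rightarrow> real measure" where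
  "gamma_measure \<rho> = density lborel (\<lambda>y. ennreal (indicator {0..} y * y powr (\<rho> - 1) / exp y / Gamma \<rho>))"

lemma gamma_moment:
  assumes \<rho>: "0 < \<rho>"
  shows "(\<integral>\<^sup>+y. ennreal (exp (- y) ^ k) \<partial>gamma_measure \<rho>) = ennreal ((real k + 1) powr (- \<rho>))"
proof -
  let ?G = "\<integral>\<^sup>+y. ennreal (exp (- y) ^ k) \<partial>gamma_measure \<rho>"
  let ?c = "real k + 1"
  let ?f = "\<lambda>y::real. ennreal (indicator {0..} y * y powr (\<rho> - 1) / exp y)"
  have G: "0 < Gamma \<rho>" using \<rho> by (rule Gamma_real_pos)
  have "ennreal (Gamma \<rho>) = (\<integral>\<^sup>+y. ?f y \<partial>lborel)" using Gamma_conv_nn_integral_real[OF \<rho>] .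
  also have "\<dots> = \<bar>?c\<bar> * (\<integral>\<^sup>+y. ?f (0 + ?c * y) \<partial>lborel)"
    by (rule nn_integral_real_affine) auto
  also have "(\<integral>\<^sup>+y. ?f (0 + ?c * y) \<partial>lborel) = (\<integral>\<^sup>+y. ennreal (?c powr (\<rho> - 1) * Gamma \<rho>) * (ennreal (indicator {0..} y * y powr (\<rho> - 1) / exp y / Gamma \<rho>) * ennreal (exp (- y) ^ k)) \<partial>lborel)"
  proof (intro nn_integral_cong)
    fix y :: real
    show "?f (0 + ?c * y) = ennreal (?c powr (\<rho> - 1) * Gamma \<rho>) * (ennreal (indicator {0..} y * y powr (\<rho> - 1) / exp y / Gamma \<rho>) * ennreal (exp (- y) ^ k))"
    proof (cases "0 \<le> y")
      case True
      have e1: "exp (?c * y) = exp y * exp y ^ k" by (simp add: exp_of_nat_mult[symmetric] exp_add[symmetric] algebra_simps)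
      have e2: "(?c * y) powr (\<rho> - 1) = ?c powr (\<rho> - 1) * y powr (\<rho> - 1)" using True by (simp add: powr_mult)
      have "(?c * y) powr (\<rho> - 1) / exp (?c * y) =
          (?c powr (\<rho> - 1) * Gamma \<rho>) * ((y powr (\<rho> - 1) / exp y / Gamma \<rho>) * exp (- y) ^ k)"
        unfolding e1 e2 using G by (simp add: exp_minus power_inverse divide_inverse mult_ac)
      then show ?thesis using True G
        by (simp add: ennreal_mult'[symmetric] less_imp_le del: distrib_right_numeral)
    next
      case False
      then have "\<not> 0 \<le> ?c * y" by (simp add: mult_pos_neg not_le)
      then show ?thesis using False by (simp add: not_le)
    qed
  qed
  also have "\<dots> = ennreal (?c powr (\<rho> - 1) * Gamma \<rho>) * ?G"
    unfolding gamma_measure_def by (subst nn_integral_density) (auto simp: nn_integral_cmult)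
  also have "ennreal \<bar>?c\<bar> * (ennreal (?c powr (\<rho> - 1) * Gamma \<rho>) * ?G) =
      ennreal (?c powr \<rho> * Gamma \<rho>) * ?G"
  proof -
    have "\<bar>?c\<bar> * (?c powr (\<rho> - 1) * Gamma \<rho>) = ?c powr \<rho> * Gamma \<rho>"
      using powr_mult_base[of ?c "\<rho> - 1"] by (simp add: mult.assoc[symmetric])
    then show ?thesis by (simp only: mult.assoc[symmetric] ennreal_mult'[OF abs_ge_zero, symmetric])
  qed
  finally have eq: "ennreal (Gamma \<rho>) = ennreal (?c powr \<rho> * Gamma \<rho>) * ?G" .
  have "?G =
      ennreal (1 / (?c powr \<rho> * Gamma \<rho>)) * (ennreal (?c powr \<rho> * Gamma \<rho>) * ?G)"
    using G by (simp add: mult.assoc[symmetric] ennreal_mult'[symmetric])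
  also have "\<dots> = ennreal (1 / (?c powr \<rho> * Gamma \<rho>) * Gamma \<rho>)"
    unfolding eq[symmetric] by (rule ennreal_mult'[symmetric]) (use G in simp)
  also have "1 / (?c powr \<rho> * Gamma \<rho>) * Gamma \<rho> = ?c powr (- \<rho>)" using G by (simp add: powr_minus field_simps)
  finally show ?thesis .
qed

lemma prob_space_gamma: "0 < \<rho> \<Longrightarrow> prob_space (gamma_measure \<rho>)"
  using gamma_moment[of \<rho> 0] by (intro prob_spaceI) (simp add: gamma_measure_def)

lemma gamma_AE_pos: "AE y in gamma_measure \<rho>. 0 \<le> y"
  unfolding gamma_measure_def by (subst AE_density) (auto simp: indicator_def)

lemma gamma_exp_le_1:
  assumes \<rho>: "0 < \<rho>"
  shows "(\<integral>\<^sup>+y. ennreal (exp y * indicator {0..1} y) \<partial>gamma_measure \<rho>) = ennreal (1 / Gamma (\<rho> + 1))"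
proof -
  have G: "0 < Gamma \<rho>" using \<rho> by (rule Gamma_real_pos)
  have "((\<lambda>x. x powr (\<rho> - 1)) has_integral (1 powr (\<rho> - 1 + 1) / (\<rho> - 1 + 1))) {0..1::real}"
    using \<rho> by (intro has_integral_powr_from_0) auto
  then have 1: "((\<lambda>x. x powr (\<rho> - 1)) has_integral (1 / \<rho>)) {0..1::real}" by simp
  have "(\<integral>\<^sup>+y. ennreal (exp y * indicator {0..1} y) \<partial>gamma_measure \<rho>) =
     (\<integral>\<^sup>+y. ennreal (1 / Gamma \<rho>) * ennreal (indicator {0..1} y * y powr (\<rho> - 1)) \<partial>lborel)"
    unfolding gamma_measure_def
    by (subst nn_integral_density) (auto intro!: nn_integral_cong simp: indicator_def less_imp_le[OF G] G less_imp_neq[OF G] simp flip: ennreal_mult')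
  also have "\<dots> = ennreal (1 / Gamma \<rho>) * (\<integral>\<^sup>+y. ennreal (indicator {0..1} y * y powr (\<rho> - 1)) \<partial>lborel)"
    by (rule nn_integral_cmult) auto
  also have "(\<integral>\<^sup>+y. ennreal (indicator {0..1} y * y powr (\<rho> - 1)) \<partial>lborel) = ennreal (1 / \<rho>)"
    by (rule nn_integral_has_integral_lebesgue[OF _ 1]) simp
  also have "ennreal (1 / Gamma \<rho>) * ennreal (1 / \<rho>) = ennreal (1 / Gamma (\<rho> + 1))"
    using \<rho> G Gamma_plus1[of \<rho>] nonpos_Ints_nonpos[of \<rho>] by (force simp: ennreal_mult'[symmetric] mult.commute add.commute)
  finally show ?thesis .
qed

text \<open>Tilting \<open>\<mu>\<close> exponentially and rescaling gives probability measures on the unit interval whose moments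
  converge to those of the image of a Gamma law. The distribution function of \<open>\<mu>\<close> is the integral of a
  function with one discontinuity, which the limit law does not charge.\<close>

theorem Karamata_Tauberian:
  fixes \<mu> :: "real measure" and \<phi> :: "real \<Rightarrow> real"
  assumes \<mu> [measurable_cong]: "sets \<mu> = sets borel"
    and \<phi>: "\<And>q. q \<ge> q0 \<Longrightarrow> (\<integral>\<^sup>+x\<in>{0..}. ennreal (exp (- q * x)) \<partial>\<mu>) = ennreal (\<phi> q)"
    and \<phi>_pos: "\<And>q. q \<ge> q0 \<Longrightarrow> 0 < \<phi> q"
    and ratio: "\<And>k::nat. ((\<lambda>q. \<phi> (real (Suc k) * q) / \<phi> q) \<longlongrightarrow> real (Suc k) powr (- \<rho>)) at_top"
    and \<rho>: "0 < \<rho>"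
  shows "((\<lambda>q. measure \<mu> {0..1 / q} / \<phi> q) \<longlongrightarrow> 1 / Gamma (\<rho> + 1)) at_top"
proof (rule tendsto_at_topI_sequentially)
  fix X :: "nat \<Rightarrow> real" assume X: "filterlim X at_top sequentially"
  have "\<forall>\<^sub>F n in sequentially. X n \<ge> max q0 1" using X unfolding filterlim_at_top by blast
  then obtain n0 where n0: "\<And>n. n \<ge> n0 \<Longrightarrow> X n \<ge> max q0 1" by (auto simp: eventually_sequentially)
  define q where "q n = X (n + n0)" for n
  have q: "q n \<ge> q0" "q n \<ge> 1" for n using n0[of "n + n0"] by (auto simp: q_def)
  have qlim: "filterlim q at_top sequentially"
    unfolding q_def using X by (rule filterlim_compose) (rule filterlim_add_const_nat_at_top)
  (* The k-th moment of \<nu> n is \<phi>((k+1) q n) / \<phi>(q n). *)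
  define \<nu> where "\<nu> n = distr (density \<mu> (\<lambda>x. ennreal (indicator {0..} x * exp (- q n * x) / \<phi> (q n)))) borel (\<lambda>x. exp (- q n * x))" for n
  define \<nu>' where "\<nu>' = distr (gamma_measure \<rho>) borel (\<lambda>y. exp (- y))"
  have pos: "0 < \<phi> (q n)" for n using \<phi>_pos q by blast
  have nn: "(\<integral>\<^sup>+u. ennreal (f u) \<partial>\<nu> n) = ennreal (1 / \<phi> (q n)) * (\<integral>\<^sup>+x\<in>{0..}. ennreal (exp (- q n * x) * f (exp (- q n * x))) \<partial>\<mu>)"
    if [measurable]: "f \<in> borel_measurable borel" and f0: "\<And>u. 0 \<le> f u" for f n
  proof -
    have "(\<integral>\<^sup>+u. ennreal (f u) \<partial>\<nu> n) = (\<integral>\<^sup>+x. ennreal (indicator {0..} x * exp (- q n * x) / \<phi> (q n)) * ennreal (f (exp (- q n * x))) \<partial>\<mu>)"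
      unfolding \<nu>_def by (subst nn_integral_distr) (auto intro!: nn_integral_density)
    also have "\<dots> = (\<integral>\<^sup>+x. ennreal (1 / \<phi> (q n)) * (ennreal (exp (- q n * x) * f (exp (- q n * x))) * indicator {0..} x) \<partial>\<mu>)"
      using pos[of n] f0 by (intro nn_integral_cong) (auto simp: indicator_def ennreal_mult'[symmetric])
    also have "\<dots> = ennreal (1 / \<phi> (q n)) * (\<integral>\<^sup>+x\<in>{0..}. ennreal (exp (- q n * x) * f (exp (- q n * x))) \<partial>\<mu>)"
      by (rule nn_integral_cmult) measurable
    finally show ?thesis .
  qed
  have moment: "(\<integral>\<^sup>+u. ennreal (\<bar>u\<bar> ^ k) \<partial>\<nu> n) = ennreal (\<phi> (real (Suc k) * q n) / \<phi> (q n))" for k n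
  proof -
    have "real (Suc k) * q n \<ge> 1 * q n" using q(2)[of n] by (intro mult_right_mono) auto
    then have ge: "real (Suc k) * q n \<ge> q0" using q(1)[of n] by simp
    have e: "exp (- q n * x) * \<bar>exp (- q n * x)\<bar> ^ k = exp (- (real (Suc k) * q n) * x)" for x
      by (simp add: exp_of_nat_mult[symmetric] exp_add[symmetric] algebra_simps)
    have "(\<integral>\<^sup>+u. ennreal (\<bar>u\<bar> ^ k) \<partial>\<nu> n) = ennreal (1 / \<phi> (q n)) * (\<integral>\<^sup>+x\<in>{0..}. ennreal (exp (- (real (Suc k) * q n) * x)) \<partial>\<mu>)"
      unfolding e[symmetric] by (rule nn) auto
    also have "\<dots> = ennreal (1 / \<phi> (q n)) * ennreal (\<phi> (real (Suc k) * q n))" by (subst \<phi>[OF ge]) simp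
    finally show ?thesis using pos[of n] by (simp add: ennreal_mult'[symmetric])
  qed
  have prob: "prob_space (\<nu> n)" for n
    using moment[where k=0 and n=n] pos[of n] by (intro prob_spaceI) (simp add: \<nu>_def)
  have R: "real_distribution (\<nu> n)" for n
    using prob[of n] by (simp add: real_distribution_def real_distribution_axioms_def \<nu>_def)
  have prob': "prob_space \<nu>'" unfolding \<nu>'_def
    by (rule prob_space.prob_space_distr[OF prob_space_gamma[OF \<rho>]]) (simp add: gamma_measure_def)
  then have R': "real_distribution \<nu>'" by (simp add: real_distribution_def real_distribution_axioms_def \<nu>'_def)
  have supp: "AE u in \<nu> n. u \<in> {0..1}" for n
    unfolding \<nu>_def using q(2)[of n]
    by (subst AE_distr_iff) (auto simp: AE_density indicator_def mult_nonneg_nonneg)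
  have supp': "AE u in \<nu>'. u \<in> {0..1}"
    unfolding \<nu>'_def using gamma_AE_pos[of \<rho>]
    by (subst AE_distr_iff) (auto simp: gamma_measure_def)
  have moment': "(\<integral>\<^sup>+u. ennreal (\<bar>u\<bar> ^ k) \<partial>\<nu>') = ennreal (real (Suc k) powr (- \<rho>))" for k
    unfolding \<nu>'_def using gamma_moment[OF \<rho>, of k]
    by (subst nn_integral_distr) (auto simp: gamma_measure_def add.commute)
  have to_real: "(\<integral>u. u ^ k \<partial>D) = c" if D: "AE u in D. u \<in> {0..1}" "sets D = sets borel"
      "(\<integral>\<^sup>+u. ennreal (\<bar>u\<bar> ^ k) \<partial>D) = ennreal c" "0 \<le> c" for D :: "real measure" and k c
  proof -
    have "(\<integral>u. u ^ k \<partial>D) = (\<integral>u. \<bar>u\<bar> ^ k \<partial>D)"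
      using D by (intro integral_cong_AE) (auto elim!: eventually_mono simp: measurable_cong_sets[OF D(2) refl])
    also have "\<dots> = c"
      using D by (subst integral_eq_nn_integral) (auto simp: measurable_cong_sets[OF D(2) refl])
    finally show ?thesis .
  qed
  have W: "weak_conv_m \<nu> \<nu>'"
  proof (rule moments_imp_weak_conv[OF R R' supp supp'])
    fix k
    have "(\<integral>u. u ^ k \<partial>\<nu> n) = \<phi> (real (Suc k) * q n) / \<phi> (q n)" for n
    proof (rule to_real[OF supp _ moment])
      have "real (Suc k) * q n \<ge> 1 * q n" using q(2)[of n] by (intro mult_right_mono) auto
      then show "0 \<le> \<phi> (real (Suc k) * q n) / \<phi> (q n)"
        using q(1)[of n] pos[of n] \<phi>_pos[of "real (Suc k) * q n"] by (simp add: less_imp_le)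
    qed (simp add: \<nu>_def)
    moreover have "(\<integral>u. u ^ k \<partial>\<nu>') = real (Suc k) powr (- \<rho>)"
      by (rule to_real[OF supp' _ moment']) (auto simp: \<nu>'_def)
    moreover have "(\<lambda>n. \<phi> (real (Suc k) * q n) / \<phi> (q n)) \<longlonglongrightarrow> real (Suc k) powr (- \<rho>)"
      by (rule filterlim_compose[OF ratio qlim])
    ultimately show "(\<lambda>n. \<integral>u. u ^ k \<partial>\<nu> n) \<longlonglongrightarrow> (\<integral>u. u ^ k \<partial>\<nu>')" by simp
  qed
  define f :: "real \<Rightarrow> real" where "f u = (if exp (- 1) \<le> u then 1 / u else 0)" for u
  have f_meas: "f \<in> borel_measurable borel" unfolding f_def by measurable
  have f0: "0 \<le> f u" for u unfolding f_def using order_trans[OF exp_ge_zero[of "-1::real"], of u] by auto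
  have fb: "norm (f u) \<le> exp 1" for u
  proof (cases "exp (- 1) \<le> u")
    case True
    moreover from this have "0 < u" by (rule less_le_trans[OF exp_gt_zero])
    ultimately have "1 / u \<le> 1 / exp (- 1)" by (intro divide_left_mono) auto
    also have "1 / exp (- 1) = exp (1::real)" by (simp add: exp_minus divide_inverse)
    finally show ?thesis using True f0[of u] by (simp add: f_def)
  qed (simp add: f_def)
  have "isCont f u" if "u \<noteq> exp (- 1)" for u
  proof (cases "u < exp (- 1)")
    case True
    then have "\<forall>\<^sub>F v in nhds u. f v = 0"
      using eventually_nhds_in_open[of "{..<exp (- 1)}" u] by (auto elim!: eventually_mono simp: f_def)
    then show ?thesis by (subst isCont_cong) auto
  next
    case False
    with that have "exp (- 1) < u" by simp
    moreover from this have "0 < u" by (rule less_trans[OF exp_gt_zero])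
    ultimately have u: "exp (- 1) < u" "0 < u" .
    then have "\<forall>\<^sub>F v in nhds u. f v = 1 / v"
      using eventually_nhds_in_open[of "{exp (- 1)<..}" u] by (auto elim!: eventually_mono simp: f_def)
    then show ?thesis using u by (subst isCont_cong) (auto intro!: continuous_intros)
  qed
  then have sub: "{u. \<not> isCont f u} \<subseteq> {exp (- 1)}" by blast
  have null: "emeasure \<nu>' {u. \<not> isCont f u} = 0"
  proof -
    have "emeasure \<nu>' {exp (- 1)} = emeasure (gamma_measure \<rho>) {1}"
      unfolding \<nu>'_def by (subst emeasure_distr) (auto simp: gamma_measure_def vimage_def intro!: arg_cong2[where f=emeasure])
    also have "\<dots> = 0"
      unfolding gamma_measure_def by (subst emeasure_density) (auto simp: nn_integral_indicator_singleton)
    finally show ?thesis using sub by (metis emeasure_mono le_zero_eq null_setsI borel_singleton sets_distr \<nu>'_def sets.empty_sets borel_closed closed_singleton)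
  qed
  have lim: "(\<lambda>n. integral\<^sup>L (\<nu> n) f) \<longlonglongrightarrow> integral\<^sup>L \<nu>' f"
    by (rule weak_conv_imp_bdd_ae_continuous_conv[OF R R' W null fb f_meas])
  have int: "integral\<^sup>L D f = c" if "sets D = sets borel" "(\<integral>\<^sup>+u. ennreal (f u) \<partial>D) = ennreal c" "0 \<le> c" for D c
  proof -
    have "integral\<^sup>L D f = enn2real (\<integral>\<^sup>+u. ennreal (f u) \<partial>D)"
      using f0 f_meas by (intro integral_eq_nn_integral) (auto simp: measurable_cong_sets[OF that(1) refl])
    then show ?thesis using that by simp
  qed
  have I': "integral\<^sup>L \<nu>' f = 1 / Gamma (\<rho> + 1)"
  proof (rule int)
    have "(\<integral>\<^sup>+u. ennreal (f u) \<partial>\<nu>') = (\<integral>\<^sup>+y. ennreal (f (exp (- y))) \<partial>gamma_measure \<rho>)"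
      unfolding \<nu>'_def using f_meas by (subst nn_integral_distr) (auto simp: gamma_measure_def)
    also have "\<dots> = (\<integral>\<^sup>+y. ennreal (exp y * indicator {0..1} y) \<partial>gamma_measure \<rho>)"
      using gamma_AE_pos[of \<rho>] by (intro nn_integral_cong_AE) (auto elim!: eventually_mono simp: f_def indicator_def exp_minus field_simps)
    finally show "(\<integral>\<^sup>+u. ennreal (f u) \<partial>\<nu>') = ennreal (1 / Gamma (\<rho> + 1))" using gamma_exp_le_1[OF \<rho>] by simp
    have "0 < Gamma (\<rho> + 1)" using \<rho> by (intro Gamma_real_pos) simp
    then show "0 \<le> 1 / Gamma (\<rho> + 1)" by simp
  qed (simp add: \<nu>'_def)
  have I: "integral\<^sup>L (\<nu> n) f = measure \<mu> {0..1 / q n} / \<phi> (q n)" for n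
  proof (rule int)
    have eq: "ennreal (exp (- q n * x) * f (exp (- q n * x))) * indicator {0..} x = indicator {0..1 / q n} x" for x
      using q(2)[of n] by (auto simp: f_def indicator_def field_simps)
    have fin: "emeasure \<mu> {0..1 / q n} \<noteq> \<infinity>"
    proof -
      have "emeasure \<mu> {0..1 / q n} = (\<integral>\<^sup>+x. indicator {0..1 / q n} x \<partial>\<mu>)" by simp
      also have "\<dots> \<le> (\<integral>\<^sup>+x. ennreal (exp 1) * (ennreal (exp (- q n * x)) * indicator {0..} x) \<partial>\<mu>)"
      proof (intro nn_integral_mono)
        fix x
        have "(1::ennreal) \<le> ennreal (exp (1 - q n * x))" if "x \<le> 1 / q n"
          using that q(2)[of n] by (subst ennreal_1[symmetric], intro ennreal_leI) (simp add: field_simps)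
        then show "indicator {0..1 / q n} x \<le> ennreal (exp 1) * (ennreal (exp (- q n * x)) * indicator {0..} x)"
          by (auto simp: indicator_def ennreal_mult'[symmetric] exp_add[symmetric] exp_diff exp_minus field_simps)
      qed
      also have "\<dots> = ennreal (exp 1) * ennreal (\<phi> (q n))"
        using \<phi>[OF q(1)[of n]] by (subst nn_integral_cmult) auto
      finally show ?thesis by (auto simp: top_unique ennreal_mult'[symmetric])
    qed
    have "(\<integral>\<^sup>+u. ennreal (f u) \<partial>\<nu> n) = ennreal (1 / \<phi> (q n)) * emeasure \<mu> {0..1 / q n}"
      unfolding nn[OF f_meas f0] eq by simp
    also have "\<dots> = ennreal (measure \<mu> {0..1 / q n} / \<phi> (q n))"
      using fin pos[of n] by (subst emeasure_eq_ennreal_measure) (auto simp: ennreal_mult'[symmetric])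
    finally show "(\<integral>\<^sup>+u. ennreal (f u) \<partial>\<nu> n) = ennreal (measure \<mu> {0..1 / q n} / \<phi> (q n))" .
    show "0 \<le> measure \<mu> {0..1 / q n} / \<phi> (q n)" using pos[of n] by (simp add: less_imp_le)
  qed (simp add: \<nu>_def)
  have "(\<lambda>n. measure \<mu> {0..1 / X (n + n0)} / \<phi> (X (n + n0))) \<longlonglongrightarrow> 1 / Gamma (\<rho> + 1)"
    using lim unfolding I I' q_def .
  then show "(\<lambda>n. measure \<mu> {0..1 / X n} / \<phi> (X n)) \<longlonglongrightarrow> 1 / Gamma (\<rho> + 1)" by (rule LIMSEQ_offset)
qed

section \<open>Special Bernstein functions\<close>

lemma power_le_exp:
  fixes x :: real assumes "0 \<le> x" shows "x ^ k / fact k \<le> exp x"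
proof -
  have s: "(\<lambda>n. x ^ n / fact n) sums exp x"
    using exp_converges[of x] by (simp add: divide_inverse mult.commute)
  have "(\<Sum>n\<in>{k}. x ^ n / fact n) \<le> (\<Sum>n. x ^ n / fact n)"
    using assms by (intro sum_le_suminf sums_summable[OF s]) auto
  then show ?thesis using sums_unique[OF s] by simp
qed

definition poisson_cdf :: "real \<Rightarrow> nat \<Rightarrow> real" where
  "poisson_cdf m K = (\<Sum>k\<le>K. exp (- m) * m ^ k / fact k)"

lemma poisson_sums: "(\<lambda>k. exp (- m) * (z * m) ^ k / fact k) sums exp ((z - 1) * m)" for m z :: real
proof -
  have "(\<lambda>n. exp (- m) * ((z * m) ^ n / fact n)) sums (exp (- m) * exp (z * m))"
    using exp_converges[of "z * m"] by (intro sums_mult) (simp add: divide_inverse mult.commute)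
  then show ?thesis by (simp add: exp_add[symmetric] algebra_simps)
qed

lemma poisson_cdf_nonneg: "0 \<le> m \<Longrightarrow> 0 \<le> poisson_cdf m K"
  unfolding poisson_cdf_def by (intro sum_nonneg) auto

lemma poisson_cdf_le_1: assumes "0 \<le> m" shows "poisson_cdf m K \<le> 1"
proof -
  have s: "(\<lambda>k. exp (- m) * m ^ k / fact k) sums 1" using poisson_sums[of m 1] by simp
  have "(\<Sum>k\<le>K. exp (- m) * m ^ k / fact k) \<le> (\<Sum>k. exp (- m) * m ^ k / fact k)"
    using assms by (intro sum_le_suminf sums_summable[OF s]) auto
  then show ?thesis using sums_unique[OF s] by (simp add: poisson_cdf_def)
qed

lemma poisson_lower_tail:
  assumes m: "0 \<le> m" and z: "0 < z" "z \<le> 1" and K: "real K \<le> y"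
  shows "poisson_cdf m K \<le> exp (- y * ln z - (1 - z) * m)"
proof -
  have s: "(\<lambda>k. exp (- m) * (z * m) ^ k / fact k) sums exp ((z - 1) * m)" by (rule poisson_sums)
  have "z powr y * poisson_cdf m K = (\<Sum>k\<le>K. z powr y * (exp (- m) * m ^ k / fact k))"
    by (simp add: poisson_cdf_def sum_distrib_left)
  also have "\<dots> \<le> (\<Sum>k\<le>K. exp (- m) * (z * m) ^ k / fact k)"
  proof (rule sum_mono)
    fix k assume "k \<in> {..K}"
    then have "real k \<le> y" using K by (simp add: order_trans[rotated])
    then have "z powr y \<le> z powr real k" using z by (intro powr_mono') auto
    also have "\<dots> = z ^ k" using z by (simp add: powr_realpow)
    finally have "z powr y * (exp (- m) * m ^ k / fact k) \<le> z ^ k * (exp (- m) * m ^ k / fact k)"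
      using m by (intro mult_right_mono) auto
    then show "z powr y * (exp (- m) * m ^ k / fact k) \<le> exp (- m) * (z * m) ^ k / fact k"
      by (simp add: power_mult_distrib mult_ac)
  qed
  also have "\<dots> \<le> (\<Sum>k. exp (- m) * (z * m) ^ k / fact k)"
    using m z by (intro sum_le_suminf sums_summable[OF s]) auto
  also have "\<dots> = exp ((z - 1) * m)" using sums_unique[OF s] by simp
  finally have "poisson_cdf m K \<le> exp ((z - 1) * m) / z powr y" using z by (simp add: field_simps)
  also have "\<dots> = exp (- y * ln z - (1 - z) * m)"
    using z by (simp add: powr_def exp_diff[symmetric] algebra_simps)
  finally show ?thesis .
qed

lemma poisson_upper_tail:
  assumes m: "0 \<le> m" and z: "1 \<le> z" and K: "y \<le> real (Suc K)"
  shows "1 - poisson_cdf m K \<le> exp (- y * ln z - (1 - z) * m)"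
proof -
  have s1: "(\<lambda>k. exp (- m) * m ^ k / fact k) sums 1" using poisson_sums[of m 1] by simp
  have s: "(\<lambda>k. exp (- m) * (z * m) ^ k / fact k) sums exp ((z - 1) * m)" by (rule poisson_sums)
  have t1: "(\<lambda>k. exp (- m) * m ^ (k + Suc K) / fact (k + Suc K)) sums (1 - poisson_cdf m K)"
    using sums_split_initial_segment[OF s1, of "Suc K"] by (simp add: poisson_cdf_def lessThan_Suc_atMost)
  have t2: "(\<lambda>k. exp (- m) * (z * m) ^ (k + Suc K) / fact (k + Suc K)) sums
      (exp ((z - 1) * m) - (\<Sum>k<Suc K. exp (- m) * (z * m) ^ k / fact k))"
    by (rule sums_split_initial_segment[OF s])
  have "z powr y * (1 - poisson_cdf m K) \<le> exp ((z - 1) * m) - (\<Sum>k<Suc K. exp (- m) * (z * m) ^ k / fact k)"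
  proof (rule sums_le[OF _ sums_mult[OF t1] t2])
    fix k
    have "z powr y \<le> z powr real (k + Suc K)" using z K by (intro powr_mono) auto
    also have "\<dots> = z ^ (k + Suc K)" using z by (subst powr_realpow) auto
    finally have "z powr y * (exp (- m) * m ^ (k + Suc K) / fact (k + Suc K)) \<le> z ^ (k + Suc K) * (exp (- m) * m ^ (k + Suc K) / fact (k + Suc K))"
      using m by (intro mult_right_mono) auto
    also have "\<dots> = exp (- m) * (z * m) ^ (k + Suc K) / fact (k + Suc K)"
      by (simp only: power_mult_distrib times_divide_eq_right mult_ac)
    finally show "z powr y * (exp (- m) * m ^ (k + Suc K) / fact (k + Suc K)) \<le> exp (- m) * (z * m) ^ (k + Suc K) / fact (k + Suc K)" .
  qed
  also have "\<dots> \<le> exp ((z - 1) * m)"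
  proof -
    have "0 \<le> (\<Sum>k<Suc K. exp (- m) * (z * m) ^ k / fact k)" using m z by (intro sum_nonneg) auto
    then show ?thesis by linarith
  qed
  finally have "1 - poisson_cdf m K \<le> exp ((z - 1) * m) / z powr y" using z by (simp add: field_simps)
  also have "\<dots> = exp (- y * ln z - (1 - z) * m)"
    using z by (simp add: powr_def exp_diff[symmetric] algebra_simps)
  finally show ?thesis .
qed

text \<open>The law of large numbers for Poisson variables in the form of Chernoff bounds.\<close>

lemma poisson_cdf_tendsto:
  assumes x: "0 < x" and s: "0 < s" "s \<noteq> x"
  shows "(\<lambda>n. poisson_cdf (real n * s) (nat \<lfloor>real n * x\<rfloor>)) \<longlonglongrightarrow> (if s < x then 1 else 0)"
proof -
  (* Chernoff exponent; negative because ln u < u - 1 for u different from 1. *)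
  define c where "c = x * ln (s / x) - (s - x)"
  have c: "c < 0"
  proof -
    have "ln (s / x) \<noteq> s / x - 1" using x s ln_eq_minus_one[of "s / x"] by auto
    moreover have "ln (s / x) \<le> s / x - 1" using x s by (intro ln_le_minus_one) auto
    ultimately have "x * ln (s / x) < x * (s / x - 1)" using x by (intro mult_strict_left_mono) auto
    then show ?thesis using x by (simp add: c_def algebra_simps)
  qed
  have lim: "(\<lambda>n. exp (real n * c)) \<longlonglongrightarrow> 0"
  proof -
    have "(\<lambda>n. exp c ^ n) \<longlonglongrightarrow> 0" using c by (intro LIMSEQ_realpow_zero) auto
    then show ?thesis by (simp add: exp_of_nat_mult)
  qed
  have e: "- (real n * x) * ln (x / s) - (1 - x / s) * (real n * s) = real n * c" for n
    using x s by (simp add: c_def ln_div field_simps)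
  have fl: "real (nat \<lfloor>real n * x\<rfloor>) = of_int \<lfloor>real n * x\<rfloor>" for n using x by simp
  show ?thesis
  proof (cases "s < x")
    case True
    have "(\<lambda>n. 1 - poisson_cdf (real n * s) (nat \<lfloor>real n * x\<rfloor>)) \<longlonglongrightarrow> 0"
    proof (rule tendsto_sandwich[OF _ _ tendsto_const lim])
      show "\<forall>\<^sub>F n in sequentially. 0 \<le> 1 - poisson_cdf (real n * s) (nat \<lfloor>real n * x\<rfloor>)"
        using poisson_cdf_le_1 s by (intro always_eventually allI) simp
      show "\<forall>\<^sub>F n in sequentially. 1 - poisson_cdf (real n * s) (nat \<lfloor>real n * x\<rfloor>) \<le> exp (real n * c)"
      proof (intro always_eventually allI)
        fix n
        have "real n * x \<le> real (Suc (nat \<lfloor>real n * x\<rfloor>))" using fl[of n] by simp linarith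
        then show "1 - poisson_cdf (real n * s) (nat \<lfloor>real n * x\<rfloor>) \<le> exp (real n * c)"
          unfolding e[symmetric] using True s x by (intro poisson_upper_tail) auto
      qed
    qed
    from tendsto_diff[OF tendsto_const this, of 1] show ?thesis using True by simp
  next
    case False
    have "(\<lambda>n. poisson_cdf (real n * s) (nat \<lfloor>real n * x\<rfloor>)) \<longlonglongrightarrow> 0"
    proof (rule tendsto_sandwich[OF _ _ tendsto_const lim])
      show "\<forall>\<^sub>F n in sequentially. 0 \<le> poisson_cdf (real n * s) (nat \<lfloor>real n * x\<rfloor>)"
        using poisson_cdf_nonneg s by (intro always_eventually allI) simp
      show "\<forall>\<^sub>F n in sequentially. poisson_cdf (real n * s) (nat \<lfloor>real n * x\<rfloor>) \<le> exp (real n * c)"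
      proof (intro always_eventually allI)
        fix n
        have "real (nat \<lfloor>real n * x\<rfloor>) \<le> real n * x" using fl[of n] by simp
        then show "poisson_cdf (real n * s) (nat \<lfloor>real n * x\<rfloor>) \<le> exp (real n * c)"
          unfolding e[symmetric] using False s x by (intro poisson_lower_tail) auto
      qed
    qed
    then show ?thesis using False by simp
  qed
qed

lemma poisson_cdf_domination:
  assumes x: "0 < x" and s: "0 \<le> s" and q: "0 \<le> q" "4 * q \<le> real n"
  shows "poisson_cdf (real n * s) (nat \<lfloor>real n * x\<rfloor>) \<le> exp (4 * q * x) * exp (- q * s)"
proof (cases "s \<le> 4 * x")
  case True
  have "poisson_cdf (real n * s) (nat \<lfloor>real n * x\<rfloor>) \<le> 1" using s by (intro poisson_cdf_le_1) simp
  also have "1 \<le> exp (q * (4 * x - s))" using True q by simp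
  also have "\<dots> = exp (4 * q * x) * exp (- q * s)" by (simp add: exp_add[symmetric] algebra_simps)
  finally show ?thesis .
next
  case False
  have "poisson_cdf (real n * s) (nat \<lfloor>real n * x\<rfloor>) \<le> exp (- (real n * x) * ln (1/2) - (1 - 1/2) * (real n * s))"
    using s x by (intro poisson_lower_tail) auto
  also have "\<dots> \<le> exp (4 * q * x + - q * s)"
  proof (subst exp_le_cancel_iff)
    have "- (real n * x) * ln (1/2) \<le> real n * x * 1"
    proof -
      have "- ln (1/2::real) \<le> 1" using ln_le_minus_one[of "2::real"] by (simp add: ln_div)
      then have "(real n * x) * (- ln (1/2)) \<le> (real n * x) * 1" using x by (intro mult_left_mono) auto
      then show ?thesis by simp
    qed
    moreover have "real n * (4 * x) \<le> real n * s" using False by (intro mult_left_mono) auto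
    moreover have "(4 * q) * s \<le> real n * s" using q s by (intro mult_right_mono) auto
    moreover have "0 \<le> 4 * q * x" using q x by simp
    ultimately show "- (real n * x) * ln (1/2) - (1 - 1/2) * (real n * s) \<le> 4 * q * x + - q * s"
      by (simp add: algebra_simps)
  qed
  finally show ?thesis by (simp only: exp_add)
qed

text \<open>A measure on the positive half-line with finite Laplace transform from \<open>q0\<close> on, not necessarily finite.\<close>

locale laplace_measure =
  fixes \<mu> :: "real measure" and q0 :: real
  assumes sets_\<mu> [measurable_cong]: "sets \<mu> = sets borel"
    and q0: "0 \<le> q0"
    and support: "AE s in \<mu>. 0 < s"
    and integrable_exp: "integrable \<mu> (\<lambda>s. exp (- q0 * s))"
begin

definition c :: "nat \<Rightarrow> real \<Rightarrow> real" where "c k q = (\<integral>s. s ^ k * exp (- q * s) \<partial>\<mu>)"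

lemma c_integrable:
  assumes "q0 < q" shows "integrable \<mu> (\<lambda>s. s ^ k * exp (- q * s))"
proof (rule Bochner_Integration.integrable_bound)
  show "integrable \<mu> (\<lambda>s. (fact k / (q - q0) ^ k) * exp (- q0 * s))" using integrable_exp by simp
  show "AE s in \<mu>. norm (s ^ k * exp (- q * s)) \<le> norm ((fact k / (q - q0) ^ k) * exp (- q0 * s))"
    using support
  proof eventually_elim
    case (elim s)
    define d where "d = q - q0"
    have d: "0 < d" using assms by (simp add: d_def)
    have "(d * s) ^ k / fact k \<le> exp (d * s)" using d elim by (intro power_le_exp) auto
    then have "s ^ k \<le> fact k / d ^ k * exp (d * s)"
      using d by (simp add: power_mult_distrib field_simps)
    then have "s ^ k * exp (- q * s) \<le> fact k / d ^ k * exp (d * s) * exp (- q * s)"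
      by (intro mult_right_mono) auto
    also have "\<dots> = fact k / (q - q0) ^ k * exp (- q0 * s)"
      by (simp add: d_def mult.assoc exp_add[symmetric] algebra_simps)
    finally show ?case using elim assms by simp
  qed
qed simp

lemma exp_difference_bound:
  fixes d s :: real assumes "0 \<le> s" "d \<noteq> 0" "\<bar>d\<bar> \<le> e"
  shows "\<bar>(exp (- d * s) - 1) / d\<bar> \<le> s * exp (e * s)"
proof -
  have "\<bar>exp (- d * s) - 1\<bar> \<le> \<bar>d\<bar> * s * exp (\<bar>d\<bar> * s)"
  proof (cases "0 \<le> d")
    case True
    have "1 - exp (- d * s) \<le> d * s" using exp_ge_add_one_self[of "- d * s"] by simp
    also have "\<dots> \<le> d * s * exp (d * s)" using True assms by (simp add: mult_le_cancel_left1)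
    finally show ?thesis using True assms by simp
  next
    case False
    have "1 + d * s \<le> exp (d * s)" by (rule exp_ge_add_one_self)
    then have "exp (- d * s) * (1 + d * s) \<le> exp (- d * s) * exp (d * s)" by (intro mult_left_mono) auto
    then have "exp (- d * s) - 1 \<le> (- d * s) * exp (- d * s)"
      by (simp add: exp_add[symmetric] algebra_simps)
    moreover have "0 \<le> exp (- d * s) - 1" using False assms by (simp add: mult_nonpos_nonneg)
    ultimately show ?thesis using False by simp
  qed
  also have "\<dots> \<le> \<bar>d\<bar> * s * exp (e * s)"
    using assms by (intro mult_left_mono) (auto intro: mult_right_mono)
  finally have "\<bar>exp (- d * s) - 1\<bar> / \<bar>d\<bar> \<le> s * exp (e * s)" using assms by (simp add: field_simps)
  then show ?thesis by simp
qed

lemma c_has_derivative: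
  assumes q: "q0 < q" shows "(c k has_field_derivative - c (Suc k) q) (at q)"
  unfolding DERIV_def
proof (rule tendsto_at_iff_sequentially[THEN iffD2], intro allI impI, unfold comp_def)
  fix X :: "nat \<Rightarrow> real" assume X: "\<forall>i. X i \<in> UNIV - {0}" "X \<longlonglongrightarrow> 0"
  define e where "e = (q - q0) / 2"
  have e: "0 < e" "q0 < q - e" using q by (auto simp: e_def field_simps)
  have "\<forall>\<^sub>F i in sequentially. \<bar>X i\<bar> < e"
    using tendsto_norm[OF X(2)] e by (intro order_tendstoD) auto
  then obtain n0 where n0: "\<And>i. i \<ge> n0 \<Longrightarrow> \<bar>X i\<bar> < e" by (auto simp: eventually_sequentially)
  let ?d = "\<lambda>i s. s ^ k * exp (- q * s) * ((exp (- X i * s) - 1) / X i)"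
  have eq: "(c k (q + X i) - c k q) / X i = (\<integral>s. ?d i s \<partial>\<mu>)" if "i \<ge> n0" for i
  proof -
    have q': "q0 < q + X i" using n0[OF that] e by linarith
    have E: "c k (q + X i) - c k q = (\<integral>s. s ^ k * exp (- (q + X i) * s) - s ^ k * exp (- q * s) \<partial>\<mu>)"
      unfolding c_def by (rule Bochner_Integration.integral_diff[symmetric]) (rule c_integrable[OF q'] c_integrable[OF q])+
    have "(c k (q + X i) - c k q) / X i = (\<integral>s. (s ^ k * exp (- (q + X i) * s) - s ^ k * exp (- q * s)) / X i \<partial>\<mu>)"
      unfolding E by simp
    also have "\<dots> = (\<integral>s. ?d i s \<partial>\<mu>)"
      by (intro Bochner_Integration.integral_cong refl) (simp add: algebra_simps exp_add diff_divide_distrib exp_diff exp_minus divide_inverse)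
    finally show ?thesis .
  qed
  have "(\<lambda>i. \<integral>s. ?d (i + n0) s \<partial>\<mu>) \<longlonglongrightarrow> (\<integral>s. s ^ k * exp (- q * s) * (- s) \<partial>\<mu>)"
  proof (rule integral_dominated_convergence)
    show "integrable \<mu> (\<lambda>s. s ^ Suc k * exp (- (q - e) * s))" by (rule c_integrable[OF e(2)])
    show "AE s in \<mu>. (\<lambda>i. ?d (i + n0) s) \<longlonglongrightarrow> s ^ k * exp (- q * s) * (- s)"
    proof (intro AE_I2 tendsto_mult tendsto_const)
      fix s :: real
      have "((\<lambda>d. exp (- d * s)) has_field_derivative (- s)) (at 0)"
        by (auto intro!: derivative_eq_intros)
      then have "((\<lambda>d. (exp (- (0 + d) * s) - exp (- 0 * s)) / d) \<longlongrightarrow> - s) (at 0)"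
        unfolding DERIV_def .
      then have "((\<lambda>d. (exp (- d * s) - 1) / d) \<longlongrightarrow> - s) (at 0)" by simp
      moreover have "filterlim (\<lambda>i. X (i + n0)) (at 0) sequentially"
        using X LIMSEQ_ignore_initial_segment[OF X(2), of n0] by (auto simp: filterlim_at intro!: always_eventually)
      ultimately show "(\<lambda>i. (exp (- X (i + n0) * s) - 1) / X (i + n0)) \<longlonglongrightarrow> - s"
        by (rule filterlim_compose)
    qed
    show "AE s in \<mu>. norm (?d (i + n0) s) \<le> s ^ Suc k * exp (- (q - e) * s)" for i
      using support
    proof eventually_elim
      case (elim s)
      have "\<bar>(exp (- X (i + n0) * s) - 1) / X (i + n0)\<bar> \<le> s * exp (e * s)"
        using X(1) n0[of "i + n0"] elim by (intro exp_difference_bound) auto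
      then have "norm (?d (i + n0) s) \<le> (s ^ k * exp (- q * s)) * (s * exp (e * s))"
        using elim unfolding norm_mult by (intro mult_mono) (auto simp: abs_mult)
      also have "\<dots> = s ^ Suc k * exp (- (q - e) * s)" by (simp add: exp_add[symmetric] algebra_simps)
      finally show ?case .
    qed
  qed auto
  moreover have "(\<integral>s. s ^ k * exp (- q * s) * (- s) \<partial>\<mu>) = - c (Suc k) q"
    unfolding c_def by (subst Bochner_Integration.integral_minus[symmetric]) (auto intro!: Bochner_Integration.integral_cong)
  moreover have "(\<lambda>i. (c k (q + X (i + n0)) - c k q) / X (i + n0)) = (\<lambda>i. \<integral>s. ?d (i + n0) s \<partial>\<mu>)"
    by (intro ext eq) simp
  ultimately have "(\<lambda>i. (c k (q + X (i + n0)) - c k q) / X (i + n0)) \<longlonglongrightarrow> - c (Suc k) q" by (simp only:)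
  then show "(\<lambda>i. (c k (q + X i) - c k q) / X i) \<longlonglongrightarrow> - c (Suc k) q" by (rule LIMSEQ_offset)
qed

text \<open>Leibniz' rule; the Bernstein sign conditions on \<open>\<Psi>\<close> thus compare consecutive moments \<open>c k\<close>.\<close>

lemma iterated_deriv_times_id:
  assumes \<Psi>: "\<And>q. q0 < q \<Longrightarrow> \<Psi> q = q * c 0 q" and q: "q0 < q"
  shows "(deriv ^^ Suc k) \<Psi> q = (-1) ^ k * (real (Suc k) * c k q - q * c (Suc k) q)"
  using q
proof (induction k arbitrary: q)
  case 0
  have "\<forall>\<^sub>F p in nhds q. \<Psi> p = p * c 0 p"
    using eventually_nhds_in_open[of "{q0<..}" q] 0 \<Psi> by (auto elim!: eventually_mono)
  then have "deriv \<Psi> q = deriv (\<lambda>p. p * c 0 p) q" by (intro deriv_cong_ev) auto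
  also have "\<dots> = c 0 q - q * c 1 q"
    using 0 by (intro DERIV_imp_deriv) (auto intro!: derivative_eq_intros c_has_derivative)
  finally show ?case by simp
next
  case (Suc k)
  have "\<forall>\<^sub>F p in nhds q. (deriv ^^ Suc k) \<Psi> p = (-1) ^ k * (real (Suc k) * c k p - p * c (Suc k) p)"
    using eventually_nhds_in_open[of "{q0<..}" q] Suc by (auto elim!: eventually_mono simp del: funpow.simps of_nat_Suc)
  then have "deriv ((deriv ^^ Suc k) \<Psi>) q = deriv (\<lambda>p. (-1) ^ k * (real (Suc k) * c k p - p * c (Suc k) p)) q"
    by (intro deriv_cong_ev) auto
  also have "\<dots> = (-1) ^ k * (real (Suc k) * (- c (Suc k) q) - (c (Suc k) q - q * c (Suc (Suc k)) q))"
    using Suc.prems by (intro DERIV_imp_deriv) (auto intro!: derivative_eq_intros c_has_derivative simp: algebra_simps)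
  finally show ?case by (simp add: algebra_simps)
qed

text \<open>The weights of Feller's inversion formula: the \<open>\<mu>\<close>-integral of the Poisson probability of \<open>k\<close> with mean
  \<open>n s\<close>.\<close>

definition p :: "nat \<Rightarrow> nat \<Rightarrow> real" where "p n k = real n ^ k / fact k * c k (real n)"

lemma c_nonneg: "0 \<le> c k q"
  unfolding c_def using support by (intro integral_nonneg_AE) (auto elim!: eventually_mono)

lemma p_decreasing:
  assumes \<Psi>: "\<And>q. q0 < q \<Longrightarrow> \<Psi> q = q * c 0 q" and B: "bernstein \<Psi>" and n: "q0 < real n"
  shows "p n (Suc k) \<le> p n k"
proof -
  have "0 < real n" using n q0 by linarith
  have "(- 1) ^ Suc k * (deriv ^^ Suc k) \<Psi> (real n) \<le> 0"
    using B \<open>0 < real n\<close> unfolding bernstein_def by (metis Suc_le_mono le0 One_nat_def)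
  then have "(- 1) ^ Suc k * ((-1) ^ k * (real (Suc k) * c k (real n) - real n * c (Suc k) (real n))) \<le> 0"
    by (subst (asm) iterated_deriv_times_id[OF \<Psi> n])
  then have "real n * c (Suc k) (real n) \<le> real (Suc k) * c k (real n)"
    by (simp add: mult.assoc[symmetric] power_add[symmetric] flip: mult_2 power_mult_distrib)
  then have "real n ^ k / fact (Suc k) * (real n * c (Suc k) (real n)) \<le> real n ^ k / fact (Suc k) * (real (Suc k) * c k (real n))"
    by (intro mult_left_mono) auto
  also have "\<dots> = p n k" by (simp add: p_def fact_Suc del: of_nat_Suc)
  finally show ?thesis by (simp add: p_def mult_ac)
qed

lemma sum_p_eq:
  assumes n: "q0 < real n"
  shows "(\<Sum>k\<le>K. p n k) = (\<integral>s. poisson_cdf (real n * s) K \<partial>\<mu>)"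
proof -
  have i: "integrable \<mu> (\<lambda>s. exp (- (real n * s)) * (real n * s) ^ k / fact k)" for k
  proof -
    have "integrable \<mu> (\<lambda>s. (real n ^ k / fact k) * (s ^ k * exp (- real n * s)))" using c_integrable[OF n] by simp
    then show ?thesis by (simp add: power_mult_distrib mult_ac)
  qed
  have "(\<integral>s. poisson_cdf (real n * s) K \<partial>\<mu>) = (\<Sum>k\<le>K. \<integral>s. exp (- (real n * s)) * (real n * s) ^ k / fact k \<partial>\<mu>)"
    unfolding poisson_cdf_def by (rule Bochner_Integration.integral_sum) (rule i)
  also have "\<dots> = (\<Sum>k\<le>K. p n k)"
  proof (rule sum.cong[OF refl])
    fix k
    have "(\<integral>s. exp (- (real n * s)) * (real n * s) ^ k / fact k \<partial>\<mu>) = (\<integral>s. (real n ^ k / fact k) * (s ^ k * exp (- real n * s)) \<partial>\<mu>)"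
      by (intro Bochner_Integration.integral_cong refl) (simp add: power_mult_distrib mult_ac)
    then show "(\<integral>s. exp (- (real n * s)) * (real n * s) ^ k / fact k \<partial>\<mu>) = p n k" by (simp add: p_def c_def)
  qed
  finally show ?thesis ..
qed

text \<open>Sums of the weights integrate Poisson distribution functions, which converge to an indicator.\<close>

lemma Feller_inversion:
  assumes x: "0 < x" and atom: "emeasure \<mu> {x} = 0"
  shows "(\<lambda>n. \<Sum>k\<le>nat \<lfloor>real n * x\<rfloor>. p n k) \<longlonglongrightarrow> measure \<mu> {0..<x}"
proof -
  obtain n0 :: nat where n0: "4 * q0 + 1 < real n0" using reals_Archimedean2 by blast
  let ?f = "\<lambda>n s. poisson_cdf (real n * s) (nat \<lfloor>real n * x\<rfloor>)"
  have "(\<lambda>i. \<integral>s. ?f (i + n0) s \<partial>\<mu>) \<longlonglongrightarrow> (\<integral>s. indicator {0..<x} s \<partial>\<mu>)"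
  proof (rule integral_dominated_convergence)
    show "integrable \<mu> (\<lambda>s. exp (4 * q0 * x) * exp (- q0 * s))" using integrable_exp by simp
    have "{x} \<in> null_sets \<mu>" using atom by auto
    then have "AE s in \<mu>. s \<notin> {x}" by (rule AE_not_in)
    with support show "AE s in \<mu>. (\<lambda>i. ?f (i + n0) s) \<longlonglongrightarrow> indicator {0..<x} s"
    proof eventually_elim
      case (elim s)
      have "(\<lambda>n. ?f n s) \<longlonglongrightarrow> (if s < x then 1 else 0)" using elim x by (intro poisson_cdf_tendsto) auto
      then have "(\<lambda>i. ?f (i + n0) s) \<longlonglongrightarrow> (if s < x then 1 else 0)" by (rule LIMSEQ_ignore_initial_segment)
      then show ?case using elim by (auto simp: indicator_def)
    qed
    show "AE s in \<mu>. norm (?f (i + n0) s) \<le> exp (4 * q0 * x) * exp (- q0 * s)" for i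
      using support
    proof eventually_elim
      case (elim s)
      have "?f (i + n0) s \<le> exp (4 * q0 * x) * exp (- q0 * s)"
        using x elim q0 n0 by (intro poisson_cdf_domination) auto
      moreover have "0 \<le> ?f (i + n0) s" using elim by (intro poisson_cdf_nonneg) simp
      ultimately show ?case by simp
    qed
    show "?f (i + n0) \<in> borel_measurable \<mu>" for i unfolding poisson_cdf_def by measurable
  qed auto
  moreover have "(\<integral>s. ?f (i + n0) s \<partial>\<mu>) = (\<Sum>k\<le>nat \<lfloor>real (i + n0) * x\<rfloor>. p (i + n0) k)" for i
    using n0 q0 by (intro sum_p_eq[symmetric]) simp
  moreover have "(\<integral>s. indicator {0..<x} s \<partial>\<mu>) = measure \<mu> {0..<x}"
    using sets_eq_imp_space_eq[OF sets_\<mu>] by simp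
  ultimately have "(\<lambda>i. \<Sum>k\<le>nat \<lfloor>real (i + n0) * x\<rfloor>. p (i + n0) k) \<longlonglongrightarrow> measure \<mu> {0..<x}" by simp
  then show ?thesis by (rule LIMSEQ_offset)
qed

lemma p0_tendsto: "(\<lambda>n. p n 0) \<longlonglongrightarrow> 0"
proof -
  obtain n0 :: nat where n0: "q0 < real n0" using reals_Archimedean2 by blast
  have "(\<lambda>i. \<integral>s. exp (- real (i + n0) * s) \<partial>\<mu>) \<longlonglongrightarrow> (\<integral>s. 0 \<partial>\<mu>)"
  proof (rule integral_dominated_convergence[OF _ _ integrable_exp])
    show "AE s in \<mu>. (\<lambda>i. exp (- real (i + n0) * s)) \<longlonglongrightarrow> 0"
      using support
    proof eventually_elim
      case (elim s)
      have "(\<lambda>n. exp (- s) ^ n) \<longlonglongrightarrow> 0" using elim by (intro LIMSEQ_realpow_zero) auto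
      then have "(\<lambda>n. exp (- real n * s)) \<longlonglongrightarrow> 0" by (simp add: exp_of_nat_mult[symmetric])
      then show ?case by (rule LIMSEQ_ignore_initial_segment)
    qed
    show "AE s in \<mu>. norm (exp (- real (i + n0) * s)) \<le> exp (- q0 * s)" for i
      using support
    proof eventually_elim
      case (elim s)
      have "q0 * s \<le> real (i + n0) * s" using elim n0 by (intro mult_right_mono) auto
      then show ?case by (simp add: algebra_simps)
    qed
  qed auto
  then have "(\<lambda>i. p (i + n0) 0) \<longlonglongrightarrow> 0" by (simp add: p_def c_def)
  then show ?thesis by (rule LIMSEQ_offset)
qed

text \<open>The weights \<open>p n k\<close> decrease in \<open>k\<close> because \<open>q\<close> times the Laplace transform is a Bernstein function. Hence
  discretized increments over intervals of equal length decrease up to one weight, and inversion passes this to \<open>\<mu>\<close>.\<close>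

theorem special_increments_decreasing:
  assumes \<Psi>: "\<And>q. q0 < q \<Longrightarrow> \<Psi> q = q * c 0 q" and B: "bernstein \<Psi>"
    and atom: "\<And>x. emeasure \<mu> {x} = 0"
    and x: "0 < x" "x \<le> y" "0 \<le> h"
  shows "measure \<mu> {0..<y + h} - measure \<mu> {0..<y} \<le> measure \<mu> {0..<x + h} - measure \<mu> {0..<x}"
proof -
  let ?S = "\<lambda>x n. \<Sum>k\<le>nat \<lfloor>real n * x\<rfloor>. p n k"
  obtain n0 :: nat where n0: "q0 < real n0" using reals_Archimedean2 by blast
  have step: "?S (y + h) n - ?S y n \<le> ?S (x + h) n - ?S x n + p n 0" if n: "n \<ge> n0" for n
  proof -
    have qn: "q0 < real n" using n n0 by simp
    define a b e d where "a = nat \<lfloor>real n * x\<rfloor>" and "b = nat \<lfloor>real n * (x + h)\<rfloor>"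
      and "e = nat \<lfloor>real n * y\<rfloor>" and "d = nat \<lfloor>real n * (y + h)\<rfloor>"
    have dec: "p n j \<le> p n i" if "i \<le> j" for i j
      using that by (induction j rule: dec_induct) (auto intro: order_trans[OF p_decreasing[OF \<Psi> B qn]])
    have pn: "0 \<le> p n k" for k using c_nonneg by (simp add: p_def)
    have nx: "0 \<le> real n * x" "0 \<le> real n * h" "real n * x \<le> real n * y" using x by (auto intro: mult_left_mono)
    have ab: "a \<le> b" unfolding a_def b_def using nx by (intro nat_mono floor_mono) (simp add: algebra_simps)
    have ae: "a \<le> e" unfolding a_def e_def using nx by (intro nat_mono floor_mono) simp
    have ed: "e \<le> d" unfolding e_def d_def using nx by (intro nat_mono floor_mono) (simp add: algebra_simps)
    (* The numbers of grid points in two intervals of equal length differ by at most one. *)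
    have de: "d \<le> e + (b - a) + 1"
    proof -
      have "\<lfloor>real n * (y + h)\<rfloor> \<le> \<lfloor>real n * y\<rfloor> + (\<lfloor>real n * (x + h)\<rfloor> - \<lfloor>real n * x\<rfloor>) + 1"
        by (simp add: distrib_left) linarith
      then show ?thesis using nx unfolding a_def b_def e_def d_def by (simp add: distrib_left nat_diff_distrib) linarith
    qed
    have split: "(\<Sum>k\<le>j. p n k) - (\<Sum>k\<le>i. p n k) = (\<Sum>k\<in>{i<..j}. p n k)" if "i \<le> j" for i j
    proof -
      have "{..j} = {..i} \<union> {i<..j}" using that by auto
      then have "(\<Sum>k\<le>j. p n k) = (\<Sum>k\<le>i. p n k) + (\<Sum>k\<in>{i<..j}. p n k)"
        by (simp only:) (rule sum.union_disjoint, auto)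
      then show ?thesis by simp
    qed
    have "(\<Sum>k\<in>{e<..d}. p n k) \<le> (\<Sum>k\<in>{e<..e + (b - a) + 1}. p n k)"
      using de pn by (intro sum_mono2) auto
    also have "\<dots> = (\<Sum>k\<in>{e<..e + (b - a)}. p n k) + p n (e + (b - a) + 1)"
    proof -
      have "{e<..e + (b - a) + 1} = insert (e + (b - a) + 1) {e<..e + (b - a)}" by auto
      then show ?thesis by simp
    qed
    also have "\<dots> \<le> (\<Sum>k\<in>{e<..e + (b - a)}. p n k) + p n 0" using dec[of 0] by simp
    also have "(\<Sum>k\<in>{e<..e + (b - a)}. p n k) = (\<Sum>k\<in>{a<..b}. p n (k + (e - a)))"
      by (rule sum.reindex_bij_witness[of _ "\<lambda>k. k + (e - a)" "\<lambda>k. k - (e - a)"]) (use ae ab in auto)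
    also have "\<dots> \<le> (\<Sum>k\<in>{a<..b}. p n k)" by (intro sum_mono dec) simp
    finally show ?thesis using split[OF ab] split[OF ed] by (simp add: a_def b_def e_def d_def)
  qed
  have y: "0 < y" "0 < y + h" "0 < x + h" using x by auto
  show ?thesis
  proof (rule LIMSEQ_le)
    show "(\<lambda>n. ?S (y + h) n - ?S y n) \<longlonglongrightarrow> measure \<mu> {0..<y + h} - measure \<mu> {0..<y}"
      by (intro tendsto_diff Feller_inversion y atom)
    have "(\<lambda>n. ?S (x + h) n - ?S x n + p n 0) \<longlonglongrightarrow> measure \<mu> {0..<x + h} - measure \<mu> {0..<x} + 0"
      by (intro tendsto_add tendsto_diff Feller_inversion y x atom p0_tendsto)
    then show "(\<lambda>n. ?S (x + h) n - ?S x n + p n 0) \<longlonglongrightarrow> measure \<mu> {0..<x + h} - measure \<mu> {0..<x}" by simp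
  qed (use step in auto)
qed

end

section \<open>The last visit\<close>

lemma one_over_Suc_tendsto: "(\<lambda>n. 1 / real (Suc n)) \<longlonglongrightarrow> 0"
  using LIMSEQ_inverse_real_of_nat by (simp add: inverse_eq_divide)

context regenerative_clock
begin

lemma \<tau>_finite_cases:
  assumes sp: "w \<in> space M" and s: "0 \<le> s" and t: "0 < t" "s < A t w"
  obtains u where "\<tau> s w = ennreal u" "0 \<le> u" "u < t" "A u w = s" "\<And>v. u < v \<Longrightarrow> s < A v w"
proof -
  have lt: "\<tau> s w < ennreal t" using \<tau>_less_iff[OF sp t(1)] t by simp
  then obtain u where u: "\<tau> s w = ennreal u" "0 \<le> u" by (cases "\<tau> s w") auto
  have "u < t" using lt u by (simp add: ennreal_less_iff)
  moreover have z: "A 0 w = 0" "mono_on {0..} (\<lambda>t. A t w)" "continuous_on {0..} (\<lambda>t. A t w)"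
    using A_nonpos[OF sp] A_mono[OF sp] continuous_on_subset[OF A_cont[OF sp]] by (auto simp: mono_on_def)
  ultimately show ?thesis
    using that u at_inverse_local_time[of A w s u, OF z s u] by blast
qed

text \<open>The last visit up to \<open>t\<close> exceeds \<open>x\<close> if and only if the clock increases between \<open>x\<close> and every time after \<open>t\<close>;
  an increase up to \<open>t\<close> itself is not necessary, because \<open>t\<close> may be a visit that ends a flat stretch.\<close>

lemma last_visit_greater_iff:
  assumes sp: "w \<in> space M" and x: "0 \<le> x" "x < t"
  shows "x < last_visit A t w \<longleftrightarrow> (\<forall>n. A x w < A (t + 1 / real (Suc n)) w)"
proof -
  let ?S = "{\<tau> s w |s. 0 \<le> s \<and> \<tau> s w \<le> ennreal t}"
  have "Sup ?S \<le> ennreal t" by (intro Sup_least) auto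
  then obtain g where g: "Sup ?S = ennreal g" "0 \<le> g" by (cases "Sup ?S") (auto simp: top_unique)
  have "x < last_visit A t w \<longleftrightarrow> ennreal x < Sup ?S"
    unfolding last_visit_def g using g x by (simp add: ennreal_less_iff)
  also have "\<dots> \<longleftrightarrow> (\<exists>s\<ge>0. ennreal x < \<tau> s w \<and> \<tau> s w \<le> ennreal t)"
    unfolding less_Sup_iff by blast
  also have "\<dots> \<longleftrightarrow> (\<forall>n. A x w < A (t + 1 / real (Suc n)) w)"
  proof
    assume "\<exists>s\<ge>0. ennreal x < \<tau> s w \<and> \<tau> s w \<le> ennreal t"
    then obtain s where s: "0 \<le> s" "ennreal x < \<tau> s w" "\<tau> s w \<le> ennreal t" by blast
    have "A x w \<le> s"
    proof (cases "x = 0")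
      case False
      then show ?thesis using \<tau>_less_iff[OF sp, of x s] s x by (auto simp: not_less)
    qed (use A_nonpos[OF sp, of 0] s in simp)
    moreover have "s < A (t + 1 / real (Suc n)) w" for n
    proof -
      have "t < t + 1 / real (Suc n)" by simp
      moreover from this have "0 < t + 1 / real (Suc n)" using x by linarith
      ultimately have "ennreal t < ennreal (t + 1 / real (Suc n))" by (intro ennreal_lessI)
      then have "\<tau> s w < ennreal (t + 1 / real (Suc n))" using s(3) by (rule le_less_trans[rotated])
      moreover have "0 < t + 1 / real (Suc n)" using x by (intro add_pos_pos) (linarith, simp)
      ultimately show ?thesis using \<tau>_less_iff[OF sp, of "t + 1 / real (Suc n)" s] by simp
    qed
    ultimately show "\<forall>n. A x w < A (t + 1 / real (Suc n)) w" by (meson le_less_trans)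
  next
    assume all: "\<forall>n. A x w < A (t + 1 / real (Suc n)) w"
    have t: "0 < t" using x by simp
    have Axt: "A x w \<le> A t w" using A_mono[OF sp] x by simp
    show "\<exists>s\<ge>0. ennreal x < \<tau> s w \<and> \<tau> s w \<le> ennreal t"
    proof (cases "A x w < A t w")
      case True
      define s where "s = (A x w + A t w) / 2"
      have s: "A x w < s" "s < A t w" "0 \<le> s" using True A_nonneg[OF sp, of x] A_nonneg[OF sp, of t] by (auto simp: s_def)
      obtain u where u: "\<tau> s w = ennreal u" "0 \<le> u" "u < t" "A u w = s"
        by (rule \<tau>_finite_cases[OF sp s(3) t s(2)])
      have "x < u" using u(4) s(1) A_mono[OF sp, of u x] by (cases "u \<le> x") auto
      then show ?thesis using u s x by (intro exI[of _ s]) (auto simp: ennreal_less_iff)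
    next
      case False
      define s where "s = A x w"
      have At: "A t w = s" using False Axt by (simp add: s_def)
      have s: "0 \<le> s" using A_nonneg[OF sp] by (simp add: s_def)
      have pos: "0 < t + 1 / real (Suc n)" for n using t by (intro add_pos_pos) auto
      have lt0: "s < A (t + 1 / real (Suc 0)) w" using spec[OF all, of 0] unfolding s_def .
      obtain u where u: "\<tau> s w = ennreal u" "0 \<le> u" "u < t + 1 / real (Suc 0)" "A u w = s" "\<And>v. u < v \<Longrightarrow> s < A v w"
        using \<tau>_finite_cases[OF sp s pos[of 0] lt0] by metis
      have "\<not> u < t" using u(5)[of t] At by auto
      have "u \<le> t + 1 / real (Suc n)" for n
      proof -
        have "\<tau> s w < ennreal (t + 1 / real (Suc n))"
          using \<tau>_less_iff[OF sp pos, of s n] all by (simp add: s_def)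
        then show ?thesis using u by (simp add: ennreal_less_iff)
      qed
      moreover have "(\<lambda>n. t + 1 / real (Suc n)) \<longlonglongrightarrow> t + 0"
        by (intro tendsto_add tendsto_const one_over_Suc_tendsto) 
      ultimately have "u \<le> t + 0" by (intro LIMSEQ_le_const) auto
      then show ?thesis using u \<open>\<not> u < t\<close> s x by (intro exI[of _ s]) (auto simp: ennreal_less_iff)
    qed
  qed
  finally show ?thesis .
qed

lemma last_visit_greater_sets:
  assumes "0 \<le> x" "x < t" shows "{w\<in>space M. x < last_visit A t w} \<in> sets M"
proof -
  have "{w\<in>space M. x < last_visit A t w} = {w\<in>space M. \<forall>n. A x w < A (t + 1 / real (Suc n)) w}"
    using last_visit_greater_iff[OF _ assms] by blast
  also have "\<dots> \<in> sets M" by measurable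
  finally show ?thesis .
qed

lemma last_visit_ge_sets:
  assumes "0 < y" "y \<le> t" shows "{w\<in>space M. y \<le> last_visit A t w} \<in> sets M"
proof -
  (* An event with weak inequality is the intersection of those with strict ones. *)
  let ?y = "\<lambda>n. max 0 (y - 1 / real (Suc n))"
  have y: "0 \<le> ?y n" "?y n < y" for n using assms by auto
  have "{w\<in>space M. y \<le> last_visit A t w} = (\<Inter>n. {w\<in>space M. ?y n < last_visit A t w})"
  proof (intro equalityI subsetI)
    fix w assume w: "w \<in> (\<Inter>n. {w\<in>space M. ?y n < last_visit A t w})"
    have "(\<lambda>n. y - 1 / real (Suc n)) \<longlonglongrightarrow> y - 0"
      by (intro tendsto_diff tendsto_const one_over_Suc_tendsto)
    moreover have "y - 1 / real (Suc n) \<le> last_visit A t w" for n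
    proof -
      from w have "?y n < last_visit A t w" by blast
      then show ?thesis by linarith
    qed
    ultimately have "y - 0 \<le> last_visit A t w" by (intro LIMSEQ_le_const2) auto
    then show "w \<in> {w\<in>space M. y \<le> last_visit A t w}" using w by simp
  next
    fix w assume w: "w \<in> {w\<in>space M. y \<le> last_visit A t w}"
    show "w \<in> (\<Inter>n. {w\<in>space M. ?y n < last_visit A t w})"
    proof (rule INT_I)
      fix n
      show "w \<in> {w\<in>space M. ?y n < last_visit A t w}"
        using w less_le_trans[OF y(2)[of n]] by blast
    qed
  qed
  also have "\<dots> \<in> sets M"
  proof (intro sets.countable_INT image_subsetI last_visit_greater_sets y(1))
    fix n show "?y n < t" using y(2)[of n] assms by linarith
  qed simp
  finally show ?thesis .
qed

lemma last_visit_le_bounds: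
  assumes x: "0 < x" "x < t" "t < t'"
  shows "U x * N t' \<le> prob {w\<in>space M. last_visit A t w \<le> x}"
    "prob {w\<in>space M. last_visit A t w \<le> x} \<le> U x * N (t - x)"
proof -
  have iff: "last_visit A t w \<le> x \<longleftrightarrow> \<not> (\<forall>n. A x w < A (t + 1 / real (Suc n)) w)" if "w \<in> space M" for w
    using last_visit_greater_iff[OF that, of x t] x by (auto simp: not_less[symmetric])
  have m: "{w\<in>space M. last_visit A t w \<le> x} \<in> sets M"
  proof -
    have "{w\<in>space M. last_visit A t w \<le> x} = space M - {w\<in>space M. x < last_visit A t w}" by auto
    then show ?thesis using last_visit_greater_sets[of x t] x by auto
  qed
  have "U x * N t' \<le> prob {w\<in>space M. A t' w = A x w}" using x by (intro flat_lower) auto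
  also have "\<dots> \<le> prob {w\<in>space M. last_visit A t w \<le> x}"
  proof (rule finite_measure_mono[OF _ m])
    obtain n where n: "inverse (real (Suc n)) < t' - t" using reals_Archimedean[of "t' - t"] x by auto
    show "{w\<in>space M. A t' w = A x w} \<subseteq> {w\<in>space M. last_visit A t w \<le> x}"
    proof safe
      fix w assume sp: "w \<in> space M" and eq: "A t' w = A x w"
      have "A (t + 1 / real (Suc n)) w \<le> A t' w" using n by (intro A_mono[OF sp]) (simp add: inverse_eq_divide)
      then have "\<not> A x w < A (t + 1 / real (Suc n)) w" using eq by simp
      then show "last_visit A t w \<le> x" using iff[OF sp] by blast
    qed
  qed
  finally show "U x * N t' \<le> prob {w\<in>space M. last_visit A t w \<le> x}" .
  have "prob {w\<in>space M. last_visit A t w \<le> x} \<le> prob {w\<in>space M. A t w = A x w}"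
  proof (rule finite_measure_mono)
    show "{w\<in>space M. last_visit A t w \<le> x} \<subseteq> {w\<in>space M. A t w = A x w}"
    proof safe
      fix w assume sp: "w \<in> space M" and le: "last_visit A t w \<le> x"
      then obtain n where "A (t + 1 / real (Suc n)) w \<le> A x w" using iff[OF sp] by (auto simp: not_less)
      moreover have "A t w \<le> A (t + 1 / real (Suc n)) w" by (rule A_mono[OF sp]) simp
      moreover have "A x w \<le> A t w" using x by (intro A_mono[OF sp]) simp
      ultimately show "A t w = A x w" by simp
    qed
  qed measurable
  also have "\<dots> \<le> U x * N (t - x)" using x by (intro flat_upper) auto
  finally show "prob {w\<in>space M. last_visit A t w \<le> x} \<le> U x * N (t - x)" .
qed

lemma last_visit_ge_bounds:
  assumes y: "0 \<le> y'" "y' < y" "y < t" "t < t'"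
  shows "prob {w\<in>space M. A y w < A t w} \<le> prob {w\<in>space M. y \<le> last_visit A t w}"
    "prob {w\<in>space M. y \<le> last_visit A t w} \<le> prob {w\<in>space M. A y' w < A t' w}"
proof -
  show "prob {w\<in>space M. A y w < A t w} \<le> prob {w\<in>space M. y \<le> last_visit A t w}"
  proof (rule finite_measure_mono)
    show "{w\<in>space M. A y w < A t w} \<subseteq> {w\<in>space M. y \<le> last_visit A t w}"
    proof safe
      fix w assume sp: "w \<in> space M" and lt: "A y w < A t w"
      have "A y w < A (t + 1 / real (Suc n)) w" for n
        using lt A_mono[OF sp, of t "t + 1 / real (Suc n)"] by (simp add: less_le_trans)
      then have "y < last_visit A t w" using last_visit_greater_iff[OF sp, of y t] y by simp
      then show "y \<le> last_visit A t w" by simp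
    qed
  qed (use last_visit_ge_sets y in simp)
  obtain n where n: "inverse (real (Suc n)) < t' - t" using reals_Archimedean[of "t' - t"] y by auto
  show "prob {w\<in>space M. y \<le> last_visit A t w} \<le> prob {w\<in>space M. A y' w < A t' w}"
  proof (rule finite_measure_mono)
    show "{w\<in>space M. y \<le> last_visit A t w} \<subseteq> {w\<in>space M. A y' w < A t' w}"
    proof safe
      fix w assume sp: "w \<in> space M" and le: "y \<le> last_visit A t w"
      then have "y' < last_visit A t w" using y by simp
      then have "A y' w < A (t + 1 / real (Suc n)) w" using last_visit_greater_iff[OF sp, of y' t] y by simp
      also have "\<dots> \<le> A t' w" using n by (intro A_mono[OF sp]) (simp add: inverse_eq_divide)
      finally show "A y' w < A t' w" .
    qed
  qed measurable
qed

end

text \<open>\<open>1 / (q r q)\<close> tends to the drift of the subordinator.\<close>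

locale driftless_clock = resolvent_clock +
  assumes driftless: "filterlim (\<lambda>q. q * r q) at_top at_top"
begin

definition H :: "real \<Rightarrow> real" where "H x = enn2real (\<integral>\<^sup>+s\<in>{0<..x}. ennreal (N s) \<partial>lborel)"

lemma N_interval_measurable [measurable]: "(\<lambda>s. ennreal (N s) * indicator {0<..x} s) \<in> borel_measurable borel"
proof -
  have "(\<lambda>s. ennreal (N s) * indicator {0<..x} s) = (\<lambda>s. (ennreal (N s) * indicator {0<..} s) * indicator {..x} s)"
    by (auto simp: indicator_def)
  then show ?thesis by simp
qed

lemma H_le_Laplace:
  assumes q: "1 \<le> q" and x: "0 \<le> x"
  shows "(\<integral>\<^sup>+s\<in>{0<..x}. ennreal (N s) \<partial>lborel) \<le> ennreal (exp (q * x) / (q * r q))"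
proof -
  have "(\<integral>\<^sup>+s\<in>{0<..x}. ennreal (N s) \<partial>lborel) \<le>
      (\<integral>\<^sup>+t. ennreal (exp (q * x) / q) * (ennreal (q * exp (- q * t)) * (ennreal (N t) * indicator {0<..} t)) \<partial>lborel)"
  proof (rule nn_integral_mono)
    fix t :: real
    show "ennreal (N t) * indicator {0<..x} t \<le> ennreal (exp (q * x) / q) * (ennreal (q * exp (- q * t)) * (ennreal (N t) * indicator {0<..} t))"
    proof (cases "t \<in> {0<..x}")
      case True
      have "exp (q * x) / q * (q * exp (- q * t)) = exp (q * (x - t))"
        using q by (simp add: exp_diff exp_minus right_diff_distrib divide_inverse)
      moreover have "1 \<le> exp (q * (x - t))" using q True by simp
      ultimately have "1 \<le> exp (q * x) / q * (q * exp (- q * t))" by simp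
      then have "1 * N t \<le> exp (q * x) / q * (q * exp (- q * t)) * N t"
        using N_nonneg[of t] True by (intro mult_right_mono) auto
      then have "ennreal (N t) \<le> ennreal (exp (q * x) / q * (q * exp (- q * t)) * N t)" by (intro ennreal_leI) simp
      also have "\<dots> = ennreal (exp (q * x) / q) * (ennreal (q * exp (- q * t)) * ennreal (N t))"
        using q by (subst mult.assoc, subst ennreal_mult', simp, subst ennreal_mult', simp_all)
      finally show ?thesis using True by simp
    qed simp
  qed
  also have "\<dots> = ennreal (exp (q * x) / q) * ennreal (1 / r q)"
    unfolding Laplace_N[OF driftless q, symmetric] by (rule nn_integral_cmult) measurable
  also have "\<dots> = ennreal (exp (q * x) / (q * r q))" using q by (subst ennreal_mult'[symmetric]) auto
  finally show ?thesis .
qed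

lemma H_ennreal: "(\<integral>\<^sup>+s\<in>{0<..x}. ennreal (N s) \<partial>lborel) = ennreal (H x)"
proof (cases "0 \<le> x")
  case True
  from H_le_Laplace[OF order_refl True] show ?thesis
    unfolding H_def by (intro ennreal_enn2real[symmetric]) (auto simp: le_less_trans)
qed (simp add: H_def)

lemma H_nonneg: "0 \<le> H x" by (simp add: H_def)

lemma H_add:
  assumes "0 < x" "x \<le> z"
  shows "(z - x) * N z \<le> H z - H x" "H z - H x \<le> (z - x) * N x"
proof -
  have m: "(\<lambda>s. ennreal (N s) * indicator {x<..z} s) \<in> borel_measurable borel"
  proof -
    have "(\<lambda>s. ennreal (N s) * indicator {x<..z} s) = (\<lambda>s. (ennreal (N s) * indicator {0<..} s) * indicator {x<..z} s)"
      using assms by (auto simp: indicator_def)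
    then show ?thesis by simp
  qed
  have "ennreal (H z) = (\<integral>\<^sup>+s. ennreal (N s) * indicator {0<..x} s + ennreal (N s) * indicator {x<..z} s \<partial>lborel)"
    unfolding H_ennreal[symmetric] using assms by (intro nn_integral_cong) (auto simp: indicator_def)
  also have "\<dots> = ennreal (H x) + (\<integral>\<^sup>+s\<in>{x<..z}. ennreal (N s) \<partial>lborel)"
    unfolding H_ennreal[symmetric] using m by (intro nn_integral_add) auto
  finally have eq: "ennreal (H z) = ennreal (H x) + (\<integral>\<^sup>+s\<in>{x<..z}. ennreal (N s) \<partial>lborel)" .
  have "ennreal (N z) * ennreal (z - x) = (\<integral>\<^sup>+s. ennreal (N z) * indicator {x<..z} s \<partial>lborel)"
    using assms by (subst nn_integral_cmult_indicator) auto
  also have "\<dots> \<le> (\<integral>\<^sup>+s\<in>{x<..z}. ennreal (N s) \<partial>lborel)"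
    using assms by (intro nn_integral_mono) (auto simp: indicator_def intro!: ennreal_leI N_antimono)
  finally have "ennreal (H x + N z * (z - x)) \<le> ennreal (H z)"
    unfolding eq using assms H_nonneg N_nonneg[of z] by (simp add: ennreal_mult ennreal_plus)
  then show "(z - x) * N z \<le> H z - H x"
    using H_nonneg by (subst (asm) ennreal_le_iff) (auto simp: mult.commute)
  have "(\<integral>\<^sup>+s\<in>{x<..z}. ennreal (N s) \<partial>lborel) \<le> (\<integral>\<^sup>+s. ennreal (N x) * indicator {x<..z} s \<partial>lborel)"
    using assms by (intro nn_integral_mono) (auto simp: indicator_def intro!: ennreal_leI N_antimono)
  also have "\<dots> = ennreal (N x) * ennreal (z - x)"
    using assms by (subst nn_integral_cmult_indicator) auto
  finally have "ennreal (H z) \<le> ennreal (H x + N x * (z - x))"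
    unfolding eq using assms H_nonneg N_nonneg[of x] by (simp add: ennreal_mult ennreal_plus add_left_mono)
  then show "H z - H x \<le> (z - x) * N x"
    using H_nonneg[of x] N_nonneg[of x] assms by (subst (asm) ennreal_le_iff) (auto simp: mult.commute)
qed

lemma H_ge: assumes "0 < x" shows "x * N x \<le> H x"
proof -
  have "ennreal (N x) * ennreal x = (\<integral>\<^sup>+s. ennreal (N x) * indicator {0<..x} s \<partial>lborel)"
    using assms by (subst nn_integral_cmult_indicator) auto
  also have "\<dots> \<le> ennreal (H x)" unfolding H_ennreal[symmetric]
    using assms by (intro nn_integral_mono) (auto simp: indicator_def intro!: ennreal_leI N_antimono)
  finally have "ennreal (N x * x) \<le> ennreal (H x)" using assms N_nonneg[of x] by (simp add: ennreal_mult)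
  then show ?thesis using H_nonneg by (simp add: mult.commute)
qed

definition dN :: "real measure" where "dN = density lborel (\<lambda>s. ennreal (N s) * indicator {0<..} s)"

lemma sets_dN: "sets dN = sets borel" by (simp add: dN_def)

lemma Laplace_dN:
  assumes q: "1 \<le> q"
  shows "(\<integral>\<^sup>+x\<in>{0..}. ennreal (exp (- q * x)) \<partial>dN) = ennreal (1 / (q * r q))"
proof -
  have "(\<integral>\<^sup>+x\<in>{0..}. ennreal (exp (- q * x)) \<partial>dN) =
      (\<integral>\<^sup>+t. (ennreal (N t) * indicator {0<..} t) * (ennreal (exp (- q * t)) * indicator {0..} t) \<partial>lborel)"
    unfolding dN_def by (rule nn_integral_density) measurable
  also have "\<dots> = (\<integral>\<^sup>+t. ennreal (1 / q) * (ennreal (q * exp (- q * t)) * (ennreal (N t) * indicator {0<..} t)) \<partial>lborel)"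
  proof (rule nn_integral_cong)
    fix t :: real
    have "ennreal (exp (- q * t)) = ennreal (1 / q) * ennreal (q * exp (- q * t))"
      using q by (simp add: ennreal_mult'[symmetric])
    then show "(ennreal (N t) * indicator {0<..} t) * (ennreal (exp (- q * t)) * indicator {0..} t) =
        ennreal (1 / q) * (ennreal (q * exp (- q * t)) * (ennreal (N t) * indicator {0<..} t))"
      by (cases "0 < t") (simp_all add: mult_ac)
  qed
  also have "\<dots> = ennreal (1 / q) * ennreal (1 / r q)"
    unfolding Laplace_N[OF driftless q, symmetric] by (rule nn_integral_cmult) measurable
  finally show ?thesis using q by (simp add: ennreal_mult'[symmetric])
qed

lemma measure_dN: "measure dN {0..x} = H x"
proof -
  have "emeasure dN {0..x} = (\<integral>\<^sup>+s\<in>{0<..x}. ennreal (N s) \<partial>lborel)"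
  proof -
    have "emeasure dN {0..x} = (\<integral>\<^sup>+s. (ennreal (N s) * indicator {0<..} s) * indicator {0..x} s \<partial>lborel)"
      unfolding dN_def by (rule emeasure_density) simp_all
    also have "\<dots> = (\<integral>\<^sup>+s\<in>{0<..x}. ennreal (N s) \<partial>lborel)"
      by (intro nn_integral_cong) (auto simp: indicator_def)
    finally show ?thesis .
  qed
  then show ?thesis by (simp add: measure_def H_def)
qed

lemma Laplace_dU:
  assumes q: "1 \<le> q"
  shows "(\<integral>\<^sup>+x\<in>{0..}. ennreal (exp (- q * x)) \<partial>interval_measure U) = ennreal (r q)"
  using Laplace_Stieltjes[of U q] r_eq[OF q] q by (simp add: U_mono U_continuous_on U_nonpos)

lemma measure_dU: assumes "0 \<le> x" shows "measure (interval_measure U) {0..x} = U x"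
proof -
  have "emeasure (interval_measure U) {0..x} = ennreal (U x - U 0)"
    using assms by (intro emeasure_interval_measure_Icc) (auto simp: U_mono U_continuous_on)
  then show ?thesis using U_nonneg by (simp add: measure_def U_nonpos)
qed

end

section \<open>Regular variation at zero\<close>

text \<open>Squeezing by a family of bounds whose own limits become tight as the parameter \<open>\<eta>\<close> tends to \<open>0\<close>.\<close>

lemma tendsto_squeeze_family:
  fixes f :: "'x \<Rightarrow> real" and lo hi :: "real \<Rightarrow> 'x \<Rightarrow> real" and a b :: "real \<Rightarrow> real"
  assumes lo: "\<And>\<eta>. 0 < \<eta> \<Longrightarrow> \<eta> < 1/4 \<Longrightarrow> \<forall>\<^sub>F x in F. lo \<eta> x \<le> f x" "\<And>\<eta>. 0 < \<eta> \<Longrightarrow> \<eta> < 1/4 \<Longrightarrow> (lo \<eta> \<longlongrightarrow> a \<eta>) F"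
    and hi: "\<And>\<eta>. 0 < \<eta> \<Longrightarrow> \<eta> < 1/4 \<Longrightarrow> \<forall>\<^sub>F x in F. f x \<le> hi \<eta> x" "\<And>\<eta>. 0 < \<eta> \<Longrightarrow> \<eta> < 1/4 \<Longrightarrow> (hi \<eta> \<longlongrightarrow> b \<eta>) F"
    and lim: "(a \<longlongrightarrow> c) (at_right 0)" "(b \<longlongrightarrow> c) (at_right (0::real))"
  shows "(f \<longlongrightarrow> c) F"
proof (rule order_tendstoI)
  have small: "\<forall>\<^sub>F \<eta> in at_right 0. 0 < \<eta> \<and> \<eta> < (1/4::real)"
    by (intro eventually_at_rightI[of 0 "1/4"]) auto
  fix u assume u: "u < c"
  have "\<forall>\<^sub>F \<eta> in at_right 0. u < a \<eta>" using lim(1) u by (rule order_tendstoD)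
  with small have "\<forall>\<^sub>F \<eta> in at_right 0. u < a \<eta> \<and> 0 < \<eta> \<and> \<eta> < 1/4" by eventually_elim simp
  then obtain \<eta> where \<eta>: "u < a \<eta>" "0 < \<eta>" "\<eta> < 1/4" using eventually_happens[of _ "at_right (0::real)"] by auto
  have "\<forall>\<^sub>F x in F. u < lo \<eta> x" using lo(2)[OF \<eta>(2,3)] \<eta>(1) by (rule order_tendstoD)
  with lo(1)[OF \<eta>(2,3)] show "\<forall>\<^sub>F x in F. u < f x" by eventually_elim simp
next
  have small: "\<forall>\<^sub>F \<eta> in at_right 0. 0 < \<eta> \<and> \<eta> < (1/4::real)"
    by (intro eventually_at_rightI[of 0 "1/4"]) auto
  fix u assume u: "c < u"
  have "\<forall>\<^sub>F \<eta> in at_right 0. b \<eta> < u" using lim(2) u by (rule order_tendstoD)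
  with small have "\<forall>\<^sub>F \<eta> in at_right 0. b \<eta> < u \<and> 0 < \<eta> \<and> \<eta> < 1/4" by eventually_elim simp
  then obtain \<eta> where \<eta>: "b \<eta> < u" "0 < \<eta>" "\<eta> < 1/4" using eventually_happens[of _ "at_right (0::real)"] by auto
  have "\<forall>\<^sub>F x in F. hi \<eta> x < u" using hi(2)[OF \<eta>(2,3)] \<eta>(1) by (rule order_tendstoD)
  with hi(1)[OF \<eta>(2,3)] show "\<forall>\<^sub>F x in F. f x < u" by eventually_elim simp
qed

lemma powr_slope_right: "((\<lambda>\<eta>. ((1 + \<eta>) powr \<rho> - 1) / \<eta>) \<longlongrightarrow> \<rho>) (at_right (0::real))"
proof -
  have "((\<lambda>x. x powr \<rho>) has_field_derivative \<rho>) (at 1)"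
    by (auto intro!: derivative_eq_intros)
  then have "((\<lambda>\<eta>. ((1 + \<eta>) powr \<rho> - 1 powr \<rho>) / \<eta>) \<longlongrightarrow> \<rho>) (at 0)" by (simp only: DERIV_def)
  then have "((\<lambda>\<eta>. ((1 + \<eta>) powr \<rho> - 1) / \<eta>) \<longlongrightarrow> \<rho>) (at 0)" by simp
  then show ?thesis by (rule filterlim_mono) (auto simp: at_le)
qed

lemma powr_slope_left: "((\<lambda>\<eta>. (1 - (1 - \<eta>) powr \<rho>) / \<eta>) \<longlongrightarrow> \<rho>) (at_right (0::real))"
proof -
  have "((\<lambda>x. x powr \<rho>) has_field_derivative \<rho>) (at 1)"
    by (auto intro!: derivative_eq_intros)
  then have "((\<lambda>\<eta>. ((1 + \<eta>) powr \<rho> - 1 powr \<rho>) / \<eta>) \<longlongrightarrow> \<rho>) (at 0)" by (simp only: DERIV_def)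
  then have "((\<lambda>\<eta>. ((1 + \<eta>) powr \<rho> - 1) / \<eta>) \<longlongrightarrow> \<rho>) (at 0)" by simp
  moreover have "filterlim (\<lambda>\<eta>. - \<eta>) (at 0) (at_right (0::real))"
    by (auto simp: filterlim_at intro!: tendsto_eq_intros eventually_at_rightI[of 0 1])
  ultimately have "((\<lambda>\<eta>. ((1 + - \<eta>) powr \<rho> - 1) / (- \<eta>)) \<longlongrightarrow> \<rho>) (at_right 0)" by (rule filterlim_compose)
  then show ?thesis by (simp add: minus_divide_right[symmetric] minus_divide_left)
qed

lemma filterlim_times_at_right_0: "0 < c \<Longrightarrow> filterlim (\<lambda>x. c * x) (at_right 0) (at_right (0::real))"
  by (auto simp: filterlim_at intro!: tendsto_eq_intros eventually_at_rightI[of 0 1])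

lemma filterlim_inverse_at_top: "filterlim (\<lambda>q. 1 / q) (at_right (0::real)) at_top"
  using filterlim_inverse_at_right_top by (simp add: inverse_eq_divide)

lemma filterlim_inverse_at_right_0: "filterlim (\<lambda>x. 1 / x) at_top (at_right (0::real))"
  using filterlim_inverse_at_top_right by (simp add: inverse_eq_divide)

definition regularly_varying_0 :: "(real \<Rightarrow> real) \<Rightarrow> real \<Rightarrow> bool" where
  "regularly_varying_0 V \<rho> \<longleftrightarrow> (\<forall>x>0. 0 < V x) \<and> (\<forall>c>0. ((\<lambda>x. V (c * x) / V x) \<longlongrightarrow> c powr \<rho>) (at_right 0))"

lemma rv_pos: "regularly_varying_0 V \<rho> \<Longrightarrow> 0 < x \<Longrightarrow> 0 < V x"
  and rv_ratio: "regularly_varying_0 V \<rho> \<Longrightarrow> 0 < c \<Longrightarrow> ((\<lambda>x. V (c * x) / V x) \<longlongrightarrow> c powr \<rho>) (at_right 0)"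
  by (auto simp: regularly_varying_0_def)

lemma eventually_pos_at_right_0: "\<forall>\<^sub>F x in at_right (0::real). 0 < x"
  by (intro eventually_at_rightI[of 0 1]) auto

lemma rv_bigtheta:
  assumes V: "regularly_varying_0 V \<rho>" and c: "0 < c"
  shows "(\<lambda>x. V (c * x)) \<in> \<Theta>[at_right 0](V)"
proof (rule bigthetaI_tendsto[OF _ rv_ratio[OF V c]])
  show "c powr \<rho> \<noteq> 0" using c by simp
qed

lemma Laplace_upper_bound:
  assumes \<mu> [measurable_cong]: "sets \<mu> = sets borel"
    and \<phi>: "(\<integral>\<^sup>+x\<in>{0..}. ennreal (exp (- q * x)) \<partial>\<mu>) = ennreal \<phi>" and q: "0 < q" and x: "0 \<le> x" and \<phi>0: "0 \<le> \<phi>"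
  shows "emeasure \<mu> {0..x} \<le> ennreal (exp (q * x) * \<phi>)"
proof -
  have "emeasure \<mu> {0..x} = (\<integral>\<^sup>+y. indicator {0..x} y \<partial>\<mu>)" by simp
  also have "\<dots> \<le> (\<integral>\<^sup>+y. ennreal (exp (q * x)) * (ennreal (exp (- q * y)) * indicator {0..} y) \<partial>\<mu>)"
  proof (intro nn_integral_mono)
    fix y
    have "ennreal 1 \<le> ennreal (exp (q * x) * exp (- q * y))" if "y \<le> x"
      using that q by (intro ennreal_leI) (simp add: exp_add[symmetric])
    then show "indicator {0..x} y \<le> ennreal (exp (q * x)) * (ennreal (exp (- q * y)) * indicator {0..} y)"
      by (auto simp: indicator_def ennreal_mult')
  qed
  also have "\<dots> = ennreal (exp (q * x)) * ennreal \<phi>" unfolding \<phi>[symmetric] by (rule nn_integral_cmult) measurable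
  finally show ?thesis using \<phi>0 by (simp add: ennreal_mult)
qed

lemma Laplace_lower_bound:
  assumes \<mu> [measurable_cong]: "sets \<mu> = sets borel"
    and \<phi>: "(\<integral>\<^sup>+x\<in>{0..}. ennreal (exp (- q * x)) \<partial>\<mu>) = ennreal \<phi>1" "(\<integral>\<^sup>+x\<in>{0..}. ennreal (exp (- (q / 2) * x)) \<partial>\<mu>) = ennreal \<phi>2"
    and q: "0 < q" and x: "0 \<le> x" and \<phi>0: "0 \<le> \<phi>1" "0 \<le> \<phi>2"
  shows "\<phi>1 \<le> measure \<mu> {0..x} + exp (- (q * x / 2)) * \<phi>2"
proof -
  have fin: "emeasure \<mu> {0..x} \<noteq> top"
    using Laplace_upper_bound[OF \<mu> \<phi>(1) q x \<phi>0(1)] by (auto simp: top_unique)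
  have "ennreal \<phi>1 \<le> (\<integral>\<^sup>+y. indicator {0..x} y + ennreal (exp (- (q * x / 2))) * (ennreal (exp (- (q / 2) * y)) * indicator {0..} y) \<partial>\<mu>)"
    unfolding \<phi>(1)[symmetric]
  proof (intro nn_integral_mono)
    fix y
    show "ennreal (exp (- q * y)) * indicator {0..} y \<le> indicator {0..x} y + ennreal (exp (- (q * x / 2))) * (ennreal (exp (- (q / 2) * y)) * indicator {0..} y)"
    proof (cases "y \<le> x")
      case True
      show ?thesis
      proof (cases "0 \<le> y")
        case y: True
        have "ennreal (exp (- q * y)) \<le> 1" using y q by simp
        also have "1 \<le> 1 + ennreal (exp (- (q * x / 2))) * ennreal (exp (- (q / 2) * y))" by simp
        finally show ?thesis using True y by simp
      qed simp
    next
      case False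
      then have "q * x \<le> q * y" using q by simp
      then have "exp (- q * y) \<le> exp (- (q * x / 2)) * exp (- (q / 2) * y)" by (simp add: exp_add[symmetric])
      then have "ennreal (exp (- q * y)) \<le> ennreal (exp (- (q * x / 2))) * ennreal (exp (- (q / 2) * y))"
        by (simp add: ennreal_mult'[symmetric] ennreal_leI)
      then show ?thesis using False x by simp
    qed
  qed
  also have "\<dots> = emeasure \<mu> {0..x} + ennreal (exp (- (q * x / 2))) * ennreal \<phi>2"
    unfolding \<phi>(2)[symmetric] by (subst nn_integral_add) (auto simp: nn_integral_cmult)
  also have "\<dots> = ennreal (measure \<mu> {0..x} + exp (- (q * x / 2)) * \<phi>2)"
    using fin \<phi>0 by (simp add: emeasure_eq_ennreal_measure ennreal_mult ennreal_plus)
  finally show ?thesis using \<phi>0 by (subst (asm) ennreal_le_iff) auto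
qed

text \<open>\<open>Karamata_Tauberian\<close> in terms of a regularly varying function of \<open>x = 1 / q\<close>.\<close>

theorem Karamata_Tauberian_0:
  assumes \<mu>: "sets \<mu> = sets borel"
    and \<phi>: "\<And>q. q \<ge> 1 \<Longrightarrow> (\<integral>\<^sup>+x\<in>{0..}. ennreal (exp (- q * x)) \<partial>\<mu>) = ennreal (\<phi> q)"
    and \<phi>_pos: "\<And>q. q \<ge> 1 \<Longrightarrow> 0 < \<phi> q"
    and V: "regularly_varying_0 V \<rho>" and \<rho>: "0 < \<rho>"
    and lim: "((\<lambda>x. \<phi> (1 / x) / V x) \<longlongrightarrow> 1) (at_right 0)"
  shows "((\<lambda>x. measure \<mu> {0..x} / V x) \<longlongrightarrow> 1 / Gamma (\<rho> + 1)) (at_right 0)"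
proof -
  have ratio: "((\<lambda>q. \<phi> (real (Suc k) * q) / \<phi> q) \<longlongrightarrow> real (Suc k) powr (- \<rho>)) at_top" for k :: nat
  proof -
    define c where "c = 1 / real (Suc k)"
    have c: "0 < c" by (simp add: c_def)
    have "((\<lambda>x. (\<phi> (1 / (c * x)) / V (c * x)) * (V (c * x) / V x) / (\<phi> (1 / x) / V x)) \<longlongrightarrow> 1 * c powr \<rho> / 1) (at_right 0)"
      by (intro tendsto_divide tendsto_mult filterlim_compose[OF lim filterlim_times_at_right_0[OF c]] rv_ratio[OF V c] lim) simp
    then have "((\<lambda>q. (\<phi> (1 / (c * (1 / q))) / V (c * (1 / q))) * (V (c * (1 / q)) / V (1 / q)) / (\<phi> (1 / (1 / q)) / V (1 / q))) \<longlongrightarrow> 1 * c powr \<rho> / 1) at_top"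
      by (rule filterlim_compose[OF _ filterlim_inverse_at_top])
    moreover have "\<forall>\<^sub>F q in at_top. (\<phi> (1 / (c * (1 / q))) / V (c * (1 / q))) * (V (c * (1 / q)) / V (1 / q)) / (\<phi> (1 / (1 / q)) / V (1 / q)) = \<phi> (real (Suc k) * q) / \<phi> q"
      using eventually_gt_at_top[of 0]
    proof eventually_elim
      case (elim q)
      have e: "1 / (c * (1 / q)) = real (Suc k) * q" by (simp add: c_def)
      have "0 < V (c * (1 / q))" "0 < V (1 / q)" using rv_pos[OF V] c elim by auto
      then show ?case unfolding e by simp
    qed
    ultimately have "((\<lambda>q. \<phi> (real (Suc k) * q) / \<phi> q) \<longlongrightarrow> 1 * c powr \<rho> / 1) at_top"
      by (blast intro: Lim_transform_eventually)
    also have "1 * c powr \<rho> / 1 = real (Suc k) powr (- \<rho>)" by (simp add: c_def powr_minus powr_divide inverse_eq_divide)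
    finally show ?thesis .
  qed
  have "((\<lambda>q. measure \<mu> {0..1 / q} / \<phi> q) \<longlongrightarrow> 1 / Gamma (\<rho> + 1)) at_top"
    by (rule Karamata_Tauberian[OF \<mu> \<phi> \<phi>_pos ratio \<rho>])
  then have "((\<lambda>x. measure \<mu> {0..1 / (1 / x)} / \<phi> (1 / x)) \<longlongrightarrow> 1 / Gamma (\<rho> + 1)) (at_right 0)"
    by (rule filterlim_compose[OF _ filterlim_inverse_at_right_0])
  from tendsto_mult[OF this lim]
  have "((\<lambda>x. measure \<mu> {0..x} / \<phi> (1 / x) * (\<phi> (1 / x) / V x)) \<longlongrightarrow> 1 / Gamma (\<rho> + 1)) (at_right 0)" by simp
  moreover have "\<forall>\<^sub>F x in at_right 0. measure \<mu> {0..x} / \<phi> (1 / x) * (\<phi> (1 / x) / V x) = measure \<mu> {0..x} / V x"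
  proof -
    have "\<forall>\<^sub>F x in at_right 0. 0 < x \<and> x < (1::real)" by (intro eventually_at_rightI[of 0 1]) auto
    then show ?thesis
    proof eventually_elim
      case (elim x)
      have "0 < \<phi> (1 / x)" using elim by (intro \<phi>_pos) simp
      then show ?case by simp
    qed
  qed
  ultimately show ?thesis by (blast intro: Lim_transform_eventually)
qed

text \<open>The upper bound is Markov's inequality for the exponential. For the lower one, the contribution of
  \<open>(\<Lambda>y, \<infinity>)\<close> is at most \<open>exp (- \<Lambda> / 2)\<close> times the transform at half the argument, which regular variation
  makes negligible for large \<open>\<Lambda>\<close>.\<close>

theorem O_Tauberian_0:
  assumes \<mu>: "sets \<mu> = sets borel"
    and \<phi>: "\<And>q. q \<ge> 1 \<Longrightarrow> (\<integral>\<^sup>+x\<in>{0..}. ennreal (exp (- q * x)) \<partial>\<mu>) = ennreal (\<phi> q)"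
    and \<phi>_pos: "\<And>q. q \<ge> 1 \<Longrightarrow> 0 < \<phi> q"
    and V: "regularly_varying_0 V \<rho>"
    and \<Theta>: "(\<lambda>x. \<phi> (1 / x)) \<in> \<Theta>[at_right 0](V)"
  shows "(\<lambda>x. measure \<mu> {0..x}) \<in> \<Theta>[at_right 0](V)"
proof (rule bigthetaI)
  have small: "\<forall>\<^sub>F x in at_right 0. 0 < x \<and> x < d" if "0 < d" for d :: real
    using that by (intro eventually_at_rightI[of 0 d]) auto
  have "(\<lambda>x. measure \<mu> {0..x}) \<in> O[at_right 0](\<lambda>x. \<phi> (1 / x))"
  proof (rule bigoI[of _ "exp 1"])
    show "\<forall>\<^sub>F x in at_right 0. norm (measure \<mu> {0..x}) \<le> exp 1 * norm (\<phi> (1 / x))"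
      using small[of 1, OF zero_less_one]
    proof eventually_elim
      case (elim x)
      have q: "1 \<le> 1 / x" using elim by simp
      have "emeasure \<mu> {0..x} \<le> ennreal (exp (1 / x * x) * \<phi> (1 / x))"
        using elim \<phi>_pos[OF q] by (intro Laplace_upper_bound[OF \<mu> \<phi>[OF q]]) auto
      then have "measure \<mu> {0..x} \<le> exp (1 / x * x) * \<phi> (1 / x)"
        using \<phi>_pos[OF q] unfolding measure_def by (intro enn2real_leI) auto
      then show ?case using elim \<phi>_pos[OF q] by simp
    qed
  qed
  also have "(\<lambda>x. \<phi> (1 / x)) \<in> O[at_right 0](V)" using \<Theta> by (rule bigthetaD1)
  finally show "(\<lambda>x. measure \<mu> {0..x}) \<in> O[at_right 0](V)" .
  obtain c2 where c2: "0 < c2" "\<forall>\<^sub>F x in at_right 0. norm (\<phi> (1 / x)) \<le> c2 * norm (V x)"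
    by (rule landau_o.bigE[OF bigthetaD1[OF \<Theta>]])
  obtain c1 where c1: "0 < c1" "\<forall>\<^sub>F x in at_right 0. norm (\<phi> (1 / x)) \<ge> c1 * norm (V x)"
    by (rule landau_omega.bigE[OF bigthetaD2[OF \<Theta>]])
  note c = c1(1) c2(1) c1(2) c2(2)
  have "((\<lambda>\<Lambda>::real. exp (- \<Lambda> / 2)) \<longlongrightarrow> 0) at_top" by real_asymp
  then have "\<forall>\<^sub>F \<Lambda> in at_top. exp (- \<Lambda> / 2) < c1 / (2 * c2 * (2 powr \<rho> + 1))"
    using c by (intro order_tendstoD) (auto intro!: divide_pos_pos mult_pos_pos add_pos_pos)
  then have "\<forall>\<^sub>F \<Lambda> in at_top. exp (- \<Lambda> / 2) < c1 / (2 * c2 * (2 powr \<rho> + 1)) \<and> 2 \<le> \<Lambda>"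
    using eventually_ge_at_top[of 2] by eventually_elim simp
  then obtain \<Lambda> where \<Lambda>: "exp (- \<Lambda> / 2) < c1 / (2 * c2 * (2 powr \<rho> + 1))" "2 \<le> \<Lambda>"
    using eventually_happens[of _ "at_top :: real filter"] by auto
  have "(\<lambda>y. V y) \<in> O[at_right 0](\<lambda>y. measure \<mu> {0..\<Lambda> * y})"
  proof (rule bigoI[of _ "2 / c1"])
    have "\<forall>\<^sub>F y in at_right 0. V (2 * y) / V y < 2 powr \<rho> + 1"
      using rv_ratio[OF V, of 2] by (rule order_tendstoD) auto
    moreover have "\<forall>\<^sub>F y in at_right 0. norm (\<phi> (1 / (2 * y))) \<le> c2 * norm (V (2 * y))"
      using c(4) filterlim_times_at_right_0[of 2] by (auto simp: filterlim_iff)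
    moreover have "\<forall>\<^sub>F y in at_right 0. 0 < y \<and> y < (1 / 2::real)" by (rule small) simp
    ultimately show "\<forall>\<^sub>F y in at_right 0. norm (V y) \<le> 2 / c1 * norm (measure \<mu> {0..\<Lambda> * y})"
      using c(3)
    proof eventually_elim
      case (elim y)
      have Vy: "0 < V y" "0 < V (2 * y)" using rv_pos[OF V] elim by auto
      have q: "1 \<le> 1 / y" "1 \<le> 1 / (2 * y)" using elim by auto
      have p: "0 < \<phi> (1 / y)" "0 < \<phi> (1 / (2 * y))" using \<phi>_pos q by auto
      have "\<phi> (1 / y) \<le> measure \<mu> {0..\<Lambda> * y} + exp (- (1 / y * (\<Lambda> * y) / 2)) * \<phi> (1 / (2 * y))"
      proof (rule Laplace_lower_bound[OF \<mu> \<phi>[OF q(1)]])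
        show "(\<integral>\<^sup>+x\<in>{0..}. ennreal (exp (- (1 / y / 2) * x)) \<partial>\<mu>) = ennreal (\<phi> (1 / (2 * y)))"
          using \<phi>[OF q(2)] by (simp add: mult.commute)
      qed (use elim \<Lambda> p in auto)
      also have "exp (- (1 / y * (\<Lambda> * y) / 2)) * \<phi> (1 / (2 * y)) \<le> c1 / (2 * c2 * (2 powr \<rho> + 1)) * (c2 * ((2 powr \<rho> + 1) * V y))"
      proof (rule mult_mono)
        show "exp (- (1 / y * (\<Lambda> * y) / 2)) \<le> c1 / (2 * c2 * (2 powr \<rho> + 1))" using \<Lambda> elim by simp
        have "V (2 * y) \<le> (2 powr \<rho> + 1) * V y" using elim(1) Vy by (simp add: divide_less_eq)
        then have "c2 * V (2 * y) \<le> c2 * ((2 powr \<rho> + 1) * V y)" using c by (intro mult_left_mono) auto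
        then show "\<phi> (1 / (2 * y)) \<le> c2 * ((2 powr \<rho> + 1) * V y)" using elim(2) p Vy by simp
        have "0 < 2 powr \<rho> + (1::real)" by (intro add_pos_pos) auto
        then show "0 \<le> c1 / (2 * c2 * (2 powr \<rho> + 1))" using c by simp
      qed (use p in simp)
      also have "c1 / (2 * c2 * (2 powr \<rho> + 1)) * (c2 * ((2 powr \<rho> + 1) * V y)) = c1 / 2 * V y"
      proof -
        have "c1 / (2 * c2 * P) * (c2 * (P * v)) = c1 / 2 * v" if "0 < P" for P v :: real
          using that c(2) by (simp add: field_simps)
        moreover have "0 < 2 powr \<rho> + (1::real)" by (intro add_pos_pos) auto
        ultimately show ?thesis by blast
      qed
      finally have "\<phi> (1 / y) \<le> measure \<mu> {0..\<Lambda> * y} + c1 / 2 * V y" by simp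
      moreover have "c1 * V y \<le> \<phi> (1 / y)" using elim(4) p Vy by simp
      ultimately have "c1 * V y / 2 \<le> measure \<mu> {0..\<Lambda> * y}" by simp
      then show ?case using c Vy by (simp add: field_simps)
    qed
  qed
  then have "(\<lambda>x. V (1 / \<Lambda> * x)) \<in> O[at_right 0](\<lambda>x. measure \<mu> {0..\<Lambda> * (1 / \<Lambda> * x)})"
    by (rule landau_o.big.compose) (rule filterlim_times_at_right_0, use \<Lambda> in simp)
  then have "(\<lambda>x. V (1 / \<Lambda> * x)) \<in> O[at_right 0](\<lambda>x. measure \<mu> {0..x})" using \<Lambda> by simp
  moreover have "V \<in> O[at_right 0](\<lambda>x. V (1 / \<Lambda> * x))"
    using rv_bigtheta[OF V, of "1 / \<Lambda>"] \<Lambda> by (intro bigthetaD1) (simp add: bigtheta_sym)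
  ultimately have "V \<in> O[at_right 0](\<lambda>x. measure \<mu> {0..x})" by (rule landau_o.big_trans[rotated])
  then show "(\<lambda>x. measure \<mu> {0..x}) \<in> \<Omega>[at_right 0](V)" by (simp add: bigomega_iff_bigo)
qed

section \<open>Drift and slopes of the potential\<close>

text \<open>With index \<open>\<alpha> < 1\<close>, \<open>V(x) / x\<close> grows geometrically along \<open>x = x0 / 2\<^sup>n\<close>.\<close>

lemma (in resolvent_clock) driftless_if_regularly_varying:
  assumes V: "regularly_varying_0 V \<alpha>" and \<alpha>: "\<alpha> < 1"
    and \<Theta>: "(\<lambda>x. r (1 / x)) \<in> \<Theta>[at_right 0](V)"
  shows "filterlim (\<lambda>q. q * r q) at_top at_top"
proof -
  define w where "w x = V x / x" for x
  (* Halving x multiplies V x / x by nearly 2 powr (1 - \<alpha>) > \<rho> > 1. *)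
  define \<rho> where "\<rho> = (2 powr (1 - \<alpha>) + 1) / 2"
  have two: "1 < 2 powr (1 - \<alpha>)" using \<alpha> by simp
  have \<rho>: "1 < \<rho>" "\<rho> < 2 powr (1 - \<alpha>)" using two by (auto simp: \<rho>_def)
  obtain c where c: "0 < c" "\<forall>\<^sub>F x in at_right 0. norm (r (1 / x)) \<ge> c * norm (V x)"
    by (rule landau_omega.bigE[OF bigthetaD2[OF \<Theta>]])
  have "((\<lambda>x. 2 * (V (1/2 * x) / V x)) \<longlongrightarrow> 2 * (1/2) powr \<alpha>) (at_right 0)"
    by (intro tendsto_intros rv_ratio[OF V]) simp
  moreover have "2 * (1/2) powr \<alpha> = 2 powr (1 - \<alpha>)" by (simp add: powr_diff powr_divide)
  ultimately have "\<forall>\<^sub>F x in at_right 0. \<rho> < 2 * (V (1/2 * x) / V x)" using \<rho> by (intro order_tendstoD) auto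
  with c(2) have "\<forall>\<^sub>F x in at_right 0. \<rho> < 2 * (V (1/2 * x) / V x) \<and> norm (r (1 / x)) \<ge> c * norm (V x)"
    by eventually_elim simp
  then obtain b where b: "0 < b" "\<And>x. 0 < x \<Longrightarrow> x < b \<Longrightarrow> \<rho> < 2 * (V (1/2 * x) / V x) \<and> norm (r (1 / x)) \<ge> c * norm (V x)"
    unfolding eventually_at_right_field by auto
  define x0 where "x0 = min (b / 2) 1"
  have x0: "0 < x0" "x0 < b" "x0 \<le> 1" using b by (auto simp: x0_def)
  have xn: "0 < x0 / 2 ^ n" "x0 / 2 ^ n < b" "x0 / 2 ^ n \<le> 1" for n :: nat
  proof -
    have "x0 / 2 ^ n \<le> x0 / 1" using x0 by (intro divide_left_mono) auto
    moreover have "0 < x0 / 2 ^ n" using x0 by simp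
    ultimately show "0 < x0 / 2 ^ n" "x0 / 2 ^ n < b" "x0 / 2 ^ n \<le> 1" using x0 by linarith+
  qed
  have wpos: "0 < w x" if "0 < x" for x using rv_pos[OF V that] that by (simp add: w_def)
  have grow: "\<rho> ^ n * w x0 \<le> w (x0 / 2 ^ n)" for n
  proof (induction n)
    case (Suc n)
    let ?x = "x0 / 2 ^ n"
    have "\<rho> < 2 * (V (1/2 * ?x) / V ?x)" using b(2)[OF xn(1,2)[of n]] by simp
    then have "\<rho> * w ?x \<le> 2 * V (1/2 * ?x) / ?x"
      using rv_pos[OF V xn(1)[of n]] xn(1)[of n] by (simp add: w_def field_simps)
    also have "\<dots> = w (x0 / 2 ^ Suc n)" by (simp add: w_def)
    finally have "\<rho> * w ?x \<le> w (x0 / 2 ^ Suc n)" .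
    moreover have "\<rho> * (\<rho> ^ n * w x0) \<le> \<rho> * w ?x" using Suc \<rho> by (intro mult_left_mono) auto
    ultimately show ?case by simp
  qed simp
  show ?thesis
    unfolding filterlim_at_top
  proof
    fix Z :: real
    obtain n where n: "\<rho> ^ n \<ge> Z / (c * w x0)" using real_arch_pow[OF \<rho>(1)] less_imp_le by blast
    define q where "q = 1 / (x0 / 2 ^ n)"
    have "1 \<le> 1 / y" if "0 < y" "y \<le> 1" for y :: real using that by simp
    from this[OF xn(1,3)[of n]] have q: "1 \<le> q" by (simp only: q_def)
    have "Z \<le> c * (\<rho> ^ n * w x0)" using n c wpos[OF x0(1)] by (simp add: field_simps)
    also have "\<dots> \<le> c * w (x0 / 2 ^ n)" using grow c by (intro mult_left_mono) auto
    also have "\<dots> \<le> q * r q"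
    proof -
      have "c * norm (V (x0 / 2 ^ n)) \<le> norm (r q)" using b(2)[OF xn(1,2)[of n]] by (simp add: q_def)
      then have "c * V (x0 / 2 ^ n) \<le> r q" using r_pos[OF q] rv_pos[OF V xn(1)[of n]] by simp
      then have "q * (c * V (x0 / 2 ^ n)) \<le> q * r q" using q by (intro mult_left_mono) auto
      then show ?thesis by (simp add: w_def q_def field_simps)
    qed
    finally have "Z \<le> q * r q" .
    then have "Z \<le> p * r p" if "q \<le> p" for p using qr_mono[OF q that] by linarith
    then show "\<forall>\<^sub>F p in at_top. Z \<le> p * r p" by (rule eventually_mono[OF eventually_ge_at_top])
  qed
qed

lemma rv_dual:
  assumes V: "regularly_varying_0 V \<alpha>" shows "regularly_varying_0 (\<lambda>x. x / V x) (1 - \<alpha>)"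
  unfolding regularly_varying_0_def
proof (intro conjI allI impI)
  show "0 < x / V x" if "0 < x" for x using rv_pos[OF V that] that by simp
  fix c :: real assume c: "0 < c"
  have "((\<lambda>x. c / (V (c * x) / V x)) \<longlongrightarrow> c / c powr \<alpha>) (at_right 0)"
    using c by (intro tendsto_divide tendsto_const rv_ratio[OF V]) auto
  moreover have "\<forall>\<^sub>F x in at_right 0. c / (V (c * x) / V x) = (c * x / V (c * x)) / (x / V x)"
    using eventually_pos_at_right_0
  proof eventually_elim
    case (elim x)
    then show ?case using rv_pos[OF V, of x] rv_pos[OF V, of "c * x"] c by (simp add: field_simps)
  qed
  ultimately have "((\<lambda>x. (c * x / V (c * x)) / (x / V x)) \<longlongrightarrow> c / c powr \<alpha>) (at_right 0)"
    by (blast intro: Lim_transform_eventually)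
  then show "((\<lambda>x. (c * x / V (c * x)) / (x / V x)) \<longlongrightarrow> c powr (1 - \<alpha>)) (at_right 0)"
    using c by (simp add: powr_diff)
qed

text \<open>For decreasing increments, difference quotients decrease as well; a commensurability argument replaces
  concavity, which is known only through increments of equal length.\<close>

lemma slope_compare:
  fixes U :: "real \<Rightarrow> real"
  assumes mono: "\<And>s t. s \<le> t \<Longrightarrow> U s \<le> U t"
    and dec: "\<And>x y h. 0 < x \<Longrightarrow> x \<le> y \<Longrightarrow> 0 \<le> h \<Longrightarrow> U (y + h) - U y \<le> U (x + h) - U x"
    and x: "0 < x" "0 < h" "x + h \<le> y" and k: "0 \<le> k"
  shows "(U (y + k) - U y) * h \<le> k * (U (x + h) - U x)"
proof -
  define DX where "DX = U (x + h) - U x"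
  have DX: "0 \<le> DX" using mono[of x "x + h"] x by (simp add: DX_def)
  have bound: "U (y + k) - U y \<le> (k / h + 1 / real (Suc n)) * DX" for n
  proof -
    (* Both intervals are cut into pieces of length h / (n + 1); the rounding error vanishes. *)
    define \<delta> where "\<delta> = h / real (Suc n)"
    define m where "m = nat \<lceil>k / \<delta>\<rceil>"
    have \<delta>: "0 < \<delta>" "real (Suc n) * \<delta> = h" using x by (auto simp: \<delta>_def)
    have kd: "0 \<le> k / \<delta>" using k \<delta> by simp
    then have m: "real m = of_int \<lceil>k / \<delta>\<rceil>" by (simp add: m_def)
    have m1: "k \<le> real m * \<delta>"
    proof -
      have "k / \<delta> \<le> real m" unfolding m by (rule le_of_int_ceiling)
      then show ?thesis using \<delta> by (simp add: field_simps)
    qed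
    have m2: "real m \<le> k / \<delta> + 1" unfolding m by linarith
    define I where "I = U (y + \<delta>) - U y"
    have I: "0 \<le> I" using mono[of y "y + \<delta>"] \<delta> by (simp add: I_def)
    have up: "U (y + real j * \<delta>) - U y \<le> real j * I" for j
    proof (induction j)
      case (Suc j)
      have "U (y + real j * \<delta> + \<delta>) - U (y + real j * \<delta>) \<le> U (y + \<delta>) - U y"
        using x \<delta> by (intro dec) auto
      then show ?case using Suc by (simp add: I_def algebra_simps)
    qed simp
    have low: "real j * I \<le> U (x + real j * \<delta>) - U x" if "j \<le> Suc n" for j
      using that
    proof (induction j)
      case (Suc j)
      have "real j * \<delta> \<le> real (Suc n) * \<delta>" using Suc.prems \<delta> by (intro mult_right_mono) auto
      then have "x + real j * \<delta> \<le> y" unfolding \<delta>(2) using x by linarith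
      then have "I \<le> U (x + real j * \<delta> + \<delta>) - U (x + real j * \<delta>)"
        unfolding I_def using x \<delta> by (intro dec) (auto intro: add_pos_nonneg)
      then show ?case using Suc by (simp add: algebra_simps)
    qed simp
    have nI: "real (Suc n) * I \<le> DX" using low[of "Suc n"] \<delta> by (simp add: DX_def)
    have "U (y + k) - U y \<le> U (y + real m * \<delta>) - U y" using mono[of "y + k" "y + real m * \<delta>"] m1 by simp
    also have "\<dots> \<le> real m * I" by (rule up)
    also have "\<dots> \<le> (k / \<delta> + 1) * I" using m2 I by (rule mult_right_mono)
    also have "\<dots> = (k / h + 1 / real (Suc n)) * (real (Suc n) * I)"
      using x by (simp add: \<delta>_def field_simps del: of_nat_Suc)
    also have "\<dots> \<le> (k / h + 1 / real (Suc n)) * DX" using nI k x by (intro mult_left_mono) auto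
    finally show ?thesis .
  qed
  have "(\<lambda>n. (k / h + 1 / real (Suc n)) * DX) \<longlonglongrightarrow> (k / h + 0) * DX"
    by (intro tendsto_intros one_over_Suc_tendsto)
  then have "U (y + k) - U y \<le> (k / h + 0) * DX" by (rule LIMSEQ_le_const) (use bound in auto)
  then show ?thesis using x by (simp add: DX_def field_simps)
qed

context driftless_clock
begin

text \<open>The last visit is at least \<open>t - d\<close> if and only if, up to boundary cases, the clock increases in the last
  \<open>d\<close> units of time. The slope of the concave \<open>U\<close> there is bounded from below by a difference quotient to the
  right of \<open>t\<close>, from above by one to the left.\<close>

lemma late_bounds:
  assumes dec: "\<And>x y h. 0 < x \<Longrightarrow> x \<le> y \<Longrightarrow> 0 \<le> h \<Longrightarrow> U (y + h) - U y \<le> U (x + h) - U x"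
    and t: "0 < t" and d: "0 < d" "d < t" and \<kappa>: "0 < \<kappa>"
  shows "(U ((1 + \<kappa>) * t) - U t) / (\<kappa> * t) * H d \<le> prob {w\<in>space M. t - d \<le> last_visit A t w}"
    and "0 < \<eta> \<Longrightarrow> \<eta> < 1/4 \<Longrightarrow> (1 + \<eta>) * d \<le> \<eta> * t \<Longrightarrow>
      prob {w\<in>space M. t - d \<le> last_visit A t w} \<le>
      (U ((1 - \<eta>) * t) - U ((1 - 2 * \<eta>) * t)) / (\<eta> * t) * H ((1 + 2 * \<eta>) * d)"
proof -
  note sc = slope_compare[where U=U, OF U_mono dec]
  let ?P = "prob {w\<in>space M. t - d \<le> last_visit A t w}"
  let ?D = "(U ((1 + \<kappa>) * t) - U t) / (\<kappa> * t)"
  have D: "0 \<le> ?D" using U_mono[of t "(1 + \<kappa>) * t"] t \<kappa> by (simp add: algebra_simps)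
  have "ennreal ?D * (\<integral>\<^sup>+s\<in>{0<..t - (t - d)}. ennreal (N s) \<partial>lborel) \<le> ennreal (prob {w\<in>space M. A (t - d) w < A t w})"
  proof (rule increase_lower[OF _ _ D])
    fix a b assume ab: "t - d \<le> a" "a \<le> b" "b \<le> t"
    show "?D * (b - a) \<le> U b - U a"
    proof (cases "a = b")
      case False
      have "(U (t + \<kappa> * t) - U t) * (b - a) \<le> (\<kappa> * t) * (U (a + (b - a)) - U a)"
        using ab False d t \<kappa> by (intro sc) auto
      then show ?thesis using t \<kappa> by (simp add: field_simps)
    qed simp
  qed (use d in auto)
  then have "?D * H d \<le> prob {w\<in>space M. A (t - d) w < A t w}"
    unfolding H_ennreal using D H_nonneg by (simp add: ennreal_mult'[symmetric])
  also have "\<dots> \<le> ?P"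
    using d by (intro last_visit_ge_bounds(1)[of 0 _ _ "t + 1"]) auto
  finally show "?D * H d \<le> ?P" .
  assume \<eta>: "0 < \<eta>" "\<eta> < 1/4" "(1 + \<eta>) * d \<le> \<eta> * t"
  let ?E = "(U ((1 - \<eta>) * t) - U ((1 - 2 * \<eta>) * t)) / (\<eta> * t)"
  (* The margins \<eta> d absorb the strict inequalities between times. *)
  define y where "y = t - (1 + \<eta>) * d"
  have y: "(1 - \<eta>) * t \<le> y" using \<eta>(3) by (simp add: y_def algebra_simps)
  have "0 < (1 - \<eta>) * t" using \<eta> t by simp
  then have y0: "0 < y" using y by linarith
  have \<eta>d: "0 < \<eta> * d" using \<eta> d by simp
  have E: "0 \<le> ?E" using U_mono[of "(1 - 2 * \<eta>) * t" "(1 - \<eta>) * t"] t \<eta> by (simp add: algebra_simps)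
  define t1 where "t1 = t + \<eta> * d / 2"
  define t2 where "t2 = t + \<eta> * d"
  have "y = t - d - \<eta> * d" by (simp add: y_def algebra_simps)
  then have tt: "t < t1" "t1 < t2" "y < t1" "y < t - d" using \<eta>d d unfolding t1_def t2_def by linarith+
  have "ennreal (?P) \<le> ennreal (prob {w\<in>space M. A y w < A t1 w})"
    using d y0 tt by (intro ennreal_leI last_visit_ge_bounds(2)) auto
  also have "\<dots> \<le> ennreal ?E * (\<integral>\<^sup>+s\<in>{0<..t2 - y}. ennreal (N s) \<partial>lborel)"
  proof (rule increase_upper[OF driftless y0 tt(3,2) E])
    fix a b assume ab: "y \<le> a" "a \<le> b"
    have "(U (a + (b - a)) - U a) * (\<eta> * t) \<le> (b - a) * (U ((1 - 2 * \<eta>) * t + \<eta> * t) - U ((1 - 2 * \<eta>) * t))"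
      using ab y \<eta> t by (intro sc) (auto simp: algebra_simps)
    moreover have "(1 - 2 * \<eta>) * t + \<eta> * t = (1 - \<eta>) * t" by (simp add: algebra_simps)
    ultimately show "U b - U a \<le> ?E * (b - a)" using t \<eta> by (simp add: field_simps)
  qed
  also have "t2 - y = (1 + 2 * \<eta>) * d" by (simp add: t2_def y_def algebra_simps)
  finally have "ennreal (?P) \<le> ennreal (?E * H ((1 + 2 * \<eta>) * d))"
    unfolding H_ennreal ennreal_mult'[OF E] .
  then show "?P \<le> ?E * H ((1 + 2 * \<eta>) * d)"
    by (subst (asm) ennreal_le_iff) (rule mult_nonneg_nonneg[OF E H_nonneg])
qed

end

section \<open>Asymptotics of early and late last visits\<close>

lemma rv_scale:
  assumes V: "regularly_varying_0 V \<rho>" and f: "((\<lambda>x. f x / V x) \<longlongrightarrow> C) (at_right 0)" and c: "0 < c"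
  shows "((\<lambda>x. f (c * x) / V x) \<longlongrightarrow> C * c powr \<rho>) (at_right 0)"
proof -
  have "((\<lambda>x. f (c * x) / V (c * x) * (V (c * x) / V x)) \<longlongrightarrow> C * c powr \<rho>) (at_right 0)"
    by (intro tendsto_mult filterlim_compose[OF f filterlim_times_at_right_0[OF c]] rv_ratio[OF V c])
  moreover have "\<forall>\<^sub>F x in at_right 0. f (c * x) / V (c * x) * (V (c * x) / V x) = f (c * x) / V x"
    using eventually_pos_at_right_0
  proof eventually_elim
    case (elim x)
    then show ?case using rv_pos[OF V, of "c * x"] c by simp
  qed
  ultimately show ?thesis by (blast intro: Lim_transform_eventually)
qed

lemma rv_inverse: assumes V: "regularly_varying_0 V \<rho>" shows "regularly_varying_0 (\<lambda>x. 1 / V x) (- \<rho>)"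
  unfolding regularly_varying_0_def
proof (intro conjI allI impI)
  show "0 < 1 / V x" if "0 < x" for x using rv_pos[OF V that] by simp
  show "((\<lambda>x. 1 / V (c * x) / (1 / V x)) \<longlongrightarrow> c powr (- \<rho>)) (at_right 0)" if c: "0 < c" for c
  proof -
    have "((\<lambda>x. inverse (V (c * x) / V x)) \<longlongrightarrow> inverse (c powr \<rho>)) (at_right 0)"
      using c by (intro tendsto_inverse rv_ratio[OF V]) auto
    then show ?thesis by (simp add: powr_minus inverse_eq_divide divide_divide_eq_left divide_divide_eq_right mult.commute)
  qed
qed

lemma bigtheta_bounds:
  assumes V: "regularly_varying_0 V \<rho>" and f: "\<And>x. 0 < x \<Longrightarrow> 0 \<le> f x" and \<Theta>: "f \<in> \<Theta>[at_right 0](V)"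
  obtains c C where "0 < c" "0 < C" "\<forall>\<^sub>F x in at_right 0. c * V x \<le> f x \<and> f x \<le> C * V x"
proof -
  obtain C where C: "0 < C" "\<forall>\<^sub>F x in at_right 0. norm (f x) \<le> C * norm (V x)"
    by (rule landau_o.bigE[OF bigthetaD1[OF \<Theta>]])
  obtain c where c: "0 < c" "\<forall>\<^sub>F x in at_right 0. norm (f x) \<ge> c * norm (V x)"
    by (rule landau_omega.bigE[OF bigthetaD2[OF \<Theta>]])
  have "\<forall>\<^sub>F x in at_right 0. c * V x \<le> f x \<and> f x \<le> C * V x"
    using c(2) C(2) eventually_pos_at_right_0
  proof eventually_elim
    case (elim x)
    then show ?case using rv_pos[OF V elim(3)] f[OF elim(3)] by simp
  qed
  with c(1) C(1) show ?thesis by (rule that)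
qed

lemma bigthetaI_bounds:
  fixes f g :: "real \<Rightarrow> real"
  assumes "0 < c" and "\<forall>\<^sub>F x in F. 0 \<le> g x \<and> c * g x \<le> f x \<and> f x \<le> C * g x"
  shows "f \<in> \<Theta>[F](g)"
proof (rule bigthetaI)
  show "f \<in> O[F](g)"
    by (rule bigoI[of _ C], rule eventually_mono[OF assms(2)])
       (metis abs_of_nonneg assms(1) mult_nonneg_nonneg order_less_imp_le order_trans real_norm_def)
  show "f \<in> \<Omega>[F](g)"
    by (rule landau_omega.bigI[OF assms(1)], rule eventually_mono[OF assms(2)]) auto
qed

text \<open>Large multiples of \<open>x\<close> beat the ratio of the two constants hidden in the \<open>\<Theta>\<close>-relation.\<close>

lemma rv_increase:
  assumes V: "regularly_varying_0 V \<rho>" and \<rho>: "0 < \<rho>" and f: "\<And>x. 0 < x \<Longrightarrow> 0 \<le> f x" and \<Theta>: "f \<in> \<Theta>[at_right 0](V)"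
  obtains b where "1 < b" "\<forall>\<^sub>F x in at_right 0. V x \<le> f (b * x) - f x"
proof -
  obtain c C where cC: "0 < c" "0 < C" "\<forall>\<^sub>F x in at_right 0. c * V x \<le> f x \<and> f x \<le> C * V x"
    by (rule bigtheta_bounds[OF V f \<Theta>])
  have "filterlim (\<lambda>b::real. b powr \<rho>) at_top at_top" using \<rho> by real_asymp
  then have "\<forall>\<^sub>F b in at_top. (C + 1) / c < b powr \<rho> \<and> 1 < b"
    using eventually_gt_at_top[of 1] by (auto simp: filterlim_at_top_dense intro: eventually_conj)
  then obtain b where b: "(C + 1) / c < b powr \<rho>" "1 < b"
    using eventually_happens[of _ "at_top :: real filter"] by auto
  have "\<forall>\<^sub>F x in at_right 0. V x \<le> f (b * x) - f x"
  proof -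
    have "\<forall>\<^sub>F x in at_right 0. (C + 1) / c < V (b * x) / V x"
      using b by (intro order_tendstoD(1)[OF rv_ratio[OF V]]) auto
    moreover have "\<forall>\<^sub>F x in at_right 0. c * V (b * x) \<le> f (b * x) \<and> f (b * x) \<le> C * V (b * x)"
      using cC(3) filterlim_times_at_right_0[of b] b by (auto simp: filterlim_iff)
    ultimately show ?thesis using cC(3) eventually_pos_at_right_0
    proof eventually_elim
      case (elim x)
      have Vx: "0 < V x" using elim by (intro rv_pos[OF V])
      then have "(C + 1) * V x < c * V (b * x)" using elim(1) cC(1) by (simp add: field_simps)
      then show ?case using elim by (simp add: algebra_simps)
    qed
  qed
  with b(2) show ?thesis by (rule that)
qed

lemma Gamma_times_reflection:
  fixes \<alpha> :: real
  assumes "0 < \<alpha>" "\<alpha> < 1"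
  shows "1 / (Gamma (\<alpha> + 1) * Gamma (1 - \<alpha>)) = sin (pi * \<alpha>) / (pi * \<alpha>)"
    and "\<alpha> * (1 / Gamma (\<alpha> + 1) * (1 / Gamma (2 - \<alpha>))) = sin (pi * (1 - \<alpha>)) / (pi * (1 - \<alpha>))"
    and "(1 - \<alpha>) * (1 / Gamma (2 - \<alpha>)) = 1 / Gamma (1 - \<alpha>)"
proof -
  have "complex_of_real (Gamma \<alpha> * Gamma (1 - \<alpha>)) = Gamma (of_real \<alpha>) * Gamma (1 - of_real \<alpha>)"
    by (simp add: Gamma_complex_of_real[symmetric])
  also have "\<dots> = of_real pi / sin (of_real pi * of_real \<alpha>)" by (rule Gamma_reflection_complex)
  also have "\<dots> = of_real (pi / sin (pi * \<alpha>))" by (simp add: sin_of_real[symmetric])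
  finally have refl: "Gamma \<alpha> * Gamma (1 - \<alpha>) = pi / sin (pi * \<alpha>)" by (simp only: of_real_eq_iff)
  have pos: "0 < Gamma \<alpha>" "0 < Gamma (1 - \<alpha>)" using assms by (auto intro!: Gamma_real_pos)
  have plus: "Gamma (\<alpha> + 1) = \<alpha> * Gamma \<alpha>" "Gamma ((1 - \<alpha>) + 1) = (1 - \<alpha>) * Gamma (1 - \<alpha>)"
    using assms by (intro Gamma_plus1; auto elim!: nonpos_Ints_cases)+
  have two: "2 - \<alpha> = (1 - \<alpha>) + 1" by simp
  have plus': "Gamma (2 - \<alpha>) = (1 - \<alpha>) * Gamma (1 - \<alpha>)" unfolding two by (rule plus(2))
  have "0 < pi / sin (pi * \<alpha>)" unfolding refl[symmetric] using pos by simp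
  then have s: "0 < sin (pi * \<alpha>)" using pi_gt_zero by (simp add: zero_less_divide_iff)
  have inv: "1 / (Gamma \<alpha> * Gamma (1 - \<alpha>)) = sin (pi * \<alpha>) / pi" unfolding refl by simp
  show "1 / (Gamma (\<alpha> + 1) * Gamma (1 - \<alpha>)) = sin (pi * \<alpha>) / (pi * \<alpha>)"
    unfolding plus(1) using inv assms by (simp add: field_simps)
  have "sin (pi * (1 - \<alpha>)) = sin (pi * \<alpha>)" by (simp add: right_diff_distrib sin_diff)
  moreover have "\<alpha> * (1 / Gamma (\<alpha> + 1) * (1 / Gamma (2 - \<alpha>))) = 1 / (Gamma \<alpha> * Gamma (1 - \<alpha>)) / (1 - \<alpha>)"
    unfolding plus(1) plus' using assms by simp
  ultimately show "\<alpha> * (1 / Gamma (\<alpha> + 1) * (1 / Gamma (2 - \<alpha>))) = sin (pi * (1 - \<alpha>)) / (pi * (1 - \<alpha>))"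
    unfolding inv by simp
  show "(1 - \<alpha>) * (1 / Gamma (2 - \<alpha>)) = 1 / Gamma (1 - \<alpha>)" unfolding plus' using assms by simp
qed

lemma small_window:
  fixes \<epsilon> :: "real \<Rightarrow> real"
  assumes \<epsilon>: "\<forall>t>0. 0 < \<epsilon> t \<and> \<epsilon> t < 1" and lim: "(\<epsilon> \<longlongrightarrow> 0) (at_right 0)"
  shows "filterlim (\<lambda>t. \<epsilon> t * t) (at_right 0) (at_right 0)"
    and "0 < c \<Longrightarrow> \<forall>\<^sub>F t in at_right 0. 0 < t \<and> 0 < \<epsilon> t * t \<and> \<epsilon> t * t < t \<and> \<epsilon> t * t \<le> c * t"
proof -
  have "((\<lambda>t. \<epsilon> t * t) \<longlongrightarrow> 0 * 0) (at_right 0)" by (intro tendsto_mult lim tendsto_ident_at)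
  moreover have "\<forall>\<^sub>F t in at_right 0. \<epsilon> t * t \<in> {0<..}"
    using eventually_pos_at_right_0 by eventually_elim (use \<epsilon> in auto)
  ultimately show "filterlim (\<lambda>t. \<epsilon> t * t) (at_right 0) (at_right 0)" by (auto simp: filterlim_at elim!: eventually_mono)
  assume c: "0 < c"
  have "\<forall>\<^sub>F t in at_right 0. \<epsilon> t < c" using lim c by (rule order_tendstoD)
  with eventually_pos_at_right_0
  show "\<forall>\<^sub>F t in at_right 0. 0 < t \<and> 0 < \<epsilon> t * t \<and> \<epsilon> t * t < t \<and> \<epsilon> t * t \<le> c * t"
  proof eventually_elim
    case (elim t)
    then show ?case using \<epsilon>[rule_format, OF elim(1)] mult_strict_right_mono[of "\<epsilon> t" 1 t] mult_right_mono[of "\<epsilon> t" c t] by auto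
  qed
qed

context driftless_clock
begin

lemma U_sharp:
  assumes V: "regularly_varying_0 V \<alpha>" and \<alpha>: "0 < \<alpha>" and lim: "((\<lambda>x. r (1 / x) / V x) \<longlongrightarrow> 1) (at_right 0)"
  shows "((\<lambda>x. U x / V x) \<longlongrightarrow> 1 / Gamma (\<alpha> + 1)) (at_right 0)"
proof -
  have "((\<lambda>x. measure (interval_measure U) {0..x} / V x) \<longlongrightarrow> 1 / Gamma (\<alpha> + 1)) (at_right 0)"
    by (rule Karamata_Tauberian_0[OF _ Laplace_dU r_pos V \<alpha> lim]) auto
  moreover have "\<forall>\<^sub>F x in at_right 0. measure (interval_measure U) {0..x} / V x = U x / V x"
    using eventually_pos_at_right_0 by eventually_elim (simp add: measure_dU)
  ultimately show ?thesis by (blast intro: Lim_transform_eventually)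
qed

lemma H_sharp:
  assumes V: "regularly_varying_0 V \<alpha>" and \<alpha>: "\<alpha> < 1" and lim: "((\<lambda>x. r (1 / x) / V x) \<longlongrightarrow> 1) (at_right 0)"
  shows "((\<lambda>x. H x / (x / V x)) \<longlongrightarrow> 1 / Gamma (2 - \<alpha>)) (at_right 0)"
proof -
  have "((\<lambda>x. inverse (r (1 / x) / V x)) \<longlongrightarrow> inverse 1) (at_right 0)" by (intro tendsto_inverse lim) simp
  moreover have "\<forall>\<^sub>F x in at_right 0. inverse (r (1 / x) / V x) = 1 / (1 / x * r (1 / x)) / (x / V x)"
    using eventually_pos_at_right_0 by eventually_elim (simp add: field_simps)
  ultimately have "((\<lambda>x. 1 / (1 / x * r (1 / x)) / (x / V x)) \<longlongrightarrow> 1) (at_right 0)"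
    by (auto intro: Lim_transform_eventually)
  then have "((\<lambda>x. measure dN {0..x} / (x / V x)) \<longlongrightarrow> 1 / Gamma ((1 - \<alpha>) + 1)) (at_right 0)"
    using \<alpha> r_pos by (intro Karamata_Tauberian_0[OF sets_dN Laplace_dN _ rv_dual[OF V]]) auto
  then show ?thesis by (simp add: measure_dN)
qed

text \<open>The monotone density theorem: difference quotients of \<open>H\<close> bound its decreasing derivative \<open>N\<close>.\<close>

lemma N_sharp:
  assumes V: "regularly_varying_0 V \<alpha>" and \<alpha>: "0 < \<alpha>" "\<alpha> < 1" and lim: "((\<lambda>x. r (1 / x) / V x) \<longlongrightarrow> 1) (at_right 0)"
  shows "((\<lambda>x. N x / (1 / V x)) \<longlongrightarrow> 1 / Gamma (1 - \<alpha>)) (at_right 0)"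
proof -
  define C where "C = 1 / Gamma (2 - \<alpha>)"
  define W where "W x = x / V x" for x
  have Hc: "((\<lambda>x. H (c * x) / W x) \<longlongrightarrow> C * c powr (1 - \<alpha>)) (at_right 0)" if "0 < c" for c
    unfolding C_def W_def using rv_scale[OF rv_dual[OF V] H_sharp[OF V \<alpha>(2) lim] that] .
  have H1: "((\<lambda>x. H x / W x) \<longlongrightarrow> C) (at_right 0)" using Hc[of 1] by simp
  have "((\<lambda>x. N x / (1 / V x)) \<longlongrightarrow> C * (1 - \<alpha>)) (at_right 0)"
  proof (rule tendsto_squeeze_family)
    fix \<eta> :: real assume \<eta>: "0 < \<eta>" "\<eta> < 1/4"
    show "\<forall>\<^sub>F x in at_right 0. (H ((1 + \<eta>) * x) / W x - H x / W x) / \<eta> \<le> N x / (1 / V x)"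
      using eventually_pos_at_right_0
    proof eventually_elim
      case (elim x)
      have "H ((1 + \<eta>) * x) - H x \<le> ((1 + \<eta>) * x - x) * N x"
        using elim \<eta> by (intro H_add) (auto simp: algebra_simps)
      then have "(H ((1 + \<eta>) * x) - H x) * (V x / (\<eta> * x)) \<le> (((1 + \<eta>) * x - x) * N x) * (V x / (\<eta> * x))"
        using elim \<eta> rv_pos[OF V elim] by (intro mult_right_mono) auto
      also have "(((1 + \<eta>) * x - x) * N x) * (V x / (\<eta> * x)) = N x / (1 / V x)" using elim \<eta> by (simp add: field_simps)
      also have "(H ((1 + \<eta>) * x) - H x) * (V x / (\<eta> * x)) = (H ((1 + \<eta>) * x) / W x - H x / W x) / \<eta>"
        using elim \<eta> by (simp add: W_def field_simps)
      finally show ?case .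
    qed
    show "((\<lambda>x. (H ((1 + \<eta>) * x) / W x - H x / W x) / \<eta>) \<longlongrightarrow> (C * (1 + \<eta>) powr (1 - \<alpha>) - C) / \<eta>) (at_right 0)"
      using \<eta> by (intro tendsto_divide tendsto_diff Hc H1 tendsto_const) auto
    show "\<forall>\<^sub>F x in at_right 0. N x / (1 / V x) \<le> (H x / W x - H ((1 - \<eta>) * x) / W x) / \<eta>"
      using eventually_pos_at_right_0
    proof eventually_elim
      case (elim x)
      have "(x - (1 - \<eta>) * x) * N x \<le> H x - H ((1 - \<eta>) * x)"
        using elim \<eta> by (intro H_add) (auto simp: algebra_simps)
      then have "((x - (1 - \<eta>) * x) * N x) * (V x / (\<eta> * x)) \<le> (H x - H ((1 - \<eta>) * x)) * (V x / (\<eta> * x))"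
        using elim \<eta> rv_pos[OF V elim] by (intro mult_right_mono) auto
      also have "((x - (1 - \<eta>) * x) * N x) * (V x / (\<eta> * x)) = N x / (1 / V x)" using elim \<eta> by (simp add: field_simps)
      also have "(H x - H ((1 - \<eta>) * x)) * (V x / (\<eta> * x)) = (H x / W x - H ((1 - \<eta>) * x) / W x) / \<eta>"
        using elim \<eta> by (simp add: W_def field_simps)
      finally show ?case .
    qed
    show "((\<lambda>x. (H x / W x - H ((1 - \<eta>) * x) / W x) / \<eta>) \<longlongrightarrow> (C - C * (1 - \<eta>) powr (1 - \<alpha>)) / \<eta>) (at_right 0)"
      using \<eta> by (intro tendsto_divide tendsto_diff Hc H1 tendsto_const) auto
  next
    have "((\<lambda>\<eta>. C * (((1 + \<eta>) powr (1 - \<alpha>) - 1) / \<eta>)) \<longlongrightarrow> C * (1 - \<alpha>)) (at_right 0)"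
      by (intro tendsto_mult tendsto_const powr_slope_right)
    then show "((\<lambda>\<eta>. (C * (1 + \<eta>) powr (1 - \<alpha>) - C) / \<eta>) \<longlongrightarrow> C * (1 - \<alpha>)) (at_right 0)"
      by (simp add: right_diff_distrib)
    have "((\<lambda>\<eta>. C * ((1 - (1 - \<eta>) powr (1 - \<alpha>)) / \<eta>)) \<longlongrightarrow> C * (1 - \<alpha>)) (at_right 0)"
      by (intro tendsto_mult tendsto_const powr_slope_left)
    then show "((\<lambda>\<eta>. (C - C * (1 - \<eta>) powr (1 - \<alpha>)) / \<eta>) \<longlongrightarrow> C * (1 - \<alpha>)) (at_right 0)"
      by (simp add: right_diff_distrib)
  qed
  also have "C * (1 - \<alpha>) = 1 / Gamma (1 - \<alpha>)"
    using Gamma_times_reflection(3)[OF \<alpha>] by (simp add: C_def mult.commute)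
  finally show ?thesis .
qed

lemma early_sharp:
  assumes V: "regularly_varying_0 V \<alpha>" and \<alpha>: "0 < \<alpha>" "\<alpha> < 1" and lim: "((\<lambda>x. r (1 / x) / V x) \<longlongrightarrow> 1) (at_right 0)"
    and \<epsilon>: "\<And>t. 0 < t \<Longrightarrow> 0 < \<epsilon> t \<and> \<epsilon> t < 1" and \<epsilon>0: "(\<epsilon> \<longlongrightarrow> 0) (at_right 0)"
  shows "((\<lambda>t. prob {w\<in>space M. last_visit A t w \<le> \<epsilon> t * t} * (V t / V (\<epsilon> t * t))) \<longlongrightarrow> sin (pi * \<alpha>) / (pi * \<alpha>)) (at_right 0)"
proof -
  have "\<forall>t>0. 0 < \<epsilon> t \<and> \<epsilon> t < 1" using \<epsilon> by blast
  note small = small_window[OF this \<epsilon>0]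
  define C1 where "C1 = 1 / Gamma (\<alpha> + 1)"
  define C2 where "C2 = 1 / Gamma (1 - \<alpha>)"
  let ?d = "\<lambda>t. \<epsilon> t * t"
  let ?P = "\<lambda>t. prob {w\<in>space M. last_visit A t w \<le> ?d t}"
  have Ud: "((\<lambda>t. U (?d t) / V (?d t)) \<longlongrightarrow> C1) (at_right 0)"
    unfolding C1_def by (rule filterlim_compose[OF U_sharp[OF V \<alpha>(1) lim] small(1)])
  have Nc: "((\<lambda>x. N (c * x) / (1 / V x)) \<longlongrightarrow> C2 * c powr (- \<alpha>)) (at_right 0)" if "0 < c" for c
    unfolding C2_def by (rule rv_scale[OF rv_inverse[OF V] N_sharp[OF V \<alpha> lim] that])
  have "((\<lambda>t. ?P t * (V t / V (?d t))) \<longlongrightarrow> C1 * C2) (at_right 0)"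
  proof (rule tendsto_squeeze_family)
    fix \<eta> :: real assume \<eta>: "0 < \<eta>" "\<eta> < 1/4"
    show "\<forall>\<^sub>F t in at_right 0. U (?d t) / V (?d t) * (N ((1 + \<eta>) * t) / (1 / V t)) \<le>
        ?P t * (V t / V (?d t))"
      using small(2)[OF \<eta>(1)]
    proof eventually_elim
      case (elim t)
      have "U (?d t) * N ((1 + \<eta>) * t) \<le> ?P t"
        using elim \<eta> by (intro last_visit_le_bounds) auto
      then have "U (?d t) * N ((1 + \<eta>) * t) * (V t / V (?d t)) \<le> ?P t * (V t / V (?d t))"
        using elim rv_pos[OF V, of t] rv_pos[OF V, of "?d t"] by (intro mult_right_mono) auto
      then show ?case by (simp add: mult_ac)
    qed
    show "((\<lambda>t. U (?d t) / V (?d t) * (N ((1 + \<eta>) * t) / (1 / V t))) \<longlongrightarrow> C1 * (C2 * (1 + \<eta>) powr (- \<alpha>))) (at_right 0)"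
      using \<eta> by (intro tendsto_mult Ud Nc) auto
    show "\<forall>\<^sub>F t in at_right 0. ?P t * (V t / V (?d t)) \<le>
        U (?d t) / V (?d t) * (N ((1 - \<eta>) * t) / (1 / V t))"
      using small(2)[OF \<eta>(1)]
    proof eventually_elim
      case (elim t)
      have "?P t \<le> U (?d t) * N (t - ?d t)"
        using elim \<eta> by (intro last_visit_le_bounds[of _ _ "t + 1"]) auto
      also have "\<dots> \<le> U (?d t) * N ((1 - \<eta>) * t)"
        using elim \<eta> by (intro mult_left_mono N_antimono U_nonneg) (auto simp: algebra_simps)
      finally have "?P t * (V t / V (?d t)) \<le> U (?d t) * N ((1 - \<eta>) * t) * (V t / V (?d t))"
        using elim rv_pos[OF V, of t] rv_pos[OF V, of "?d t"] by (intro mult_right_mono) auto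
      then show ?case by (simp add: mult_ac)
    qed
    show "((\<lambda>t. U (?d t) / V (?d t) * (N ((1 - \<eta>) * t) / (1 / V t))) \<longlongrightarrow> C1 * (C2 * (1 - \<eta>) powr (- \<alpha>))) (at_right 0)"
      using \<eta> by (intro tendsto_mult Ud Nc) auto
  next
    show "((\<lambda>\<eta>. C1 * (C2 * (1 + \<eta>) powr (- \<alpha>))) \<longlongrightarrow> C1 * C2) (at_right 0)"
      by (auto intro!: tendsto_eq_intros)
    show "((\<lambda>\<eta>. C1 * (C2 * (1 - \<eta>) powr (- \<alpha>))) \<longlongrightarrow> C1 * C2) (at_right 0)"
      by (auto intro!: tendsto_eq_intros)
  qed
  also have "C1 * C2 = sin (pi * \<alpha>) / (pi * \<alpha>)"
    using Gamma_times_reflection(1)[OF \<alpha>] by (simp add: C1_def C2_def)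
  finally show ?thesis .
qed

text \<open>The bounds of \<open>late_bounds\<close> at scale \<open>\<eta>\<close> have limits of the form of difference quotients of \<open>x \<mapsto> x\<^sup>\<alpha>\<close> at \<open>1\<close>.\<close>

lemma late_sharp:
  assumes V: "regularly_varying_0 V \<alpha>" and \<alpha>: "0 < \<alpha>" "\<alpha> < 1" and lim: "((\<lambda>x. r (1 / x) / V x) \<longlongrightarrow> 1) (at_right 0)"
    and \<epsilon>: "\<And>t. 0 < t \<Longrightarrow> 0 < \<epsilon> t \<and> \<epsilon> t < 1" and \<epsilon>0: "(\<epsilon> \<longlongrightarrow> 0) (at_right 0)"
    and dec: "\<And>x y h. 0 < x \<Longrightarrow> x \<le> y \<Longrightarrow> 0 \<le> h \<Longrightarrow> U (y + h) - U y \<le> U (x + h) - U x"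
  shows "((\<lambda>t. prob {w\<in>space M. t - \<epsilon> t * t \<le> last_visit A t w} / (\<epsilon> t * V t / V (\<epsilon> t * t))) \<longlongrightarrow>
    sin (pi * (1 - \<alpha>)) / (pi * (1 - \<alpha>))) (at_right 0)"
proof -
  have "\<forall>t>0. 0 < \<epsilon> t \<and> \<epsilon> t < 1" using \<epsilon> by blast
  note small = small_window[OF this \<epsilon>0]
  define C1 where "C1 = 1 / Gamma (\<alpha> + 1)"
  define C3 where "C3 = 1 / Gamma (2 - \<alpha>)"
  define W where "W x = x / V x" for x
  let ?d = "\<lambda>t. \<epsilon> t * t"
  let ?P = "\<lambda>t. prob {w\<in>space M. t - ?d t \<le> last_visit A t w}"
  let ?B = "\<lambda>t. \<epsilon> t * V t / V (?d t)"
  have Uc: "((\<lambda>x. U (c * x) / V x) \<longlongrightarrow> C1 * c powr \<alpha>) (at_right 0)" if "0 < c" for c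
    unfolding C1_def using rv_scale[OF V U_sharp[OF V \<alpha>(1) lim] that] .
  have U1: "((\<lambda>x. U x / V x) \<longlongrightarrow> C1) (at_right 0)" using Uc[of 1] by simp
  have Hc: "((\<lambda>t. H (c * ?d t) / W (?d t)) \<longlongrightarrow> C3 * c powr (1 - \<alpha>)) (at_right 0)" if "0 < c" for c
    unfolding C3_def W_def using filterlim_compose[OF rv_scale[OF rv_dual[OF V] H_sharp[OF V \<alpha>(2) lim] that] small(1)] .
  have H1: "((\<lambda>t. H (?d t) / W (?d t)) \<longlongrightarrow> C3) (at_right 0)" using Hc[of 1] by simp
  have split: "x / (\<eta> * t) * z / ?B t = x / V t / \<eta> * (z / W (?d t))" if "0 < t" "0 < \<eta>" for x z t \<eta> :: real
    using that by (simp add: W_def field_simps)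
  have "((\<lambda>t. ?P t / ?B t) \<longlongrightarrow> \<alpha> * (C1 * C3)) (at_right 0)"
  proof (rule tendsto_squeeze_family)
    fix \<eta> :: real assume \<eta>: "0 < \<eta>" "\<eta> < 1/4"
    show "\<forall>\<^sub>F t in at_right 0. (U ((1 + \<eta>) * t) - U t) / V t / \<eta> * (H (?d t) / W (?d t)) \<le> ?P t / ?B t"
      using small(2)[OF \<eta>(1)]
    proof eventually_elim
      case (elim t)
      have "(U ((1 + \<eta>) * t) - U t) / (\<eta> * t) * H (?d t) \<le> ?P t"
        using elim \<eta> by (intro late_bounds(1)[OF dec]) auto
      then have "(U ((1 + \<eta>) * t) - U t) / (\<eta> * t) * H (?d t) / ?B t \<le> ?P t / ?B t"
        using elim rv_pos[OF V, of t] rv_pos[OF V, of "?d t"] \<epsilon>[of t] by (intro divide_right_mono) auto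
      then show ?case using elim \<eta> by (subst (asm) split) auto
    qed
    have "((\<lambda>t. (U ((1 + \<eta>) * t) / V t - U t / V t) / \<eta> * (H (?d t) / W (?d t))) \<longlongrightarrow> (C1 * (1 + \<eta>) powr \<alpha> - C1) / \<eta> * C3) (at_right 0)"
      using \<eta> by (intro tendsto_mult tendsto_divide tendsto_diff Uc U1 H1 tendsto_const) auto
    then show "((\<lambda>t. (U ((1 + \<eta>) * t) - U t) / V t / \<eta> * (H (?d t) / W (?d t))) \<longlongrightarrow> (C1 * (1 + \<eta>) powr \<alpha> - C1) / \<eta> * C3) (at_right 0)"
      by (simp add: diff_divide_distrib)
    have "0 < \<eta> / (1 + \<eta>)" using \<eta> by simp
    from small(2)[OF this]
    show "\<forall>\<^sub>F t in at_right 0. ?P t / ?B t \<le>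
        (U ((1 - \<eta>) * t) - U ((1 - 2 * \<eta>) * t)) / V t / \<eta> * (H ((1 + 2 * \<eta>) * ?d t) / W (?d t))"
    proof eventually_elim
      case (elim t)
      have "(1 + \<eta>) * ?d t \<le> \<eta> * t" using elim \<eta> by (simp add: field_simps)
      then have "?P t \<le> (U ((1 - \<eta>) * t) - U ((1 - 2 * \<eta>) * t)) / (\<eta> * t) * H ((1 + 2 * \<eta>) * ?d t)"
        using elim \<eta> by (intro late_bounds(2)[OF dec _ _ _ zero_less_one]) auto
      then have "?P t / ?B t \<le> (U ((1 - \<eta>) * t) - U ((1 - 2 * \<eta>) * t)) / (\<eta> * t) * H ((1 + 2 * \<eta>) * ?d t) / ?B t"
        using elim rv_pos[OF V, of t] rv_pos[OF V, of "?d t"] \<epsilon>[of t] by (intro divide_right_mono) auto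
      then show ?case using elim \<eta> by (subst (asm) split) auto
    qed
    have "((\<lambda>t. (U ((1 - \<eta>) * t) / V t - U ((1 - 2 * \<eta>) * t) / V t) / \<eta> * (H ((1 + 2 * \<eta>) * ?d t) / W (?d t))) \<longlongrightarrow>
        (C1 * (1 - \<eta>) powr \<alpha> - C1 * (1 - 2 * \<eta>) powr \<alpha>) / \<eta> * (C3 * (1 + 2 * \<eta>) powr (1 - \<alpha>))) (at_right 0)"
      using \<eta> by (intro tendsto_mult tendsto_divide tendsto_diff Uc Hc tendsto_const) auto
    then show "((\<lambda>t. (U ((1 - \<eta>) * t) - U ((1 - 2 * \<eta>) * t)) / V t / \<eta> * (H ((1 + 2 * \<eta>) * ?d t) / W (?d t))) \<longlongrightarrow>
        (C1 * (1 - \<eta>) powr \<alpha> - C1 * (1 - 2 * \<eta>) powr \<alpha>) / \<eta> * (C3 * (1 + 2 * \<eta>) powr (1 - \<alpha>))) (at_right 0)"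
      by (simp add: diff_divide_distrib)
  next
    have "((\<lambda>\<eta>. ((1 + \<eta>) powr \<alpha> - 1) / \<eta> * (C1 * C3)) \<longlongrightarrow> \<alpha> * (C1 * C3)) (at_right 0)"
      by (intro tendsto_mult tendsto_const powr_slope_right)
    then show "((\<lambda>\<eta>. (C1 * (1 + \<eta>) powr \<alpha> - C1) / \<eta> * C3) \<longlongrightarrow> \<alpha> * (C1 * C3)) (at_right 0)"
      by (simp add: algebra_simps)
    have left2: "((\<lambda>\<eta>. (1 - (1 - 2 * \<eta>) powr \<alpha>) / (2 * \<eta>)) \<longlongrightarrow> \<alpha>) (at_right 0)"
      by (rule filterlim_compose[OF powr_slope_left filterlim_times_at_right_0]) simp
    have "((\<lambda>\<eta>. (2 * ((1 - (1 - 2 * \<eta>) powr \<alpha>) / (2 * \<eta>)) - (1 - (1 - \<eta>) powr \<alpha>) / \<eta>) * (C1 * (C3 * (1 + 2 * \<eta>) powr (1 - \<alpha>)))) \<longlongrightarrow>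
        (2 * \<alpha> - \<alpha>) * (C1 * (C3 * 1))) (at_right 0)"
      by (intro tendsto_mult tendsto_diff tendsto_const powr_slope_left left2) (auto intro!: tendsto_eq_intros)
    moreover have "(2 * ((1 - (1 - 2 * \<eta>) powr \<alpha>) / (2 * \<eta>)) - (1 - (1 - \<eta>) powr \<alpha>) / \<eta>) * (C1 * (C3 * (1 + 2 * \<eta>) powr (1 - \<alpha>))) =
        (C1 * (1 - \<eta>) powr \<alpha> - C1 * (1 - 2 * \<eta>) powr \<alpha>) / \<eta> * (C3 * (1 + 2 * \<eta>) powr (1 - \<alpha>))" for \<eta> :: real
      by (cases "\<eta> = 0") (simp_all add: field_simps)
    ultimately show "((\<lambda>\<eta>. (C1 * (1 - \<eta>) powr \<alpha> - C1 * (1 - 2 * \<eta>) powr \<alpha>) / \<eta> * (C3 * (1 + 2 * \<eta>) powr (1 - \<alpha>))) \<longlongrightarrow> \<alpha> * (C1 * C3)) (at_right 0)"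
      by simp
  qed
  then show ?thesis using Gamma_times_reflection(2)[OF \<alpha>] by (simp add: C1_def C3_def)
qed

lemma U_theta:
  assumes V: "regularly_varying_0 V \<alpha>" and \<Theta>: "(\<lambda>x. r (1 / x)) \<in> \<Theta>[at_right 0](V)"
  shows "U \<in> \<Theta>[at_right 0](V)"
proof -
  have "(\<lambda>x. measure (interval_measure U) {0..x}) \<in> \<Theta>[at_right 0](V)"
    by (rule O_Tauberian_0[OF _ Laplace_dU r_pos V \<Theta>]) auto
  moreover have "\<forall>\<^sub>F x in at_right 0. measure (interval_measure U) {0..x} = U x"
    using eventually_pos_at_right_0 by eventually_elim (simp add: measure_dU)
  ultimately show ?thesis by (subst (asm) landau_theta.in_cong) auto
qed

lemma H_theta:
  assumes V: "regularly_varying_0 V \<alpha>" and \<Theta>: "(\<lambda>x. r (1 / x)) \<in> \<Theta>[at_right 0](V)"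
  shows "H \<in> \<Theta>[at_right 0](\<lambda>x. x / V x)"
proof -
  have "(\<lambda>x. 1 / (1 / x * r (1 / x))) = (\<lambda>x. x / r (1 / x))" by (simp add: fun_eq_iff)
  moreover have "(\<lambda>x. x * inverse (r (1 / x))) \<in> \<Theta>[at_right 0](\<lambda>x. x * inverse (V x))"
  proof (rule landau_theta.mult_left, rule landau_theta.inverse[OF _ _ bigtheta_sym[THEN iffD1, OF \<Theta>]])
    have "\<forall>\<^sub>F x in at_right 0. 0 < x \<and> x < (1::real)" by (intro eventually_at_rightI[of 0 1]) auto
    then show "\<forall>\<^sub>F x in at_right 0. r (1 / x) \<noteq> 0"
    proof eventually_elim
      case (elim x)
      then show ?case using r_pos[of "1 / x"] by simp
    qed
    show "\<forall>\<^sub>F x in at_right 0. V x \<noteq> 0"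
      using eventually_pos_at_right_0
    proof eventually_elim
      case (elim x)
      then show ?case using rv_pos[OF V, of x] by simp
    qed
  qed
  then have "(\<lambda>x. x / r (1 / x)) \<in> \<Theta>[at_right 0](\<lambda>x. x / V x)" by (simp add: divide_inverse)
  ultimately have "(\<lambda>x. measure dN {0..x}) \<in> \<Theta>[at_right 0](\<lambda>x. x / V x)"
    using r_pos by (intro O_Tauberian_0[OF sets_dN Laplace_dN _ rv_dual[OF V]]) auto
  then show ?thesis by (simp add: measure_dN)
qed

lemma N_theta:
  assumes V: "regularly_varying_0 V \<alpha>" and \<alpha>: "\<alpha> < 1" and \<Theta>: "(\<lambda>x. r (1 / x)) \<in> \<Theta>[at_right 0](V)"
  shows "N \<in> \<Theta>[at_right 0](\<lambda>x. 1 / V x)"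
proof -
  note W = rv_dual[OF V]
  obtain c C where C: "0 < C" "\<forall>\<^sub>F x in at_right 0. c * (x / V x) \<le> H x \<and> H x \<le> C * (x / V x)"
    by (rule bigtheta_bounds[OF W H_nonneg H_theta[OF V \<Theta>]])
  obtain b where b: "1 < b" "\<forall>\<^sub>F x in at_right 0. x / V x \<le> H (b * x) - H x"
    by (rule rv_increase[OF W _ H_nonneg H_theta[OF V \<Theta>]]) (use \<alpha> in auto)
  show ?thesis
  proof (rule bigthetaI_bounds)
    show "0 < 1 / (b - 1)" using b by simp
    show "\<forall>\<^sub>F x in at_right 0. 0 \<le> 1 / V x \<and> 1 / (b - 1) * (1 / V x) \<le> N x \<and> N x \<le> C * (1 / V x)"
      using C(2) b(2) eventually_pos_at_right_0
    proof eventually_elim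
      case (elim x)
      have Vx: "0 < V x" using elim by (intro rv_pos[OF V])
      have "x * N x \<le> C * (x / V x)" using H_ge[of x] elim by linarith
      then have "x * N x \<le> x * (C * (1 / V x))" by (simp add: mult_ac)
      then have up: "N x \<le> C * (1 / V x)" using elim(3) by (simp only: mult_le_cancel_left_pos)
      have "x / V x \<le> (b * x - x) * N x" using elim(2) H_add(2)[of x "b * x"] elim(3) b(1) by simp
      also have "\<dots> = x * ((b - 1) * N x)" by (simp add: algebra_simps)
      finally have "x * (1 / V x) \<le> x * ((b - 1) * N x)" by simp
      then have "1 / V x \<le> (b - 1) * N x" using elim(3) by (simp only: mult_le_cancel_left_pos)
      moreover have "1 / (b - 1) * v \<le> n" if "v \<le> (b - 1) * n" for v n
        using that b(1) by (simp add: divide_le_eq mult.commute)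
      ultimately have "1 / (b - 1) * (1 / V x) \<le> N x" by blast
      with up Vx show ?case by simp
    qed
  qed
qed

lemma early_theta:
  assumes V: "regularly_varying_0 V \<alpha>" and \<alpha>: "\<alpha> < 1" and \<Theta>: "(\<lambda>x. r (1 / x)) \<in> \<Theta>[at_right 0](V)"
    and \<epsilon>: "\<And>t. 0 < t \<Longrightarrow> 0 < \<epsilon> t \<and> \<epsilon> t < 1" and \<epsilon>0: "(\<epsilon> \<longlongrightarrow> 0) (at_right 0)"
  shows "(\<lambda>t. prob {w\<in>space M. last_visit A t w \<le> \<epsilon> t * t}) \<in> \<Theta>[at_right 0](\<lambda>t. V (\<epsilon> t * t) * (1 / V t))"
proof -
  have "\<forall>t>0. 0 < \<epsilon> t \<and> \<epsilon> t < 1" using \<epsilon> by blast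
  note small = small_window[OF this \<epsilon>0]
  let ?d = "\<lambda>t. \<epsilon> t * t"
  let ?P = "\<lambda>t. prob {w\<in>space M. last_visit A t w \<le> ?d t}"
  have UN: "(\<lambda>t. U (?d t) * N (c * t)) \<in> \<Theta>[at_right 0](\<lambda>t. V (?d t) * (1 / V t))" if c: "0 < c" for c
  proof (rule landau_theta.mult)
    show "(\<lambda>t. U (?d t)) \<in> \<Theta>[at_right 0](\<lambda>t. V (?d t))" by (rule landau_theta.compose[OF U_theta[OF V \<Theta>] small(1)])
    have "(\<lambda>t. N (c * t)) \<in> \<Theta>[at_right 0](\<lambda>t. 1 / V (c * t))"
      by (rule landau_theta.compose[OF N_theta[OF V \<alpha> \<Theta>] filterlim_times_at_right_0[OF c]])
    also have "(\<lambda>t. 1 / V (c * t)) \<in> \<Theta>[at_right 0](\<lambda>t. 1 / V t)" by (rule rv_bigtheta[OF rv_inverse[OF V] c])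
    finally show "(\<lambda>t. N (c * t)) \<in> \<Theta>[at_right 0](\<lambda>t. 1 / V t)" .
  qed
  have sm: "\<forall>\<^sub>F t in at_right 0. 0 < t \<and> 0 < ?d t \<and> ?d t < t \<and> ?d t \<le> 1/2 * t" by (rule small(2)) simp
  show ?thesis
  proof (rule bigthetaI)
    have "?P \<in> O[at_right 0](\<lambda>t. U (?d t) * N (1/2 * t))"
    proof (rule bigoI[of _ 1], rule eventually_mono[OF sm])
      fix t assume t: "0 < t \<and> 0 < ?d t \<and> ?d t < t \<and> ?d t \<le> 1/2 * t"
      have "?P t \<le> U (?d t) * N (t - ?d t)" using t by (intro last_visit_le_bounds[of _ _ "t + 1"]) auto
      also have "\<dots> \<le> U (?d t) * N (1/2 * t)" using t by (intro mult_left_mono N_antimono U_nonneg) auto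
      finally show "norm (?P t) \<le> 1 * norm (U (?d t) * N (1/2 * t))" by simp
    qed
    also have "(\<lambda>t. U (?d t) * N (1/2 * t)) \<in> O[at_right 0](\<lambda>t. V (?d t) * (1 / V t))" by (rule bigthetaD1[OF UN]) simp
    finally show "?P \<in> O[at_right 0](\<lambda>t. V (?d t) * (1 / V t))" .
    have "(\<lambda>t. V (?d t) * (1 / V t)) \<in> O[at_right 0](\<lambda>t. U (?d t) * N (2 * t))"
      using UN[of 2] by (intro bigthetaD1) (simp add: bigtheta_sym)
    also have "(\<lambda>t. U (?d t) * N (2 * t)) \<in> O[at_right 0](?P)"
    proof (rule bigoI[of _ 1], rule eventually_mono[OF sm])
      fix t assume t: "0 < t \<and> 0 < ?d t \<and> ?d t < t \<and> ?d t \<le> 1/2 * t"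
      have "U (?d t) * N (2 * t) \<le> ?P t" using t by (intro last_visit_le_bounds) auto
      moreover have "0 \<le> U (?d t) * N (2 * t)" using t N_nonneg[of "2 * t"] U_nonneg by simp
      ultimately show "norm (U (?d t) * N (2 * t)) \<le> 1 * norm (?P t)" by simp
    qed
    finally show "?P \<in> \<Omega>[at_right 0](\<lambda>t. V (?d t) * (1 / V t))" by (simp add: bigomega_iff_bigo)
  qed
qed

lemma late_theta:
  assumes V: "regularly_varying_0 V \<alpha>" and \<alpha>: "0 < \<alpha>" "\<alpha> < 1" and \<Theta>: "(\<lambda>x. r (1 / x)) \<in> \<Theta>[at_right 0](V)"
    and \<epsilon>: "\<And>t. 0 < t \<Longrightarrow> 0 < \<epsilon> t \<and> \<epsilon> t < 1" and \<epsilon>0: "(\<epsilon> \<longlongrightarrow> 0) (at_right 0)"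
    and dec: "\<And>x y h. 0 < x \<Longrightarrow> x \<le> y \<Longrightarrow> 0 \<le> h \<Longrightarrow> U (y + h) - U y \<le> U (x + h) - U x"
  shows "(\<lambda>t. prob {w\<in>space M. t - \<epsilon> t * t \<le> last_visit A t w}) \<in> \<Theta>[at_right 0](\<lambda>t. V t / t * (\<epsilon> t * t / V (\<epsilon> t * t)))"
proof -
  have "\<forall>t>0. 0 < \<epsilon> t \<and> \<epsilon> t < 1" using \<epsilon> by blast
  note small = small_window[OF this \<epsilon>0]
  let ?d = "\<lambda>t. \<epsilon> t * t"
  let ?P = "\<lambda>t. prob {w\<in>space M. t - ?d t \<le> last_visit A t w}"
  have Hc: "(\<lambda>t. H (c * ?d t)) \<in> \<Theta>[at_right 0](\<lambda>t. ?d t / V (?d t))" if c: "0 < c" for c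
  proof -
    have "(\<lambda>x. H (c * x)) \<in> \<Theta>[at_right 0](\<lambda>x. c * x / V (c * x))"
      by (rule landau_theta.compose[OF H_theta[OF V \<Theta>] filterlim_times_at_right_0[OF c]])
    also have "(\<lambda>x. c * x / V (c * x)) \<in> \<Theta>[at_right 0](\<lambda>x. x / V x)" by (rule rv_bigtheta[OF rv_dual[OF V] c])
    finally show ?thesis by (rule landau_theta.compose[OF _ small(1)])
  qed
  have H1: "(\<lambda>t. H (?d t)) \<in> \<Theta>[at_right 0](\<lambda>t. ?d t / V (?d t))" using Hc[of 1] by simp
  obtain b where b: "1 < b" "\<forall>\<^sub>F t in at_right 0. V t \<le> U (b * t) - U t"
    by (rule rv_increase[OF V \<alpha>(1) U_nonneg U_theta[OF V \<Theta>]])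
  (* For \<eta> = 1/8 the condition (1 + \<eta>) d \<le> \<eta> t reads d \<le> t / 9. *)
  have sm: "\<forall>\<^sub>F t in at_right 0. 0 < t \<and> 0 < ?d t \<and> ?d t < t \<and> ?d t \<le> 1/9 * t" by (rule small(2)) simp
  show ?thesis
  proof (rule bigthetaI)
    have "?P \<in> O[at_right 0](\<lambda>t. U t / t * H (5/4 * ?d t))"
    proof (rule bigoI[of _ 8], rule eventually_mono[OF sm])
      fix t assume t: "0 < t \<and> 0 < ?d t \<and> ?d t < t \<and> ?d t \<le> 1/9 * t"
      have "(1 + 1/8) * y \<le> 1/8 * z" if "y \<le> 1/9 * z" for y z :: real using that by simp
      then have w: "(1 + 1/8) * ?d t \<le> 1/8 * t" using t by blast
      have "?P t \<le> (U ((1 - 1/8) * t) - U ((1 - 2 * (1/8)) * t)) / (1/8 * t) * H ((1 + 2 * (1/8)) * ?d t)"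
        using t w by (intro late_bounds(2)[OF dec _ _ _ zero_less_one _ _ w]) auto
      also have "\<dots> \<le> U t / (1/8 * t) * H ((1 + 2 * (1/8)) * ?d t)"
      proof (intro mult_right_mono divide_right_mono H_nonneg)
        show "U ((1 - 1/8) * t) - U ((1 - 2 * (1/8)) * t) \<le> U t"
          using U_mono[of "(1 - 1/8) * t" t] U_nonneg[of "(1 - 2 * (1/8)) * t"] t by simp
      qed (use t in auto)
      finally show "norm (?P t) \<le> 8 * norm (U t / t * H (5/4 * ?d t))" using t U_nonneg[of t] H_nonneg by (simp add: mult_ac)
    qed
    also have "(\<lambda>t. U t / t * H (5/4 * ?d t)) \<in> O[at_right 0](\<lambda>t. V t / t * (?d t / V (?d t)))"
    proof (intro landau_o.big.mult bigthetaD1[OF Hc])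
      have "(\<lambda>t. U t * (1 / t)) \<in> O[at_right 0](\<lambda>t. V t * (1 / t))"
        by (intro landau_o.big.mult bigthetaD1[OF U_theta[OF V \<Theta>]]) simp
      then show "(\<lambda>t. U t / t) \<in> O[at_right 0](\<lambda>t. V t / t)" by simp
    qed simp
    finally show "?P \<in> O[at_right 0](\<lambda>t. V t / t * (?d t / V (?d t)))" .
    have "(\<lambda>t. V t / t * (?d t / V (?d t))) \<in> O[at_right 0](\<lambda>t. V t / t * H (?d t))"
      using H1 by (intro landau_o.big.mult bigthetaD1) (auto simp: bigtheta_sym)
    also have "(\<lambda>t. V t / t * H (?d t)) \<in> O[at_right 0](?P)"
    proof (rule bigoI[of _ "b - 1"])
      show "\<forall>\<^sub>F t in at_right 0. norm (V t / t * H (?d t)) \<le> (b - 1) * norm (?P t)"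
        using sm b(2)
      proof eventually_elim
        case (elim t)
        have "(U ((1 + (b - 1)) * t) - U t) / ((b - 1) * t) * H (?d t) \<le> ?P t"
          using elim b(1) by (intro late_bounds(1)[OF dec]) auto
        then have "(U (b * t) - U t) / ((b - 1) * t) * H (?d t) \<le> ?P t" by simp
        moreover have "V t / ((b - 1) * t) * H (?d t) \<le> (U (b * t) - U t) / ((b - 1) * t) * H (?d t)"
          using elim b(1) by (intro mult_right_mono divide_right_mono H_nonneg) auto
        ultimately have "V t / ((b - 1) * t) * H (?d t) \<le> ?P t" by simp
        then have "(b - 1) * (V t / ((b - 1) * t) * H (?d t)) \<le> (b - 1) * ?P t" using b(1) by (intro mult_left_mono) auto
        then have "V t / t * H (?d t) \<le> (b - 1) * ?P t" using b(1) by simp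
        moreover have "0 \<le> V t / t * H (?d t)" using elim rv_pos[OF V, of t] H_nonneg by simp
        ultimately show ?case by simp
      qed
    qed
    finally show "?P \<in> \<Omega>[at_right 0](\<lambda>t. V t / t * (?d t / V (?d t)))" by (simp add: bigomega_iff_bigo)
  qed
qed

end

section \<open>The exponent of the subordinator\<close>

context resolvent_clock
begin

text \<open>Divide \<open>1 - g\<close> by \<open>h\<close> and let \<open>h\<close> tend to \<open>0\<close>.\<close>

lemma r_eq_inverse_exponent:
  assumes q: "1 \<le> q" and \<Phi>: "\<And>s. 0 < s \<Longrightarrow> g q s = ennreal (exp (- \<phi> * s))"
  shows "r q = 1 / \<phi>"
proof -
  have lim: "((\<lambda>h::real. (1 - exp (- \<phi> * h)) / h) \<longlongrightarrow> \<phi>) (at_right 0)" by real_asymp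
  have b: "1 / (r q + h) \<le> (1 - exp (- \<phi> * h)) / h" "(1 - exp (- \<phi> * h)) / h \<le> 1 / r q" if "0 < h" for h
    using one_minus_g_bounds[OF q that] \<Phi>[OF that] by simp_all
  have up: "\<phi> \<le> 1 / r q"
  proof (rule tendsto_upperbound[OF lim])
    show "\<forall>\<^sub>F h in at_right 0. (1 - exp (- \<phi> * h)) / h \<le> 1 / r q"
      using eventually_pos_at_right_0 by eventually_elim (rule b(2))
  qed simp
  have "((\<lambda>h. 1 / (r q + h)) \<longlongrightarrow> 1 / (r q + 0)) (at_right 0)"
    using r_pos[OF q] by (intro tendsto_intros) auto
  then have "1 / (r q + 0) \<le> \<phi>"
  proof (rule tendsto_le[OF _ lim, rotated])
    show "\<forall>\<^sub>F h in at_right 0. 1 / (r q + h) \<le> (1 - exp (- \<phi> * h)) / h"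
      using eventually_pos_at_right_0 by eventually_elim (rule b(1))
  qed simp
  with up have "\<phi> = 1 / r q" by simp
  then show ?thesis using r_pos[OF q] by simp
qed

end

lemma (in driftless_clock) special_U_increments:
  assumes \<Phi>: "\<And>q s. 0 < q \<Longrightarrow> 0 \<le> s \<Longrightarrow> g q s = ennreal (exp (- \<Phi> q * s))" and B: "bernstein (\<lambda>q. q / \<Phi> q)"
    and x: "0 < x" "x \<le> y" "0 \<le> h"
  shows "U (y + h) - U y \<le> U (x + h) - U x"
proof -
  let ?\<mu> = "interval_measure U"
  have Ioc: "emeasure ?\<mu> {a<..b} = ennreal (U b - U a)" if "a \<le> b" for a b by (rule emeasure_dU[OF that])
  have atom: "emeasure ?\<mu> {s} = 0" for s
  proof -
    have "emeasure ?\<mu> {s..s} = ennreal (U s - U s)"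
      by (intro emeasure_interval_measure_Icc) (auto simp: U_mono U_continuous_on)
    then show ?thesis by simp
  qed
  have "emeasure ?\<mu> (\<Union>n. {- real n<..0}) = 0"
    by (rule emeasure_UN_eq_0) (auto simp: Ioc U_nonpos)
  moreover have "(\<Union>n. {- real n<..0}) = {..0}"
    by (auto intro: reals_Archimedean2[of "- _"] simp: minus_less_iff)
  ultimately have "{..0} \<in> null_sets ?\<mu>" by (simp add: null_sets_def)
  then have supp: "AE s in ?\<mu>. 0 < s" using AE_not_in[of "{..0}" ?\<mu>] by (auto elim!: eventually_mono)
  have nn: "(\<integral>\<^sup>+s. ennreal (exp (- q * s)) \<partial>?\<mu>) = ennreal (r q)" if "1 \<le> q" for q
    unfolding Laplace_dU[OF that, symmetric] using supp
    by (intro nn_integral_cong_AE) (auto elim!: eventually_mono)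
  interpret E: laplace_measure ?\<mu> 1
  proof
    show "AE s in ?\<mu>. 0 < s" by (rule supp)
    show "integrable ?\<mu> (\<lambda>s. exp (- 1 * s))"
      using nn[of 1] by (intro integrableI_nonneg) auto
  qed auto
  have c: "E.c 0 q = r q" if "1 < q" for q
    unfolding E.c_def using nn[of q] that r_pos[of q] by (subst integral_eq_nn_integral) auto
  have meas: "measure ?\<mu> {0..<z} = U z" if "0 \<le> z" for z
  proof -
    have "emeasure ?\<mu> {0..<z} = emeasure ?\<mu> {0<..z}"
    proof (rule emeasure_eq_AE)
      have "AE s in ?\<mu>. s \<noteq> z" using AE_not_in[of "{z}" ?\<mu>] atom[of z] by (simp add: null_sets_def)
      with supp show "AE s in ?\<mu>. s \<in> {0..<z} \<longleftrightarrow> s \<in> {0<..z}" by eventually_elim auto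
    qed auto
    then show ?thesis using that Ioc[of 0 z] U_nonneg by (simp add: measure_def U_nonpos)
  qed
  have "measure ?\<mu> {0..<y + h} - measure ?\<mu> {0..<y} \<le> measure ?\<mu> {0..<x + h} - measure ?\<mu> {0..<x}"
  proof (rule E.special_increments_decreasing[OF _ B atom x])
    fix q :: real assume q: "1 < q"
    then show "q / \<Phi> q = q * E.c 0 q"
      using r_eq_inverse_exponent[of q "\<Phi> q"] \<Phi>[of q] c[OF q] by simp
  qed
  then show ?thesis using x by (simp add: meas)
qed

section \<open>The local time as a clock\<close>

text \<open>Continuity in time approximates the process by its values at grid points.\<close>

lemma measurable_continuous_process:
  fixes A :: "real \<Rightarrow> 'w \<Rightarrow> real"
  assumes meas: "\<And>t. A t \<in> borel_measurable M" and cont: "\<And>w. w \<in> space M \<Longrightarrow> continuous_on UNIV (\<lambda>t. A t w)"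
  shows "(\<lambda>(w, t). A t w) \<in> borel_measurable (M \<Otimes>\<^sub>M borel)"
proof (rule borel_measurable_LIMSEQ_real)
  let ?a = "\<lambda>n p. A (real_of_int \<lfloor>real (Suc n) * snd p\<rfloor> / real (Suc n)) (fst p)"
  show "?a n \<in> borel_measurable (M \<Otimes>\<^sub>M borel)" for n
  proof (rule measurable_compose_countable[where f="\<lambda>i p. A (real_of_int i / real (Suc n)) (fst p)" and g="\<lambda>p. \<lfloor>real (Suc n) * snd p\<rfloor>"])
    show "(\<lambda>p. A (real_of_int i / real (Suc n)) (fst p)) \<in> borel_measurable (M \<Otimes>\<^sub>M borel)" for i
      by (rule measurable_compose[OF measurable_fst meas])
  qed measurable
  fix p assume p: "p \<in> space (M \<Otimes>\<^sub>M (borel :: real measure))"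
  then have w: "fst p \<in> space M" by (auto simp: space_pair_measure)
  have "(\<lambda>n. real_of_int \<lfloor>real (Suc n) * snd p\<rfloor> / real (Suc n)) \<longlonglongrightarrow> snd p"
  proof (rule tendsto_sandwich[of "\<lambda>n. snd p - 1 / real (Suc n)" _ _ "\<lambda>n. snd p"])
    have *: "snd p - 1 / real (Suc n) \<le> real_of_int \<lfloor>real (Suc n) * snd p\<rfloor> / real (Suc n) \<and>
        real_of_int \<lfloor>real (Suc n) * snd p\<rfloor> / real (Suc n) \<le> snd p" for n
    proof
      have "real (Suc n) * snd p - 1 \<le> real_of_int \<lfloor>real (Suc n) * snd p\<rfloor>" by linarith
      then have "(real (Suc n) * snd p - 1) / real (Suc n) \<le> real_of_int \<lfloor>real (Suc n) * snd p\<rfloor> / real (Suc n)"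
        by (intro divide_right_mono) auto
      then show "snd p - 1 / real (Suc n) \<le> real_of_int \<lfloor>real (Suc n) * snd p\<rfloor> / real (Suc n)"
        by (simp add: diff_divide_distrib del: of_nat_Suc)
      have "real_of_int \<lfloor>real (Suc n) * snd p\<rfloor> / real (Suc n) \<le> real (Suc n) * snd p / real (Suc n)"
        by (intro divide_right_mono of_int_floor_le) auto
      then show "real_of_int \<lfloor>real (Suc n) * snd p\<rfloor> / real (Suc n) \<le> snd p" by (simp del: of_nat_Suc)
    qed
    show "\<forall>\<^sub>F n in sequentially. snd p - 1 / real (Suc n) \<le> real_of_int \<lfloor>real (Suc n) * snd p\<rfloor> / real (Suc n)"
      "\<forall>\<^sub>F n in sequentially. real_of_int \<lfloor>real (Suc n) * snd p\<rfloor> / real (Suc n) \<le> snd p"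
      using * by (auto simp del: of_nat_Suc)
    have "(\<lambda>n. snd p - 1 / real (Suc n)) \<longlonglongrightarrow> snd p - 0"
      by (intro tendsto_intros one_over_Suc_tendsto)
    then show "(\<lambda>n. snd p - 1 / real (Suc n)) \<longlonglongrightarrow> snd p" by simp
  qed simp
  moreover have "isCont (\<lambda>t. A t (fst p)) (snd p)"
    using cont[OF w] by (simp add: continuous_on_eq_continuous_at)
  ultimately have "(\<lambda>n. ?a n p) \<longlonglongrightarrow> A (snd p) (fst p)"
    by (rule isCont_tendsto_compose[rotated])
  then show "(\<lambda>n. ?a n p) \<longlonglongrightarrow> (case p of (w, t) \<Rightarrow> A t w)" by (simp add: case_prod_beta)
qed

lemma Laplace_expectation:
  assumes M: "sigma_finite_measure M"
    and meas: "\<And>t. A t \<in> borel_measurable M" and cont: "\<And>w. w \<in> space M \<Longrightarrow> continuous_on UNIV (\<lambda>t. A t w)"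
    and mono: "\<And>w s t. w \<in> space M \<Longrightarrow> s \<le> t \<Longrightarrow> A s w \<le> A t w" and zero: "\<And>w. w \<in> space M \<Longrightarrow> A 0 w = 0"
    and q: "0 < q"
  shows "(\<integral>\<^sup>+w. (\<integral>\<^sup>+t\<in>{0..}. ennreal (exp (- q * t)) \<partial>interval_measure (\<lambda>t. A t w)) \<partial>M) =
    (\<integral>\<^sup>+t\<in>{0..}. ennreal (q * exp (- q * t)) * (\<integral>\<^sup>+w. ennreal (A t w) \<partial>M) \<partial>lborel)"
proof -
  interpret M: sigma_finite_measure M by (rule M)
  interpret P: pair_sigma_finite M lborel ..
  have [measurable]: "(\<lambda>(w, t). A t w) \<in> borel_measurable (M \<Otimes>\<^sub>M borel)"
    by (rule measurable_continuous_process[OF meas cont])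
  have [measurable]: "A t \<in> borel_measurable M" for t by (rule meas)
  have "(\<integral>\<^sup>+w. (\<integral>\<^sup>+t\<in>{0..}. ennreal (exp (- q * t)) \<partial>interval_measure (\<lambda>t. A t w)) \<partial>M) =
      (\<integral>\<^sup>+w. (\<integral>\<^sup>+t. ennreal (q * exp (- q * t) * A t w) * indicator {0..} t \<partial>lborel) \<partial>M)"
    by (intro nn_integral_cong Laplace_Stieltjes) (auto simp: mono cont zero q)
  also have "\<dots> = (\<integral>\<^sup>+t. (\<integral>\<^sup>+w. ennreal (q * exp (- q * t) * A t w) * indicator {0..} t \<partial>M) \<partial>lborel)"
    by (rule P.Fubini'[symmetric]) measurable
  also have "\<dots> = (\<integral>\<^sup>+t\<in>{0..}. ennreal (q * exp (- q * t)) * (\<integral>\<^sup>+w. ennreal (A t w) \<partial>M) \<partial>lborel)"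
  proof (rule nn_integral_cong)
    fix t
    have "(\<integral>\<^sup>+w. ennreal (q * exp (- q * t) * A t w) * indicator {0..} t \<partial>M) =
        (\<integral>\<^sup>+w. (ennreal (q * exp (- q * t)) * indicator {0..} t) * ennreal (A t w) \<partial>M)"
      by (intro nn_integral_cong) (subst ennreal_mult', use q in simp, simp only: mult_ac)
    also have "\<dots> = (ennreal (q * exp (- q * t)) * indicator {0..} t) * (\<integral>\<^sup>+w. ennreal (A t w) \<partial>M)"
      by (rule nn_integral_cmult) measurable
    finally show "(\<integral>\<^sup>+w. ennreal (q * exp (- q * t) * A t w) * indicator {0..} t \<partial>M) =
        ennreal (q * exp (- q * t)) * (\<integral>\<^sup>+w. ennreal (A t w) \<partial>M) * indicator {0..} t" by (simp add: mult_ac)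
  qed
  finally show ?thesis .
qed

lemma measure_completion_cong_AE:
  assumes AE: "AE w in M. P w \<longleftrightarrow> R w"
  shows "measure (completion M) {w\<in>space M. P w} = measure (completion M) {w\<in>space M. R w}"
proof -
  have sets: "{w\<in>space M. P' w} \<in> sets (completion M)"
    if 1: "AE w in M. P' w \<longleftrightarrow> R' w" and 2: "{w\<in>space M. R' w} \<in> sets (completion M)" for P' R'
  proof -
    obtain N where N: "{w\<in>space M. \<not> (P' w \<longleftrightarrow> R' w)} \<subseteq> N" "emeasure M N = 0" "N \<in> sets M"
      using AE_E[OF 1] by blast
    have "{w\<in>space M. P' w} \<inter> N \<in> null_sets (completion M)"
      by (rule null_sets_completion_subset[of _ N]) (use N in \<open>auto intro: null_sets_completionI\<close>)
    then have "({w\<in>space M. R' w} - N) \<union> ({w\<in>space M. P' w} \<inter> N) \<in> sets (completion M)"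
      using 2 N(3) by auto
    also have "({w\<in>space M. R' w} - N) \<union> ({w\<in>space M. P' w} \<inter> N) = {w\<in>space M. P' w}" using N(1) by blast
    finally show ?thesis .
  qed
  show ?thesis
  proof (cases "{w\<in>space M. R w} \<in> sets (completion M)")
    case True
    show ?thesis
    proof (rule measure_eq_AE[OF _ sets[OF AE True] True])
      show "AE w in completion M. w \<in> {w\<in>space M. P w} \<longleftrightarrow> w \<in> {w\<in>space M. R w}"
        by (rule AE_completion) (use AE in eventually_elim, auto)
    qed
  next
    case False
    moreover have "{w\<in>space M. P w} \<notin> sets (completion M)"
    proof
      assume "{w\<in>space M. P w} \<in> sets (completion M)"
      then have "{w\<in>space M. R w} \<in> sets (completion M)" by (rule sets[rotated]) (use AE in eventually_elim, auto)
      with False show False ..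
    qed
    ultimately show ?thesis by (simp add: measure_notin_sets)
  qed
qed

context local_time_process
begin

text \<open>The local time, set to \<open>0\<close> off the good paths and at negative times, so that path properties hold
  everywhere.\<close>

definition clock :: "real \<Rightarrow> 'w \<Rightarrow> real" where
  "clock t w = (if w \<in> \<Lambda> \<inter> Omega X then L (max 0 t) w else 0)"

abbreviation M where "M \<equiv> completion (law X (Some a))"

lemma space_M: "space M = Omega X"
  using space_law[of "Some a"] by simp

lemma AE_good: "AE w in law X x. w \<in> \<Lambda> \<inter> Omega X"
  using \<Lambda>_AE[of x] AE_space[of "law X x"] by eventually_elim (simp add: space_law[of x])

lemma clock_eq: "w \<in> \<Lambda> \<inter> Omega X \<Longrightarrow> 0 \<le> t \<Longrightarrow> clock t w = L t w"
  by (simp add: clock_def)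

lemma inverse_clock_eq: "w \<in> \<Lambda> \<inter> Omega X \<Longrightarrow> inverse_local_time clock s w = \<tau> s w"
  unfolding inverse_local_time_def by (intro arg_cong[where f=Inf]) (auto simp: clock_eq)

lemma last_visit_clock_eq: "w \<in> \<Lambda> \<inter> Omega X \<Longrightarrow> last_visit clock t w = last_visit L t w"
  unfolding last_visit_def by (simp add: inverse_clock_eq)

lemma clock_measurable: "clock t \<in> borel_measurable M"
proof -
  have "L (max 0 t) \<in> borel_measurable M"
  proof (rule measurableI)
    fix E :: "real set" assume E: "E \<in> sets borel"
    have "L (max 0 t) -` E \<inter> Omega X \<in> sets (completed_filtration X (ennreal (max 0 t)))"
      using measurable_sets[OF L_adapted[of "max 0 t"] E] by (simp add: space_completed_filtration)
    then show "L (max 0 t) -` E \<inter> space M \<in> sets M" unfolding space_M by (rule sets_completed_completion)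
  qed simp
  moreover have "\<Lambda> \<inter> Omega X \<in> sets M"
    using sets_completed_completion[OF \<Lambda>_sets, of "Some a"] sets.top[of M] unfolding space_M by (rule sets.Int)
  ultimately show ?thesis unfolding clock_def by (intro measurable_If_set) (auto simp: space_M intro: sets.Int)
qed

lemma clock_mono: "s \<le> t \<Longrightarrow> clock s w \<le> clock t w"
  using L_mono[of w] by (auto simp: clock_def mono_on_def)

lemma clock_nonpos: "t \<le> 0 \<Longrightarrow> clock t w = 0"
  by (auto simp: clock_def L_0 max_def)

lemma clock_cont: "continuous_on UNIV (\<lambda>t. clock t w)"
proof (cases "w \<in> \<Lambda> \<inter> Omega X")
  case True
  have "continuous_on UNIV (\<lambda>t. L (max 0 t) w)"
    using True by (intro continuous_on_compose2[OF L_cont[of w]] continuous_intros) auto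
  then show ?thesis using True by (simp add: clock_def)
next
  case False
  then have "clock t w = 0" for t by (auto simp: clock_def)
  then show ?thesis by simp
qed

lemma clock_pos: assumes t: "0 < t" shows "AE w in M. 0 < clock t w"
proof (rule AE_completion)
  have "AE w in law X (Some a). Inf {ennreal t |t. 0 \<le> t \<and> 0 < L t w} = 0"
    using L_support by (auto simp: af_support_def)
  with AE_good[of "Some a"] show "AE w in law X (Some a). 0 < clock t w"
  proof eventually_elim
    case (elim w)
    have "Inf {ennreal t |t. 0 \<le> t \<and> 0 < L t w} < ennreal t" using elim(2) t by simp
    then obtain u where u: "0 \<le> u" "0 < L u w" "ennreal u < ennreal t" unfolding Inf_less_iff by blast
    then have "u \<le> t" by (simp add: ennreal_less_iff)
    then have "L u w \<le> L t w" using L_mono[of w] elim(1) u t by (auto simp: mono_on_def)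
    then show ?case using u t elim(1) by (simp add: clock_eq)
  qed
qed

text \<open>Integrability and the resolvent equation both come from the normalization of the local time, rewritten
  by Fubini's theorem as the exponential transform of its expectation.\<close>

theorem clock_is_resolvent_clock:
  assumes lap: "\<And>q. 0 < q \<Longrightarrow> (\<integral>\<^sup>+w. (\<integral>\<^sup>+t\<in>{0..}. ennreal (exp (- q * t)) \<partial>interval_measure (\<lambda>t. L (max 0 t) w)) \<partial>M) = R q"
    and fin: "R 1 < \<infinity>"
  shows "resolvent_clock M clock (\<lambda>q. enn2real (R q))"
proof -
  interpret law: prob_space "law X (Some a)" by (rule prob_law)
  interpret M: prob_space M by (rule law.prob_space_completion)
  define e where "e t = (\<integral>\<^sup>+w. ennreal (clock t w) \<partial>M)" for t
  have e_mono: "e s \<le> e t" if "s \<le> t" for s t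
    unfolding e_def using clock_mono[OF that] by (intro nn_integral_mono ennreal_leI)
  have Re: "R q = (\<integral>\<^sup>+t\<in>{0..}. ennreal (q * exp (- q * t)) * e t \<partial>lborel)" if q: "0 < q" for q
  proof -
    have "R q = (\<integral>\<^sup>+w. (\<integral>\<^sup>+t\<in>{0..}. ennreal (exp (- q * t)) \<partial>interval_measure (\<lambda>t. clock t w)) \<partial>M)"
      unfolding lap[OF q, symmetric]
    proof (rule nn_integral_cong_AE, rule AE_completion)
      show "AE w in law X (Some a). (\<integral>\<^sup>+t\<in>{0..}. ennreal (exp (- q * t)) \<partial>interval_measure (\<lambda>t. L (max 0 t) w)) =
          (\<integral>\<^sup>+t\<in>{0..}. ennreal (exp (- q * t)) \<partial>interval_measure (\<lambda>t. clock t w))"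
        using AE_good by eventually_elim (simp add: clock_def)
    qed
    also have "\<dots> = (\<integral>\<^sup>+t\<in>{0..}. ennreal (q * exp (- q * t)) * e t \<partial>lborel)"
      unfolding e_def
      by (rule Laplace_expectation) (auto simp: clock_measurable clock_cont clock_mono clock_nonpos q intro: M.sigma_finite_measure)
    finally show ?thesis .
  qed
  have R_le: "R q \<le> R 1" if q: "1 \<le> q" for q
  proof -
    have "ennreal (exp (- q * t)) * indicator {0..} t \<le> ennreal (exp (- 1 * t)) * indicator {0..} t" for t
      using mult_right_mono[OF q, of t] by (auto simp: indicator_def intro!: ennreal_leI)
    then show ?thesis
      unfolding lap[OF less_le_trans[OF zero_less_one q], symmetric] lap[OF zero_less_one, symmetric]
      by (intro nn_integral_mono)
  qed
  have e_fin: "e t < \<infinity>" for t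
  proof -
    have "e t * ennreal (exp (- max 0 t)) = (\<integral>\<^sup>+u\<in>{max 0 t..}. ennreal (exp (- u)) * e t \<partial>lborel)"
    proof -
      have "(\<integral>\<^sup>+u. e t * (ennreal (exp (- u)) * indicator {max 0 t..} u) \<partial>lborel) = e t * ennreal (exp (- max 0 t))"
        using nn_integral_exp_tail(1)[of 1 "max 0 t"] by (subst nn_integral_cmult) auto
      then show ?thesis by (simp add: mult_ac)
    qed
    also have "\<dots> \<le> R 1"
      unfolding Re[OF zero_less_one]
      by (intro nn_integral_mono) (auto simp: indicator_def intro!: mult_left_mono e_mono)
    finally have "e t * ennreal (exp (- max 0 t)) < \<infinity>" using fin by (rule le_less_trans)
    then show ?thesis by (auto simp: ennreal_mult_less_top less_top[symmetric] ennreal_mult_eq_top_iff)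
  qed
  have int: "integrable M (clock t)" for t
    using e_fin[of t] clock_mono[of "min 0 t" t] clock_nonpos[of "min 0 t"]
    by (intro integrableI_nonneg clock_measurable) (auto simp: e_def)
  have e_eq: "e t = ennreal (\<integral>w. clock t w \<partial>M)" for t
    unfolding e_def using clock_mono[of "min 0 t" t] clock_nonpos[of "min 0 t"]
    by (intro nn_integral_eq_integral int) auto
  interpret C: regenerative_clock M clock
  proof
    show "integrable M (clock t)" for t by (rule int)
    show "AE w in M. 0 < clock t w" if "0 < t" for t by (rule clock_pos[OF that])
    fix s h x y :: real assume *: "0 \<le> s" "0 \<le> h" "0 < x" "0 < y"
    note cong = measure_completion_cong_AE[where M="law X (Some a)", unfolded space_law[of "Some a"]]
    have "M.prob {w\<in>space M. inverse_local_time clock s w < ennreal x \<and>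
        inverse_local_time clock (s + h) w < inverse_local_time clock s w + ennreal y} =
      M.prob {w\<in>Omega X. \<tau> s w < ennreal x \<and> \<tau> (s + h) w < \<tau> s w + ennreal y}"
      unfolding space_M by (rule cong) (use AE_good in eventually_elim, simp add: inverse_clock_eq)
    also have "\<dots> = M.prob {w\<in>Omega X. \<tau> s w < ennreal x} * M.prob {w\<in>Omega X. h < L y w}"
      by (rule regeneration[OF *])
    also have "M.prob {w\<in>Omega X. \<tau> s w < ennreal x} = M.prob {w\<in>space M. inverse_local_time clock s w < ennreal x}"
      unfolding space_M by (rule cong) (use AE_good in eventually_elim, simp add: inverse_clock_eq)
    also have "M.prob {w\<in>Omega X. h < L y w} = M.prob {w\<in>space M. h < clock y w}"
      unfolding space_M by (rule cong) (use AE_good in eventually_elim, use * in \<open>simp add: clock_eq\<close>)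
    finally show "M.prob {w\<in>space M. inverse_local_time clock s w < ennreal x \<and>
        inverse_local_time clock (s + h) w < inverse_local_time clock s w + ennreal y} =
      M.prob {w\<in>space M. inverse_local_time clock s w < ennreal x} * M.prob {w\<in>space M. h < clock y w}" .
  qed (auto simp: clock_nonpos clock_mono clock_cont)
  show ?thesis
  proof
    fix q :: real assume q: "1 \<le> q"
    have "(\<integral>\<^sup>+t\<in>{0..}. ennreal (q * exp (- q * t) * C.U t) \<partial>lborel) = R q"
      unfolding Re[OF less_le_trans[OF zero_less_one q]] e_eq C.U_def[symmetric]
      using q by (intro nn_integral_cong) (simp add: ennreal_mult')
    also have "R q = ennreal (enn2real (R q))" using le_less_trans[OF R_le[OF q] fin] by simp
    finally show "(\<integral>\<^sup>+t\<in>{0..}. ennreal (q * exp (- q * t) * C.U t) \<partial>lborel) = ennreal (enn2real (R q))" .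
  qed
qed

end

section \<open>The asymptotic relations\<close>

lemma rv_of_slowly_varying:
  assumes l: "slowly_varying_at_0 l"
  shows "regularly_varying_0 (\<lambda>x. x powr \<alpha> / l x) \<alpha>"
  unfolding regularly_varying_0_def
proof (intro conjI allI impI)
  have pos: "0 < l x" if "0 < x" for x using l that by (simp add: slowly_varying_at_0_def)
  show "0 < x powr \<alpha> / l x" if "0 < x" for x using pos[OF that] that by simp
  fix c :: real assume c: "0 < c"
  have "((\<lambda>x. c powr \<alpha> / (l (c * x) / l x)) \<longlongrightarrow> c powr \<alpha> / 1) (at_right 0)"
    using l c by (intro tendsto_intros) (auto simp: slowly_varying_at_0_def)
  moreover have "\<forall>\<^sub>F x in at_right 0. c powr \<alpha> / (l (c * x) / l x) = ((c * x) powr \<alpha> / l (c * x)) / (x powr \<alpha> / l x)"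
    using eventually_pos_at_right_0
  proof eventually_elim
    case (elim x)
    then show ?case using pos[of x] pos[of "c * x"] c by (simp add: powr_mult field_simps)
  qed
  ultimately show "((\<lambda>x. ((c * x) powr \<alpha> / l (c * x)) / (x powr \<alpha> / l x)) \<longlongrightarrow> c powr \<alpha>) (at_right 0)"
    by (simp add: Lim_transform_eventually)
qed

lemma window_ratios:
  fixes l \<epsilon> :: "real \<Rightarrow> real"
  assumes t: "0 < t" "0 < \<epsilon> t" and l: "\<And>x. 0 < x \<Longrightarrow> 0 < l x"
  shows "(\<epsilon> t * t) powr \<alpha> / l (\<epsilon> t * t) * (1 / (t powr \<alpha> / l t)) = l t / l (\<epsilon> t * t) * \<epsilon> t powr \<alpha>"
    and "\<epsilon> t * (t powr \<alpha> / l t) / ((\<epsilon> t * t) powr \<alpha> / l (\<epsilon> t * t)) = l (\<epsilon> t * t) / l t * \<epsilon> t powr (1 - \<alpha>)"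
  using t l[of t] l[of "\<epsilon> t * t"] by (simp_all add: powr_mult powr_diff field_simps)

theorem theorem6p5:
  fixes X :: "('w, 'a :: {metric_space, second_countable_topology}) process"
    and X' :: "('v, 'a) process"
    and m :: "'a measure"
    and r :: "real \<Rightarrow> 'a \<Rightarrow> 'a \<Rightarrow> ennreal"
    and a :: 'a
    and L :: "real \<Rightarrow> 'w \<Rightarrow> real"
    and \<alpha> \<alpha>' :: real
    and l \<epsilon> :: "real \<Rightarrow> real"
  assumes "locally_compact_space (euclidean :: 'a topology)"
    and "hunt_process X" and "hunt_process X'"
    and "radon_measure m" and "in_duality X X' m"
    and "resolvent_density X X' m r"
    and "r 1 a a < \<infinity>" and "isCont (\<lambda>x. r 1 x a) a"
    and "local_time X r a L"
    and "0 < \<alpha>" and "\<alpha> < 1" and "\<alpha>' = 1 - \<alpha>"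
    and "slowly_varying_at_0 l"
    and "\<And>t. 0 < t \<Longrightarrow> 0 < \<epsilon> t \<and> \<epsilon> t < 1"
    and "(\<epsilon> \<longlongrightarrow> 0) (at_right 0)"
  shows "((\<lambda>q. enn2real (r q a a)) \<sim>[at_top] (\<lambda>q. q powr (- \<alpha>) / l (1 / q)) \<longrightarrow>
            (\<lambda>t. measure (completion (law X (Some a))) {\<omega>\<in>space (law X (Some a)). last_visit L t \<omega> / t \<le> \<epsilon> t})
              \<sim>[at_right 0]
            (\<lambda>t. sin (pi * \<alpha>) / (pi * \<alpha>) * (l t / l (\<epsilon> t * t)) * \<epsilon> t powr \<alpha>)
          \<and> (special_subordinator (law X (Some a)) (inverse_local_time L) \<longrightarrow>
              (\<lambda>t. measure (completion (law X (Some a))) {\<omega>\<in>space (law X (Some a)). last_visit L t \<omega> / t \<ge> 1 - \<epsilon> t})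
                \<sim>[at_right 0]
              (\<lambda>t. sin (pi * \<alpha>') / (pi * \<alpha>') * (l (\<epsilon> t * t) / l t) * \<epsilon> t powr \<alpha>')))
       \<and> ((\<lambda>q. enn2real (r q a a)) \<in> \<Theta>[at_top](\<lambda>q. q powr (- \<alpha>) / l (1 / q)) \<longrightarrow>
            (\<lambda>t. measure (completion (law X (Some a))) {\<omega>\<in>space (law X (Some a)). last_visit L t \<omega> / t \<le> \<epsilon> t})
              \<in> \<Theta>[at_right 0](\<lambda>t. l t / l (\<epsilon> t * t) * \<epsilon> t powr \<alpha>)
          \<and> (special_subordinator (law X (Some a)) (inverse_local_time L) \<longrightarrow>
              (\<lambda>t. measure (completion (law X (Some a))) {\<omega>\<in>space (law X (Some a)). last_visit L t \<omega> / t \<ge> 1 - \<epsilon> t})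
                \<in> \<Theta>[at_right 0](\<lambda>t. l (\<epsilon> t * t) / l t * \<epsilon> t powr \<alpha>')))"
proof -
  obtain F where F: "admissible_filtration X F" "strong_markov X F"
    using assms(2) unfolding hunt_process_def by blast
  have lt: "perfect_PCAF X L" "af_support X L = {a}"
    and lap: "\<And>q. 0 < q \<Longrightarrow> (\<integral>\<^sup>+w. (\<integral>\<^sup>+t\<in>{0..}. ennreal (exp (- q * t)) \<partial>interval_measure (\<lambda>t. L (max 0 t) w))
        \<partial>completion (law X (Some a))) = r q a a"
    using assms(9) unfolding local_time_def by blast+
  obtain \<Lambda> where \<Lambda>: "\<Lambda> \<in> sets (completed_filtration X \<infinity>)" "\<forall>x. AE w in law X x. w \<in> \<Lambda>"
    "\<forall>w\<in>\<Lambda>. L 0 w = 0 \<and> mono_on {0..} (\<lambda>t. L t w) \<and> continuous_on {0..} (\<lambda>t. L t w) \<and>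
           (\<forall>s\<ge>0. \<forall>t\<ge>s. lifetime X w \<le> ennreal s \<longrightarrow> L t w = L s w) \<and>
           (\<forall>s\<ge>0. \<forall>t\<ge>0. L (s + t) w = L s w + L t (shift X (ennreal s) w))"
    using lt(1) unfolding perfect_PCAF_def by blast
  interpret X: local_time_process X F L a \<Lambda>
  proof
    show "L t \<in> borel_measurable (completed_filtration X (ennreal t))" if "0 \<le> t" for t
      using lt(1) that unfolding perfect_PCAF_def by blast
  qed (use assms(1,2) F lt(2) \<Lambda> in blast)+
  let ?M = "completion (law X (Some a))"
  let ?r = "\<lambda>q. enn2real (r q a a)"
  interpret C: resolvent_clock ?M X.clock ?r
    by (rule X.clock_is_resolvent_clock[OF lap assms(7)])
  define V where "V x = x powr \<alpha> / l x" for x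
  have V: "regularly_varying_0 V \<alpha>" unfolding V_def by (rule rv_of_slowly_varying[OF assms(13)])
  have l: "0 < l x" if "0 < x" for x using assms(13) that by (simp add: slowly_varying_at_0_def)
  have V_inv: "\<forall>\<^sub>F q in at_top. q powr (- \<alpha>) / l (1 / q) = V (1 / q)"
    using eventually_gt_at_top[of 0] by eventually_elim (simp add: V_def powr_divide powr_minus_divide)
  note \<epsilon> = assms(14) and \<epsilon>0 = assms(15)
  let ?E = "\<lambda>t. measure ?M {w\<in>space (law X (Some a)). last_visit L t w / t \<le> \<epsilon> t}"
  let ?E' = "\<lambda>t. measure ?M {w\<in>space ?M. last_visit X.clock t w \<le> \<epsilon> t * t}"
  let ?F = "\<lambda>t. measure ?M {w\<in>space (law X (Some a)). last_visit L t w / t \<ge> 1 - \<epsilon> t}"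
  let ?F' = "\<lambda>t. measure ?M {w\<in>space ?M. t - \<epsilon> t * t \<le> last_visit X.clock t w}"
  have E_eq: "\<forall>\<^sub>F t in at_right 0. ?E' t = ?E t"
    using eventually_pos_at_right_0
  proof eventually_elim
    case (elim t)
    have "AE w in law X (Some a). last_visit X.clock t w \<le> \<epsilon> t * t \<longleftrightarrow> last_visit L t w / t \<le> \<epsilon> t"
      using X.AE_good by eventually_elim (use elim in \<open>simp add: X.last_visit_clock_eq divide_le_eq\<close>)
    from measure_completion_cong_AE[OF this] show ?case by simp
  qed
  have F_eq: "\<forall>\<^sub>F t in at_right 0. ?F' t = ?F t"
    using eventually_pos_at_right_0
  proof eventually_elim
    case (elim t)
    have "AE w in law X (Some a). t - \<epsilon> t * t \<le> last_visit X.clock t w \<longleftrightarrow> 1 - \<epsilon> t \<le> last_visit L t w / t"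
      using X.AE_good by eventually_elim (use elim in \<open>simp add: X.last_visit_clock_eq le_divide_eq left_diff_distrib\<close>)
    from measure_completion_cong_AE[OF this] show ?case by simp
  qed
  have ratio1: "\<forall>\<^sub>F t in at_right 0. V (\<epsilon> t * t) * (1 / V t) = l t / l (\<epsilon> t * t) * \<epsilon> t powr \<alpha>"
    using eventually_pos_at_right_0 by eventually_elim (unfold V_def, rule window_ratios(1), use \<epsilon> l in auto)
  have ratio2: "\<forall>\<^sub>F t in at_right 0. \<epsilon> t * V t / V (\<epsilon> t * t) = l (\<epsilon> t * t) / l t * \<epsilon> t powr \<alpha>'"
    using eventually_pos_at_right_0
    by eventually_elim (unfold V_def assms(12), rule window_ratios(2), use \<epsilon> l in auto)
  have sin_pos: "0 < sin (pi * \<beta>) / (pi * \<beta>)" if "0 < \<beta>" "\<beta> < 1" for \<beta> :: real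
    using that by (intro divide_pos_pos sin_gt_zero) auto
  have driftless: "driftless_clock ?M X.clock ?r" if "(\<lambda>x. ?r (1 / x)) \<in> \<Theta>[at_right 0](V)"
    by unfold_locales (rule C.driftless_if_regularly_varying[OF V assms(11) that])
  have decreasing: "C.U (y + h) - C.U y \<le> C.U (x + h) - C.U x"
    if sp: "special_subordinator (law X (Some a)) (inverse_local_time L)" and D: "driftless_clock ?M X.clock ?r"
      and x: "0 < x" "x \<le> y" "0 \<le> h" for x y h
  proof -
    interpret D: driftless_clock ?M X.clock ?r by (rule D)
    obtain \<Phi> where \<Phi>: "laplace_exponent (law X (Some a)) (inverse_local_time L) \<Phi>" "special_bernstein \<Phi>"
      using sp unfolding special_subordinator_def by blast
    show ?thesis
    proof (rule D.special_U_increments[OF _ _ x])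
      show "bernstein (\<lambda>q. q / \<Phi> q)" using \<Phi>(2) by (simp add: special_bernstein_def)
      fix q s :: real assume qs: "0 < q" "0 \<le> s"
      have "C.g q s = (\<integral>\<^sup>+w. exp_neg q (inverse_local_time L s w) \<partial>?M)"
        unfolding C.g_def
      proof (rule nn_integral_cong_AE, rule AE_completion)
        show "AE w in law X (Some a). exp_neg q (inverse_local_time X.clock s w) = exp_neg q (inverse_local_time L s w)"
          using X.AE_good by eventually_elim (simp add: X.inverse_clock_eq)
      qed
      also have "\<dots> = ennreal (exp (- \<Phi> q * s))"
        using \<Phi>(1) qs unfolding laplace_exponent_def exp_neg_def by blast
      finally show "C.g q s = ennreal (exp (- \<Phi> q * s))" .
    qed
  qed
  show ?thesis
  proof (intro conjI impI)
    assume sim: "?r \<sim>[at_top] (\<lambda>q. q powr (- \<alpha>) / l (1 / q))"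
    have "?r \<sim>[at_top] (\<lambda>q. V (1 / q))" using sim asymp_equiv_cong[OF always_eventually[of "\<lambda>q. ?r q = ?r q"] V_inv] by simp
    then have "((\<lambda>q. ?r q / V (1 / q)) \<longlongrightarrow> 1) at_top"
    proof (rule asymp_equivD_strong)
      show "\<forall>\<^sub>F q in at_top. ?r q \<noteq> 0 \<or> V (1 / q) \<noteq> 0"
        using eventually_gt_at_top[of 0]
      proof eventually_elim
        case (elim q)
        then show ?case using rv_pos[OF V, of "1 / q"] by simp
      qed
    qed
    then have "((\<lambda>x. ?r (1 / x) / V (1 / (1 / x))) \<longlongrightarrow> 1) (at_right 0)"
      by (rule filterlim_compose[OF _ filterlim_inverse_at_right_0])
    then have lim: "((\<lambda>x. ?r (1 / x) / V x) \<longlongrightarrow> 1) (at_right 0)" by simp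
    then have "(\<lambda>x. ?r (1 / x)) \<in> \<Theta>[at_right 0](V)" by (rule bigthetaI_tendsto[rotated]) simp
    then have D: "driftless_clock ?M X.clock ?r" by (rule driftless)
    interpret D: driftless_clock ?M X.clock ?r by (rule D)
    let ?k = "sin (pi * \<alpha>) / (pi * \<alpha>)"
    show "?E \<sim>[at_right 0] (\<lambda>t. ?k * (l t / l (\<epsilon> t * t)) * \<epsilon> t powr \<alpha>)"
    proof (rule asymp_equivI')
      have "((\<lambda>t. ?E' t * (V t / V (\<epsilon> t * t)) / ?k) \<longlongrightarrow> ?k / ?k) (at_right 0)"
        using sin_pos[OF assms(10,11)] by (intro tendsto_divide D.early_sharp[OF V assms(10,11) lim \<epsilon> \<epsilon>0] tendsto_const) auto
      moreover have "\<forall>\<^sub>F t in at_right 0. ?E' t * (V t / V (\<epsilon> t * t)) / ?k = ?E t / (?k * (l t / l (\<epsilon> t * t)) * \<epsilon> t powr \<alpha>)"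
        using E_eq ratio1
      proof eventually_elim
        case (elim t)
        have "?E' t * (V t / V (\<epsilon> t * t)) / ?k = ?E t / (?k * (V (\<epsilon> t * t) * (1 / V t)))" unfolding elim(1) by (simp add: mult_ac)
        then show ?case unfolding elim(2) by (simp only: mult.assoc)
      qed
      ultimately have "((\<lambda>t. ?E t / (?k * (l t / l (\<epsilon> t * t)) * \<epsilon> t powr \<alpha>)) \<longlongrightarrow> ?k / ?k) (at_right 0)"
        by (rule Lim_transform_eventually)
      moreover have "?k / ?k = 1" using sin_pos[OF assms(10,11)] by (intro divide_self) linarith
      ultimately show "((\<lambda>t. ?E t / (?k * (l t / l (\<epsilon> t * t)) * \<epsilon> t powr \<alpha>)) \<longlongrightarrow> 1) (at_right 0)"
        by (simp only:)
    qed
    assume sp: "special_subordinator (law X (Some a)) (inverse_local_time L)"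
    let ?k' = "sin (pi * \<alpha>') / (pi * \<alpha>')"
    have k': "0 < ?k'" by (rule sin_pos) (use assms(10-12) in auto)
    have late: "((\<lambda>t. ?F' t / (\<epsilon> t * V t / V (\<epsilon> t * t))) \<longlongrightarrow> ?k') (at_right 0)"
      unfolding assms(12) by (rule D.late_sharp[OF V assms(10,11) lim \<epsilon> \<epsilon>0 decreasing[OF sp D]])
    have nz: "?k' \<noteq> 0" using k' by linarith
    show "?F \<sim>[at_right 0] (\<lambda>t. ?k' * (l (\<epsilon> t * t) / l t) * \<epsilon> t powr \<alpha>')"
    proof (rule asymp_equivI')
      have "((\<lambda>t. ?F' t / (\<epsilon> t * V t / V (\<epsilon> t * t)) / ?k') \<longlongrightarrow> ?k' / ?k') (at_right 0)"
        by (rule tendsto_divide[OF late tendsto_const nz])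
      moreover have "\<forall>\<^sub>F t in at_right 0. ?F' t / (\<epsilon> t * V t / V (\<epsilon> t * t)) / ?k' = ?F t / (?k' * (l (\<epsilon> t * t) / l t) * \<epsilon> t powr \<alpha>')"
        using F_eq ratio2
      proof eventually_elim
        case (elim t)
        show ?case unfolding elim by (simp add: mult_ac)
      qed
      ultimately have "((\<lambda>t. ?F t / (?k' * (l (\<epsilon> t * t) / l t) * \<epsilon> t powr \<alpha>')) \<longlongrightarrow> ?k' / ?k') (at_right 0)"
        by (rule Lim_transform_eventually)
      moreover have "?k' / ?k' = 1" by (rule divide_self[OF nz])
      ultimately show "((\<lambda>t. ?F t / (?k' * (l (\<epsilon> t * t) / l t) * \<epsilon> t powr \<alpha>')) \<longlongrightarrow> 1) (at_right 0)"
        by (simp only:)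
    qed
  next
    assume th: "?r \<in> \<Theta>[at_top](\<lambda>q. q powr (- \<alpha>) / l (1 / q))"
    have "?r \<in> \<Theta>[at_top](\<lambda>q. V (1 / q))" using th landau_theta.cong[OF V_inv] by simp
    then have "(\<lambda>x. ?r (1 / x)) \<in> \<Theta>[at_right 0](\<lambda>x. V (1 / (1 / x)))"
      by (rule landau_theta.compose[OF _ filterlim_inverse_at_right_0])
    then have \<Theta>: "(\<lambda>x. ?r (1 / x)) \<in> \<Theta>[at_right 0](V)" by simp
    then have D: "driftless_clock ?M X.clock ?r" by (rule driftless)
    interpret D: driftless_clock ?M X.clock ?r by (rule D)
    show "?E \<in> \<Theta>[at_right 0](\<lambda>t. l t / l (\<epsilon> t * t) * \<epsilon> t powr \<alpha>)"
      using D.early_theta[OF V assms(11) \<Theta> \<epsilon> \<epsilon>0] landau_theta.in_cong[OF E_eq] landau_theta.cong[OF ratio1] by simp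
    assume sp: "special_subordinator (law X (Some a)) (inverse_local_time L)"
    have ratio3: "\<forall>\<^sub>F t in at_right 0. V t / t * (\<epsilon> t * t / V (\<epsilon> t * t)) = l (\<epsilon> t * t) / l t * \<epsilon> t powr \<alpha>'"
      using eventually_pos_at_right_0 ratio2
    proof eventually_elim
      case (elim t)
      then show ?case unfolding elim(2)[symmetric] by (simp add: mult_ac)
    qed
    have "?F' \<in> \<Theta>[at_right 0](\<lambda>t. V t / t * (\<epsilon> t * t / V (\<epsilon> t * t)))"
      by (rule D.late_theta[OF V assms(10,11) \<Theta> \<epsilon> \<epsilon>0 decreasing[OF sp D]])
    then show "?F \<in> \<Theta>[at_right 0](\<lambda>t. l (\<epsilon> t * t) / l t * \<epsilon> t powr \<alpha>')"
      unfolding landau_theta.cong[OF ratio3] landau_theta.in_cong[OF F_eq] .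
  qed
qed

end
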